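(* Let $X \subset \mathbf{P}^n$ be a nonsingular complete intersection in projective space over $\mathbb{C}$. If $X$ is convex and rationally connected, then $X$ is a homogeneous space, i.e. $X$ is isomorphic to a variety $\mathbf{G}/\mathbf{P}$.
   Context: Let $X$ be a nonsingular projective variety over $\mathbb{C}$, with tangent bundle $T_X$. A morphism $\mu: \mathbf{P}^1 \rightarrow X$ is unobstructed if $H^1(\mathbf{P}^1, \mu^* T_X)=0$. The variety $X$ is convex if all morphisms $\mu: \mathbf{P}^1 \rightarrow X$ are unobstructed. A rational curve in $X$ is the image of a morphism $\mathbf{P}^1 \rightarrow X$. The variety $X$ is rationally connected if every pair of points of $X$ is connected by a rational curve, i.e. for all $x,y\in X$ there is a morphism $\mu:\mathbf{P}^1\to X$ whose image contains $x$ and $y$. A homogeneous space here means a nonsingular projective variety of the form $\mathbf{G}/\mathbf{P}$, where $\mathbf{G}$ is a connected linear algebraic group over $\mathbb{C}$ and $\mathbf{P}\subset \mathbf{G}$ is a parabolic subgroup. A nonsingular complete intersection in $\mathbf{P}^n$ of type $(d_1,\ldots,d_l)$ (with all $d_i\ge 1$) is a nonempty nonsingular closed subscheme of dimension $n-l$ which is the scheme-theoretic intersection of $l$ hypersurfaces of degrees $d_1,\ldots,d_l$. *)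

theory Defs
  imports
    "HOL-Analysis.Abstract_Topology"
    "HOL-Library.Poly_Mapping"
    "HOL-Library.Function_Algebras"
    "HOL-Library.Extended_Nat"
    "HOL-Algebra.Coset"
    "Jordan_Normal_Form.DL_Rank"
begin

section \<open>Polynomials\<close>

text \<open>A polynomial is a finitely supported function from exponent vectors to coefficients.\<close>

type_synonym 'x cpoly = "('x \<Rightarrow>\<^sub>0 nat) \<Rightarrow>\<^sub>0 complex"

definition poly_eval :: "('x \<Rightarrow> complex) \<Rightarrow> 'x cpoly \<Rightarrow> complex" where
  "poly_eval a F =
     (\<Sum>m\<in>Poly_Mapping.keys F. Poly_Mapping.lookup F m *
        (\<Prod>x\<in>Poly_Mapping.keys m. a x ^ Poly_Mapping.lookup m x))"

definition partial_deriv :: "'x \<Rightarrow> 'x cpoly \<Rightarrow> 'x cpoly" where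
  "partial_deriv x F =
     (\<Sum>m\<in>Poly_Mapping.keys F.
        Poly_Mapping.single (m - Poly_Mapping.single x 1)
          (Poly_Mapping.lookup F m * of_nat (Poly_Mapping.lookup m x)))"

definition polys_in :: "'x set \<Rightarrow> 'x cpoly set" where
  "polys_in I = {F. \<forall>m\<in>Poly_Mapping.keys F. Poly_Mapping.keys m \<subseteq> I}"

text \<open>The homogeneous coordinates on \<open>\<P>\<^sup>n\<close> are the variables \<open>0, \<dots>, n\<close>. The zero
  polynomial is homogeneous of every degree.\<close>

definition forms :: "nat \<Rightarrow> nat \<Rightarrow> nat cpoly set" where
  "forms n d = {F \<in> polys_in {..n}.
     \<forall>m\<in>Poly_Mapping.keys F. (\<Sum>x\<in>Poly_Mapping.keys m. Poly_Mapping.lookup m x) = d}"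


section \<open>Topological preliminaries\<close>

definition quotient_topology :: "'a topology \<Rightarrow> ('a \<Rightarrow> 'b) \<Rightarrow> 'b topology" where
  "quotient_topology T q =
     topology (\<lambda>W. W \<subseteq> q ` topspace T \<and> openin T {x \<in> topspace T. q x \<in> W})"

lemma openin_quotient_topology:
  "openin (quotient_topology T q) W \<longleftrightarrow>
     W \<subseteq> q ` topspace T \<and> openin T {x \<in> topspace T. q x \<in> W}"
proof -
  have "istopology (\<lambda>W. W \<subseteq> q ` topspace T \<and> openin T {x \<in> topspace T. q x \<in> W})"
    unfolding istopology_def
  proof (intro conjI allI impI)
    fix A B
    assume A: "A \<subseteq> q ` topspace T \<and> openin T {x \<in> topspace T. q x \<in> A}"
      and B: "B \<subseteq> q ` topspace T \<and> openin T {x \<in> topspace T. q x \<in> B}"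
    show "A \<inter> B \<subseteq> q ` topspace T" using A by blast
    have "{x \<in> topspace T. q x \<in> A \<inter> B} =
        {x \<in> topspace T. q x \<in> A} \<inter> {x \<in> topspace T. q x \<in> B}" by blast
    moreover have "openin T ({x \<in> topspace T. q x \<in> A} \<inter> {x \<in> topspace T. q x \<in> B})"
      using A B by (blast intro: openin_Int)
    ultimately show "openin T {x \<in> topspace T. q x \<in> A \<inter> B}" by (simp only:)
  next
    fix K
    assume K: "\<forall>W\<in>K. W \<subseteq> q ` topspace T \<and> openin T {x \<in> topspace T. q x \<in> W}"
    show "\<Union>K \<subseteq> q ` topspace T" using K by blast
    have "{x \<in> topspace T. q x \<in> \<Union>K} = (\<Union>W\<in>K. {x \<in> topspace T. q x \<in> W})" by blast
    moreover have "openin T (\<Union>W\<in>K. {x \<in> topspace T. q x \<in> W})"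
      using K by (blast intro: openin_Union)
    ultimately show "openin T {x \<in> topspace T. q x \<in> \<Union>K}" by (simp only:)
  qed
  then show ?thesis unfolding quotient_topology_def by (simp only: topology_inverse')
qed

definition irreducible_closed_in :: "'a topology \<Rightarrow> 'a set \<Rightarrow> bool" where
  "irreducible_closed_in T A \<longleftrightarrow> closedin T A \<and> A \<noteq> {} \<and>
     (\<forall>B C. closedin T B \<and> closedin T C \<and> A = B \<union> C \<longrightarrow> A = B \<or> A = C)"

definition krull_dim :: "'a topology \<Rightarrow> enat" where
  "krull_dim T = Sup {enat k | k. \<exists>C :: nat \<Rightarrow> 'a set.
     (\<forall>i\<le>k. irreducible_closed_in T (C i)) \<and> (\<forall>i<k. C i \<subset> C (Suc i))}"


section \<open>Varieties as spaces with functions\<close>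

text \<open>Classical varieties over the complex numbers are encoded as a topological space together
  with, for each open subset \<open>U\<close>, the functions that are regular on \<open>U\<close>. Functions are total;
  \<open>regular X U f\<close> only depends on the values of \<open>f\<close> on \<open>U\<close>, and is only used for open \<open>U\<close>.\<close>

record 'a fspace =
  ftop :: "'a topology"
  regular :: "'a set \<Rightarrow> ('a \<Rightarrow> complex) \<Rightarrow> bool"

definition regular_near :: "'a fspace \<Rightarrow> 'a \<Rightarrow> ('a \<Rightarrow> complex) \<Rightarrow> bool" where
  "regular_near X x f \<longleftrightarrow> (\<exists>V. openin (ftop X) V \<and> x \<in> V \<and> regular X V f)"

definition morphism :: "'a fspace \<Rightarrow> 'b fspace \<Rightarrow> ('a \<Rightarrow> 'b) \<Rightarrow> bool" where
  "morphism X Y \<phi> \<longleftrightarrow> continuous_map (ftop X) (ftop Y) \<phi> \<and>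
     (\<forall>V f. openin (ftop Y) V \<and> regular Y V f \<longrightarrow>
        regular X {x \<in> topspace (ftop X). \<phi> x \<in> V} (f \<circ> \<phi>))"

definition isomorphic :: "'a fspace \<Rightarrow> 'b fspace \<Rightarrow> bool" where
  "isomorphic X Y \<longleftrightarrow> (\<exists>\<phi> \<psi>. morphism X Y \<phi> \<and> morphism Y X \<psi> \<and>
     (\<forall>x \<in> topspace (ftop X). \<psi> (\<phi> x) = x) \<and> (\<forall>y \<in> topspace (ftop Y). \<phi> (\<psi> y) = y))"


section \<open>Projective varieties\<close>

text \<open>Points of \<open>\<P>\<^sup>n\<close> are the lines through the origin in \<open>\<complex>\<^sup>n\<^sup>+\<^sup>1\<close>.\<close>

definition line :: "complex vec \<Rightarrow> complex vec set" where
  "line v = {c \<cdot>\<^sub>v v | c. True}"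

definition proj_space :: "nat \<Rightarrow> complex vec set set" where
  "proj_space n = {line v | v. v \<in> carrier_vec (Suc n) \<and> v \<noteq> 0\<^sub>v (Suc n)}"

definition zero_locus :: "nat \<Rightarrow> nat cpoly set \<Rightarrow> complex vec set set" where
  "zero_locus n S = {line v | v. v \<in> carrier_vec (Suc n) \<and> v \<noteq> 0\<^sub>v (Suc n) \<and>
     (\<forall>F\<in>S. poly_eval (\<lambda>i. v $ i) F = 0)}"

text \<open>The principal open sets are stable under finite intersections, so the closed sets of the
  generated topology are exactly the zero loci of sets of forms.\<close>

definition zariski_proj :: "nat \<Rightarrow> complex vec set topology" where
  "zariski_proj n = topology_generated_by
     {proj_space n - zero_locus n {F} | F d. F \<in> forms n d}"

definition proj_variety :: "nat \<Rightarrow> complex vec set set \<Rightarrow> complex vec set fspace" where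
  "proj_variety n Z = \<lparr>
     ftop = subtopology (zariski_proj n) Z,
     regular = (\<lambda>U f. \<forall>p\<in>U. \<exists>V d g h.
        openin (subtopology (zariski_proj n) Z) V \<and> p \<in> V \<and> V \<subseteq> U \<and>
        g \<in> forms n d \<and> h \<in> forms n d \<and>
        (\<forall>v. v \<in> carrier_vec (Suc n) \<and> line v \<in> V \<longrightarrow>
           poly_eval (\<lambda>i. v $ i) h \<noteq> 0 \<and>
           f (line v) = poly_eval (\<lambda>i. v $ i) g / poly_eval (\<lambda>i. v $ i) h))\<rparr>"

definition P1 :: "complex vec set fspace" where
  "P1 = proj_variety 1 (proj_space 1)"

definition jacobian :: "nat \<Rightarrow> nat cpoly list \<Rightarrow> complex vec \<Rightarrow> complex mat" where
  "jacobian n Fs v = mat (length Fs) (Suc n)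
     (\<lambda>(i, j). poly_eval (\<lambda>k. v $ k) (partial_deriv j (Fs ! i)))"

text \<open>\<open>Z\<close> is the set of points of a nonsingular complete intersection of type \<open>ds\<close>. The Jacobian
  condition is imposed on the defining equations themselves, so it expresses that their
  scheme-theoretic intersection is nonsingular of codimension \<open>length ds\<close>; in particular this
  scheme is reduced and hence determined by \<open>Z\<close>.\<close>

definition nonsingular_complete_intersection ::
    "nat \<Rightarrow> nat list \<Rightarrow> complex vec set set \<Rightarrow> bool" where
  "nonsingular_complete_intersection n ds Z \<longleftrightarrow>
     (\<exists>Fs. length Fs = length ds \<and>
        (\<forall>i < length ds. 1 \<le> ds ! i \<and> Fs ! i \<in> forms n (ds ! i) \<and> Fs ! i \<noteq> 0) \<and>
        Z = zero_locus n (set Fs) \<and> Z \<noteq> {} \<and>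
        krull_dim (subtopology (zariski_proj n) Z) + enat (length ds) = enat n \<and>
        (\<forall>v. v \<in> carrier_vec (Suc n) \<and> v \<noteq> 0\<^sub>v (Suc n) \<and> line v \<in> Z \<longrightarrow>
           vec_space.rank (length Fs) (jacobian n Fs v) = length Fs))"


section \<open>Tangent vectors, convexity and rational connectedness\<close>

text \<open>Tangent vectors at \<open>x\<close> are the derivations of the local ring at \<open>x\<close>, given on functions
  regular near \<open>x\<close> and normalised to vanish on all other functions.\<close>

definition tangent_space :: "'a fspace \<Rightarrow> 'a \<Rightarrow> (('a \<Rightarrow> complex) \<Rightarrow> complex) set" where
  "tangent_space X x = {D.
     (\<forall>f g. regular_near X x f \<and> regular_near X x g \<longrightarrow>
        D (\<lambda>y. f y + g y) = D f + D g \<and>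
        D (\<lambda>y. f y * g y) = f x * D g + g x * D f) \<and>
     (\<forall>c f. regular_near X x f \<longrightarrow> D (\<lambda>y. c * f y) = c * D f) \<and>
     (\<forall>f g V. regular_near X x f \<and> regular_near X x g \<and>
        openin (ftop X) V \<and> x \<in> V \<and> (\<forall>y\<in>V. f y = g y) \<longrightarrow> D f = D g) \<and>
     (\<forall>f. \<not> regular_near X x f \<longrightarrow> D f = 0)}"

text \<open>For \<open>X\<close> nonsingular and \<open>\<mu> : Y \<rightarrow> X\<close>, the sections over \<open>U\<close> of the pull-back along \<open>\<mu>\<close> of
  the tangent bundle: families of tangent vectors \<open>s t\<close> at \<open>\<mu> t\<close> that depend regularly on
  \<open>t\<close>. Regularity is tested against the differentials of local functions, which generate
  the cotangent bundle. Sections are extended by zero outside \<open>U\<close>.\<close>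

definition pullback_tangent ::
    "'b fspace \<Rightarrow> 'a fspace \<Rightarrow> ('b \<Rightarrow> 'a) \<Rightarrow> 'b set \<Rightarrow> ('b \<Rightarrow> ('a \<Rightarrow> complex) \<Rightarrow> complex) set" where
  "pullback_tangent Y X \<mu> U = {s.
     (\<forall>t\<in>U. s t \<in> tangent_space X (\<mu> t)) \<and>
     (\<forall>t. t \<notin> U \<longrightarrow> s t = 0) \<and>
     (\<forall>V f. openin (ftop X) V \<and> regular X V f \<longrightarrow>
        regular Y {t \<in> U. \<mu> t \<in> V} (\<lambda>t. s t f))}"

text \<open>Vanishing of \<open>H\<^sup>1(T, \<F>)\<close> for a sheaf \<open>\<F>\<close> whose sections over \<open>U\<close> are functions on \<open>U\<close>
  (extended by zero, with restriction of functions as restriction maps): every Cech 1-cocycle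
  on every open cover is a coboundary. In degree one, sheaf cohomology is the colimit of the
  Cech cohomology groups of open covers, and the maps into this colimit are injective.\<close>

definition H1_vanishes ::
    "'b topology \<Rightarrow> ('b set \<Rightarrow> ('b \<Rightarrow> 'v::ab_group_add) set) \<Rightarrow> bool" where
  "H1_vanishes T \<F> \<longleftrightarrow> (\<forall>\<U> c.
     (\<forall>U\<in>\<U>. openin T U) \<and> \<Union>\<U> = topspace T \<and>
     (\<forall>U\<in>\<U>. \<forall>V\<in>\<U>. c U V \<in> \<F> (U \<inter> V)) \<and>
     (\<forall>U\<in>\<U>. \<forall>V\<in>\<U>. \<forall>W\<in>\<U>. \<forall>t \<in> U \<inter> V \<inter> W. c U V t + c V W t = c U W t) \<longrightarrow>
     (\<exists>b. (\<forall>U\<in>\<U>. b U \<in> \<F> U) \<and>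
          (\<forall>U\<in>\<U>. \<forall>V\<in>\<U>. \<forall>t \<in> U \<inter> V. c U V t = b V t - b U t)))"

definition unobstructed :: "'a fspace \<Rightarrow> (complex vec set \<Rightarrow> 'a) \<Rightarrow> bool" where
  "unobstructed X \<mu> \<longleftrightarrow> H1_vanishes (ftop P1) (pullback_tangent P1 X \<mu>)"

definition convex_variety :: "'a fspace \<Rightarrow> bool" where
  "convex_variety X \<longleftrightarrow> (\<forall>\<mu>. morphism P1 X \<mu> \<longrightarrow> unobstructed X \<mu>)"

definition rational_curve :: "'a fspace \<Rightarrow> 'a set \<Rightarrow> bool" where
  "rational_curve X C \<longleftrightarrow> (\<exists>\<mu>. morphism P1 X \<mu> \<and> C = \<mu> ` topspace (ftop P1))"

definition rationally_connected :: "'a fspace \<Rightarrow> bool" where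
  "rationally_connected X \<longleftrightarrow>
     (\<forall>x \<in> topspace (ftop X). \<forall>y \<in> topspace (ftop X). \<exists>C. rational_curve X C \<and> x \<in> C \<and> y \<in> C)"


section \<open>Linear algebraic groups and homogeneous spaces\<close>

definition GL :: "nat \<Rightarrow> complex mat monoid" where
  "GL m = units_of (ring_mat TYPE(complex) m ())"

definition zariski_GL :: "nat \<Rightarrow> complex mat topology" where
  "zariski_GL m = topology_generated_by
     {{A \<in> carrier (GL m). poly_eval (\<lambda>ij. A $$ ij) F \<noteq> 0} | F.
        F \<in> polys_in ({..<m} \<times> {..<m})}"

definition linear_algebraic_group :: "nat \<Rightarrow> complex mat set \<Rightarrow> bool" where
  "linear_algebraic_group m G \<longleftrightarrow> subgroup G (GL m) \<and> closedin (zariski_GL m) G"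

definition group_variety :: "nat \<Rightarrow> complex mat set \<Rightarrow> complex mat fspace" where
  "group_variety m G = \<lparr>
     ftop = subtopology (zariski_GL m) G,
     regular = (\<lambda>U f. \<forall>A\<in>U. \<exists>V g h.
        openin (subtopology (zariski_GL m) G) V \<and> A \<in> V \<and> V \<subseteq> U \<and>
        g \<in> polys_in ({..<m} \<times> {..<m}) \<and> h \<in> polys_in ({..<m} \<times> {..<m}) \<and>
        (\<forall>B\<in>V. poly_eval (\<lambda>ij. B $$ ij) h \<noteq> 0 \<and>
           f B = poly_eval (\<lambda>ij. B $$ ij) g / poly_eval (\<lambda>ij. B $$ ij) h))\<rparr>"

text \<open>The quotient \<open>G/P\<close>: its points are the left cosets of \<open>P\<close> in \<open>G\<close>, and a function is
  regular if and only if its pull-back to \<open>G\<close> is.\<close>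

definition quotient_variety ::
    "nat \<Rightarrow> complex mat set \<Rightarrow> complex mat set \<Rightarrow> complex mat set fspace" where
  "quotient_variety m G P = \<lparr>
     ftop = quotient_topology (subtopology (zariski_GL m) G) (\<lambda>A. A <#\<^bsub>GL m\<^esub> P),
     regular = (\<lambda>U f. regular (group_variety m G)
        {A \<in> G. A <#\<^bsub>GL m\<^esub> P \<in> U} (\<lambda>A. f (A <#\<^bsub>GL m\<^esub> P)))\<rparr>"

text \<open>A closed subgroup is parabolic if the quotient by it is a projective variety; as such
  quotients are always quasi-projective, this is the same as the quotient being complete.\<close>

definition parabolic_subgroup :: "nat \<Rightarrow> complex mat set \<Rightarrow> complex mat set \<Rightarrow> bool" where
  "parabolic_subgroup m G P \<longleftrightarrow> linear_algebraic_group m P \<and> P \<subseteq> G \<and>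
     (\<exists>N Z. closedin (zariski_proj N) Z \<and>
        isomorphic (quotient_variety m G P) (proj_variety N Z))"

definition homogeneous_space :: "'a fspace \<Rightarrow> bool" where
  "homogeneous_space X \<longleftrightarrow> (\<exists>m G P.
     linear_algebraic_group m G \<and> connectedin (zariski_GL m) G \<and>
     parabolic_subgroup m G P \<and> isomorphic X (quotient_variety m G P))"

end

theory Submission
  imports
    Defs
    "HOL-Computational_Algebra.Fundamental_Theorem_Algebra"
    "HOL-Analysis.Continuum_Not_Denumerable"
    "HOL-Analysis.Abstract_Topology_2"
    "Jordan_Normal_Form.Char_Poly"
begin

text \<open>A morphism from the projective line to \<open>Z\<close> is given by forms of some degree \<open>E\<close>. Convexity
  makes the Jacobian along it surjective on global sections, as a map of bundles
  \<open>O(E)\<^sup>n\<^sup>+\<^sup>1 \<rightarrow> \<Oplus>\<^sub>i O(d\<^sub>i E)\<close>; pulling back along double covers and taking odd parts, the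
  same holds after twisting both sides by \<open>O(-1)\<close>. For a nonconstant curve, which rational
  connectedness provides, the velocity is in the kernel, and comparing dimensions gives
  \<open>\<Sum> d\<^sub>i \<le> n\<close>. In this range, unless \<open>Z\<close> is a linear space or a quadric in a linear space, a
  count of bihomogeneous equations produces a line in \<open>Z\<close> and a point \<open>x\<close> of it at which the
  twisted map is not surjective. In the two remaining cases, transvections or products of two
  reflections, which lie on rational curves of automorphisms through the identity, give
  local sections of the orbit map of the identity component of the group of linear automorphisms,
  so that \<open>Z\<close> is a quotient of this group.\<close>

section \<open>Evaluation of polynomials\<close>

text \<open>On the projective line the vanishing of H^1 only says that the splitting degrees of the
  pulled-back tangent bundle are at least -1. The count needs them nonnegative. A summand of degree
  -1 becomes one of degree -2 on a double cover, where it would be obstructed; hence the application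
  of convexity to covers of the given curve. The twisted spaces of sections have dimensions
  \<open>(n + 1) * E\<close> and \<open>E\<close> times the sum of the degrees, and the nonzero
  kernel makes the inequality strict: this is why the bound is \<open>n\<close> and not
  \<open>n + 1\<close>. The unknowns of the equations for a bad line form two groups, neither of
  which may vanish, and \<open>n\<close> is also the largest sum of degrees for which the equations
  do not outnumber the dimensions. A zero is found by deforming a system of monomials that has a
  visible simple zero. Formal curves through smooth points are used both in this deformation and to
  make derivations along tangent directions well defined. The stabilizer is parabolic because the
  quotient by it is \<open>Z\<close> itself, which is closed in projective space.\<close>

definition powprod :: "('x \<Rightarrow> 'r::comm_monoid_mult) \<Rightarrow> ('x \<Rightarrow>\<^sub>0 nat) \<Rightarrow> 'r" where
  "powprod a m = (\<Prod>x\<in>Poly_Mapping.keys m. a x ^ Poly_Mapping.lookup m x)"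

text \<open>The map \<open>h\<close> on coefficients is a parameter so that one construction covers
  values at a point, polynomial curves and substitutions; \<open>hom_gev\<close> then relates the
  three.\<close>

definition gev :: "(complex \<Rightarrow> 'r) \<Rightarrow> ('x \<Rightarrow> 'r::comm_ring_1) \<Rightarrow> 'x cpoly \<Rightarrow> 'r" where
  "gev h a F = (\<Sum>m\<in>Poly_Mapping.keys F. h (Poly_Mapping.lookup F m) * powprod a m)"

definition Cst :: "complex \<Rightarrow> 'x cpoly" where
  "Cst c = Poly_Mapping.single 0 c"

definition Var :: "'x \<Rightarrow> 'x cpoly" where
  "Var x = Poly_Mapping.single (Poly_Mapping.single x 1) 1"

lemma poly_eval_gev: "poly_eval a F = gev (\<lambda>c. c) a F"
  by (simp add: poly_eval_def gev_def powprod_def)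

lemma powprod_superset:
  assumes "finite A" "Poly_Mapping.keys m \<subseteq> A"
  shows "powprod a m = (\<Prod>x\<in>A. a x ^ Poly_Mapping.lookup m x)"
  unfolding powprod_def using assms
  by (intro prod.mono_neutral_left) (auto simp: in_keys_iff)

lemma powprod_0 [simp]: "powprod a 0 = 1"
  by (simp add: powprod_def)

lemma powprod_add: "powprod a (m + m') = powprod a m * powprod a m'"
proof -
  let ?A = "Poly_Mapping.keys m \<union> Poly_Mapping.keys m'"
  have "Poly_Mapping.keys (m + m') \<subseteq> ?A" by (rule keys_add)
  then show ?thesis
    by (simp add: powprod_superset[of ?A] lookup_add power_add prod.distrib)
qed

lemma powprod_single: "powprod a (Poly_Mapping.single x k) = a x ^ k"
  by (subst powprod_superset[of "{x}"]) auto

lemma gev_superset: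
  assumes "finite A" "Poly_Mapping.keys F \<subseteq> A" "h 0 = 0"
  shows "gev h a F = (\<Sum>m\<in>A. h (Poly_Mapping.lookup F m) * powprod a m)"
  unfolding gev_def using assms
  by (intro sum.mono_neutral_left) (auto simp: in_keys_iff)

lemma poly_mapping_sum_single:
  "F = (\<Sum>m\<in>Poly_Mapping.keys F. Poly_Mapping.single m (Poly_Mapping.lookup F m))"
  by (intro poly_mapping_eqI)
    (auto simp: lookup_sum lookup_single when_def in_keys_iff sum.delta' split: if_splits)

lemma cpoly_induct [case_names single add]:
  assumes "\<And>m c. P (Poly_Mapping.single m c)" "\<And>F G. P F \<Longrightarrow> P G \<Longrightarrow> P (F + G)"
  shows "P (F :: 'x cpoly)"
proof -
  have "P (\<Sum>m\<in>A. Poly_Mapping.single m (Poly_Mapping.lookup F m))" if "finite A" for A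
    using that
  proof induction
    case empty
    have "P (Poly_Mapping.single 0 0)" by (rule assms(1))
    then show ?case by simp
  qed (simp add: assms)
  then show ?thesis by (subst poly_mapping_sum_single) simp
qed

lemma gev_single:
  assumes "comm_ring_hom h"
  shows "gev h a (Poly_Mapping.single m c) = h c * powprod a m"
proof -
  interpret comm_ring_hom h by (rule assms)
  show ?thesis by (subst gev_superset[of "{m}"]) auto
qed

lemma gev_add:
  assumes "comm_ring_hom h"
  shows "gev h a (F + G) = gev h a F + gev h a G"
proof -
  interpret comm_ring_hom h by (rule assms)
  let ?A = "Poly_Mapping.keys F \<union> Poly_Mapping.keys G"
  have "Poly_Mapping.keys (F + G) \<subseteq> ?A" by (rule keys_add)
  then show ?thesis
    by (simp add: gev_superset[of ?A] lookup_add hom_add distrib_right sum.distrib)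
qed

lemma gev_mult:
  assumes "comm_ring_hom h"
  shows "gev h a (F * G) = gev h a F * gev h a G"
proof -
  interpret comm_ring_hom h by (rule assms)
  note s = gev_single[OF assms] gev_add[OF assms]
  show ?thesis
  proof (induction F rule: cpoly_induct)
    case (single m c)
    show ?case
      by (induction G rule: cpoly_induct)
        (simp_all add: mult_single powprod_add hom_mult algebra_simps s)
  qed (simp add: distrib_right s)
qed

lemma gev_Cst: "comm_ring_hom h \<Longrightarrow> gev h a (Cst c) = h c"
  by (simp add: Cst_def gev_single)

lemma gev_Var:
  assumes "comm_ring_hom h"
  shows "gev h a (Var x) = a x"
proof -
  interpret comm_ring_hom h by (rule assms)
  show ?thesis by (simp add: Var_def gev_single[OF assms] powprod_single)
qed

lemma gev_hom:
  assumes "comm_ring_hom h"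
  shows "comm_ring_hom (gev h a)"
proof -
  interpret comm_ring_hom h by (rule assms)
  show ?thesis
  proof
    show "gev h a 0 = 0" using gev_Cst[OF assms, of a 0] by (simp add: Cst_def)
    show "gev h a 1 = 1" using gev_Cst[OF assms, of a 1] by (simp add: Cst_def)
  qed (simp_all add: gev_add[OF assms] gev_mult[OF assms])
qed

lemma hom_powprod:
  assumes "comm_ring_hom k"
  shows "k (powprod a m) = powprod (\<lambda>x. k (a x)) m"
proof -
  interpret comm_ring_hom k by (rule assms)
  show ?thesis by (simp add: powprod_def hom_distribs)
qed

lemma hom_gev:
  assumes "comm_ring_hom k"
  shows "k (gev h a F) = gev (\<lambda>c. k (h c)) (\<lambda>x. k (a x)) F"
proof -
  interpret comm_ring_hom k by (rule assms)
  show ?thesis by (simp add: gev_def hom_distribs hom_powprod[OF assms])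
qed

lemma hom_id: "comm_ring_hom (\<lambda>c::complex. c)"
  by unfold_locales auto

interpretation poly_eval: comm_ring_hom "poly_eval a" for a :: "'x \<Rightarrow> complex"
  unfolding poly_eval_gev using gev_hom[OF hom_id] .

lemmas poly_eval_homs = poly_eval.hom_zero poly_eval.hom_one poly_eval.hom_add poly_eval.hom_mult
  poly_eval.hom_uminus poly_eval.hom_minus poly_eval.hom_sum poly_eval.hom_prod poly_eval.hom_power

lemma poly_eval_Cst [simp]: "poly_eval a (Cst c) = c"
  unfolding poly_eval_gev by (rule gev_Cst[OF hom_id])

lemma poly_eval_Var [simp]: "poly_eval a (Var x) = a x"
  unfolding poly_eval_gev by (rule gev_Var[OF hom_id])

lemma poly_eval_single: "poly_eval a (Poly_Mapping.single m c) = c * powprod a m"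
  unfolding poly_eval_gev by (rule gev_single[OF hom_id])

section \<open>Evaluation along polynomial curves, and substitution\<close>

definition poly_curve :: "('x \<Rightarrow> complex poly) \<Rightarrow> 'x cpoly \<Rightarrow> complex poly" where
  "poly_curve = gev (\<lambda>c. [:c:])"

lemma hom_pCons: "comm_ring_hom (\<lambda>c::complex. [:c:])"
  by unfold_locales (auto simp: one_pCons)

interpretation poly_curve: comm_ring_hom "poly_curve a" for a :: "'x \<Rightarrow> complex poly"
  unfolding poly_curve_def using gev_hom[OF hom_pCons] .

lemmas poly_curve_homs = poly_curve.hom_zero poly_curve.hom_one poly_curve.hom_add poly_curve.hom_mult
  poly_curve.hom_uminus poly_curve.hom_minus poly_curve.hom_sum poly_curve.hom_prod poly_curve.hom_power

lemma poly_curve_Cst [simp]: "poly_curve a (Cst c) = [:c:]"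
  unfolding poly_curve_def by (rule gev_Cst[OF hom_pCons])

lemma poly_curve_Var [simp]: "poly_curve a (Var x) = a x"
  unfolding poly_curve_def by (rule gev_Var[OF hom_pCons])

lemma poly_poly_curve: "poly (poly_curve \<gamma> F) t = poly_eval (\<lambda>x. poly (\<gamma> x) t) F"
proof -
  have "comm_ring_hom (\<lambda>p. poly p t)" by unfold_locales auto
  from hom_gev[OF this, of "\<lambda>c. [:c:]" \<gamma> F] show ?thesis by (simp add: poly_curve_def poly_eval_gev)
qed

definition poly_subst :: "('x \<Rightarrow> 'y cpoly) \<Rightarrow> 'x cpoly \<Rightarrow> 'y cpoly" where
  "poly_subst = gev Cst"

lemma Cst_0 [simp]: "Cst 0 = 0" and Cst_1 [simp]: "Cst 1 = 1"
  by (simp_all add: Cst_def)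

lemma Cst_add: "Cst (c + d) = Cst c + Cst d"
  by (simp add: Cst_def single_add)

lemma Cst_mult: "Cst (c * d) = Cst c * Cst d"
  by (simp add: Cst_def mult_single)

lemma hom_Cst: "comm_ring_hom Cst"
  by unfold_locales (auto simp: Cst_add Cst_mult)

interpretation poly_subst: comm_ring_hom "poly_subst a" for a :: "'x \<Rightarrow> 'y cpoly"
  unfolding poly_subst_def using gev_hom[OF hom_Cst] .

lemmas poly_subst_homs = poly_subst.hom_zero poly_subst.hom_one poly_subst.hom_add poly_subst.hom_mult
  poly_subst.hom_uminus poly_subst.hom_minus poly_subst.hom_sum poly_subst.hom_prod poly_subst.hom_power

lemma poly_subst_Cst [simp]: "poly_subst a (Cst c) = Cst c"
  unfolding poly_subst_def by (rule gev_Cst[OF hom_Cst])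

lemma poly_subst_Var [simp]: "poly_subst a (Var x) = a x"
  unfolding poly_subst_def by (rule gev_Var[OF hom_Cst])

lemma poly_eval_subst: "poly_eval a (poly_subst \<sigma> F) = poly_eval (\<lambda>x. poly_eval a (\<sigma> x)) F"
  unfolding poly_subst_def
  by (subst hom_gev[OF poly_eval.comm_ring_hom_axioms]) (simp add: poly_eval_gev[of _ F])

lemma poly_curve_subst: "poly_curve a (poly_subst \<sigma> F) = poly_curve (\<lambda>x. poly_curve a (\<sigma> x)) F"
  unfolding poly_subst_def
  by (subst hom_gev[OF poly_curve.comm_ring_hom_axioms])
    (simp add: poly_curve_Cst[unfolded poly_curve_def] poly_curve_def)

section \<open>Polynomials in a given set of variables\<close>

lemma polys_in_0 [simp]: "0 \<in> polys_in I"
  by (simp add: polys_in_def)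

lemma polys_in_add [intro]: "F \<in> polys_in I \<Longrightarrow> G \<in> polys_in I \<Longrightarrow> F + G \<in> polys_in I"
  using keys_add[of F G] by (fastforce simp: polys_in_def)

lemma polys_in_mult [intro]: "F \<in> polys_in I \<Longrightarrow> G \<in> polys_in I \<Longrightarrow> F * G \<in> polys_in I"
proof -
  assume F: "F \<in> polys_in I" and G: "G \<in> polys_in I"
  have "Poly_Mapping.keys m \<subseteq> I" if "m \<in> Poly_Mapping.keys (F * G)" for m
  proof -
    obtain a b where "m = a + b" "a \<in> Poly_Mapping.keys F" "b \<in> Poly_Mapping.keys G"
      using keys_mult[of F G] \<open>m \<in> Poly_Mapping.keys (F * G)\<close> by blast
    then show ?thesis using F G keys_add[of a b] unfolding polys_in_def by blast
  qed
  then show ?thesis by (simp add: polys_in_def)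
qed

lemma polys_in_single: "Poly_Mapping.keys m \<subseteq> I \<Longrightarrow> Poly_Mapping.single m c \<in> polys_in I"
  by (auto simp: polys_in_def split: if_splits)

lemma polys_in_Cst [simp, intro]: "Cst c \<in> polys_in I"
  by (auto simp: Cst_def intro: polys_in_single)

lemma polys_in_1 [simp, intro]: "1 \<in> polys_in I"
  using polys_in_Cst[of 1] by simp

lemma polys_in_Var [intro]: "x \<in> I \<Longrightarrow> Var x \<in> polys_in I"
  by (auto simp: Var_def intro!: polys_in_single)

lemma polys_in_sum [intro]: "(\<And>i. i \<in> A \<Longrightarrow> f i \<in> polys_in I) \<Longrightarrow> sum f A \<in> polys_in I"
  by (induction A rule: infinite_finite_induct) auto

lemma polys_in_prod [intro]: "(\<And>i. i \<in> A \<Longrightarrow> f i \<in> polys_in I) \<Longrightarrow> prod f A \<in> polys_in I"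
  by (induction A rule: infinite_finite_induct) auto

lemma polys_in_power [intro]: "F \<in> polys_in I \<Longrightarrow> F ^ k \<in> polys_in I"
  by (induction k) auto

lemma uminus_Cst: "- F = Cst (-1) * F" for F :: "'x cpoly"
  by (metis Cst_add Cst_0 Cst_1 add.inverse_unique add.right_inverse mult_1 mult_minus1)

lemma polys_in_uminus [intro]: "F \<in> polys_in I \<Longrightarrow> - F \<in> polys_in I"
  by (subst uminus_Cst) auto

lemma polys_in_diff [intro]: "F \<in> polys_in I \<Longrightarrow> G \<in> polys_in I \<Longrightarrow> F - G \<in> polys_in I"
  using polys_in_add[of F I "- G"] by auto

lemma polys_in_mono: "F \<in> polys_in I \<Longrightarrow> I \<subseteq> J \<Longrightarrow> F \<in> polys_in J"
  by (fastforce simp: polys_in_def)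

lemma powprod_Var: "powprod Var m = (Poly_Mapping.single m 1 :: 'x cpoly)"
proof -
  have *: "Var x ^ k = (Poly_Mapping.single (Poly_Mapping.single x k) 1 :: 'x cpoly)" for x :: 'x and k
  proof (induction k)
    case (Suc k)
    have "Poly_Mapping.single x 1 + Poly_Mapping.single x k = Poly_Mapping.single x (Suc k)"
      by (metis plus_1_eq_Suc single_add)
    with Suc show ?case by (simp add: Var_def mult_single)
  qed simp
  have "(\<Prod>x\<in>A. Poly_Mapping.single (g x) 1) = (Poly_Mapping.single (\<Sum>x\<in>A. g x) 1 :: 'x cpoly)"
    for A :: "'x set" and g
    by (induction A rule: infinite_finite_induct) (auto simp: mult_single)
  then show ?thesis
    by (simp add: powprod_def * flip: poly_mapping_sum_single)
qed

lemma single_eq_powprod: "Poly_Mapping.single m c = Cst c * powprod Var m"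
  by (simp add: powprod_Var Cst_def mult_single)

text \<open>Membership of the intermediate results in \<open>polys_in I\<close> is carried through
  the induction together with \<open>P\<close>, so that the cases of sums and products may assume
  it.\<close>

lemma polys_in_induct [consumes 1, case_names Cst Var add mult]:
  assumes F: "F \<in> polys_in I"
    and P: "\<And>c. P (Cst c)" "\<And>x. x \<in> I \<Longrightarrow> P (Var x)"
      "\<And>F G. F \<in> polys_in I \<Longrightarrow> G \<in> polys_in I \<Longrightarrow> P F \<Longrightarrow> P G \<Longrightarrow> P (F + G)"
      "\<And>F G. F \<in> polys_in I \<Longrightarrow> G \<in> polys_in I \<Longrightarrow> P F \<Longrightarrow> P G \<Longrightarrow> P (F * G)"
  shows "P F"
proof -
  have pow: "P (Var x ^ k) \<and> Var x ^ k \<in> polys_in I" if "x \<in> I" for x k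
    using that P(1)[of 1] by (induction k) (auto intro!: P)
  have "P (powprod Var m) \<and> powprod Var m \<in> polys_in I" if "Poly_Mapping.keys m \<subseteq> I" for m
  proof -
    have "P (\<Prod>x\<in>A. Var x ^ Poly_Mapping.lookup m x) \<and> (\<Prod>x\<in>A. Var x ^ Poly_Mapping.lookup m x) \<in> polys_in I"
      if "finite A" "A \<subseteq> I" for A
      using that P(1)[of 1] by induction (auto intro!: P simp: pow)
    with that show ?thesis by (simp add: powprod_def)
  qed
  then have *: "P (Poly_Mapping.single m c) \<and> Poly_Mapping.single m c \<in> polys_in I" if "Poly_Mapping.keys m \<subseteq> I" for m c
    using that by (auto simp: single_eq_powprod intro!: P)
  have "P (\<Sum>m\<in>A. Poly_Mapping.single m (Poly_Mapping.lookup F m)) \<and>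
      (\<Sum>m\<in>A. Poly_Mapping.single m (Poly_Mapping.lookup F m)) \<in> polys_in I"
    if "finite A" "A \<subseteq> Poly_Mapping.keys F" for A
    using that
  proof induction
    case empty
    show ?case using P(1)[of 0] by simp
  next
    case (insert m A)
    then have "Poly_Mapping.keys m \<subseteq> I" using F by (auto simp: polys_in_def)
    with insert * show ?case by (auto intro!: P)
  qed
  then show ?thesis by (subst poly_mapping_sum_single) simp
qed

lemma poly_eval_cong_polys_in:
  assumes "F \<in> polys_in I" "\<And>x. x \<in> I \<Longrightarrow> a x = b x"
  shows "poly_eval a F = poly_eval b F"
  using assms(1) by (induction rule: polys_in_induct) (simp_all add: assms(2) poly_eval_homs)

lemma poly_subst_polys_in:
  assumes "F \<in> polys_in I" "\<And>x. x \<in> I \<Longrightarrow> \<sigma> x \<in> polys_in J"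
  shows "poly_subst \<sigma> F \<in> polys_in J"
  using assms(1) by (induction rule: polys_in_induct) (auto simp add: assms(2) poly_subst_homs)

section \<open>Partial derivatives\<close>

lemma partial_deriv_superset:
  assumes "finite A" "Poly_Mapping.keys F \<subseteq> A"
  shows "partial_deriv x F = (\<Sum>m\<in>A. Poly_Mapping.single (m - Poly_Mapping.single x 1)
          (Poly_Mapping.lookup F m * of_nat (Poly_Mapping.lookup m x)))"
  unfolding partial_deriv_def using assms
  by (intro sum.mono_neutral_left) (auto simp: in_keys_iff)

lemma partial_deriv_single: "partial_deriv x (Poly_Mapping.single m c) =
    Poly_Mapping.single (m - Poly_Mapping.single x 1) (c * of_nat (Poly_Mapping.lookup m x))"
  by (subst partial_deriv_superset[of "{m}"]) auto

lemma partial_deriv_add: "partial_deriv x (F + G) = partial_deriv x F + partial_deriv x G"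
proof -
  let ?A = "Poly_Mapping.keys F \<union> Poly_Mapping.keys G"
  have "Poly_Mapping.keys (F + G) \<subseteq> ?A" by (rule keys_add)
  then show ?thesis
    by (simp add: partial_deriv_superset[of ?A] lookup_add distrib_right single_add sum.distrib)
qed

lemma partial_deriv_mult: "partial_deriv x (F * G) = partial_deriv x F * G + F * partial_deriv x G"
proof (induction F rule: cpoly_induct)
  case (single m c)
  show ?case
  proof (induction G rule: cpoly_induct)
    case (single m' c')
    let ?e = "Poly_Mapping.single x (1::nat)"
    have 1: "m + m' - ?e = m - ?e + m'" if "Poly_Mapping.lookup m x \<noteq> 0"
      using that by (intro poly_mapping_eqI) (auto simp: lookup_add lookup_minus lookup_single when_def)
    have 2: "m + m' - ?e = m + (m' - ?e)" if "Poly_Mapping.lookup m' x \<noteq> 0"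
      using that by (intro poly_mapping_eqI) (auto simp: lookup_add lookup_minus lookup_single when_def)
    have 3: "Poly_Mapping.single (m - ?e + m') (c * c' * of_nat (Poly_Mapping.lookup m x)) =
        Poly_Mapping.single (m + m' - ?e) (c * c' * of_nat (Poly_Mapping.lookup m x))"
      using 1 by (cases "Poly_Mapping.lookup m x = 0") simp_all
    have 4: "Poly_Mapping.single (m + (m' - ?e)) (c * c' * of_nat (Poly_Mapping.lookup m' x)) =
        Poly_Mapping.single (m + m' - ?e) (c * c' * of_nat (Poly_Mapping.lookup m' x))"
      using 2 by (cases "Poly_Mapping.lookup m' x = 0") simp_all
    have 5: "c * of_nat (Poly_Mapping.lookup m x) * c' = c * c' * of_nat (Poly_Mapping.lookup m x)"
      "c * (c' * of_nat (Poly_Mapping.lookup m' x)) = c * c' * of_nat (Poly_Mapping.lookup m' x)" by simp_all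
    show ?case
      unfolding partial_deriv_single mult_single 5 3 4
      by (simp add: lookup_add distrib_left single_add)
  qed (simp add: distrib_left partial_deriv_add)
qed (simp add: distrib_right partial_deriv_add)

lemma partial_deriv_Cst [simp]: "partial_deriv x (Cst c) = 0"
  by (simp add: Cst_def partial_deriv_single)

lemma partial_deriv_Var: "partial_deriv x (Var y) = (if x = y then 1 else 0)"
  by (simp add: Var_def partial_deriv_single lookup_single when_def)

lemma partial_deriv_0 [simp]: "partial_deriv x 0 = 0"
  using partial_deriv_Cst[of x 0] by simp

lemma partial_deriv_1 [simp]: "partial_deriv x 1 = 0"
  using partial_deriv_Cst[of x 1] by simp

lemma partial_deriv_uminus: "partial_deriv x (- F) = - partial_deriv x F"
  by (metis add.inverse_unique add.right_inverse partial_deriv_0 partial_deriv_add)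

lemma partial_deriv_diff: "partial_deriv x (F - G) = partial_deriv x F - partial_deriv x G"
  by (metis add_uminus_conv_diff partial_deriv_add partial_deriv_uminus)

lemma partial_deriv_sum: "partial_deriv x (\<Sum>i\<in>A. f i) = (\<Sum>i\<in>A. partial_deriv x (f i))"
  by (induction A rule: infinite_finite_induct) (simp_all add: partial_deriv_add)

lemma partial_deriv_polys_in: "F \<in> polys_in I \<Longrightarrow> partial_deriv x F \<in> polys_in I"
  by (induction rule: polys_in_induct)
    (auto simp: partial_deriv_add partial_deriv_mult partial_deriv_Var)

lemma pderiv_poly_curve:
  assumes "F \<in> polys_in I" "finite I"
  shows "pderiv (poly_curve \<gamma> F) = (\<Sum>x\<in>I. poly_curve \<gamma> (partial_deriv x F) * pderiv (\<gamma> x))"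
  using assms(1)
proof (induction rule: polys_in_induct)
  case (Var x)
  have "(\<Sum>y\<in>I. poly_curve \<gamma> (partial_deriv y (Var x)) * pderiv (\<gamma> y)) = (\<Sum>y\<in>I. if y = x then pderiv (\<gamma> y) else 0)"
    by (intro sum.cong) (auto simp: partial_deriv_Var)
  also have "\<dots> = pderiv (\<gamma> x)" using Var assms(2) by simp
  finally show ?case by simp
next
  case (mult F G)
  have "(\<Sum>x\<in>I. poly_curve \<gamma> (partial_deriv x (F * G)) * pderiv (\<gamma> x)) =
     (\<Sum>x\<in>I. poly_curve \<gamma> G * (poly_curve \<gamma> (partial_deriv x F) * pderiv (\<gamma> x))
       + poly_curve \<gamma> F * (poly_curve \<gamma> (partial_deriv x G) * pderiv (\<gamma> x)))"
    by (intro sum.cong) (auto simp: partial_deriv_mult poly_curve_homs algebra_simps)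
  then show ?case using mult
    by (simp add: poly_curve_homs pderiv_mult sum.distrib flip: sum_distrib_left)
qed (simp_all add: poly_curve_homs partial_deriv_add pderiv_add distrib_right sum.distrib pderiv_pCons)

section \<open>Forms\<close>

definition total_deg :: "('x \<Rightarrow>\<^sub>0 nat) \<Rightarrow> nat" where
  "total_deg m = (\<Sum>x\<in>Poly_Mapping.keys m. Poly_Mapping.lookup m x)"

lemma total_deg_superset:
  assumes "finite A" "Poly_Mapping.keys m \<subseteq> A"
  shows "total_deg m = (\<Sum>x\<in>A. Poly_Mapping.lookup m x)"
  unfolding total_deg_def using assms
  by (intro sum.mono_neutral_left) (auto simp: in_keys_iff)

lemma total_deg_add: "total_deg (m + m') = total_deg m + total_deg m'"
proof -
  let ?A = "Poly_Mapping.keys m \<union> Poly_Mapping.keys m'"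
  have "Poly_Mapping.keys (m + m') \<subseteq> ?A" by (rule keys_add)
  then show ?thesis
    by (simp add: total_deg_superset[of ?A] lookup_add sum.distrib)
qed

lemma total_deg_0 [simp]: "total_deg 0 = 0"
  by (simp add: total_deg_def)

lemma total_deg_single [simp]: "total_deg (Poly_Mapping.single x k) = k"
  by (subst total_deg_superset[of "{x}"]) auto

lemma forms_iff: "F \<in> forms n d \<longleftrightarrow> F \<in> polys_in {..n} \<and> (\<forall>m\<in>Poly_Mapping.keys F. total_deg m = d)"
  by (simp add: forms_def total_deg_def)

lemma forms_polys_in: "F \<in> forms n d \<Longrightarrow> F \<in> polys_in {..n}"
  by (simp add: forms_iff)

lemma forms_0 [simp]: "0 \<in> forms n d"
  by (simp add: forms_iff)

lemma forms_add [intro]: "F \<in> forms n d \<Longrightarrow> G \<in> forms n d \<Longrightarrow> F + G \<in> forms n d"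
  using keys_add[of F G] by (auto simp: forms_iff)

lemma forms_mult: "F \<in> forms n d \<Longrightarrow> G \<in> forms n e \<Longrightarrow> F * G \<in> forms n (d + e)"
  using keys_mult[of F G] by (fastforce simp: forms_iff total_deg_add)

lemma forms_single: "Poly_Mapping.keys m \<subseteq> {..n} \<Longrightarrow> total_deg m = d \<Longrightarrow> Poly_Mapping.single m c \<in> forms n d"
  by (auto simp: forms_iff intro: polys_in_single split: if_splits)

lemma forms_Cst [simp, intro]: "Cst c \<in> forms n 0"
  by (auto simp: Cst_def intro!: forms_single)

lemma forms_1 [simp, intro]: "1 \<in> forms n 0"
  using forms_Cst[of 1] by simp

lemma forms_Var [intro]: "i \<le> n \<Longrightarrow> Var i \<in> forms n 1"
  by (auto simp: Var_def intro!: forms_single)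

lemma forms_Cst_mult: "F \<in> forms n d \<Longrightarrow> Cst c * F \<in> forms n d"
  using forms_mult[OF forms_Cst] by fastforce

lemma forms_uminus [intro]: "F \<in> forms n d \<Longrightarrow> - F \<in> forms n d"
  by (subst uminus_Cst) (rule forms_Cst_mult)

lemma forms_diff [intro]: "F \<in> forms n d \<Longrightarrow> G \<in> forms n d \<Longrightarrow> F - G \<in> forms n d"
  using forms_add[of F n d "- G"] by auto

lemma forms_sum [intro]: "(\<And>i. i \<in> A \<Longrightarrow> f i \<in> forms n d) \<Longrightarrow> sum f A \<in> forms n d"
  by (induction A rule: infinite_finite_induct) auto

lemma forms_prod: "(\<And>i. i \<in> A \<Longrightarrow> f i \<in> forms n (d i)) \<Longrightarrow> prod f A \<in> forms n (sum d A)"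
  by (induction A rule: infinite_finite_induct) (auto intro: forms_mult)

lemma forms_power: "F \<in> forms n d \<Longrightarrow> F ^ k \<in> forms n (k * d)"
  by (induction k) (auto intro: forms_mult)

lemma forms_single_key: "F \<in> forms n d \<Longrightarrow> m \<in> Poly_Mapping.keys F \<Longrightarrow>
    Poly_Mapping.keys m \<subseteq> {..n} \<and> total_deg m = d"
  by (auto simp: forms_iff polys_in_def)

text \<open>The natural subtraction gives degree 0 for the derivative of a constant, which is too
  weak in degree counts; that case is settled by \<open>partial_deriv_forms_0\<close>.\<close>

lemma partial_deriv_forms:
  assumes "F \<in> forms n d"
  shows "partial_deriv x F \<in> forms n (d - 1)"
  unfolding partial_deriv_def
proof (rule forms_sum)
  fix m assume "m \<in> Poly_Mapping.keys F"
  then have m: "Poly_Mapping.keys m \<subseteq> {..n}" "total_deg m = d" using forms_single_key[OF assms] by auto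
  show "Poly_Mapping.single (m - Poly_Mapping.single x 1)
       (Poly_Mapping.lookup F m * of_nat (Poly_Mapping.lookup m x)) \<in> forms n (d - 1)"
  proof (cases "Poly_Mapping.lookup m x = 0")
    case False
    have *: "m = (m - Poly_Mapping.single x 1) + Poly_Mapping.single x 1"
      using False by (intro poly_mapping_eqI) (auto simp: lookup_add lookup_minus lookup_single when_def)
    have "Poly_Mapping.keys (m - Poly_Mapping.single x 1) \<subseteq> {..n}"
      using m(1) by (auto simp: in_keys_iff lookup_minus subset_iff)
    moreover have "total_deg (m - Poly_Mapping.single x 1) = d - 1"
      using arg_cong[OF *, of total_deg] m(2) by (simp add: total_deg_add)
    ultimately show ?thesis by (rule forms_single)
  qed simp
qed

lemma partial_deriv_forms_0: "F \<in> forms n 0 \<Longrightarrow> partial_deriv x F = 0"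
  unfolding partial_deriv_def
  by (intro sum.neutral) (auto dest!: forms_single_key simp: total_deg_def in_keys_iff)

lemma powprod_scale: "powprod (\<lambda>x. c * a x) m = c ^ total_deg m * powprod a m" for c :: "'r::comm_monoid_mult"
  by (simp add: powprod_def total_deg_def power_mult_distrib prod.distrib power_sum)

lemma gev_forms_scale:
  assumes "F \<in> forms n d"
  shows "gev h (\<lambda>x. c * a x) F = c ^ d * gev h a F"
proof -
  have "gev h (\<lambda>x. c * a x) F = (\<Sum>m\<in>Poly_Mapping.keys F. c ^ d * (h (Poly_Mapping.lookup F m) * powprod a m))"
    unfolding gev_def using forms_single_key[OF assms]
    by (intro sum.cong) (auto simp: powprod_scale)
  then show ?thesis by (simp add: gev_def sum_distrib_left)
qed

lemma poly_eval_forms_scale: "F \<in> forms n d \<Longrightarrow> poly_eval (\<lambda>x. c * a x) F = c ^ d * poly_eval a F"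
  unfolding poly_eval_gev by (rule gev_forms_scale)

text \<open>Checked on monomials: multiplying the derivative by its variable restores the monomial,
  with the exponent as a factor, and the exponents add up to the degree.\<close>

lemma euler_forms:
  assumes "F \<in> forms n d"
  shows "(\<Sum>x\<le>n. a x * poly_eval a (partial_deriv x F)) = of_nat d * poly_eval a F"
proof -
  have *: "a x * poly_eval a (partial_deriv x (Poly_Mapping.single m c)) =
      of_nat (Poly_Mapping.lookup m x) * (c * powprod a m)" for x m c
  proof (cases "Poly_Mapping.lookup m x = 0")
    case False
    then have "m = (m - Poly_Mapping.single x 1) + Poly_Mapping.single x 1"
      by (intro poly_mapping_eqI) (auto simp: lookup_add lookup_minus lookup_single when_def)
    then have "powprod a m = powprod a (m - Poly_Mapping.single x 1) * a x"
      by (metis powprod_add powprod_single power_one_right)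
    then show ?thesis by (simp add: partial_deriv_single poly_eval_single)
  qed (simp add: partial_deriv_single poly_eval_single)
  have F: "F = (\<Sum>m\<in>Poly_Mapping.keys F. Poly_Mapping.single m (Poly_Mapping.lookup F m))"
    by (rule poly_mapping_sum_single)
  have "(\<Sum>x\<le>n. a x * poly_eval a (partial_deriv x F)) =
    (\<Sum>x\<le>n. \<Sum>m\<in>Poly_Mapping.keys F. of_nat (Poly_Mapping.lookup m x) * (Poly_Mapping.lookup F m * powprod a m))"
    by (subst (1) F) (simp add: partial_deriv_sum poly_eval.hom_sum sum_distrib_left *)
  also have "\<dots> = (\<Sum>m\<in>Poly_Mapping.keys F. (\<Sum>x\<le>n. of_nat (Poly_Mapping.lookup m x)) * (Poly_Mapping.lookup F m * powprod a m))"
    by (subst sum.swap) (simp add: sum_distrib_right)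
  also have "\<dots> = (\<Sum>m\<in>Poly_Mapping.keys F. of_nat d * (Poly_Mapping.lookup F m * powprod a m))"
  proof (intro sum.cong refl)
    fix m assume "m \<in> Poly_Mapping.keys F"
    then have "(\<Sum>x\<le>n. Poly_Mapping.lookup m x) = d" 
      using forms_single_key[OF assms] total_deg_superset[of "{..n}" m] by auto
    then show "(\<Sum>x\<le>n. of_nat (Poly_Mapping.lookup m x)) * (Poly_Mapping.lookup F m * powprod a m) =
      of_nat d * (Poly_Mapping.lookup F m * powprod a m)" by (metis of_nat_sum)
  qed
  also have "\<dots> = of_nat d * poly_eval a F"
    by (simp add: poly_eval_gev gev_def sum_distrib_left)
  finally show ?thesis .
qed

lemma poly_subst_forms:
  assumes F: "F \<in> forms n d" and \<sigma>: "\<And>x. x \<le> n \<Longrightarrow> \<sigma> x \<in> forms k e"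
  shows "poly_subst \<sigma> F \<in> forms k (d * e)"
  unfolding poly_subst_def gev_def
proof (intro forms_sum forms_Cst_mult)
  fix m assume "m \<in> Poly_Mapping.keys F"
  then have m: "Poly_Mapping.keys m \<subseteq> {..n}" "total_deg m = d" using forms_single_key[OF F] by auto
  have "powprod \<sigma> m \<in> forms k (\<Sum>x\<in>Poly_Mapping.keys m. Poly_Mapping.lookup m x * e)"
    unfolding powprod_def using m by (intro forms_prod forms_power \<sigma>) auto
  then show "powprod \<sigma> m \<in> forms k (d * e)"
    using m(2) by (simp add: total_deg_def flip: sum_distrib_right)
qed

section \<open>The Nullstellensatz\<close>

text \<open>The family \<open>r\<close> may take a value twice, so that independence of its image is
  not the right notion; a repetition is itself a relation.\<close>

lemma (in vector_space) more_vectors_dependent: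
  assumes "finite T" "finite B" "card B < card T" "\<And>c. c \<in> T \<Longrightarrow> r c \<in> span B"
  shows "\<exists>a. (\<Sum>c\<in>T. a c *s r c) = 0 \<and> (\<exists>c\<in>T. a c \<noteq> 0)"
proof (cases "inj_on r T")
  case True
  then have "dependent (r ` T)"
    using independent_span_bound[of B "r ` T"] assms by (auto simp: card_image)
  then obtain u where u: "\<exists>v\<in>r ` T. u v \<noteq> 0" "(\<Sum>v\<in>r ` T. u v *s v) = 0"
    using assms(1) by (auto simp: dependent_finite)
  then show ?thesis
    using sum.reindex[OF True, of "\<lambda>v. u v *s v"] by (intro exI[of _ "u \<circ> r"]) auto
next
  case False
  then obtain c d where cd: "c \<in> T" "d \<in> T" "c \<noteq> d" "r c = r d" by (auto simp: inj_on_def)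
  let ?a = "\<lambda>x. if x = c then 1 else if x = d then -1 else 0"
  have "(\<Sum>x\<in>T. ?a x *s r x) = (\<Sum>x\<in>{c, d}. ?a x *s r x)"
    using assms(1) cd by (intro sum.mono_neutral_right) auto
  also have "\<dots> = 0" using cd by simp
  finally show ?thesis using cd(1) by (intro exI[of _ ?a]) auto
qed

definition ring_ideal :: "'r::comm_ring_1 set \<Rightarrow> bool" where
  "ring_ideal P \<longleftrightarrow> 0 \<in> P \<and> (\<forall>a\<in>P. \<forall>b\<in>P. a + b \<in> P) \<and> (\<forall>r. \<forall>a\<in>P. r * a \<in> P)"

lemma ring_idealD:
  assumes "ring_ideal P"
  shows "0 \<in> P" "a \<in> P \<Longrightarrow> b \<in> P \<Longrightarrow> a + b \<in> P" "a \<in> P \<Longrightarrow> r * a \<in> P" "a \<in> P \<Longrightarrow> a * r \<in> P"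
    "a \<in> P \<Longrightarrow> b \<in> P \<Longrightarrow> a - b \<in> P"
proof -
  show 1: "0 \<in> P" "\<And>a b. a \<in> P \<Longrightarrow> b \<in> P \<Longrightarrow> a + b \<in> P" "\<And>a r. a \<in> P \<Longrightarrow> r * a \<in> P"
    using assms by (auto simp: ring_ideal_def)
  show "\<And>a r. a \<in> P \<Longrightarrow> a * r \<in> P" using 1(3) by (metis mult.commute)
  show "\<And>a b. a \<in> P \<Longrightarrow> b \<in> P \<Longrightarrow> a - b \<in> P"
    using 1(2) 1(3)[of _ "-1"] by (metis diff_conv_add_uminus mult_minus1)
qed

lemma ring_ideal_sum: "ring_ideal P \<Longrightarrow> (\<And>i. i \<in> A \<Longrightarrow> f i \<in> P) \<Longrightarrow> sum f A \<in> P"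
  by (induction A rule: infinite_finite_induct) (auto simp: ring_idealD)

lemma ring_ideal_generated: "ring_ideal {\<Sum>i<K. A i * f i | A :: nat \<Rightarrow> 'r::comm_ring_1. True}"
  unfolding ring_ideal_def
proof (intro conjI ballI allI)
  show "0 \<in> {\<Sum>i<K. A i * f i | A. True}" by (auto intro!: exI[of _ "\<lambda>_. 0"])
next
  fix a b assume "a \<in> {\<Sum>i<K. A i * f i | A. True}" "b \<in> {\<Sum>i<K. A i * f i | A. True}"
  then obtain A B where "a = (\<Sum>i<K. A i * f i)" "b = (\<Sum>i<K. B i * f i)" by auto
  then show "a + b \<in> {\<Sum>i<K. A i * f i | A. True}"
    by (auto intro!: exI[of _ "\<lambda>i. A i + B i"] simp: distrib_right sum.distrib)
next
  fix r a assume "a \<in> {\<Sum>i<K. A i * f i | A. True}"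
  then obtain A where "a = (\<Sum>i<K. A i * f i)" by auto
  then show "r * a \<in> {\<Sum>i<K. A i * f i | A. True}"
    by (auto intro!: exI[of _ "\<lambda>i. r * A i"] simp: sum_distrib_left mult_ac)
qed

text \<open>An ideal that is maximal among those avoiding the powers of \<open>G\<close> plays the role of a maximal
  ideal of the localisation at \<open>G\<close>.\<close>

lemma maximal_avoiding_ideal:
  fixes G :: "'r::comm_ring_1"
  assumes I: "ring_ideal I" and G: "\<And>N. G ^ N \<notin> I"
  obtains M where "ring_ideal M" "I \<subseteq> M" "\<And>N. G ^ N \<notin> M"
    "\<And>a. a \<notin> M \<Longrightarrow> \<exists>N r. G ^ N - r * a \<in> M"
    "\<And>a b. a * b \<in> M \<Longrightarrow> a \<in> M \<or> b \<in> M"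
proof -
  let ?C = "{P. ring_ideal P \<and> I \<subseteq> P \<and> (\<forall>N. G ^ N \<notin> P)}"
  have "\<exists>M\<in>?C. \<forall>X\<in>?C. M \<subseteq> X \<longrightarrow> X = M"
  proof (rule subset_Zorn_nonempty)
    show "?C \<noteq> {}" using assms by auto
    fix \<C> assume ne: "\<C> \<noteq> {}" and ch: "subset.chain ?C \<C>"
    have sub: "\<And>P. P \<in> \<C> \<Longrightarrow> P \<in> ?C" using ch by (auto simp: subset_chain_def)
    have tot: "\<And>P Q. P \<in> \<C> \<Longrightarrow> Q \<in> \<C> \<Longrightarrow> P \<subseteq> Q \<or> Q \<subseteq> P" using ch by (auto simp: subset_chain_def)
    have "ring_ideal (\<Union>\<C>)"
      unfolding ring_ideal_def
    proof (intro conjI ballI allI)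
      show "0 \<in> \<Union>\<C>" using ne sub by (fastforce dest: ring_idealD(1))
      fix a b assume "a \<in> \<Union>\<C>" "b \<in> \<Union>\<C>"
      then obtain P Q where PQ: "P \<in> \<C>" "Q \<in> \<C>" "a \<in> P" "b \<in> Q" by auto
      from tot[OF PQ(1,2)] show "a + b \<in> \<Union>\<C>"
      proof
        assume "P \<subseteq> Q" with PQ sub[OF PQ(2)] show ?thesis by (blast intro: ring_idealD(2))
      next
        assume "Q \<subseteq> P" with PQ sub[OF PQ(1)] show ?thesis by (blast intro: ring_idealD(2))
      qed
    next
      fix r a assume "a \<in> \<Union>\<C>"
      then show "r * a \<in> \<Union>\<C>" using sub by (blast intro: ring_idealD(3))
    qed
    then show "\<Union>\<C> \<in> ?C" using ne sub by fast
  qed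
  then obtain M where M: "ring_ideal M" "I \<subseteq> M" "\<And>N. G ^ N \<notin> M"
    and max: "\<And>X. ring_ideal X \<Longrightarrow> I \<subseteq> X \<Longrightarrow> (\<forall>N. G ^ N \<notin> X) \<Longrightarrow> M \<subseteq> X \<Longrightarrow> X = M" by auto
  have A: "\<exists>N r. G ^ N - r * a \<in> M" if a: "a \<notin> M" for a
  proof (rule ccontr)
    assume no: "\<not> ?thesis"
    let ?X = "{m + r * a | m r. m \<in> M}"
    have X: "ring_ideal ?X"
      unfolding ring_ideal_def
    proof (intro conjI ballI allI)
      show "0 \<in> ?X" using ring_idealD(1)[OF M(1)] by (auto intro!: exI[of _ 0])
      fix b c assume "b \<in> ?X" "c \<in> ?X"
      then obtain m r m' r' where "b = m + r * a" "c = m' + r' * a" "m \<in> M" "m' \<in> M" by auto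
      then show "b + c \<in> ?X" using ring_idealD(2)[OF M(1)]
        by (intro CollectI exI[of _ "m + m'"] exI[of _ "r + r'"]) (auto simp: algebra_simps)
    next
      fix s b assume "b \<in> ?X"
      then obtain m r where "b = m + r * a" "m \<in> M" by auto
      then show "s * b \<in> ?X" using ring_idealD(3)[OF M(1)]
        by (intro CollectI exI[of _ "s * m"] exI[of _ "s * r"]) (auto simp: algebra_simps)
    qed
    have "M \<subseteq> ?X" by (force intro: exI[of _ 0])
    moreover have "G ^ N \<notin> ?X" for N
    proof
      assume "G ^ N \<in> ?X"
      then obtain m r where "G ^ N = m + r * a" "m \<in> M" by auto
      then have "G ^ N - r * a \<in> M" by simp
      with no show False by blast
    qed
    ultimately have "?X = M" using M(2) X by (intro max) auto
    moreover have "a \<in> ?X" using ring_idealD(1)[OF M(1)] by (intro CollectI exI[of _ 0] exI[of _ 1]) auto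
    ultimately show False using a by simp
  qed
  moreover have "a \<in> M \<or> b \<in> M" if ab: "a * b \<in> M" for a b
  proof (rule ccontr)
    assume "\<not> ?thesis"
    then obtain N r N' r' where 1: "G ^ N - r * a \<in> M" "G ^ N' - r' * b \<in> M"
      using A by metis
    \<comment> \<open>The product of the two relations expresses a power of \<open>G\<close> through
      elements of \<open>M\<close>: the relations themselves and \<open>a * b\<close>.\<close>
    have "G ^ (N + N') = (G ^ N - r * a) * G ^ N' + (r * a * (G ^ N' - r' * b) + r * r' * (a * b))"
      by (simp add: power_add algebra_simps)
    also have "\<dots> \<in> M"
      using ring_idealD(4)[OF M(1) 1(1)] ring_idealD(3)[OF M(1) 1(2)] ring_idealD(3)[OF M(1) ab]
      by (intro ring_idealD(2)[OF M(1)]) auto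
    finally show False using M(3) by blast
  qed
  ultimately show ?thesis using M that by blast
qed

lemma countable_monomials: "countable (UNIV :: ('x::countable \<Rightarrow>\<^sub>0 nat) set)"
proof -
  let ?g = "\<lambda>m::'x \<Rightarrow>\<^sub>0 nat. (\<lambda>x. (x, Poly_Mapping.lookup m x)) ` Poly_Mapping.keys m"
  have "inj ?g"
  proof (rule injI)
    fix m m' assume eq: "?g m = ?g m'"
    have *: "Poly_Mapping.lookup m x = k \<longleftrightarrow> (x, k) \<in> ?g m \<or> k = 0 \<and> (\<forall>j. (x, j) \<notin> ?g m)" for m :: "'x \<Rightarrow>\<^sub>0 nat" and x k
      by (auto simp: in_keys_iff image_iff)
    show "m = m'" by (intro poly_mapping_eqI) (metis * eq)
  qed
  moreover have "countable (range ?g)"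
    by (rule countable_subset[OF _ countable_Collect_finite]) auto
  ultimately show ?thesis using countable_image_inj_on by blast
qed

lemma vector_space_cpoly: "vector_space (\<lambda>c (F :: 'x cpoly). Cst c * F)"
  by unfold_locales (auto simp: algebra_simps Cst_add Cst_mult)

text \<open>There are uncountably many \<open>c\<close> but only countably many pairs of an exponent
  \<open>N c\<close> and a bound on the codes of the monomials of \<open>r c\<close>. One pair
  therefore occurs infinitely often, and the corresponding \<open>r c\<close> lie in one
  finite-dimensional space.\<close>

lemma uncountable_fibre_cpoly:
  fixes r :: "complex \<Rightarrow> 'x::countable cpoly" and N :: "complex \<Rightarrow> nat"
  shows "\<exists>T a k. finite T \<and> (\<forall>c\<in>T. N c = k) \<and> (\<Sum>c\<in>T. Cst (a c) * r c) = 0 \<and> (\<exists>c\<in>T. a c \<noteq> 0)"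
proof -
  interpret V: vector_space "\<lambda>c (F :: 'x cpoly). Cst c * F" by (rule vector_space_cpoly)
  obtain code :: "('x \<Rightarrow>\<^sub>0 nat) \<Rightarrow> nat" where code: "inj code"
    using countable_monomials by (auto simp: countable_def)
  define b where "b c = Max (insert 0 (code ` Poly_Mapping.keys (r c)))" for c
  let ?h = "\<lambda>c. (N c, b c)"
  have "\<exists>p. infinite {c. ?h c = p}"
  proof (rule ccontr)
    assume "\<not> ?thesis"
    then have "countable (\<Union>p. {c. ?h c = p})" by (intro countable_UN) (auto intro: countable_finite)
    moreover have "(\<Union>p. {c. ?h c = p}) = UNIV" by auto
    ultimately show False using uncountable_UNIV_complex by simp
  qed
  then obtain k m where inf: "infinite {c. ?h c = (k, m)}" by auto
  let ?B = "(\<lambda>m. Poly_Mapping.single m (1::complex)) ` {x. code x \<le> m}"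
  have fin: "finite {x. code x \<le> m}" using finite_vimageI[OF _ code, of "{..m}"] by (simp add: vimage_def)
  obtain T where T: "T \<subseteq> {c. ?h c = (k, m)}" "finite T" "card T = Suc (card ?B)"
    using infinite_arbitrarily_large[OF inf] by blast
  have sp: "r c \<in> V.span ?B" if "c \<in> T" for c
  proof -
    have "r c = (\<Sum>x\<in>Poly_Mapping.keys (r c). Cst (Poly_Mapping.lookup (r c) x) * Poly_Mapping.single x 1)"
      by (subst (1) poly_mapping_sum_single) (simp add: Cst_def mult_single)
    also have "\<dots> \<in> V.span ?B"
    proof (intro V.span_sum V.span_scale V.span_base imageI CollectI)
      fix x assume "x \<in> Poly_Mapping.keys (r c)"
      then have "code x \<le> b c" by (auto simp: b_def)
      also have "b c = m" using that T by auto
      finally show "code x \<le> m" .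
    qed
    finally show ?thesis .
  qed
  have "\<exists>a. (\<Sum>c\<in>T. Cst (a c) * r c) = 0 \<and> (\<exists>c\<in>T. a c \<noteq> 0)"
    by (rule V.more_vectors_dependent[of T ?B r]) (use T fin sp in auto)
  then obtain a where "(\<Sum>c\<in>T. Cst (a c) * r c) = 0" "\<exists>c\<in>T. a c \<noteq> 0" by blast
  then show ?thesis using T(1,2) by (intro exI[of _ T] exI[of _ a] exI[of _ k]) auto
qed

lemma map_poly_Cst_const: "map_poly Cst [:a:] = [:Cst a:]"
  by (intro poly_eqI) (simp add: coeff_map_poly coeff_pCons split: nat.split)

lemma map_poly_Cst_linear: "map_poly Cst [:-a, 1:] = [:-Cst a, 1:]"
proof -
  interpret comm_ring_hom Cst by (rule hom_Cst)
  show ?thesis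
    by (intro poly_eqI) (simp add: coeff_map_poly coeff_pCons hom_uminus split: nat.split)
qed

text \<open>Over the complex numbers \<open>u\<close> splits into linear factors. A prime ideal that
  contains their product contains one of them, because nonzero constants are units.\<close>

lemma prime_ideal_contains_linear_factor:
  fixes M :: "'x cpoly set"
  assumes M: "ring_ideal M" "1 \<notin> M" "\<And>a b. a * b \<in> M \<Longrightarrow> a \<in> M \<or> b \<in> M"
  shows "u \<noteq> 0 \<Longrightarrow> poly (map_poly Cst u) (Var x) \<in> M \<Longrightarrow> \<exists>c. Var x - Cst c \<in> M"
proof (induction "degree u" arbitrary: u)
  case 0
  then obtain a where a: "u = [:a:]" "a \<noteq> 0" by (metis degree_eq_zeroE pCons_eq_0_iff)
  then have "Cst a \<in> M" using 0 by (simp add: map_poly_Cst_const)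
  then have "Cst (1/a) * Cst a \<in> M" by (rule ring_idealD(3)[OF M(1)])
  then show ?case using a M(2) by (simp flip: Cst_mult)
next
  case (Suc k)
  interpret Cst: comm_ring_hom "Cst :: complex \<Rightarrow> 'x cpoly" by (rule hom_Cst)
  interpret mp: map_poly_comm_ring_hom "Cst :: complex \<Rightarrow> 'x cpoly" ..
  obtain z where z: "poly u z = 0" using fundamental_theorem_of_algebra_alt[of u] Suc(2)
    by (metis degree_pCons_0 nat.distinct(1))
  then obtain v where v: "u = [:-z, 1:] * v" by (metis dvdE poly_eq_0_iff_dvd)
  with Suc(3) have v0: "v \<noteq> 0" by auto
  then have deg: "degree u = Suc (degree v)"
    unfolding v using degree_mult_eq[of "[:-z, 1:]" v] by (simp del: mult_pCons_left)
  have "poly (map_poly Cst u) (Var x) = (Var x - Cst z) * poly (map_poly Cst v) (Var x)"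
    unfolding v mp.hom_mult poly_mult
    by (simp add: map_poly_Cst_const map_poly_Cst_linear)
  then have "Var x - Cst z \<in> M \<or> poly (map_poly Cst v) (Var x) \<in> M" using Suc(4) M(3) by metis
  then show ?case using Suc(1)[of v] v0 deg Suc(2) by auto
qed

text \<open>Otherwise every \<open>Var x - Cst c\<close> has an inverse \<open>r c / G ^ N c\<close>
  modulo \<open>M\<close>. Uncountably many inverses satisfy a linear relation; after clearing
  denominators it becomes a nonzero polynomial in the single variable \<open>x\<close> that lies in
  \<open>M\<close>, and such a polynomial has a linear factor in \<open>M\<close>.\<close>

lemma maximal_ideal_point:
  fixes M :: "'x::countable cpoly set"
  assumes M: "ring_ideal M" "\<And>N. G ^ N \<notin> M" "\<And>a. a \<notin> M \<Longrightarrow> \<exists>N r. G ^ N - r * a \<in> M"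
    "\<And>a b. a * b \<in> M \<Longrightarrow> a \<in> M \<or> b \<in> M"
  shows "\<exists>c. Var x - Cst c \<in> M"
proof (rule ccontr)
  assume "\<not> ?thesis"
  then have "\<forall>c. \<exists>N r. G ^ N - r * (Var x - Cst c) \<in> M" using M(3) by blast
  then obtain N r where r: "\<And>c. G ^ N c - r c * (Var x - Cst c) \<in> M" by metis
  from uncountable_fibre_cpoly[of N r] obtain T a k where T: "finite T" "\<And>c. c \<in> T \<Longrightarrow> N c = k"
    and a: "(\<Sum>c\<in>T. Cst (a c) * r c) = 0" and ne: "\<exists>c\<in>T. a c \<noteq> 0" by blast
  interpret Cst: comm_ring_hom "Cst :: complex \<Rightarrow> 'x cpoly" by (rule hom_Cst)
  interpret mp: map_poly_comm_ring_hom "Cst :: complex \<Rightarrow> 'x cpoly" ..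
  \<comment> \<open>The numerator of the sum of the fractions \<open>a c / (X - c)\<close>. It is
    nonzero since its value at a point \<open>c\<close> of \<open>T\<close> retains only the term of
    \<open>c\<close>.\<close>
  define u where "u = (\<Sum>c\<in>T. [:a c:] * (\<Prod>d\<in>T - {c}. [:-d, 1:]))"
  define Q where "Q c = (\<Prod>d\<in>T - {c}. Var x - Cst d)" for c
  have U: "poly (map_poly Cst u) (Var x) = (\<Sum>c\<in>T. Cst (a c) * Q c)"
    unfolding u_def Q_def mp.hom_sum mp.hom_mult mp.hom_prod poly_sum poly_mult poly_prod
    by (simp add: map_poly_Cst_const map_poly_Cst_linear)
  have "(\<Sum>c\<in>T. Cst (a c) * Q c) * G ^ k =
      (\<Sum>c\<in>T. Cst (a c) * Q c * (G ^ k - r c * (Var x - Cst c)))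
      + (\<Sum>c\<in>T. Cst (a c) * r c * (\<Prod>d\<in>T. Var x - Cst d))"
    unfolding sum_distrib_right sum.distrib[symmetric]
    by (intro sum.cong refl) (simp add: Q_def prod.remove[OF T(1)] algebra_simps)
  also have "(\<Sum>c\<in>T. Cst (a c) * r c * (\<Prod>d\<in>T. Var x - Cst d)) = 0"
    using a by (simp flip: sum_distrib_right)
  also have "(\<Sum>c\<in>T. Cst (a c) * Q c * (G ^ k - r c * (Var x - Cst c))) + 0 \<in> M"
    unfolding add_0_right
  proof (intro ring_ideal_sum[OF M(1)] ring_idealD(3)[OF M(1)])
    fix c assume "c \<in> T"
    then show "G ^ k - r c * (Var x - Cst c) \<in> M" using r[of c] T(2) by simp
  qed
  finally have "poly (map_poly Cst u) (Var x) \<in> M" using M(2,4) U by metis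
  moreover have "u \<noteq> 0"
  proof -
    obtain c where c: "c \<in> T" "a c \<noteq> 0" using ne by blast
    have "poly u c = (\<Sum>d\<in>T. a d * (\<Prod>e\<in>T - {d}. c - e))"
      by (simp add: u_def poly_sum poly_prod)
    also have "\<dots> = (\<Sum>d\<in>{c}. a d * (\<Prod>e\<in>T - {d}. c - e))"
      using c T(1) by (intro sum.mono_neutral_right) auto
    also have "\<dots> \<noteq> 0" using c T(1) by auto
    finally show ?thesis by auto
  qed
  moreover have "1 \<notin> M" using M(2)[of 0] by simp
  ultimately have "\<exists>c. Var x - Cst c \<in> M" using prime_ideal_contains_linear_factor[OF M(1) _ M(4)] by blast
  with \<open>\<not> ?thesis\<close> show False by blast
qed

text \<open>The radical form comes out directly: the common zero \<open>p\<close> is read off an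
  ideal without powers of \<open>G\<close>, so that \<open>G\<close> does not vanish at
  \<open>p\<close>. Countability of the set of variables is what the cardinality argument behind
  \<open>maximal_ideal_point\<close> uses.\<close>

theorem nullstellensatz:
  fixes f :: "nat \<Rightarrow> 'x::countable cpoly"
  assumes "\<And>a. (\<forall>i<K. poly_eval a (f i) = 0) \<Longrightarrow> poly_eval a G = 0"
  shows "\<exists>N A. G ^ N = (\<Sum>i<K. A i * f i)"
proof (rule ccontr)
  assume no: "\<not> ?thesis"
  define I where "I = {\<Sum>i<K. A i * f i | A. True}"
  have I: "ring_ideal I" unfolding I_def by (rule ring_ideal_generated)
  have "\<And>N. G ^ N \<notin> I" using no by (auto simp: I_def)
  from maximal_avoiding_ideal[OF I this] obtain M where M: "ring_ideal M" "I \<subseteq> M" "\<And>N. G ^ N \<notin> M"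
    "\<And>a. a \<notin> M \<Longrightarrow> \<exists>N r. G ^ N - r * a \<in> M"
    "\<And>a b. a * b \<in> M \<Longrightarrow> a \<in> M \<or> b \<in> M" by metis
  have "\<forall>x. \<exists>c. Var x - Cst c \<in> M" using maximal_ideal_point[OF M(1,3,4,5)] by blast
  then obtain p where p: "\<And>x. Var x - Cst (p x) \<in> M" by metis
  have *: "F - Cst (poly_eval p F) \<in> M" for F
  proof -
    have "F \<in> polys_in UNIV" by (simp add: polys_in_def)
    then show ?thesis
    proof (induction rule: polys_in_induct)
      case (add F G)
      then show ?case using ring_idealD(2)[OF M(1) add(3,4)]
        by (simp add: poly_eval_homs Cst_add algebra_simps)
    next
      case (mult F G)
      have "F * G - Cst (poly_eval p (F * G)) = (F - Cst (poly_eval p F)) * G + Cst (poly_eval p F) * (G - Cst (poly_eval p G))"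
        by (simp add: poly_eval_homs Cst_mult algebra_simps)
      then show ?case using mult ring_idealD[OF M(1)] by metis
    qed (use p ring_idealD(1)[OF M(1)] in auto)
  qed
  have unit: "c = 0" if "Cst c \<in> M" for c
  proof (rule ccontr)
    assume "c \<noteq> 0"
    then have "Cst (1/c) * Cst c = (1 :: 'x cpoly)" by (simp flip: Cst_mult)
    then have "1 \<in> M" using ring_idealD(3)[OF M(1) that] by metis
    then show False using M(3)[of 0] by simp
  qed
  have "poly_eval p (f i) = 0" if "i < K" for i
  proof -
    have "f i = (\<Sum>j<K. (if j = i then 1 else 0) * f j)"
      using that by (simp add: if_distrib[where f = "\<lambda>z. z * _"] sum.delta cong: if_cong)
    then have "f i \<in> I" unfolding I_def by (intro CollectI exI[of _ "\<lambda>j. if j = i then 1 else 0"] conjI TrueI)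
    then have "f i \<in> M" by (rule subsetD[OF M(2)])
    then have "f i - (f i - Cst (poly_eval p (f i))) \<in> M" using * ring_idealD(5)[OF M(1)] by blast
    then show ?thesis by (intro unit) simp
  qed
  then have "poly_eval p G = 0" using assms by blast
  then have "G \<in> M" using *[of G] by simp
  then show False using M(3)[of 1] by simp
qed

section \<open>Lifting solutions along formal curves\<close>

lemma poly_curve_taylor:
  assumes "F \<in> polys_in I" "finite I"
  shows "\<exists>R. poly_curve (\<lambda>x. \<gamma> x + h * \<delta> x) F =
    poly_curve \<gamma> F + h * (\<Sum>x\<in>I. poly_curve \<gamma> (partial_deriv x F) * \<delta> x) + h\<^sup>2 * R"
  using assms(1)
proof (induction rule: polys_in_induct)
  case (Var x)
  have "(\<Sum>y\<in>I. poly_curve \<gamma> (partial_deriv y (Var x)) * \<delta> y) = (\<Sum>y\<in>I. if y = x then \<delta> y else 0)"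
    by (intro sum.cong) (auto simp: partial_deriv_Var)
  also have "\<dots> = \<delta> x" using Var assms(2) by simp
  finally show ?case by (intro exI[of _ 0]) simp
next
  case (add F G)
  let ?D = "\<lambda>F. \<Sum>x\<in>I. poly_curve \<gamma> (partial_deriv x F) * \<delta> x"
  obtain R S where "poly_curve (\<lambda>x. \<gamma> x + h * \<delta> x) F = poly_curve \<gamma> F + h * ?D F + h\<^sup>2 * R"
    "poly_curve (\<lambda>x. \<gamma> x + h * \<delta> x) G = poly_curve \<gamma> G + h * ?D G + h\<^sup>2 * S" using add by blast
  moreover have "?D (F + G) = ?D F + ?D G"
    by (simp add: partial_deriv_add poly_curve_homs distrib_right sum.distrib)
  ultimately show ?case by (intro exI[of _ "R + S"]) (simp add: poly_curve_homs algebra_simps)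
next
  case (mult F G)
  let ?D = "\<lambda>F. \<Sum>x\<in>I. poly_curve \<gamma> (partial_deriv x F) * \<delta> x"
  obtain R S where RS: "poly_curve (\<lambda>x. \<gamma> x + h * \<delta> x) F = poly_curve \<gamma> F + h * ?D F + h\<^sup>2 * R"
    "poly_curve (\<lambda>x. \<gamma> x + h * \<delta> x) G = poly_curve \<gamma> G + h * ?D G + h\<^sup>2 * S" using mult by blast
  have D: "?D (F * G) = poly_curve \<gamma> G * ?D F + poly_curve \<gamma> F * ?D G"
    unfolding sum_distrib_left sum.distrib[symmetric]
    by (intro sum.cong) (auto simp: partial_deriv_mult poly_curve_homs algebra_simps)
  show ?case unfolding poly_curve_homs RS D
    by (intro exI[of _ "?D F * ?D G + poly_curve \<gamma> F * S + R * poly_curve \<gamma> G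
      + h * (?D F * S + R * ?D G) + h\<^sup>2 * R * S"]) (simp add: algebra_simps power2_eq_square)
qed (auto intro!: exI[of _ 0])

lemma coeff_0_poly_curve: "coeff (poly_curve \<gamma> F) 0 = poly_eval (\<lambda>x. coeff (\<gamma> x) 0) F"
  by (simp add: poly_poly_curve flip: poly_0_coeff_0)

lemma monom_Suc_dvd_iff: "monom 1 (Suc M) dvd p \<longleftrightarrow> monom 1 M dvd p \<and> coeff p M = 0"
  for p :: "complex poly"
  by (auto simp: monom_1_dvd_iff' less_Suc_eq)

lemma sum_const_poly: "(\<Sum>x\<in>A. [:f x:]) = [:\<Sum>x\<in>A. f x :: complex:]"
  by (induction A rule: infinite_finite_induct) auto

text \<open>Newton iteration in the parameter of the curve, starting from \<open>z + t w\<close>.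
  The vectors \<open>B k\<close> invert the linearized equations and are used unchanged at every
  stage. All corrections start in degree two, so that the velocity \<open>w\<close>
  survives.\<close>

lemma hensel_curve:
  fixes f :: "nat \<Rightarrow> 'x cpoly" and B :: "nat \<Rightarrow> 'x \<Rightarrow> complex"
  assumes I: "finite I" and f: "\<And>i. i < K \<Longrightarrow> f i \<in> polys_in I"
    and z: "\<And>i. i < K \<Longrightarrow> poly_eval z (f i) = 0"
    and w: "\<And>i. i < K \<Longrightarrow> (\<Sum>x\<in>I. poly_eval z (partial_deriv x (f i)) * w x) = 0"
    and B: "\<And>i k. i < K \<Longrightarrow> k < K \<Longrightarrow>
      (\<Sum>x\<in>I. poly_eval z (partial_deriv x (f i)) * B k x) = (if i = k then 1 else 0)"
  shows "\<exists>c. \<forall>i<K. monom 1 (M + 2) dvd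
    poly_curve (\<lambda>x. [:z x, w x:] + monom 1 2 * (\<Sum>k<K. Polynomial.smult (B k x) (c k))) (f i)"
proof (induction M)
  case 0
  have "monom 1 2 dvd poly_curve (\<lambda>x. [:z x, w x:]) (f i)" if i: "i < K" for i
  proof -
    obtain R where R: "poly_curve (\<lambda>x. [:z x:] + [:0, 1:] * [:w x:]) (f i) =
      poly_curve (\<lambda>x. [:z x:]) (f i) + [:0, 1:] * (\<Sum>x\<in>I. poly_curve (\<lambda>x. [:z x:]) (partial_deriv x (f i)) * [:w x:])
      + [:0, 1:]\<^sup>2 * R" using poly_curve_taylor[OF f[OF i] I, of "\<lambda>x. [:z x:]" "[:0, 1:]" "\<lambda>x. [:w x:]"] by blast
    have c: "poly_curve (\<lambda>x. [:z x:]) F = [:poly_eval z F:]" for F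
      using hom_gev[OF hom_pCons, of "\<lambda>c. c" z F] by (simp add: poly_curve_def poly_eval_gev)
    have "(\<Sum>x\<in>I. poly_curve (\<lambda>x. [:z x:]) (partial_deriv x (f i)) * [:w x:]) =
      [:\<Sum>x\<in>I. poly_eval z (partial_deriv x (f i)) * w x:]"
      unfolding sum_const_poly[symmetric] by (intro sum.cong) (simp_all add: c)
    also have "\<dots> = 0" using w[OF i] by simp
    finally have "poly_curve (\<lambda>x. [:z x, w x:]) (f i) = [:0, 1:]\<^sup>2 * R"
      using R z[OF i] by (simp add: c)
    then show ?thesis by (simp add: x_as_monom monom_power)
  qed
  then show ?case by (intro exI[of _ "\<lambda>_. 0"]) (simp add: numeral_2_eq_2)
next
  case (Suc M)
  then obtain c where c: "\<And>i. i < K \<Longrightarrow> monom 1 (M + 2) dvd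
    poly_curve (\<lambda>x. [:z x, w x:] + monom 1 2 * (\<Sum>k<K. Polynomial.smult (B k x) (c k))) (f i)" by blast
  define \<gamma> where "\<gamma> x = [:z x, w x:] + monom 1 2 * (\<Sum>k<K. Polynomial.smult (B k x) (c k))" for x
  \<comment> \<open>The first coefficient that may still be nonzero in equation \<open>i\<close>.
    Moving by \<open>- e\<close> along the vectors \<open>B k\<close> cancels it, and the quadratic
    Taylor term is divisible by a higher power of the parameter.\<close>
  define e where "e i = coeff (poly_curve \<gamma> (f i)) (M + 2)" for i
  define \<delta> where "\<delta> x = [:- (\<Sum>k<K. e k * B k x):]" for x
  define c' where "c' k = c k - monom (e k) M" for k
  have \<gamma>': "[:z x, w x:] + monom 1 2 * (\<Sum>k<K. Polynomial.smult (B k x) (c' k)) = \<gamma> x + monom 1 (M + 2) * \<delta> x" for x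
  proof -
    have *: "(\<Sum>k<K. Polynomial.smult (B k x) (c' k)) =
      (\<Sum>k<K. Polynomial.smult (B k x) (c k)) - monom (\<Sum>k<K. e k * B k x) M"
      by (simp add: c'_def smult_diff_right sum_subtractf smult_monom monom_sum mult.commute)
    have **: "monom 1 (M + 2) * \<delta> x = - (monom 1 2 * monom (\<Sum>k<K. e k * B k x) M)"
      by (simp add: \<delta>_def mult_monom minus_monom add.commute smult_monom)
    show ?thesis unfolding \<gamma>_def * ** right_diff_distrib by simp
  qed
  have \<gamma>0: "coeff (\<gamma> x) 0 = z x" for x by (simp add: \<gamma>_def coeff_mult)
  have "monom 1 (Suc M + 2) dvd poly_curve (\<lambda>x. \<gamma> x + monom 1 (M + 2) * \<delta> x) (f i)" if i: "i < K" for i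
  proof -
    obtain R where R: "poly_curve (\<lambda>x. \<gamma> x + monom 1 (M + 2) * \<delta> x) (f i) =
      poly_curve \<gamma> (f i) + monom 1 (M + 2) * (\<Sum>x\<in>I. poly_curve \<gamma> (partial_deriv x (f i)) * \<delta> x)
      + (monom 1 (M + 2))\<^sup>2 * R" using poly_curve_taylor[OF f[OF i] I, of \<gamma> "monom 1 (M + 2)" \<delta>] by blast
    let ?S = "\<Sum>x\<in>I. poly_curve \<gamma> (partial_deriv x (f i)) * \<delta> x"
    have sq: "(monom 1 (M + 2))\<^sup>2 * R = monom 1 (Suc (M + 2)) * (monom 1 (M + 1) * R)"
      by (simp add: monom_power mult_monom power2_eq_square flip: mult.assoc)
    have "coeff ?S 0 = (\<Sum>x\<in>I. poly_eval z (partial_deriv x (f i)) * - (\<Sum>k<K. e k * B k x))"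
      by (simp add: coeff_sum coeff_mult_0 coeff_0_poly_curve \<gamma>0 \<delta>_def mult.commute)
    also have "\<dots> = - (\<Sum>k<K. e k * (\<Sum>x\<in>I. poly_eval z (partial_deriv x (f i)) * B k x))"
      unfolding sum_distrib_left mult_minus_right sum_negf
      by (subst sum.swap) (simp add: mult_ac)
    also have "\<dots> = - (\<Sum>k<K. if i = k then e k else 0)"
      using i by (intro arg_cong[of _ _ uminus] sum.cong) (auto simp: B)
    also have "\<dots> = - e i" using i by simp
    finally have S0: "coeff ?S 0 = - e i" .
    have "coeff (poly_curve (\<lambda>x. \<gamma> x + monom 1 (M + 2) * \<delta> x) (f i)) (M + 2) = e i + coeff ?S 0"
      unfolding R sq coeff_add e_def by (simp add: coeff_monom_mult)
    moreover have "monom 1 (M + 2) dvd poly_curve (\<lambda>x. \<gamma> x + monom 1 (M + 2) * \<delta> x) (f i)"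
      unfolding R using c[OF i, folded \<gamma>_def] by (intro dvd_add) (auto simp: power2_eq_square)
    ultimately show ?thesis using S0 by (simp add: monom_Suc_dvd_iff)
  qed
  then show ?case by (intro exI[of _ c'] allI impI) (simp only: \<gamma>')
qed

section \<open>Systems of weighted bihomogeneous equations\<close>

definition wdeg :: "('x \<Rightarrow> nat) \<Rightarrow> ('x \<Rightarrow>\<^sub>0 nat) \<Rightarrow> nat" where
  "wdeg \<alpha> m = (\<Sum>x\<in>Poly_Mapping.keys m. Poly_Mapping.lookup m x * \<alpha> x)"

text \<open>Two weights on one set of variables. A variable of the second group may also have a
  first weight; this is needed for multipliers that compensate differences of degree between
  equations.\<close>

definition wforms :: "'x set \<Rightarrow> ('x \<Rightarrow> nat) \<Rightarrow> ('x \<Rightarrow> nat) \<Rightarrow> nat \<Rightarrow> nat \<Rightarrow> 'x cpoly set" where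
  "wforms I \<alpha> \<beta> p q = {F \<in> polys_in I. \<forall>m\<in>Poly_Mapping.keys F. wdeg \<alpha> m = p \<and> wdeg \<beta> m = q}"

lemma wdeg_superset:
  assumes "finite A" "Poly_Mapping.keys m \<subseteq> A"
  shows "wdeg \<alpha> m = (\<Sum>x\<in>A. Poly_Mapping.lookup m x * \<alpha> x)"
  unfolding wdeg_def using assms
  by (intro sum.mono_neutral_left) (auto simp: in_keys_iff)

lemma wdeg_add: "wdeg \<alpha> (m + m') = wdeg \<alpha> m + wdeg \<alpha> m'"
proof -
  let ?A = "Poly_Mapping.keys m \<union> Poly_Mapping.keys m'"
  have "Poly_Mapping.keys (m + m') \<subseteq> ?A" by (rule keys_add)
  then show ?thesis
    by (simp add: wdeg_superset[of ?A] lookup_add sum.distrib distrib_right)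
qed

lemma wdeg_0 [simp]: "wdeg \<alpha> 0 = 0"
  by (simp add: wdeg_def)

lemma wdeg_single [simp]: "wdeg \<alpha> (Poly_Mapping.single x k) = k * \<alpha> x"
  by (subst wdeg_superset[of "{x}"]) auto

lemma wforms_polys_in: "F \<in> wforms I \<alpha> \<beta> p q \<Longrightarrow> F \<in> polys_in I"
  by (simp add: wforms_def)

lemma wforms_0 [simp]: "0 \<in> wforms I \<alpha> \<beta> p q"
  by (simp add: wforms_def)

lemma wforms_add [intro]: "F \<in> wforms I \<alpha> \<beta> p q \<Longrightarrow> G \<in> wforms I \<alpha> \<beta> p q \<Longrightarrow> F + G \<in> wforms I \<alpha> \<beta> p q"
  using keys_add[of F G] by (auto simp: wforms_def)

lemma wforms_mult: "F \<in> wforms I \<alpha> \<beta> p q \<Longrightarrow> G \<in> wforms I \<alpha> \<beta> p' q' \<Longrightarrow> F * G \<in> wforms I \<alpha> \<beta> (p + p') (q + q')"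
  using keys_mult[of F G] by (fastforce simp: wforms_def wdeg_add)

lemma wforms_single: "Poly_Mapping.keys m \<subseteq> I \<Longrightarrow> Poly_Mapping.single m c \<in> wforms I \<alpha> \<beta> (wdeg \<alpha> m) (wdeg \<beta> m)"
  by (auto simp: wforms_def intro: polys_in_single split: if_splits)

lemma wforms_Cst [simp, intro]: "Cst c \<in> wforms I \<alpha> \<beta> 0 0"
  using wforms_single[of 0 I c \<alpha> \<beta>] by (simp add: Cst_def)

lemma wforms_Var: "x \<in> I \<Longrightarrow> Var x \<in> wforms I \<alpha> \<beta> (\<alpha> x) (\<beta> x)"
  using wforms_single[of "Poly_Mapping.single x 1" I 1 \<alpha> \<beta>] by (simp add: Var_def)

lemma wforms_Cst_mult: "F \<in> wforms I \<alpha> \<beta> p q \<Longrightarrow> Cst c * F \<in> wforms I \<alpha> \<beta> p q"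
  using wforms_mult[OF wforms_Cst] by fastforce

lemma wforms_uminus: "F \<in> wforms I \<alpha> \<beta> p q \<Longrightarrow> - F \<in> wforms I \<alpha> \<beta> p q"
  by (subst uminus_Cst) (rule wforms_Cst_mult)

lemma wforms_diff: "F \<in> wforms I \<alpha> \<beta> p q \<Longrightarrow> G \<in> wforms I \<alpha> \<beta> p q \<Longrightarrow> F - G \<in> wforms I \<alpha> \<beta> p q"
  using wforms_add[OF _ wforms_uminus, of F I \<alpha> \<beta> p q G] by simp

lemma wforms_sum: "(\<And>i. i \<in> A \<Longrightarrow> f i \<in> wforms I \<alpha> \<beta> p q) \<Longrightarrow> sum f A \<in> wforms I \<alpha> \<beta> p q"
  by (induction A rule: infinite_finite_induct) auto

lemma wforms_power: "F \<in> wforms I \<alpha> \<beta> p q \<Longrightarrow> F ^ k \<in> wforms I \<alpha> \<beta> (k * p) (k * q)"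
  using wforms_Cst[of 1 I \<alpha> \<beta>] by (induction k) (auto intro: wforms_mult)

definition bpart :: "('x \<Rightarrow> nat) \<Rightarrow> ('x \<Rightarrow> nat) \<Rightarrow> nat \<Rightarrow> nat \<Rightarrow> 'x cpoly \<Rightarrow> 'x cpoly" where
  "bpart \<alpha> \<beta> p q F = (\<Sum>m | m \<in> Poly_Mapping.keys F \<and> wdeg \<alpha> m = p \<and> wdeg \<beta> m = q.
     Poly_Mapping.single m (Poly_Mapping.lookup F m))"

lemma lookup_bpart: "Poly_Mapping.lookup (bpart \<alpha> \<beta> p q F) m =
    (if wdeg \<alpha> m = p \<and> wdeg \<beta> m = q then Poly_Mapping.lookup F m else 0)"
  by (auto simp: bpart_def lookup_sum lookup_single when_def in_keys_iff sum.delta' split: if_splits)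

lemma bpart_add: "bpart \<alpha> \<beta> p q (F + G) = bpart \<alpha> \<beta> p q F + bpart \<alpha> \<beta> p q G"
  by (intro poly_mapping_eqI) (simp add: lookup_bpart lookup_add)

lemma bpart_sum: "bpart \<alpha> \<beta> p q (sum F A) = (\<Sum>i\<in>A. bpart \<alpha> \<beta> p q (F i))"
  by (intro poly_mapping_eqI) (auto simp: lookup_bpart lookup_sum)

lemma bpart_wforms: "F \<in> wforms I \<alpha> \<beta> p' q' \<Longrightarrow> bpart \<alpha> \<beta> p q F = (if p = p' \<and> q = q' then F else 0)"
  by (intro poly_mapping_eqI) (auto simp: lookup_bpart wforms_def in_keys_iff)

lemma bpart_mult:
  assumes f: "f \<in> wforms I \<alpha> \<beta> p' q'"
  shows "bpart \<alpha> \<beta> p q (F * f) =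
    (if p' \<le> p \<and> q' \<le> q then bpart \<alpha> \<beta> (p - p') (q - q') F * f else 0)"
proof (induction F rule: cpoly_induct)
  case (single m c)
  have m: "Poly_Mapping.single m c \<in> wforms UNIV \<alpha> \<beta> (wdeg \<alpha> m) (wdeg \<beta> m)"
    by (rule wforms_single) simp
  have "f \<in> wforms UNIV \<alpha> \<beta> p' q'" using f by (auto simp: wforms_def polys_in_def)
  from wforms_mult[OF m this] show ?case
    by (auto simp: bpart_wforms[OF m] bpart_wforms)
next
  case (add F G)
  then show ?case by (simp add: distrib_right bpart_add)
qed

text \<open>The matrix \<open>T\<close> of the pencil is the identity at parameter 1, so that its
  determinant is a nonzero polynomial. Multiplication by the adjugate turns the hypothesis into
  divisibility of \<open>det T * u \<mu>\<close> by a power of the parameter larger than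
  \<open>degree (det T)\<close>, and this forces \<open>u \<mu>\<close> to vanish at 0. The exponent
  depends only on \<open>C\<close>, not on \<open>u\<close>.\<close>

lemma pencil_divisibility:
  fixes C :: "'m \<Rightarrow> 'm \<Rightarrow> complex"
  assumes S: "finite S"
  shows "\<exists>M. \<forall>u. (\<forall>\<mu>\<in>S. monom 1 M dvd
      [:1, -1:] * (\<Sum>\<nu>\<in>S. Polynomial.smult (C \<mu> \<nu>) (u \<nu>)) + [:0, 1:] * u \<mu>) \<longrightarrow>
      (\<forall>\<mu>\<in>S. coeff (u \<mu>) 0 = 0)"
proof -
  obtain e where e: "bij_betw e {..<card S} S" using ex_bij_betw_nat_finite[OF S] by (auto simp: atLeast0LessThan)
  define N where "N = card S"
  define T where "T = mat N N (\<lambda>(i, j). [:1, -1:] * [:C (e i) (e j):] + (if i = j then [:0, 1:] else 0))"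
  have T: "T \<in> carrier_mat N N" by (simp add: T_def)
  have "map_mat (\<lambda>p. poly p 1) T = 1\<^sub>m N"
    by (intro eq_matI) (auto simp: T_def)
  then have "poly (det T) 1 = 1"
    using comm_ring_hom.hom_det[OF poly_hom.comm_ring_hom_axioms, of 1 T] by simp
  then have D0: "det T \<noteq> 0" by auto
  define M where "M = Suc (degree (det T))"
  show ?thesis
  proof (intro exI[of _ M] allI impI ballI)
    fix u \<mu> assume u: "\<forall>\<mu>\<in>S. monom 1 M dvd
      [:1, -1:] * (\<Sum>\<nu>\<in>S. Polynomial.smult (C \<mu> \<nu>) (u \<nu>)) + [:0, 1:] * u \<mu>" and \<mu>: "\<mu> \<in> S"
    define U where "U = vec N (\<lambda>i. u (e i))"
    have U: "U \<in> carrier_vec N" by (simp add: U_def)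
    have TU: "monom 1 M dvd (T *\<^sub>v U) $ i" if i: "i < N" for i
    proof -
      have ei: "e i \<in> S" using e i by (auto simp: bij_betw_def N_def)
      have "(T *\<^sub>v U) $ i = (\<Sum>j<N. ([:1, -1:] * [:C (e i) (e j):] + (if i = j then [:0, 1:] else 0)) * u (e j))"
        using i by (simp add: T_def U_def scalar_prod_def atLeast0LessThan)
      also have "\<dots> = (\<Sum>j<N. [:1, -1:] * Polynomial.smult (C (e i) (e j)) (u (e j)) + (if i = j then [:0, 1:] * u (e j) else 0))"
        by (intro sum.cong) (auto simp: algebra_simps)
      also have "\<dots> = [:1, -1:] * (\<Sum>j<N. Polynomial.smult (C (e i) (e j)) (u (e j))) + [:0, 1:] * u (e i)"
        using i by (simp add: sum.distrib sum_distrib_left del: mult_pCons_left)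
      also have "(\<Sum>j<N. Polynomial.smult (C (e i) (e j)) (u (e j))) = (\<Sum>\<nu>\<in>S. Polynomial.smult (C (e i) \<nu>) (u \<nu>))"
        unfolding N_def by (rule sum.reindex_bij_betw[OF e])
      finally show ?thesis using u ei by simp
    qed
    have adj: "adj_mat T \<in> carrier_mat N N" "adj_mat T * T = det T \<cdot>\<^sub>m 1\<^sub>m N" using adj_mat[OF T] by auto
    have "adj_mat T *\<^sub>v (T *\<^sub>v U) = (det T \<cdot>\<^sub>m 1\<^sub>m N) *\<^sub>v U"
      using adj T U by (simp flip: assoc_mult_mat_vec)
    also have "\<dots> = det T \<cdot>\<^sub>v U" using U by (intro eq_vecI) (auto simp: U_def scalar_prod_def if_distrib[where f = "\<lambda>z. z * _"]
      if_distrib[where f = "\<lambda>z. _ * z"] sum.delta cong: if_cong)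
    finally have eq: "adj_mat T *\<^sub>v (T *\<^sub>v U) = det T \<cdot>\<^sub>v U" .
    obtain i where i: "i < N" "e i = \<mu>" using e \<mu> by (force simp: bij_betw_def N_def)
    have "(adj_mat T *\<^sub>v (T *\<^sub>v U)) $ i = (\<Sum>j<N. adj_mat T $$ (i, j) * (T *\<^sub>v U) $ j)"
      using i adj(1) T U by (auto simp: scalar_prod_def atLeast0LessThan intro!: sum.cong)
    then have "monom 1 M dvd (adj_mat T *\<^sub>v (T *\<^sub>v U)) $ i"
      using TU by (auto intro!: dvd_sum dvd_mult)
    then have dv: "monom 1 M dvd det T * u \<mu>" unfolding eq using i U by (simp add: U_def)
    show "coeff (u \<mu>) 0 = 0"
    proof (rule ccontr)
      assume "coeff (u \<mu>) 0 \<noteq> 0"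
      then have "u \<mu> \<noteq> 0" and o: "order 0 (u \<mu>) = 0" by (auto simp: order_0I poly_0_coeff_0)
      have "[:0, 1:] ^ M dvd det T * u \<mu>" using dv by (simp add: x_as_monom monom_power)
      then have "M \<le> order 0 (det T * u \<mu>)" using D0 \<open>u \<mu> \<noteq> 0\<close> by (intro order_max) auto
      also have "\<dots> = order 0 (det T)" using D0 \<open>u \<mu> \<noteq> 0\<close> o by (simp add: order_mult)
      also have "\<dots> \<le> degree (det T)" using D0 by (rule order_degree)
      finally show False by (simp add: M_def)
    qed
  qed
qed

lemma finite_monomials:
  assumes "finite I" "\<And>x. x \<in> I \<Longrightarrow> \<alpha> x + \<beta> x > 0"
  shows "finite {m. Poly_Mapping.keys m \<subseteq> I \<and> wdeg \<alpha> m = p \<and> wdeg \<beta> m = q}"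
proof -
  let ?S = "{m. Poly_Mapping.keys m \<subseteq> I \<and> wdeg \<alpha> m = p \<and> wdeg \<beta> m = q}"
  let ?F = "{g. \<forall>x. (x \<in> I \<longrightarrow> g x \<in> {..p+q}) \<and> (x \<notin> I \<longrightarrow> g x = 0)}"
  have "finite ?F" using assms(1) by (intro finite_set_of_finite_funs) auto
  moreover have "Poly_Mapping.lookup ` ?S \<subseteq> ?F"
  proof (rule image_subsetI)
    fix m assume "m \<in> ?S"
    then have m: "Poly_Mapping.keys m \<subseteq> I" "wdeg \<alpha> m = p" "wdeg \<beta> m = q" by auto
    have "Poly_Mapping.lookup m x \<in> {..p + q}" if x: "x \<in> I" for x
    proof -
      have "Poly_Mapping.lookup m x \<le> Poly_Mapping.lookup m x * (\<alpha> x + \<beta> x)" using assms(2)[OF x]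
        by (metis mult_le_mono2 mult.right_neutral Suc_leI One_nat_def)
      also have "\<dots> \<le> (\<Sum>x\<in>I. Poly_Mapping.lookup m x * (\<alpha> x + \<beta> x))"
        using assms(1) x by (intro member_le_sum) auto
      also have "\<dots> = p + q"
        using assms(1) m by (simp add: wdeg_superset[of I] sum.distrib distrib_left)
      finally show ?thesis by simp
    qed
    then show "Poly_Mapping.lookup m \<in> ?F" using m by (auto simp: in_keys_iff)
  qed
  ultimately have "finite (Poly_Mapping.lookup ` ?S)" by (rule finite_subset[rotated])
  moreover have "inj_on Poly_Mapping.lookup ?S" by (rule inj_onI, rule poly_mapping_eqI) simp
  ultimately show ?thesis by (rule finite_imageD)
qed

lemma sum_ge_card_mult:
  fixes h :: "'a \<Rightarrow> nat"
  assumes "finite A" "A \<noteq> {}" "card A * N \<le> sum h A"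
  shows "\<exists>a\<in>A. N \<le> h a"
proof (rule ccontr)
  assume "\<not> ?thesis"
  then have "\<And>a. a \<in> A \<Longrightarrow> h a < N" by auto
  then have "sum h A < card A * N" using assms(1,2) by (metis sum_bounded_above_strict card_gt_0_iff of_nat_id)
  with assms(3) show False by simp
qed

lemma split_monomial:
  assumes "N \<le> Poly_Mapping.lookup m a" "N \<le> Poly_Mapping.lookup m b" "a \<noteq> b"
  shows "\<exists>r. Poly_Mapping.single m 1 = r * (Var a * Var b :: 'x cpoly) ^ N"
proof -
  have V: "Var x ^ N = (Poly_Mapping.single (Poly_Mapping.single x N) 1 :: 'x cpoly)" for x
    using powprod_Var[of "Poly_Mapping.single x N"] by (simp add: powprod_single)
  let ?e = "Poly_Mapping.single a N + Poly_Mapping.single b N"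
  have "m = (m - ?e) + ?e"
    using assms by (intro poly_mapping_eqI) (auto simp: lookup_add lookup_minus lookup_single when_def)
  then have "Poly_Mapping.single m 1 = Poly_Mapping.single (m - ?e) 1 * (Poly_Mapping.single ?e 1 :: 'x cpoly)"
    by (simp add: mult_single)
  also have "Poly_Mapping.single ?e 1 = (Var a * Var b :: 'x cpoly) ^ N"
    by (simp add: power_mult_distrib V mult_single)
  finally show ?thesis by blast
qed


lemma poly_subst_restrict: "F \<in> polys_in I \<Longrightarrow> poly_subst (\<lambda>x. if x \<in> I then Var x else 0) F = F"
  by (induction rule: polys_in_induct) (simp_all add: poly_subst_homs)

lemma bpart_polys_in: "F \<in> polys_in I \<Longrightarrow> bpart \<alpha> \<beta> p q F \<in> wforms I \<alpha> \<beta> p q"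
  by (auto simp: wforms_def polys_in_def in_keys_iff lookup_bpart split: if_splits)

text \<open>A system \<open>f\<close> is compared with a system \<open>g\<close> of the same
  bidegrees that has a simple zero \<open>z\<close>. If \<open>f\<close> had no admissible zero, all
  monomials of one large bidegree would be combinations of the \<open>f i\<close>. Deform to
  \<open>(1 - \<sigma>) g + \<sigma> f\<close> and continue \<open>z\<close> to a formal curve with
  parameter \<open>\<sigma>\<close>. Along it the vector of these monomials is annihilated, to high
  order, by a pencil whose value at \<open>\<sigma> = 1\<close> is the identity. So all of them
  vanish at \<open>z\<close>, in spite of the one made of \<open>x0\<close> and \<open>y0\<close>
  only.\<close>

theorem weighted_bezout:
  fixes f g :: "nat \<Rightarrow> 'x::countable cpoly" and B :: "nat \<Rightarrow> 'x \<Rightarrow> complex"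
  assumes fin: "finite X" "finite Y" and disj: "X \<inter> Y = {}" and \<sigma>: "\<sigma> \<notin> X \<union> Y"
    and \<alpha>: "\<And>x. x \<in> X \<Longrightarrow> \<alpha> x = 1" and \<beta>: "\<And>x. x \<in> X \<Longrightarrow> \<beta> x = 0" "\<And>y. y \<in> Y \<Longrightarrow> \<beta> y = 1"
    and f: "\<And>i. i < K \<Longrightarrow> f i \<in> wforms (X \<union> Y) \<alpha> \<beta> (p i) (q i)"
    and g: "\<And>i. i < K \<Longrightarrow> g i \<in> wforms (X \<union> Y) \<alpha> \<beta> (p i) (q i)"
    and z: "\<And>i. i < K \<Longrightarrow> poly_eval z (g i) = 0"
    and B: "\<And>i k. i < K \<Longrightarrow> k < K \<Longrightarrow>
      (\<Sum>x\<in>X \<union> Y. poly_eval z (partial_deriv x (g i)) * B k x) = (if i = k then 1 else 0)"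
    and x0: "x0 \<in> X" "z x0 \<noteq> 0" and y0: "y0 \<in> Y" "z y0 \<noteq> 0"
  shows "\<exists>a. (\<forall>i<K. poly_eval a (f i) = 0) \<and> (\<exists>x\<in>X. a x \<noteq> 0) \<and> (\<exists>y\<in>Y. a y \<noteq> 0)"
proof (rule ccontr)
  assume no: "\<not> ?thesis"
  let ?I = "X \<union> Y"
  have "\<exists>N A. (Var x * Var y) ^ N = (\<Sum>i<K. A i * f i)" if "x \<in> X" "y \<in> Y" for x y
    using no that by (intro nullstellensatz) (auto simp: poly_eval_homs)
  then obtain N A where NA: "\<And>x y. x \<in> X \<Longrightarrow> y \<in> Y \<Longrightarrow> (Var x * Var y) ^ N x y = (\<Sum>i<K. A x y i * f i)"
    by metis
  define N' where "N' = Max ((\<lambda>(x, y). N x y) ` (X \<times> Y))"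
  have N': "N x y \<le> N'" if "x \<in> X" "y \<in> Y" for x y
    unfolding N'_def using that fin by (intro Max_ge) (auto intro!: image_eqI[of _ _ "(x, y)"])
  define W where "W = Max (\<alpha> ` Y)"
  have W: "\<alpha> y \<le> W" if "y \<in> Y" for y unfolding W_def using that fin by auto
  \<comment> \<open>Pigeonhole bounds: the second weight forces an exponent of at least
    \<open>N'\<close> on some \<open>y\<close>. The variables in \<open>Y\<close> contribute at most
    \<open>W * q'\<close> to the first weight, and what is left forces an exponent of at least
    \<open>N'\<close> on some \<open>x\<close>.\<close>
  define q' where "q' = card Y * N'"
  define p' where "p' = W * q' + card X * N'"
  define S where "S = {m. Poly_Mapping.keys m \<subseteq> ?I \<and> wdeg \<alpha> m = p' \<and> wdeg \<beta> m = q'}"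
  have "finite S" unfolding S_def using fin \<alpha> \<beta> by (intro finite_monomials) auto
  have wX: "wdeg \<beta> m = (\<Sum>y\<in>Y. Poly_Mapping.lookup m y)"
    "wdeg \<alpha> m = (\<Sum>x\<in>X. Poly_Mapping.lookup m x) + (\<Sum>y\<in>Y. Poly_Mapping.lookup m y * \<alpha> y)"
    if "Poly_Mapping.keys m \<subseteq> ?I" for m
    using that fin disj by (simp_all add: wdeg_superset[of ?I] sum.union_disjoint \<alpha> \<beta>)
  have "\<exists>A. Poly_Mapping.single m 1 = (\<Sum>i<K. A i * f i)" if "m \<in> S" for m
  proof -
    have k: "Poly_Mapping.keys m \<subseteq> ?I" and d: "wdeg \<alpha> m = p'" "wdeg \<beta> m = q'" using that by (auto simp: S_def)
    have "\<exists>y\<in>Y. N' \<le> Poly_Mapping.lookup m y"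
      using fin y0(1) d(2) wX(1)[OF k] by (intro sum_ge_card_mult) (auto simp: q'_def)
    then obtain y where y: "y \<in> Y" "N' \<le> Poly_Mapping.lookup m y" by blast
    have "(\<Sum>y\<in>Y. Poly_Mapping.lookup m y * \<alpha> y) \<le> (\<Sum>y\<in>Y. W * Poly_Mapping.lookup m y)"
      by (intro sum_mono) (simp add: W mult.commute)
    also have "\<dots> = W * q'" using d(2) wX(1)[OF k] by (simp flip: sum_distrib_left)
    finally have "card X * N' \<le> (\<Sum>x\<in>X. Poly_Mapping.lookup m x)"
      using d(1) wX(2)[OF k] by (simp add: p'_def)
    then have "\<exists>x\<in>X. N' \<le> Poly_Mapping.lookup m x" using fin x0(1) by (intro sum_ge_card_mult) auto
    then obtain x where x: "x \<in> X" "N' \<le> Poly_Mapping.lookup m x" by blast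
    have "x \<noteq> y" using x y disj by auto
    moreover have "N x y \<le> Poly_Mapping.lookup m x" "N x y \<le> Poly_Mapping.lookup m y"
      using x y N'[OF x(1) y(1)] by auto
    ultimately obtain r where "Poly_Mapping.single m 1 = r * (Var x * Var y) ^ N x y"
      using split_monomial[of "N x y" m x y] by metis
    then show ?thesis using NA[OF x(1) y(1)]
      by (intro exI[of _ "\<lambda>i. r * A x y i"]) (simp add: sum_distrib_left mult_ac)
  qed
  then obtain A0 where A0: "\<And>m. m \<in> S \<Longrightarrow> Poly_Mapping.single m 1 = (\<Sum>i<K. A0 m i * f i)" by metis
  \<comment> \<open>The coefficients are first stripped of all other variables and then replaced by
    their components of the right bidegree. After that the combinations \<open>G\<close> of the
    \<open>g i\<close> are again linear in the monomials of \<open>S\<close>.\<close>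
  define A1 where "A1 m i = poly_subst (\<lambda>x. if x \<in> ?I then Var x else 0) (A0 m i)" for m i
  have A1I: "A1 m i \<in> polys_in ?I" for m i
    unfolding A1_def by (rule poly_subst_polys_in[of _ UNIV]) (auto simp: polys_in_def[of UNIV])
  have A1: "Poly_Mapping.single m 1 = (\<Sum>i<K. A1 m i * f i)" if "m \<in> S" for m
  proof -
    have "Poly_Mapping.single m 1 \<in> polys_in ?I" using that by (intro polys_in_single) (auto simp: S_def)
    then have "Poly_Mapping.single m 1 = poly_subst (\<lambda>x. if x \<in> ?I then Var x else 0) (\<Sum>i<K. A0 m i * f i)"
      using poly_subst_restrict A0[OF that] by metis
    also have "\<dots> = (\<Sum>i<K. A1 m i * f i)"
      unfolding poly_subst.hom_sum poly_subst.hom_mult A1_def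
      by (intro sum.cong refl arg_cong2[of _ _ _ _ "(*)"] poly_subst_restrict wforms_polys_in[OF f]) auto
    finally show ?thesis .
  qed
  define A2 where "A2 m i = (if p i \<le> p' \<and> q i \<le> q' then bpart \<alpha> \<beta> (p' - p i) (q' - q i) (A1 m i) else 0)" for m i
  have A2: "Poly_Mapping.single m 1 = (\<Sum>i<K. A2 m i * f i)" if "m \<in> S" for m
  proof -
    have m: "Poly_Mapping.single m 1 \<in> wforms ?I \<alpha> \<beta> p' q'"
      using that wforms_single[of m ?I 1 \<alpha> \<beta>] by (auto simp: S_def)
    have "Poly_Mapping.single m 1 = bpart \<alpha> \<beta> p' q' (\<Sum>i<K. A1 m i * f i)"
      using bpart_wforms[OF m, of p' q'] A1[OF that] by simp
    also have "\<dots> = (\<Sum>i<K. A2 m i * f i)"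
      unfolding bpart_sum by (intro sum.cong) (auto simp: A2_def bpart_mult[OF f])
    finally show ?thesis .
  qed
  define G where "G m = (\<Sum>i<K. A2 m i * g i)" for m
  have Gw: "G m \<in> wforms ?I \<alpha> \<beta> p' q'" for m
    unfolding G_def
  proof (intro wforms_sum)
    fix i assume "i \<in> {..<K}"
    then have i: "i < K" by simp
    show "A2 m i * g i \<in> wforms ?I \<alpha> \<beta> p' q'"
    proof (cases "p i \<le> p' \<and> q i \<le> q'")
      case True
      then have "A2 m i \<in> wforms ?I \<alpha> \<beta> (p' - p i) (q' - q i)"
        using bpart_polys_in[OF A1I] by (simp add: A2_def)
      from wforms_mult[OF this g[OF i]] True show ?thesis by simp
    qed (auto simp: A2_def)
  qed
  define h where "h i = (1 - Var \<sigma>) * g i + Var \<sigma> * f i" for i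
  have h: "h i \<in> polys_in (insert \<sigma> ?I)" if "i < K" for i
  proof -
    have "g i \<in> polys_in (insert \<sigma> ?I)" "f i \<in> polys_in (insert \<sigma> ?I)"
      using wforms_polys_in[OF f[OF that]] wforms_polys_in[OF g[OF that]] by (auto intro: polys_in_mono)
    then show ?thesis by (auto simp: h_def)
  qed
  define z' where "z' x = (if x \<in> ?I then z x else 0)" for x
  define B' where "B' k x = (if x \<in> ?I then B k x else 0)" for k x
  \<comment> \<open>The velocity with \<open>\<sigma>\<close>-component one. Since \<open>g\<close>
    vanishes at \<open>z\<close>, the linearized deformed equations read
    \<open>Dg w + f(z) = 0\<close>, and the right inverse \<open>B'\<close> solves them.\<close>
  define w where "w x = (if x = \<sigma> then 1 else - (\<Sum>k<K. poly_eval z (f k) * B' k x))" for x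
  have ev: "poly_eval z' F = poly_eval z F" if "F \<in> polys_in ?I" for F
    by (rule poly_eval_cong_polys_in[OF that]) (auto simp: z'_def)
  have evf: "poly_eval z' (f i) = poly_eval z (f i)" "poly_eval z' (g i) = 0"
    "poly_eval z' (partial_deriv x (g i)) = poly_eval z (partial_deriv x (g i))" if "i < K" for i x
    using ev[OF wforms_polys_in[OF f[OF that]]] ev[OF wforms_polys_in[OF g[OF that]]] z[OF that]
      ev[OF partial_deriv_polys_in[OF wforms_polys_in[OF g[OF that]]]] by auto
  have z\<sigma>: "z' \<sigma> = 0" using \<sigma> by (simp add: z'_def)
  have dh: "poly_eval z' (partial_deriv x (h i)) =
    poly_eval z (partial_deriv x (g i)) + (if x = \<sigma> then poly_eval z (f i) else 0)" if "i < K" for x i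
    using evf[OF that] z\<sigma>
    by (simp add: h_def partial_deriv_add partial_deriv_mult partial_deriv_diff partial_deriv_Var poly_eval_homs)
  have d\<sigma>: "partial_deriv \<sigma> (g i) = 0" if "i < K" for i
    unfolding partial_deriv_def
  proof (intro sum.neutral ballI)
    fix m assume "m \<in> Poly_Mapping.keys (g i)"
    then have "\<sigma> \<notin> Poly_Mapping.keys m" using wforms_polys_in[OF g[OF that]] \<sigma> by (auto simp: polys_in_def)
    then show "Poly_Mapping.single (m - Poly_Mapping.single \<sigma> 1)
      (Poly_Mapping.lookup (g i) m * of_nat (Poly_Mapping.lookup m \<sigma>)) = 0" by (simp add: in_keys_iff)
  qed
  have fI: "finite (insert \<sigma> ?I)" using fin by auto
  have sum\<sigma>: "(\<Sum>x\<in>insert \<sigma> ?I. poly_eval z' (partial_deriv x (h i)) * v x) =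
    poly_eval z (f i) * v \<sigma> + (\<Sum>x\<in>?I. poly_eval z (partial_deriv x (g i)) * v x)" if "i < K" for i v
  proof -
    have "(\<Sum>x\<in>?I. poly_eval z' (partial_deriv x (h i)) * v x) = (\<Sum>x\<in>?I. poly_eval z (partial_deriv x (g i)) * v x)"
      using \<sigma> by (intro sum.cong) (auto simp: dh[OF that])
    then show ?thesis using fin \<sigma> by (simp add: dh[OF that] d\<sigma>[OF that])
  qed
  have DB: "(\<Sum>x\<in>?I. poly_eval z (partial_deriv x (g i)) * B' k x) = (if i = k then 1 else 0)" if "i < K" "k < K" for i k
    using B[OF that] by (simp add: B'_def)
  have Dw: "(\<Sum>x\<in>?I. poly_eval z (partial_deriv x (g i)) * w x) = - poly_eval z (f i)" if "i < K" for i
  proof -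
    have "(\<Sum>x\<in>?I. poly_eval z (partial_deriv x (g i)) * w x) =
       (\<Sum>x\<in>?I. poly_eval z (partial_deriv x (g i)) * - (\<Sum>k<K. poly_eval z (f k) * B' k x))"
      using \<sigma> by (intro sum.cong) (auto simp: w_def)
    also have "\<dots> = - (\<Sum>k<K. poly_eval z (f k) * (\<Sum>x\<in>?I. poly_eval z (partial_deriv x (g i)) * B' k x))"
      unfolding sum_distrib_left mult_minus_right sum_negf by (subst sum.swap) (simp add: mult_ac)
    also have "\<dots> = - (\<Sum>k<K. if i = k then poly_eval z (f k) else 0)"
      using that by (intro arg_cong[of _ _ uminus] sum.cong) (auto simp: DB)
    finally show ?thesis using that by simp
  qed
  have "\<exists>M. \<forall>u. (\<forall>\<mu>\<in>S. monom 1 M dvd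
      [:1, -1:] * (\<Sum>\<nu>\<in>S. Polynomial.smult (Poly_Mapping.lookup (G \<mu>) \<nu>) (u \<nu>)) + [:0, 1:] * u \<mu>) \<longrightarrow>
      (\<forall>\<mu>\<in>S. coeff (u \<mu>) 0 = 0)"
    by (rule pencil_divisibility[OF \<open>finite S\<close>])
  then obtain M where M: "\<And>u. (\<forall>\<mu>\<in>S. monom 1 M dvd
      [:1, -1:] * (\<Sum>\<nu>\<in>S. Polynomial.smult (Poly_Mapping.lookup (G \<mu>) \<nu>) (u \<nu>)) + [:0, 1:] * u \<mu>) \<Longrightarrow>
      (\<forall>\<mu>\<in>S. coeff (u \<mu>) 0 = 0)" by blast
  have "\<exists>c. \<forall>i<K. monom 1 (M + 2) dvd
    poly_curve (\<lambda>x. [:z' x, w x:] + monom 1 2 * (\<Sum>k<K. Polynomial.smult (B' k x) (c k))) (h i)"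
  proof (rule hensel_curve[OF fI h])
    fix i assume i: "i < K"
    show "poly_eval z' (h i) = 0" using evf[OF i] z\<sigma> by (simp add: h_def poly_eval_homs)
    show "(\<Sum>x\<in>insert \<sigma> ?I. poly_eval z' (partial_deriv x (h i)) * w x) = 0"
      unfolding sum\<sigma>[OF i] Dw[OF i] by (simp add: w_def)
    fix k assume k: "k < K"
    have "B' k \<sigma> = 0" using \<sigma> by (simp add: B'_def)
    then show "(\<Sum>x\<in>insert \<sigma> ?I. poly_eval z' (partial_deriv x (h i)) * B' k x) = (if i = k then 1 else 0)"
      unfolding sum\<sigma>[OF i] DB[OF i k] by simp
  qed
  then obtain c where c: "\<And>i. i < K \<Longrightarrow> monom 1 (M + 2) dvd
    poly_curve (\<lambda>x. [:z' x, w x:] + monom 1 2 * (\<Sum>k<K. Polynomial.smult (B' k x) (c k))) (h i)" by blast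
  define \<gamma> where "\<gamma> x = [:z' x, w x:] + monom 1 2 * (\<Sum>k<K. Polynomial.smult (B' k x) (c k))" for x
  have \<gamma>\<sigma>: "\<gamma> \<sigma> = [:0, 1:]" using \<sigma> by (simp add: \<gamma>_def z'_def B'_def w_def)
  have "monom 1 M dvd (monom 1 (M + 2) :: complex poly)" by (simp add: monom_1_dvd_iff')
  then have dvdh: "monom 1 M dvd poly_curve \<gamma> (h i)" if "i < K" for i
    using c[OF that] unfolding \<gamma>_def[symmetric] by (rule dvd_trans)
  define u where "u m = powprod \<gamma> m" for m
  have uG: "poly_curve \<gamma> (G \<mu>) = (\<Sum>\<nu>\<in>S. Polynomial.smult (Poly_Mapping.lookup (G \<mu>) \<nu>) (u \<nu>))" for \<mu>
  proof -
    have "poly_curve \<gamma> (G \<mu>) = (\<Sum>\<nu>\<in>Poly_Mapping.keys (G \<mu>). Polynomial.smult (Poly_Mapping.lookup (G \<mu>) \<nu>) (u \<nu>))"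
      by (simp add: poly_curve_def gev_def u_def)
    also have "\<dots> = (\<Sum>\<nu>\<in>S. Polynomial.smult (Poly_Mapping.lookup (G \<mu>) \<nu>) (u \<nu>))"
      using \<open>finite S\<close> Gw[of \<mu>] by (intro sum.mono_neutral_left) (auto simp: in_keys_iff S_def wforms_def polys_in_def)
    finally show ?thesis .
  qed
  have "\<forall>\<mu>\<in>S. coeff (u \<mu>) 0 = 0"
  proof (intro M ballI)
    fix \<mu> assume \<mu>: "\<mu> \<in> S"
    \<comment> \<open>The same coefficients are applied to the deformed equations: the part with
      \<open>f\<close> returns the monomial, the part with \<open>g\<close> is
      \<open>G \<mu>\<close>. This is the pencil of the matrix formed by the coefficients of the
      \<open>G \<mu>\<close>.\<close>
    have "(\<Sum>i<K. A2 \<mu> i * h i) = (1 - Var \<sigma>) * G \<mu> + Var \<sigma> * Poly_Mapping.single \<mu> 1"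
      unfolding A2[OF \<mu>] G_def h_def sum_distrib_left sum.distrib[symmetric] by (intro sum.cong) (auto simp: algebra_simps)
    then have "(\<Sum>i<K. poly_curve \<gamma> (A2 \<mu> i) * poly_curve \<gamma> (h i)) =
       (1 - [:0, 1:]) * poly_curve \<gamma> (G \<mu>) + [:0, 1:] * poly_curve \<gamma> (Poly_Mapping.single \<mu> 1)"
      by (metis (no_types, lifting) \<gamma>\<sigma> poly_curve_Var poly_curve_homs sum.cong)
    moreover have "poly_curve \<gamma> (Poly_Mapping.single \<mu> 1) = u \<mu>"
      by (simp add: poly_curve_def gev_single[OF hom_pCons] u_def)
    moreover have "monom 1 M dvd (\<Sum>i<K. poly_curve \<gamma> (A2 \<mu> i) * poly_curve \<gamma> (h i))"
      using dvdh by (intro dvd_sum dvd_mult) auto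
    moreover have "1 - [:0, 1:] = ([:1, -1:] :: complex poly)" by (simp add: one_pCons)
    ultimately show "monom 1 M dvd [:1, -1:] *
      (\<Sum>\<nu>\<in>S. Polynomial.smult (Poly_Mapping.lookup (G \<mu>) \<nu>) (u \<nu>)) + [:0, 1:] * u \<mu>"
      unfolding uG by metis
  qed
  \<comment> \<open>A monomial of the chosen bidegree in \<open>x0\<close> and \<open>y0\<close>
    alone, hence nonzero at \<open>z\<close>. The difference in the exponent is not truncated,
    because \<open>p'\<close> is at least \<open>W * q'\<close>.\<close>
  define \<nu>0 where "\<nu>0 = Poly_Mapping.single x0 (p' - \<alpha> y0 * q') + Poly_Mapping.single y0 q'"
  have "\<alpha> y0 * q' \<le> W * q'" using W[OF y0(1)] by simp
  then have "\<alpha> y0 * q' \<le> p'" unfolding p'_def by (rule trans_le_add1)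
  then have "wdeg \<alpha> \<nu>0 = p'" "wdeg \<beta> \<nu>0 = q'"
    using \<alpha>[OF x0(1)] \<beta>(1)[OF x0(1)] \<beta>(2)[OF y0(1)] by (simp_all add: \<nu>0_def wdeg_add mult.commute)
  moreover have "Poly_Mapping.keys \<nu>0 \<subseteq> ?I"
    unfolding \<nu>0_def using x0(1) y0(1) by (intro order_trans[OF keys_add]) auto
  ultimately have "\<nu>0 \<in> S" by (simp add: S_def)
  moreover have "coeff (u \<nu>0) 0 \<noteq> 0"
  proof -
    have "coeff (\<gamma> x0) 0 = z x0" "coeff (\<gamma> y0) 0 = z y0"
      using x0 y0 by (simp_all add: \<gamma>_def z'_def coeff_mult)
    then show ?thesis using x0(2) y0(2)
      by (simp add: u_def \<nu>0_def powprod_add powprod_single flip: poly_0_coeff_0)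
  qed
  ultimately show False using \<open>\<forall>\<mu>\<in>S. coeff (u \<mu>) 0 = 0\<close> by blast
qed

section \<open>Existence of a line with obstructed normal bundle\<close>

text \<open>The comparison system consists of monomials: equation \<open>e\<close> becomes its
  private variable \<open>v e\<close> times a monomial in \<open>x0\<close> and \<open>y0\<close>.
  At the point with \<open>x0 = y0 = 1\<close> and all other coordinates 0 its Jacobian is the
  identity in the variables \<open>v e\<close>. The inequalities on \<open>p\<close> and
  \<open>q\<close> say that the complementary exponents exist. Only an injective choice of variables
  remains to be found.\<close>

lemma weighted_bezout_set:
  fixes f g :: "'e \<Rightarrow> 'x::countable cpoly"
  assumes E: "finite E" and fin: "finite X" "finite Y" and disj: "X \<inter> Y = {}" and \<sigma>: "\<sigma> \<notin> X \<union> Y"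
    and w: "\<And>x. x \<in> X \<Longrightarrow> \<alpha> x = 1" "\<And>x. x \<in> X \<Longrightarrow> \<beta> x = 0" "\<And>y. y \<in> Y \<Longrightarrow> \<beta> y = 1"
    and f: "\<And>e. e \<in> E \<Longrightarrow> f e \<in> wforms (X \<union> Y) \<alpha> \<beta> (p e) (q e)"
    and v: "inj_on v E" "\<And>e. e \<in> E \<Longrightarrow> v e \<in> X \<union> Y - {x0, y0}"
    and pv: "\<And>e. e \<in> E \<Longrightarrow> \<beta> (v e) \<le> q e"
      "\<And>e. e \<in> E \<Longrightarrow> \<alpha> (v e) + (q e - \<beta> (v e)) * \<alpha> y0 \<le> p e"
    and x0: "x0 \<in> X" and y0: "y0 \<in> Y"
  shows "\<exists>a. (\<forall>e\<in>E. poly_eval a (f e) = 0) \<and> (\<exists>x\<in>X. a x \<noteq> 0) \<and> (\<exists>y\<in>Y. a y \<noteq> 0)"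
proof -
  obtain h where h: "bij_betw h {..<card E} E" using ex_bij_betw_nat_finite[OF E] by (auto simp: atLeast0LessThan)
  then have hE: "\<And>i. i < card E \<Longrightarrow> h i \<in> E" by (auto simp: bij_betw_def)
  define k where "k e = q e - \<beta> (v e)" for e
  define r where "r e = Var x0 ^ (p e - \<alpha> (v e) - k e * \<alpha> y0) * (Var y0 :: 'x cpoly) ^ k e" for e
  define z :: "'x \<Rightarrow> complex" where "z x = (if x = x0 \<or> x = y0 then 1 else 0)" for x
  let ?I = "X \<union> Y"
  have r: "Var (v e) * r e \<in> wforms ?I \<alpha> \<beta> (p e) (q e)" if "e \<in> E" for e
  proof -
    have "Var x0 ^ (p e - \<alpha> (v e) - k e * \<alpha> y0) \<in> wforms ?I \<alpha> \<beta> (p e - \<alpha> (v e) - k e * \<alpha> y0) 0"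
      using wforms_power[OF wforms_Var[of x0 ?I \<alpha> \<beta>], of "p e - \<alpha> (v e) - k e * \<alpha> y0"] x0 w by simp
    moreover have "Var y0 ^ k e \<in> wforms ?I \<alpha> \<beta> (k e * \<alpha> y0) (k e)"
      using wforms_power[OF wforms_Var[of y0 ?I \<alpha> \<beta>], of "k e"] y0 w by simp
    moreover have "Var (v e) \<in> wforms ?I \<alpha> \<beta> (\<alpha> (v e)) (\<beta> (v e))"
      using v(2)[OF that] by (intro wforms_Var) auto
    ultimately have "Var (v e) * r e \<in> wforms ?I \<alpha> \<beta>
      (\<alpha> (v e) + (p e - \<alpha> (v e) - k e * \<alpha> y0 + k e * \<alpha> y0)) (\<beta> (v e) + (0 + k e))"
      unfolding r_def by (intro wforms_mult)
    moreover have "\<alpha> (v e) + (p e - \<alpha> (v e) - k e * \<alpha> y0 + k e * \<alpha> y0) = p e" "\<beta> (v e) + (0 + k e) = q e"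
      using pv[OF that] by (auto simp: k_def)
    ultimately show ?thesis by simp
  qed
  have zr: "poly_eval z (r e) = 1" for e by (simp add: r_def poly_eval_homs z_def)
  have zv: "z (v e) = 0" if "e \<in> E" for e using v(2)[OF that] by (auto simp: z_def)
  have "\<exists>a. (\<forall>i<card E. poly_eval a (f (h i)) = 0) \<and> (\<exists>x\<in>X. a x \<noteq> 0) \<and> (\<exists>y\<in>Y. a y \<noteq> 0)"
  proof (rule weighted_bezout[where f = "\<lambda>i. f (h i)" and g = "\<lambda>i. Var (v (h i)) * r (h i)"
        and p = "\<lambda>i. p (h i)" and q = "\<lambda>i. q (h i)" and z = z
        and B = "\<lambda>i x. if x = v (h i) then 1 else 0" and \<sigma> = \<sigma> and \<alpha> = \<alpha> and \<beta> = \<beta>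
        and X = X and Y = Y and ?x0.0 = x0 and ?y0.0 = y0])
    fix i assume i: "i < card E"
    show "poly_eval z (Var (v (h i)) * r (h i)) = 0" using zv[OF hE[OF i]] by (simp add: poly_eval_homs)
    fix j assume j: "j < card E"
    have vj: "v (h j) \<in> ?I" using v(2)[OF hE[OF j]] by auto
    have "(\<Sum>x\<in>?I. poly_eval z (partial_deriv x (Var (v (h i)) * r (h i))) * (if x = v (h j) then 1 else 0))
      = poly_eval z (partial_deriv (v (h j)) (Var (v (h i)) * r (h i)))"
      using vj fin by (simp add: if_distrib[where f = "\<lambda>c. _ * c"] sum.delta' cong: if_cong)
    also have "\<dots> = (if v (h i) = v (h j) then 1 else 0)"
      using zv[OF hE[OF i]] zr by (simp add: partial_deriv_mult partial_deriv_Var poly_eval_homs)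
    also have "v (h i) = v (h j) \<longleftrightarrow> i = j"
      using i j h v(1) hE by (metis bij_betw_def inj_on_eq_iff lessThan_iff)
    finally show "(\<Sum>x\<in>?I. poly_eval z (partial_deriv x (Var (v (h i)) * r (h i))) * (if x = v (h j) then 1 else 0))
      = (if i = j then 1 else 0)" .
  qed (use fin disj \<sigma> w x0 y0 f r hE in \<open>auto simp: z_def\<close>)
  moreover have "(\<forall>e\<in>E. poly_eval a (f e) = 0) \<longleftrightarrow> (\<forall>i<card E. poly_eval a (f (h i)) = 0)" for a
    using h by (force simp: bij_betw_def)
  ultimately show ?thesis by simp
qed

section \<open>Restriction of forms to a line\<close>

lemma partial_deriv_commute: "partial_deriv x (partial_deriv y F) = partial_deriv y (partial_deriv x F)"
proof -
  have "F \<in> polys_in UNIV" by (simp add: polys_in_def)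
  then show ?thesis
    by (induction rule: polys_in_induct)
      (simp_all add: partial_deriv_add partial_deriv_mult partial_deriv_Var)
qed

text \<open>Coordinates \<open>(0, a)\<close> stand for \<open>x\<^sub>a\<close> and \<open>(1, a)\<close> for \<open>y\<^sub>a\<close>; \<open>line_coeff n F j\<close> is the
  coefficient of \<open>t ^ j\<close> in \<open>F (x + t y)\<close>.\<close>

definition in_x :: "nat cpoly \<Rightarrow> (nat \<times> nat) cpoly" where
  "in_x = poly_subst (\<lambda>a. Var (0, a))"

fun line_coeff :: "nat \<Rightarrow> nat cpoly \<Rightarrow> nat \<Rightarrow> (nat \<times> nat) cpoly" where
  "line_coeff n F 0 = in_x F"
| "line_coeff n F (Suc j) =
    Cst (1 / of_nat (Suc j)) * (\<Sum>a\<le>n. Var (1, a) * line_coeff n (partial_deriv a F) j)"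

lemma line_coeff_0: "line_coeff n 0 j = 0"
  by (induction j) (simp_all add: in_x_def poly_subst_homs)

lemma in_x_wforms:
  assumes F: "F \<in> forms n d" and I: "{0} \<times> {..n} \<subseteq> I" "\<And>a. \<alpha> (0, a) = 1" "\<And>a. \<beta> (0, a) = 0"
  shows "in_x F \<in> wforms I \<alpha> \<beta> d 0"
  unfolding in_x_def poly_subst_def gev_def
proof (intro wforms_sum wforms_Cst_mult)
  fix m assume "m \<in> Poly_Mapping.keys F"
  then have m: "Poly_Mapping.keys m \<subseteq> {..n}" "total_deg m = d" using forms_single_key[OF F] by auto
  have "(\<Prod>x\<in>A. Var (0, x) ^ Poly_Mapping.lookup m x) \<in> wforms I \<alpha> \<beta> (\<Sum>x\<in>A. Poly_Mapping.lookup m x) 0"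
    if "finite A" "A \<subseteq> {..n}" for A
    using that
  proof (induction A rule: finite_induct)
    case (insert x A)
    have "Var (0, x) \<in> wforms I \<alpha> \<beta> 1 0" using wforms_Var[of "(0, x)" I \<alpha> \<beta>] insert I by auto
    from wforms_mult[OF wforms_power[OF this, of "Poly_Mapping.lookup m x"] insert.IH] insert
    show ?case by simp
  qed (use wforms_Cst[of 1] in simp)
  with m show "powprod (\<lambda>a. Var (0, a)) m \<in> wforms I \<alpha> \<beta> d 0"
    by (auto simp: powprod_def total_deg_def)
qed

lemma line_coeff_wforms:
  assumes I: "{0, 1} \<times> {..n} \<subseteq> I" "\<And>a. \<alpha> (0, a) = 1" "\<And>a. \<beta> (0, a) = 0" "\<And>a. \<alpha> (1, a) = 1" "\<And>a. \<beta> (1, a) = 1"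
  shows "F \<in> forms n d \<Longrightarrow> line_coeff n F j \<in> wforms I \<alpha> \<beta> d j"
proof (induction j arbitrary: F d)
  case 0
  then show ?case using I by (auto intro!: in_x_wforms)
next
  case (Suc j)
  show ?case
  proof (cases d)
    case 0
    then have "partial_deriv a F = 0" for a using Suc(2) partial_deriv_forms_0 by blast
    then show ?thesis by (simp add: line_coeff_0)
  next
    case (Suc d')
    have "Var (1, a) * line_coeff n (partial_deriv a F) j \<in> wforms I \<alpha> \<beta> (1 + d') (1 + j)" if "a \<le> n" for a
    proof (rule wforms_mult)
      show "Var (1, a) \<in> wforms I \<alpha> \<beta> 1 1" using wforms_Var[of "(1, a)" I \<alpha> \<beta>] I that by auto
      show "line_coeff n (partial_deriv a F) j \<in> wforms I \<alpha> \<beta> d' j"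
        using Suc.IH[OF partial_deriv_forms[OF Suc.prems]] Suc by simp
    qed
    then show ?thesis using Suc by (auto intro!: wforms_Cst_mult wforms_sum)
  qed
qed

lemma line_coeff_eq_0: "F \<in> forms n d \<Longrightarrow> j > d \<Longrightarrow> line_coeff n F j = 0"
proof (induction j arbitrary: F d)
  case (Suc j)
  have "line_coeff n (partial_deriv a F) j = 0" for a
  proof (cases d)
    case 0
    then show ?thesis using Suc partial_deriv_forms_0 by (metis line_coeff_0)
  next
    case (Suc d')
    then show ?thesis using Suc.IH[OF partial_deriv_forms[OF Suc.prems(1)]] Suc.prems by simp
  qed
  then show ?case by simp
qed simp

lemma poly_eval_in_x: "poly_eval a (in_x F) = poly_eval (\<lambda>k. a (0, k)) F"
  by (simp add: in_x_def poly_eval_subst)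

lemma coeff_poly_curve_line:
  "F \<in> polys_in {..n} \<Longrightarrow>
    coeff (poly_curve (\<lambda>k. [:a (0, k), a (1, k):]) F) j = poly_eval a (line_coeff n F j)"
proof (induction j arbitrary: F)
  case 0
  show ?case by (simp add: coeff_0_poly_curve poly_eval_in_x)
next
  case (Suc j)
  let ?\<gamma> = "\<lambda>k. [:a (0, k), a (1, k):]"
  have "of_nat (Suc j) * coeff (poly_curve ?\<gamma> F) (Suc j) = coeff (pderiv (poly_curve ?\<gamma> F)) j"
    by (simp add: coeff_pderiv)
  also have "\<dots> = (\<Sum>k\<le>n. a (1, k) * coeff (poly_curve ?\<gamma> (partial_deriv k F)) j)"
    unfolding pderiv_poly_curve[OF Suc(2) finite_atMost] by (simp add: pderiv_pCons coeff_sum mult.commute)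
  also have "\<dots> = (\<Sum>k\<le>n. a (1, k) * poly_eval a (line_coeff n (partial_deriv k F) j))"
    using Suc.IH[OF partial_deriv_polys_in[OF Suc(2)]] by simp
  finally show ?case by (simp add: poly_eval_homs field_simps del: of_nat_Suc)
qed

text \<open>The affine parametrization misses the direction point \<open>y\<close> itself. It is
  reached because a polynomial in \<open>s\<close> that vanishes for all nonzero \<open>s\<close> is
  zero.\<close>

lemma forms_vanish_on_line:
  assumes F: "F \<in> forms n d" and 0: "poly_curve (\<lambda>k. [:x k, y k:]) F = 0"
  shows "poly_eval (\<lambda>k. s * x k + t * y k) F = 0"
proof -
  have 1: "poly_eval (\<lambda>k. s * x k + t * y k) F = 0" if "s \<noteq> 0" for s
  proof -
    have "poly_eval (\<lambda>k. s * x k + t * y k) F = poly_eval (\<lambda>k. s * (x k + (t / s) * y k)) F"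
      using that by (simp add: distrib_left)
    also have "\<dots> = s ^ d * poly_eval (\<lambda>k. x k + (t / s) * y k) F" by (rule poly_eval_forms_scale[OF F])
    also have "poly_eval (\<lambda>k. x k + (t / s) * y k) F = poly (poly_curve (\<lambda>k. [:x k, y k:]) F) (t / s)"
      by (simp add: poly_poly_curve)
    finally show ?thesis using 0 by simp
  qed
  let ?p = "poly_curve (\<lambda>k. [:t * y k, x k:]) F"
  have p: "poly ?p s = poly_eval (\<lambda>k. s * x k + t * y k) F" for s
    by (simp add: poly_poly_curve add.commute)
  have "?p = 0"
  proof (rule ccontr)
    assume "?p \<noteq> 0"
    then have "finite {s. poly ?p s = 0}" by (rule poly_roots_finite)
    moreover have "UNIV - {0} \<subseteq> {s. poly ?p s = 0}" using 1 p by auto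
    ultimately have "finite (UNIV - {0::complex})" by (rule rev_finite_subset)
    then show False using infinite_UNIV_char_0[where 'a = complex] by simp
  qed
  then show ?thesis using p[of s] by simp
qed

text \<open>One equation for each coefficient along the line except the constant ones; for the form
  \<open>s\<close> the coefficients of degree one and two are also left out, as they will follow
  from the Hessian equations. This saves the two equations that make the count succeed.\<close>

lemma sum_card_labels:
  fixes d :: "nat \<Rightarrow> nat"
  assumes "s < l" "d s \<ge> 2"
  shows "card (SIGMA i:{..<l}. {j. 1 \<le> j \<and> j \<le> d i \<and> (i = s \<longrightarrow> 3 \<le> j)}) + 2 = (\<Sum>i<l. d i)"
proof -
  have c: "card {j. 1 \<le> j \<and> j \<le> d i \<and> (i = s \<longrightarrow> 3 \<le> j)} = (if i = s then d i - 2 else d i)" for i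
  proof -
    have "{j. 1 \<le> j \<and> j \<le> d i \<and> (i = s \<longrightarrow> 3 \<le> j)} = (if i = s then {3..d i} else {1..d i})" by auto
    then show ?thesis by simp
  qed
  have fin: "finite {j. 1 \<le> j \<and> j \<le> d i \<and> (i = s \<longrightarrow> 3 \<le> j)}" for i
    by (rule finite_subset[of _ "{..d i}"]) auto
  have "card (SIGMA i:{..<l}. {j. 1 \<le> j \<and> j \<le> d i \<and> (i = s \<longrightarrow> 3 \<le> j)}) =
    (\<Sum>i<l. if i = s then d i - 2 else d i)"
    using fin by (subst card_SigmaI) (auto simp: c simp del: One_nat_def)
  also have "\<dots> = d s - 2 + (\<Sum>i\<in>{..<l} - {s}. d i)"
    using assms by (subst sum.remove[of _ s]) auto
  finally show ?thesis using assms sum.remove[of "{..<l}" s d] by simp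
qed

text \<open>The last conclusion says that the coefficient of \<open>t\<close> in row
  \<open>s\<close> of the Jacobian along the line is a combination of the constant coefficients of
  the other rows: a linear relation on the image of the twisted map. The unknowns are
  \<open>x\<close> and the pair of \<open>y\<close> and \<open>lam\<close>, of projective dimensions
  \<open>n\<close> and \<open>n + l - 1\<close>. There are \<open>n + 1\<close> Hessian equations,
  \<open>l\<close> equations for \<open>x\<close>, and the sum of the degrees minus two for the
  line.\<close>

theorem obstructed_line_exists:
  fixes F :: "nat \<Rightarrow> nat cpoly" and d :: "nat \<Rightarrow> nat"
  assumes F: "\<And>i. i < l \<Longrightarrow> F i \<in> forms n (d i)" and d1: "\<And>i. i < l \<Longrightarrow> 1 \<le> d i"
    and smooth: "\<And>x c. \<exists>k\<le>n. x k \<noteq> 0 \<Longrightarrow> \<forall>i<l. poly_eval x (F i) = 0 \<Longrightarrow>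
      \<forall>k\<le>n. (\<Sum>i<l. c i * poly_eval x (partial_deriv k (F i))) = 0 \<Longrightarrow> \<forall>i<l. c i = 0"
    and ln: "l < n" and sum_d: "(\<Sum>i<l. d i) \<le> n"
    and s: "s < l" "\<And>i. i < l \<Longrightarrow> d i \<le> d s" "2 \<le> d s"
    and big: "3 \<le> d s \<or> (\<exists>i<l. i \<noteq> s \<and> d i = d s)"
  obtains x y lam where
    "\<And>i u v. i < l \<Longrightarrow> poly_eval (\<lambda>k. u * x k + v * y k) (F i) = 0"
    "\<And>u v. \<forall>k\<le>n. u * x k + v * y k = 0 \<Longrightarrow> u = 0 \<and> v = 0"
    "\<And>k. k \<le> n \<Longrightarrow> (\<Sum>b\<le>n. poly_eval x (partial_deriv b (partial_deriv k (F s))) * y b) =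
      (\<Sum>i\<in>{..<l} - {s}. lam i * poly_eval x (partial_deriv k (F i)))"
proof -
  define X where "X = {0::nat} \<times> {..n}"
  define Y where "Y = {1::nat} \<times> {..n} \<union> {2} \<times> ({..<l} - {s})"
  \<comment> \<open>The first weight of a multiplier is chosen so that its products with the
    gradients get weight \<open>d s - 1\<close>, like the Hessian term. With weight
    \<open>(1, 1)\<close> for the \<open>y\<close> variables, the coefficient of order
    \<open>j\<close> along the line has bidegree \<open>(d i, j)\<close>.\<close>
  define \<alpha> :: "nat \<times> nat \<Rightarrow> nat" where "\<alpha> = (\<lambda>(t, i). if t = 2 then d s - d i else 1)"
  define \<beta> :: "nat \<times> nat \<Rightarrow> nat" where "\<beta> = (\<lambda>(t, i). if t = 0 then 0 else 1)"
  define E1 where "E1 = {0::nat} \<times> {..n} \<times> {0::nat}"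
  define E2 where "E2 = {1::nat} \<times> {..<l} \<times> {0::nat}"
  define L where "L = (SIGMA i:{..<l}. {j. 1 \<le> j \<and> j \<le> d i \<and> (i = s \<longrightarrow> 3 \<le> j)})"
  define E3 where "E3 = {2::nat} \<times> L"
  define hess where "hess a = (\<Sum>b\<le>n. Var (1, b) * in_x (partial_deriv b (partial_deriv a (F s))))
    - (\<Sum>i\<in>{..<l} - {s}. Var (2, i) * in_x (partial_deriv a (F i)))" for a
  define f where "f = (\<lambda>(t::nat, i, j). if t = 0 then hess i else if t = 1 then in_x (F i) else line_coeff n (F i) j)"
  define p where "p = (\<lambda>(t::nat, i, j::nat). if t = 0 then d s - 1 else d i)"
  define q where "q = (\<lambda>(t::nat, i::nat, j::nat). if t = 0 then 1 else if t = 1 then 0 else j)"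
  \<comment> \<open>The base variable of the second group. Pairing a Hessian equation with an
    \<open>x\<close> variable needs \<open>1 + \<alpha> y0 \<le> d s - 1\<close>. For degree at
    least three a \<open>y\<close> variable will do; for degree two the multiplier of a second
    quadratic equation has first weight 0. This is the point where a single quadric is
    excluded.\<close>
  have "\<exists>y0. y0 \<in> Y \<and> \<alpha> y0 \<le> 1 \<and> \<alpha> y0 + 2 \<le> d s"
  proof (cases "3 \<le> d s")
    case True
    then show ?thesis by (intro exI[of _ "(1, 0)"]) (auto simp: Y_def \<alpha>_def)
  next
    case False
    then obtain i where "i < l" "i \<noteq> s" "d i = d s" using big by auto
    then show ?thesis using s(3) by (intro exI[of _ "(2, i)"]) (auto simp: Y_def \<alpha>_def)
  qed
  then obtain y0 where y0: "y0 \<in> Y" "\<alpha> y0 \<le> 1" "\<alpha> y0 + 2 \<le> d s" by blast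
  have finL: "finite L"
    unfolding L_def by (rule finite_SigmaI) (auto intro: finite_subset[of _ "{..d _}"])
  have cardL: "card L + 2 = (\<Sum>i<l. d i)" unfolding L_def using s by (intro sum_card_labels) auto
  have finX: "finite X" and finY: "finite Y" and XY: "X \<inter> Y = {}" by (auto simp: X_def Y_def)
  have "card L \<le> card ({1::nat} \<times> {..n} - {y0})"
    using cardL sum_d by (simp add: card_Diff_singleton_if)
  then obtain v3 where v3: "v3 ` L \<subseteq> {1::nat} \<times> {..n} - {y0}" "inj_on v3 L"
    using card_le_inj[of L "{1::nat} \<times> {..n} - {y0}"] finL by auto
  define V2 where "V2 = (\<lambda>i. (0::nat, Suc i)) ` {..<l}"
  define R where "R = X \<union> Y - {(0, 0), y0} - (V2 \<union> v3 ` L)"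
  \<comment> \<open>The tight count: of the \<open>2 * n + 1 + l\<close> variables, two are base
    variables and \<open>l + card L\<close> are assigned to the other equations. By
    \<open>sum_d\<close> at least \<open>n + 1\<close> remain for the Hessian equations.\<close>
  have "card {..n} \<le> card R"
  proof -
    have cX: "card X = n + 1" by (simp add: X_def card_cartesian_product)
    have "card Y = card ({1::nat} \<times> {..n}) + card ({2::nat} \<times> ({..<l} - {s}))"
      unfolding Y_def by (intro card_Un_disjoint) auto
    then have cY: "card Y = n + l" using s(1) by (simp add: card_cartesian_product card_Diff_singleton_if)
    have "card V2 = l" unfolding V2_def by (subst card_image) (auto intro: inj_onI)
    moreover have "card (v3 ` L) = card L" using v3(2) by (rule card_image)
    ultimately have "card (V2 \<union> v3 ` L) \<le> l + card L" using card_Un_le[of V2 "v3 ` L"] by simp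
    moreover have "card (X \<union> Y) = n + 1 + (n + l)" using card_Un_disjoint[OF finX finY XY] cX cY by simp
    moreover have "card {(0, 0), y0} \<le> 2" by (simp add: card_insert_if)
    moreover have "card (X \<union> Y) - card {(0, 0), y0} \<le> card (X \<union> Y - {(0, 0), y0})"
      by (rule diff_card_le_card_Diff) auto
    moreover have "card (X \<union> Y - {(0, 0), y0}) - card (V2 \<union> v3 ` L) \<le> card R"
      unfolding R_def using finL by (intro diff_card_le_card_Diff) (auto simp: V2_def)
    ultimately show ?thesis using cardL sum_d by simp
  qed
  moreover have "finite R" using finX finY by (simp add: R_def)
  ultimately obtain v1 where v1: "v1 ` {..n} \<subseteq> R" "inj_on v1 {..n}"
    using card_le_inj[of "{..n}" R] by auto
  define v where "v = (\<lambda>(t::nat, i, j). if t = 0 then v1 i else if t = 1 then (0, Suc i) else v3 (i, j))"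
  define E where "E = E1 \<union> E2 \<union> E3"
  have v_simps: "v (0, i, j) = v1 i" "v (1, i, j) = (0, Suc i)" "v (2, i, j) = v3 (i, j)" for i j
    by (simp_all add: v_def)
  have E_cases: "(\<exists>i\<le>n. e = (0, i, 0)) \<or> (\<exists>i<l. e = (1, i, 0)) \<or> (\<exists>i j. (i, j) \<in> L \<and> e = (2, i, j))" if "e \<in> E" for e
    using that by (auto simp: E_def E1_def E2_def E3_def)
  have v1R: "v1 i \<in> R" if "i \<le> n" for i using v1(1) that by auto
  have v3L: "v3 (i, j) \<in> {1::nat} \<times> {..n} - {y0}" "v3 (i, j) \<in> v3 ` L" if "(i, j) \<in> L" for i j
    using v3(1) that by auto
  have v1n: "v1 i \<noteq> (0, Suc k)" "(i', j) \<in> L \<Longrightarrow> v1 i \<noteq> v3 (i', j)" if "i \<le> n" "k < l" for i k i' j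
    using v1R[OF that(1)] that(2) by (auto simp: R_def V2_def)
  have v3n: "v3 (i, j) \<noteq> (0, k)" if "(i, j) \<in> L" for i j k using v3L(1)[OF that] by auto
  have inj: "inj_on v E"
  proof (rule inj_onI)
    fix e e' assume e: "e \<in> E" "e' \<in> E" "v e = v e'"
    have i1: "i = i'" if "v1 i = v1 i'" "i \<le> n" "i' \<le> n" for i i' using inj_onD[OF v1(2)] that by auto
    have i3: "i = i' \<and> j = j'" if "v3 (i, j) = v3 (i', j')" "(i, j) \<in> L" "(i', j') \<in> L" for i i' j j'
      using inj_onD[OF v3(2) that] by auto
    note ne = v1n(1) v1n(1)[symmetric] v1n(2)[OF _ s(1)] v1n(2)[OF _ s(1), symmetric] v3n v3n[symmetric]
    from E_cases[OF e(1)] show "e = e'"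
    proof (elim disjE exE conjE)
      fix i assume "i \<le> n" "e = (0, i, 0)"
      with E_cases[OF e(2)] e(3) i1 ne show ?thesis by (elim disjE exE conjE) (simp_all add: v_simps v_simps(2)[unfolded One_nat_def])
    next
      fix i assume "i < l" "e = (1, i, 0)"
      with E_cases[OF e(2)] e(3) ne show ?thesis by (elim disjE exE conjE) (simp_all add: v_simps v_simps(2)[unfolded One_nat_def])
    next
      fix i j assume "(i, j) \<in> L" "e = (2, i, j)"
      with E_cases[OF e(2)] e(3) i3 ne show ?thesis by (elim disjE exE conjE) (simp_all add: v_simps v_simps(2)[unfolded One_nat_def])
    qed
  qed
  have I0: "{0, 1} \<times> {..n} \<subseteq> X \<union> Y" "{0} \<times> {..n} \<subseteq> X \<union> Y" by (auto simp: X_def Y_def)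
  have ab: "\<alpha> (0, a) = 1" "\<beta> (0, a) = 0" "\<alpha> (1, a) = 1" "\<beta> (1, a) = 1" "\<alpha> (2, a) = d s - d a" "\<beta> (2, a) = 1"
    "\<alpha> (Suc 0, a) = 1" "\<beta> (Suc 0, a) = 1" for a
    by (auto simp: \<alpha>_def \<beta>_def)
  have wX: "\<alpha> u = 1" "\<beta> u = 0" if "u \<in> X" for u using that by (auto simp: X_def ab)
  have wY: "\<beta> u = 1" if "u \<in> Y" for u using that by (auto simp: Y_def ab)
  have hess: "hess a \<in> wforms (X \<union> Y) \<alpha> \<beta> (d s - 1) 1" for a
  proof -
    have "Var (1, b) * in_x (partial_deriv b (partial_deriv a (F s))) \<in> wforms (X \<union> Y) \<alpha> \<beta> (1 + (d s - 1 - 1)) (1 + 0)" if "b \<le> n" for b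
    proof (intro wforms_mult in_x_wforms[of _ n] partial_deriv_forms F s(1) I0 ab)
      show "Var (1, b) \<in> wforms (X \<union> Y) \<alpha> \<beta> 1 1"
        using wforms_Var[of "(1, b)" "X \<union> Y" \<alpha> \<beta>] that by (simp add: ab Y_def)
    qed
    moreover have "Var (2, i) * in_x (partial_deriv a (F i)) \<in> wforms (X \<union> Y) \<alpha> \<beta> (d s - d i + (d i - 1)) (1 + 0)" if "i \<in> {..<l} - {s}" for i
    proof (intro wforms_mult in_x_wforms[of _ n] partial_deriv_forms I0 ab)
      show "Var (2, i) \<in> wforms (X \<union> Y) \<alpha> \<beta> (d s - d i) 1"
        using wforms_Var[of "(2, i)" "X \<union> Y" \<alpha> \<beta>] that by (simp add: ab Y_def)
      show "F i \<in> forms n (d i)" using that F by auto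
    qed
    moreover have "d s - d i + (d i - 1) = d s - 1" if "i \<in> {..<l} - {s}" for i using s(2)[of i] d1[of i] that by auto
    moreover have "1 + (d s - 1 - 1) = d s - 1" using s(3) by auto
    ultimately show ?thesis unfolding hess_def by (intro wforms_diff wforms_sum) auto
  qed
  have "\<exists>a. (\<forall>e\<in>E. poly_eval a (f e) = 0) \<and> (\<exists>x\<in>X. a x \<noteq> 0) \<and> (\<exists>y\<in>Y. a y \<noteq> 0)"
  proof (rule weighted_bezout_set[where \<alpha> = \<alpha> and \<beta> = \<beta> and p = p and q = q and v = v and \<sigma> = "(3, 0)"
        and ?x0.0 = "(0, 0)" and ?y0.0 = y0])
    show "finite E" using finL by (simp add: E_def E1_def E2_def E3_def)
    show "(3, 0) \<notin> X \<union> Y" by (simp add: X_def Y_def)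
    show "(0, 0) \<in> X" by (simp add: X_def)
    fix e assume e: "e \<in> E"
    show "f e \<in> wforms (X \<union> Y) \<alpha> \<beta> (p e) (q e)"
      using E_cases[OF e]
    proof (elim disjE exE conjE)
      fix i assume "e = (0, i, 0)"
      then show ?thesis using hess by (simp add: f_def p_def q_def)
    next
      fix i assume i: "i < l" "e = (1, i, 0)"
      then show ?thesis using in_x_wforms[where \<alpha> = \<alpha> and \<beta> = \<beta>, OF F[OF i(1)] I0(2)] by (simp add: ab f_def p_def q_def)
    next
      fix i j assume i: "(i, j) \<in> L" "e = (2, i, j)"
      then have "i < l" by (simp add: L_def)
      then show ?thesis using i(2) line_coeff_wforms[where \<alpha> = \<alpha> and \<beta> = \<beta>, OF I0(1) _ _ _ _ F]
        by (simp add: ab f_def p_def q_def)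
    qed
    show "v e \<in> X \<union> Y - {(0, 0), y0}"
      using E_cases[OF e]
    proof (elim disjE exE conjE)
      fix i assume "i \<le> n" "e = (0, i, 0)"
      then show ?thesis using v1R[of i] by (auto simp: v_simps R_def)
    next
      fix i assume i: "i < l" "e = (1, i, 0)"
      then show ?thesis using ln y0(1) by (auto simp: v_simps v_simps(2)[unfolded One_nat_def] X_def Y_def)
    next
      fix i j assume i: "(i, j) \<in> L" "e = (2, i, j)"
      then show ?thesis using v3L[OF i(1)] by (auto simp: v_simps Y_def)
    qed
    have *: "\<beta> (v e) \<le> q e \<and> \<alpha> (v e) + (q e - \<beta> (v e)) * \<alpha> y0 \<le> p e"
      using E_cases[OF e]
    proof (elim disjE exE conjE)
      fix i assume i: "i \<le> n" "e = (0, i, 0)"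
      have "v1 i \<in> X \<union> Y" using v1R[OF i(1)] by (simp add: R_def)
      then consider a where "v1 i = (0, a)" | a where "v1 i = (1, a)" | a where "v1 i = (2, a)" "a < l"
        by (auto simp: X_def Y_def)
      then show ?thesis
      proof cases
        case 3
        then show ?thesis using i d1[of a] s(2)[of a] by (simp add: v_simps ab p_def q_def)
      qed (use i y0(3) s(3) in \<open>simp_all add: v_simps ab p_def q_def\<close>)
    next
      fix i assume i: "i < l" "e = (1, i, 0)"
      then show ?thesis using d1[of i] by (simp add: v_simps v_simps(2)[unfolded One_nat_def] ab p_def q_def)
    next
      fix i j assume i: "(i, j) \<in> L" "e = (2, i, j)"
      then obtain a where a: "v3 (i, j) = (1, a)" using v3L(1)[OF i(1)] by auto
      have j: "1 \<le> j" "j \<le> d i" using i(1) by (auto simp: L_def)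
      have "(j - 1) * \<alpha> y0 \<le> j - 1" using y0(2) by (metis mult_le_mono2 mult.right_neutral)
      then have "Suc ((j - 1) * \<alpha> y0) \<le> d i" using j by linarith
      then show ?thesis using i(2) a j by (simp add: v_simps ab p_def q_def)
    qed
    show "\<beta> (v e) \<le> q e" "\<alpha> (v e) + (q e - \<beta> (v e)) * \<alpha> y0 \<le> p e" using * by auto
  qed (simp_all only: finX finY XY y0(1) inj wX wY)
  then obtain a where a: "\<And>e. e \<in> E \<Longrightarrow> poly_eval a (f e) = 0" "\<exists>x\<in>X. a x \<noteq> 0" "\<exists>y\<in>Y. a y \<noteq> 0" by blast
  define x where "x = (\<lambda>k. a (0, k))"
  define y where "y = (\<lambda>k. a (1, k))"
  define lam where "lam = (\<lambda>i. a (2, i))"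
  have Fx: "poly_eval x (F i) = 0" if "i < l" for i
    using a(1)[of "(1, i, 0)"] that by (simp add: E_def E2_def f_def poly_eval_in_x x_def)
  have x0: "\<exists>k\<le>n. x k \<noteq> 0" using a(2) by (auto simp: X_def x_def)
  have H: "(\<Sum>b\<le>n. poly_eval x (partial_deriv b (partial_deriv k (F s))) * y b) =
      (\<Sum>i\<in>{..<l} - {s}. lam i * poly_eval x (partial_deriv k (F i)))" if "k \<le> n" for k
  proof -
    have "poly_eval a (hess k) = 0" using a(1)[of "(0, k, 0)"] that by (simp add: E_def E1_def f_def)
    then show ?thesis
      by (simp add: hess_def poly_eval_homs poly_eval_in_x x_def y_def lam_def mult.commute)
  qed
  let ?\<gamma> = "\<lambda>k. [:x k, y k:]"
  have cf: "coeff (poly_curve ?\<gamma> G) j = poly_eval a (line_coeff n G j)" if "G \<in> forms n e" for G e j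
    unfolding x_def y_def by (rule coeff_poly_curve_line[OF forms_polys_in[OF that]])
  have Fp: "F i \<in> polys_in {..n}" if "i < l" for i using forms_polys_in[OF F[OF that]] .
  have ds: "partial_deriv b (F s) \<in> forms n (d s - 1)" for b by (rule partial_deriv_forms[OF F[OF s(1)]])
  have c1: "coeff (poly_curve ?\<gamma> G) 1 = (\<Sum>b\<le>n. y b * poly_eval x (partial_deriv b G))" if "G \<in> forms n e" for G e
    unfolding cf[OF that] by (simp add: poly_eval_homs poly_eval_in_x x_def y_def)
  have dl: "(\<Sum>b\<le>n. y b * poly_eval x (partial_deriv b (F i))) = 0" if "i < l" "i \<noteq> s" for i
  proof -
    have "(2, i, 1) \<in> E" using that d1[of i] by (simp add: E_def E3_def L_def)
    from a(1)[OF this] have "poly_eval a (line_coeff n (F i) 1) = 0" by (simp add: f_def)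
    then show ?thesis using c1[OF F[OF that(1)]] cf[OF F[OF that(1)]] by metis
  qed
  \<comment> \<open>Pairing the Hessian equations with \<open>x\<close> gives, by Euler's identity
    for the first derivatives, the derivative of \<open>F s\<close> along \<open>y\<close> up to the
    factor \<open>d s - 1\<close>. The gradients of the other forms pair to zero with
    \<open>x\<close>.\<close>
  have ds1: "(\<Sum>b\<le>n. y b * poly_eval x (partial_deriv b (F s))) = 0"
  proof -
    have "of_nat (d s - 1) * (\<Sum>b\<le>n. y b * poly_eval x (partial_deriv b (F s))) =
      (\<Sum>b\<le>n. y b * (of_nat (d s - 1) * poly_eval x (partial_deriv b (F s))))"
      by (simp add: sum_distrib_left mult_ac)
    also have "\<dots> = (\<Sum>b\<le>n. y b * (\<Sum>k\<le>n. x k * poly_eval x (partial_deriv k (partial_deriv b (F s)))))"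
      by (simp add: euler_forms[OF ds])
    also have "\<dots> = (\<Sum>k\<le>n. x k * (\<Sum>b\<le>n. poly_eval x (partial_deriv b (partial_deriv k (F s))) * y b))"
      unfolding sum_distrib_left by (subst sum.swap) (simp add: partial_deriv_commute[of _ _ "F s"] mult_ac)
    also have "\<dots> = (\<Sum>k\<le>n. x k * (\<Sum>i\<in>{..<l} - {s}. lam i * poly_eval x (partial_deriv k (F i))))"
      by (simp add: H)
    also have "\<dots> = (\<Sum>i\<in>{..<l} - {s}. lam i * (\<Sum>k\<le>n. x k * poly_eval x (partial_deriv k (F i))))"
      unfolding sum_distrib_left by (subst sum.swap) (simp add: mult_ac)
    also have "\<dots> = 0" using Fx by (intro sum.neutral) (auto simp: euler_forms[OF F])
    finally show ?thesis using s(3) by simp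
  qed
  \<comment> \<open>Pairing the same equations with \<open>y\<close> gives twice this coefficient,
    expressed through the linear coefficients of the other forms, which are already zero.\<close>
  have c2: "coeff (poly_curve ?\<gamma> (F s)) 2 = 0"
  proof -
    have "2 * coeff (poly_curve ?\<gamma> (F s)) 2 = (\<Sum>k\<le>n. y k * (\<Sum>b\<le>n. y b * poly_eval x (partial_deriv b (partial_deriv k (F s)))))"
      unfolding cf[OF F[OF s(1)]] by (simp add: numeral_2_eq_2 poly_eval_homs poly_eval_in_x x_def y_def)
    also have "\<dots> = (\<Sum>k\<le>n. y k * (\<Sum>i\<in>{..<l} - {s}. lam i * poly_eval x (partial_deriv k (F i))))"
      using H by (intro sum.cong) (auto simp: mult.commute)
    also have "\<dots> = (\<Sum>i\<in>{..<l} - {s}. lam i * (\<Sum>k\<le>n. y k * poly_eval x (partial_deriv k (F i))))"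
      unfolding sum_distrib_left by (subst sum.swap) (simp add: mult_ac)
    also have "\<dots> = 0" using dl by (intro sum.neutral) auto
    finally show ?thesis by simp
  qed
  have curve: "poly_curve ?\<gamma> (F i) = 0" if i: "i < l" for i
  proof (rule poly_eqI)
    fix j
    consider "j = 0" | "j > d i" | "i = s" "j = 1" | "i = s" "j = 2" | "(i, j) \<in> L"
      using i by (force simp: L_def)
    then show "coeff (poly_curve ?\<gamma> (F i)) j = coeff 0 j"
    proof cases
      case 1
      then show ?thesis using Fx[OF i] by (simp add: cf[OF F[OF i]] poly_eval_in_x flip: x_def)
    next
      case 2
      then show ?thesis using line_coeff_eq_0[OF F[OF i]] by (simp add: cf[OF F[OF i]])
    next
      case 3
      then show ?thesis using c1[OF F[OF i]] ds1 by simp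
    next
      case 4
      then show ?thesis using c2 by simp
    next
      case 5
      then have "(2, i, j) \<in> E" by (simp add: E_def E3_def)
      from a(1)[OF this] show ?thesis by (simp add: f_def cf[OF F[OF i]])
    qed
  qed
  show thesis
  proof (rule that)
    show "poly_eval (\<lambda>k. u * x k + v * y k) (F i) = 0" if "i < l" for i u v
      by (rule forms_vanish_on_line[OF F[OF that] curve[OF that]])
    show "u = 0 \<and> v = 0" if uv: "\<forall>k\<le>n. u * x k + v * y k = 0" for u v
    proof -
      have v: "v = 0"
      proof (rule ccontr)
        assume v: "v \<noteq> 0"
        define c where "c = - u / v"
        have yc: "y k = c * x k" if "k \<le> n" for k
        proof -
          have "u * x k + v * y k = 0" using uv that by blast
          then show ?thesis using v by (simp add: c_def field_simps add_eq_0_iff)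
        qed
        \<comment> \<open>If \<open>y\<close> were \<open>c\<close> times \<open>x\<close>, Euler's
          identity would turn the Hessian equations into a linear relation between the gradients at
          \<open>x\<close> with these coefficients. Smoothness makes all of them zero, and then
          \<open>y\<close> and \<open>lam\<close> vanish together.\<close>
        define c' where "c' i = (if i = s then c * of_nat (d s - 1) else - lam i)" for i
        have "(\<Sum>i<l. c' i * poly_eval x (partial_deriv k (F i))) = 0" if "k \<le> n" for k
        proof -
          have "(\<Sum>i<l. c' i * poly_eval x (partial_deriv k (F i))) =
            c * (of_nat (d s - 1) * poly_eval x (partial_deriv k (F s))) -
            (\<Sum>i\<in>{..<l} - {s}. lam i * poly_eval x (partial_deriv k (F i)))"
            using s(1) by (subst sum.remove[of _ s]) (auto simp: c'_def sum_negf)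
          also have "of_nat (d s - 1) * poly_eval x (partial_deriv k (F s)) =
            (\<Sum>b\<le>n. x b * poly_eval x (partial_deriv b (partial_deriv k (F s))))"
            by (rule euler_forms[OF ds, symmetric])
          also have "c * \<dots> = (\<Sum>b\<le>n. poly_eval x (partial_deriv b (partial_deriv k (F s))) * y b)"
            by (simp add: yc sum_distrib_left mult_ac)
          finally show ?thesis using H[OF that] by simp
        qed
        then have c0: "\<forall>i<l. c' i = 0" using smooth[OF x0] Fx by blast
        then have "c = 0" using s(1,3) by (auto simp: c'_def)
        then have "\<forall>k\<le>n. y k = 0" using yc by simp
        moreover have "lam i = 0" if "i < l" "i \<noteq> s" for i using c0 that by (auto simp: c'_def)
        ultimately show False using a(3) by (auto simp: Y_def y_def lam_def)
      qed
      then show ?thesis using uv x0 by auto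
    qed
  qed (rule H)
qed

section \<open>Projective varieties in homogeneous coordinates\<close>

abbreviation ev :: "complex vec \<Rightarrow> nat cpoly \<Rightarrow> complex" where
  "ev v F \<equiv> poly_eval (\<lambda>i. v $ i) F"

definition homog_coords :: "nat \<Rightarrow> complex vec set" where
  "homog_coords n = {v. v \<in> carrier_vec (Suc n) \<and> v \<noteq> 0\<^sub>v (Suc n)}"

lemma homog_coords_iff: "v \<in> homog_coords n \<longleftrightarrow> v \<in> carrier_vec (Suc n) \<and> (\<exists>i\<le>n. v $ i \<noteq> 0)"
proof -
  have "v = 0\<^sub>v (Suc n) \<longleftrightarrow> (\<forall>i\<le>n. v $ i = 0)" if "v \<in> carrier_vec (Suc n)"
    using that by (auto intro!: eq_vecI simp: less_Suc_eq_le)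
  then show ?thesis by (auto simp: homog_coords_def)
qed

lemma homog_coords_carrier: "v \<in> homog_coords n \<Longrightarrow> v \<in> carrier_vec (Suc n)"
  by (simp add: homog_coords_def)

lemma homog_coords_smult: "v \<in> homog_coords n \<Longrightarrow> c \<noteq> 0 \<Longrightarrow> c \<cdot>\<^sub>v v \<in> homog_coords n"
  by (auto simp: homog_coords_iff)

lemma proj_space_eq: "proj_space n = line ` homog_coords n"
  by (auto simp: proj_space_def homog_coords_def)

lemma line_smult: "c \<noteq> 0 \<Longrightarrow> line (c \<cdot>\<^sub>v v) = line v"
proof -
  assume c: "c \<noteq> 0"
  have "d \<cdot>\<^sub>v v = (d / c) \<cdot>\<^sub>v (c \<cdot>\<^sub>v v)" for d using c by (simp add: smult_smult_assoc)
  then have "d \<cdot>\<^sub>v v \<in> line (c \<cdot>\<^sub>v v)" for d unfolding line_def by blast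
  moreover have "d \<cdot>\<^sub>v (c \<cdot>\<^sub>v v) \<in> line v" for d unfolding line_def by (auto simp: smult_smult_assoc)
  ultimately show ?thesis by (auto simp: line_def[of v] line_def[of "c \<cdot>\<^sub>v v"])
qed

lemma line_eqD:
  assumes "line v = line w" "v \<in> homog_coords n"
  shows "\<exists>c. c \<noteq> 0 \<and> v = c \<cdot>\<^sub>v w"
proof -
  have "v \<in> line v" by (auto simp: line_def intro!: exI[of _ 1])
  then obtain c where c: "v = c \<cdot>\<^sub>v w" using assms(1) by (auto simp: line_def)
  have "c \<noteq> 0" using assms(2) c by (auto simp: homog_coords_iff)
  with c show ?thesis by blast
qed

lemma line_in_proj_space: "v \<in> carrier_vec (Suc n) \<Longrightarrow> line v \<in> proj_space n \<Longrightarrow> v \<in> homog_coords n"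
proof -
  assume v: "v \<in> carrier_vec (Suc n)" "line v \<in> proj_space n"
  then obtain w where w: "w \<in> homog_coords n" "line w = line v" by (auto simp: proj_space_eq)
  then obtain c where "c \<noteq> 0" "w = c \<cdot>\<^sub>v v" using line_eqD by metis
  then show ?thesis using w(1) v(1) by (auto simp: homog_coords_iff)
qed

lemma ev_smult:
  assumes "F \<in> forms n d" "v \<in> carrier_vec (Suc n)"
  shows "ev (c \<cdot>\<^sub>v v) F = c ^ d * ev v F"
proof -
  have "ev (c \<cdot>\<^sub>v v) F = poly_eval (\<lambda>i. c * v $ i) F"
    using assms by (intro poly_eval_cong_polys_in[OF forms_polys_in]) (auto simp: less_Suc_eq_le)
  then show ?thesis by (simp add: poly_eval_forms_scale[OF assms(1)])
qed

definition form_sys :: "nat \<Rightarrow> nat cpoly set \<Rightarrow> bool" where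
  "form_sys n S \<longleftrightarrow> (\<forall>F\<in>S. \<exists>d. F \<in> forms n d)"

lemma in_zero_locus:
  assumes "form_sys n S" "v \<in> homog_coords n"
  shows "line v \<in> zero_locus n S \<longleftrightarrow> (\<forall>F\<in>S. ev v F = 0)"
proof
  assume "line v \<in> zero_locus n S"
  then obtain w where w: "w \<in> homog_coords n" "line w = line v" "\<forall>F\<in>S. ev w F = 0"
    by (auto simp: zero_locus_def homog_coords_def)
  then obtain c where c: "c \<noteq> 0" "w = c \<cdot>\<^sub>v v" using line_eqD by metis
  show "\<forall>F\<in>S. ev v F = 0"
  proof
    fix F assume F: "F \<in> S"
    then obtain d where "F \<in> forms n d" using assms(1) by (auto simp: form_sys_def)
    from ev_smult[OF this homog_coords_carrier[OF assms(2)], of c] w(3) F c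
    show "ev v F = 0" by auto
  qed
next
  assume "\<forall>F\<in>S. ev v F = 0"
  then show "line v \<in> zero_locus n S" using assms(2) by (auto simp: zero_locus_def homog_coords_def)
qed

lemma zero_locus_subset: "zero_locus n S \<subseteq> proj_space n"
  by (auto simp: zero_locus_def proj_space_def)

lemma form_sys_single: "F \<in> forms n d \<Longrightarrow> form_sys n {F}"
  by (auto simp: form_sys_def)

lemma zariski_proj_local_basis:
  assumes "openin (zariski_proj n) U" "v \<in> homog_coords n" "line v \<in> U"
  shows "\<exists>F d. F \<in> forms n d \<and> ev v F \<noteq> 0 \<and> (\<forall>w\<in>homog_coords n. ev w F \<noteq> 0 \<longrightarrow> line w \<in> U)"
proof -
  have "generate_topology_on {proj_space n - zero_locus n {F} | F d. F \<in> forms n d} U"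
    using assms(1) by (simp add: zariski_proj_def openin_topology_generated_by_iff)
  then show ?thesis using assms(3)
  proof induction
    case (Int a b)
    then obtain F d G e where F: "F \<in> forms n d" "ev v F \<noteq> 0" "\<forall>w\<in>homog_coords n. ev w F \<noteq> 0 \<longrightarrow> line w \<in> a"
      and G: "G \<in> forms n e" "ev v G \<noteq> 0" "\<forall>w\<in>homog_coords n. ev w G \<noteq> 0 \<longrightarrow> line w \<in> b" by blast
    then show ?case by (intro exI[of _ "F * G"] exI[of _ "d + e"]) (auto simp: poly_eval_homs intro: forms_mult)
  next
    case (UN K)
    then obtain k where k: "k \<in> K" "line v \<in> k" by blast
    from UN.IH[OF this] k(1) show ?case by blast
  next
    case (Basis s)
    then obtain F d where F: "F \<in> forms n d" "s = proj_space n - zero_locus n {F}" by blast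
    then have "line w \<in> s \<longleftrightarrow> ev w F \<noteq> 0" if "w \<in> homog_coords n" for w
      using in_zero_locus[OF form_sys_single[OF F(1)] that] that by (auto simp: proj_space_eq)
    then show ?case using F(1) Basis(2) assms(2) by blast
  qed simp
qed

definition principal :: "nat \<Rightarrow> complex vec set set \<Rightarrow> nat cpoly \<Rightarrow> complex vec set set" where
  "principal n Z F = {line v | v. v \<in> homog_coords n \<and> line v \<in> Z \<and> ev v F \<noteq> 0}"

lemma in_principal:
  assumes "F \<in> forms n d" "v \<in> homog_coords n"
  shows "line v \<in> principal n Z F \<longleftrightarrow> line v \<in> Z \<and> ev v F \<noteq> 0"
proof
  assume "line v \<in> principal n Z F"
  then obtain w where w: "w \<in> homog_coords n" "line w = line v" "line w \<in> Z" "ev w F \<noteq> 0"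
    by (auto simp: principal_def)
  then obtain c where c: "c \<noteq> 0" "w = c \<cdot>\<^sub>v v" using line_eqD by metis
  from ev_smult[OF assms(1) homog_coords_carrier[OF assms(2)], of c] w c
  show "line v \<in> Z \<and> ev v F \<noteq> 0" by auto
qed (use assms in \<open>auto simp: principal_def\<close>)

lemma principal_subset: "principal n Z F \<subseteq> Z"
  by (auto simp: principal_def)

lemma openin_principal_proj: "F \<in> forms n d \<Longrightarrow> openin (zariski_proj n) (principal n (proj_space n) F)"
proof -
  assume F: "F \<in> forms n d"
  have "principal n (proj_space n) F = proj_space n - zero_locus n {F}"
    using in_zero_locus[OF form_sys_single[OF F]] by (auto simp: principal_def proj_space_eq)
  then show ?thesis unfolding zariski_proj_def using F by (auto intro!: topology_generated_by_Basis)
qed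

lemma openin_principal:
  assumes "F \<in> forms n d"
  shows "openin (subtopology (zariski_proj n) Z) (principal n Z F)"
proof -
  have "principal n Z F = principal n (proj_space n) F \<inter> Z" by (auto simp: principal_def proj_space_eq)
  then show ?thesis using openin_principal_proj[OF assms] by (auto simp: openin_subtopology)
qed

lemma topspace_zariski_proj: "topspace (zariski_proj n) = proj_space n"
proof
  show "topspace (zariski_proj n) \<subseteq> proj_space n" by (auto simp: zariski_proj_def)
  have "principal n (proj_space n) 1 = proj_space n"
    by (auto simp: principal_def proj_space_eq poly_eval_homs)
  then show "proj_space n \<subseteq> topspace (zariski_proj n)"
    using openin_subset[OF openin_principal_proj[OF forms_1, of n]] by simp
qed

lemma ftop_proj_variety: "ftop (proj_variety n Z) = subtopology (zariski_proj n) Z"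
  by (simp add: proj_variety_def)

lemma topspace_proj_variety: "Z \<subseteq> proj_space n \<Longrightarrow> topspace (ftop (proj_variety n Z)) = Z"
  by (auto simp: ftop_proj_variety topspace_zariski_proj)

lemma open_local_principal:
  assumes "openin (subtopology (zariski_proj n) Z) U" "v \<in> homog_coords n" "line v \<in> U"
  shows "\<exists>F d. F \<in> forms n d \<and> ev v F \<noteq> 0 \<and> principal n Z F \<subseteq> U"
proof -
  obtain T where T: "openin (zariski_proj n) T" "U = T \<inter> Z" using assms(1) by (auto simp: openin_subtopology)
  then obtain F d where "F \<in> forms n d" "ev v F \<noteq> 0" "\<forall>w\<in>homog_coords n. ev w F \<noteq> 0 \<longrightarrow> line w \<in> T"
    using zariski_proj_local_basis[OF T(1) assms(2)] assms(3) by auto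
  then show ?thesis using T(2) by (intro exI[of _ F] exI[of _ d]) (auto simp: principal_def)
qed

lemma openin_by_principal:
  assumes "U \<subseteq> Z" "Z \<subseteq> proj_space n"
    and "\<And>v. v \<in> homog_coords n \<Longrightarrow> line v \<in> U \<Longrightarrow> \<exists>F d. F \<in> forms n d \<and> ev v F \<noteq> 0 \<and> principal n Z F \<subseteq> U"
  shows "openin (subtopology (zariski_proj n) Z) U"
proof (subst openin_subopen, intro ballI)
  fix p assume p: "p \<in> U"
  then obtain v where v: "v \<in> homog_coords n" "p = line v" using assms(1,2) by (auto simp: proj_space_eq)
  then obtain F d where F: "F \<in> forms n d" "ev v F \<noteq> 0" "principal n Z F \<subseteq> U" using assms(3) p by blast
  have "p \<in> principal n Z F" using in_principal[OF F(1) v(1)] v(2) F(2) p assms(1) by auto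
  then show "\<exists>T. openin (subtopology (zariski_proj n) Z) T \<and> p \<in> T \<and> T \<subseteq> U"
    using openin_principal[OF F(1)] F(3) by blast
qed

text \<open>The neighbourhood is the principal open set of the denominator itself. Multiplying
  numerator and denominator by one more form shrinks it, so that open sets need not be
  mentioned.\<close>

definition is_fraction_near ::
    "nat \<Rightarrow> complex vec set set \<Rightarrow> complex vec set set \<Rightarrow> (complex vec set \<Rightarrow> complex) \<Rightarrow> complex vec \<Rightarrow>
      nat cpoly \<Rightarrow> nat cpoly \<Rightarrow> bool" where
  "is_fraction_near n Z U f v g h \<longleftrightarrow> (\<exists>d. g \<in> forms n d \<and> h \<in> forms n d) \<and> ev v h \<noteq> 0 \<and>
     (\<forall>w\<in>homog_coords n. line w \<in> Z \<longrightarrow> ev w h \<noteq> 0 \<longrightarrow> line w \<in> U \<and> f (line w) = ev w g / ev w h)"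

lemma regular_proj_iff:
  assumes Z: "Z \<subseteq> proj_space n" and U: "U \<subseteq> Z"
  shows "regular (proj_variety n Z) U f \<longleftrightarrow>
    (\<forall>v\<in>homog_coords n. line v \<in> U \<longrightarrow> (\<exists>g h. is_fraction_near n Z U f v g h))"
proof
  assume reg: "regular (proj_variety n Z) U f"
  show "\<forall>v\<in>homog_coords n. line v \<in> U \<longrightarrow> (\<exists>g h. is_fraction_near n Z U f v g h)"
  proof (intro ballI impI)
    fix v assume v: "v \<in> homog_coords n" "line v \<in> U"
    then obtain V d g h where V: "openin (subtopology (zariski_proj n) Z) V" "line v \<in> V" "V \<subseteq> U"
      and gh: "g \<in> forms n d" "h \<in> forms n d"
      and f: "\<And>w. w \<in> carrier_vec (Suc n) \<Longrightarrow> line w \<in> V \<Longrightarrow> ev w h \<noteq> 0 \<and> f (line w) = ev w g / ev w h"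
      using reg by (auto simp: proj_variety_def)
    from open_local_principal[OF V(1) v(1) V(2)] obtain k e where k: "k \<in> forms n e" "ev v k \<noteq> 0" "principal n Z k \<subseteq> V"
      by blast
    have "is_fraction_near n Z U f v (g * k) (h * k)"
      unfolding is_fraction_near_def
    proof (intro conjI ballI impI)
      show "\<exists>d. g * k \<in> forms n d \<and> h * k \<in> forms n d" using gh k forms_mult by blast
      show "ev v (h * k) \<noteq> 0" using f[OF homog_coords_carrier[OF v(1)] V(2)] k by (simp add: poly_eval_homs)
      fix w assume w: "w \<in> homog_coords n" "line w \<in> Z" "ev w (h * k) \<noteq> 0"
      then have "line w \<in> V" using k(3) by (auto simp: principal_def poly_eval_homs)
      then show "line w \<in> U" "f (line w) = ev w (g * k) / ev w (h * k)"
        using V(3) f[OF homog_coords_carrier[OF w(1)]] w(3) by (auto simp: poly_eval_homs)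
    qed
    then show "\<exists>g h. is_fraction_near n Z U f v g h" by blast
  qed
next
  assume R: "\<forall>v\<in>homog_coords n. line v \<in> U \<longrightarrow> (\<exists>g h. is_fraction_near n Z U f v g h)"
  show "regular (proj_variety n Z) U f"
    unfolding proj_variety_def fspace.simps
  proof (rule ballI)
    fix p assume p: "p \<in> U"
    then obtain v where v: "v \<in> homog_coords n" "p = line v" using Z U by (auto simp: proj_space_eq)
    then obtain g h where gh: "is_fraction_near n Z U f v g h" using R p by blast
    then obtain d where d: "g \<in> forms n d" "h \<in> forms n d" by (auto simp: is_fraction_near_def)
    let ?V = "principal n Z h"
    have *: "ev w h \<noteq> 0 \<and> f (line w) = ev w g / ev w h" if w: "w \<in> carrier_vec (Suc n)" "line w \<in> ?V" for w
    proof -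
      have "line w \<in> proj_space n" using w(2) principal_subset Z by blast
      then have wh: "w \<in> homog_coords n" using w(1) line_in_proj_space by blast
      then have "line w \<in> Z \<and> ev w h \<noteq> 0" using in_principal[OF d(2)] w(2) by blast
      then show ?thesis using gh wh by (auto simp: is_fraction_near_def)
    qed
    have "?V \<subseteq> U" using gh by (auto simp: is_fraction_near_def principal_def)
    moreover have "p \<in> ?V" using in_principal[OF d(2) v(1)] v(2) p U gh by (auto simp: is_fraction_near_def)
    ultimately show "\<exists>V d g h. openin (subtopology (zariski_proj n) Z) V \<and> p \<in> V \<and> V \<subseteq> U \<and>
        g \<in> forms n d \<and> h \<in> forms n d \<and>
        (\<forall>w. w \<in> carrier_vec (Suc n) \<and> line w \<in> V \<longrightarrow> ev w h \<noteq> 0 \<and> f (line w) = ev w g / ev w h)"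
      using openin_principal[OF d(2)] d * by blast
  qed
qed

lemma is_fraction_near_mono: "is_fraction_near n Z U f v g h \<Longrightarrow> U \<subseteq> U' \<Longrightarrow> is_fraction_near n Z U' f v g h"
  unfolding is_fraction_near_def by blast

lemma regular_near_iff:
  assumes Z: "Z \<subseteq> proj_space n" and v: "v \<in> homog_coords n" "line v \<in> Z"
  shows "regular_near (proj_variety n Z) (line v) f \<longleftrightarrow> (\<exists>g h. is_fraction_near n Z Z f v g h)"
proof
  assume "regular_near (proj_variety n Z) (line v) f"
  then obtain V where V: "openin (subtopology (zariski_proj n) Z) V" "line v \<in> V" "regular (proj_variety n Z) V f"
    by (auto simp: regular_near_def ftop_proj_variety)
  have "V \<subseteq> Z" using openin_subset[OF V(1)] by auto
  then obtain g h where "is_fraction_near n Z V f v g h"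
    using V(2,3) v(1) regular_proj_iff[OF Z] by blast
  then show "\<exists>g h. is_fraction_near n Z Z f v g h" using is_fraction_near_mono[OF _ \<open>V \<subseteq> Z\<close>] by blast
next
  assume "\<exists>g h. is_fraction_near n Z Z f v g h"
  then obtain g h d where gh: "g \<in> forms n d" "h \<in> forms n d" "ev v h \<noteq> 0"
    and f: "\<And>w. w \<in> homog_coords n \<Longrightarrow> line w \<in> Z \<Longrightarrow> ev w h \<noteq> 0 \<Longrightarrow> f (line w) = ev w g / ev w h"
    by (auto simp: is_fraction_near_def)
  have "regular (proj_variety n Z) (principal n Z h) f"
    unfolding regular_proj_iff[OF Z principal_subset]
  proof (intro ballI impI exI)
    fix w assume w: "w \<in> homog_coords n" "line w \<in> principal n Z h"
    then have "ev w h \<noteq> 0" using in_principal[OF gh(2)] by blast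
    then show "is_fraction_near n Z (principal n Z h) f w g h"
      using gh f in_principal[OF gh(2)] by (auto simp: is_fraction_near_def)
  qed
  moreover have "line v \<in> principal n Z h" using in_principal[OF gh(2) v(1)] v(2) gh(3) by blast
  ultimately show "regular_near (proj_variety n Z) (line v) f"
    using openin_principal[OF gh(2)] by (auto simp: regular_near_def ftop_proj_variety)
qed

section \<open>Morphisms given by forms\<close>

definition tuple_vec :: "nat \<Rightarrow> (nat \<Rightarrow> nat cpoly) \<Rightarrow> complex vec \<Rightarrow> complex vec" where
  "tuple_vec n M v = vec (Suc n) (\<lambda>j. ev v (M j))"

definition tuple_map :: "nat \<Rightarrow> nat \<Rightarrow> (nat \<Rightarrow> nat cpoly) \<Rightarrow> complex vec set \<Rightarrow> complex vec set" where
  "tuple_map k n M p = line (tuple_vec n M (SOME v. v \<in> homog_coords k \<and> line v = p))"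

lemma tuple_vec_carrier [simp]: "tuple_vec n M v \<in> carrier_vec (Suc n)"
  by (simp add: tuple_vec_def)

lemma tuple_vec_index: "j \<le> n \<Longrightarrow> tuple_vec n M v $ j = ev v (M j)"
  by (simp add: tuple_vec_def)

lemma ev_tuple_vec:
  assumes "G \<in> polys_in {..n}"
  shows "ev (tuple_vec n M v) G = ev v (poly_subst M G)"
  unfolding poly_eval_subst by (rule poly_eval_cong_polys_in[OF assms]) (simp add: tuple_vec_index)

text \<open>All \<open>M j\<close> have the same degree, so another representative vector only
  rescales the image vector by a nonzero factor.\<close>

lemma tuple_map_line:
  assumes M: "\<And>j. j \<le> n \<Longrightarrow> M j \<in> forms k e" and v: "v \<in> homog_coords k"
  shows "tuple_map k n M (line v) = line (tuple_vec n M v)"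
proof -
  define u where "u = (SOME u. u \<in> homog_coords k \<and> line u = line v)"
  have "u \<in> homog_coords k \<and> line u = line v" unfolding u_def by (rule someI[of _ v]) (simp add: v)
  then obtain c where c: "c \<noteq> 0" "u = c \<cdot>\<^sub>v v" using line_eqD by metis
  have "tuple_vec n M u = c ^ e \<cdot>\<^sub>v tuple_vec n M v"
    using ev_smult[OF M homog_coords_carrier[OF v], of _ c] c(2)
    by (intro eq_vecI) (auto simp: tuple_vec_def less_Suc_eq_le)
  then show ?thesis using c(1) by (simp add: tuple_map_def line_smult flip: u_def)
qed

locale form_map =
  fixes k n e :: nat and M :: "nat \<Rightarrow> nat cpoly" and Y Z :: "complex vec set set"
  assumes M: "\<And>j. j \<le> n \<Longrightarrow> M j \<in> forms k e"
    and Y: "Y \<subseteq> proj_space k" and Z: "Z \<subseteq> proj_space n"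
    and maps: "\<And>v. v \<in> homog_coords k \<Longrightarrow> line v \<in> Y \<Longrightarrow>
      tuple_vec n M v \<in> homog_coords n \<and> line (tuple_vec n M v) \<in> Z"
begin

lemma subst_forms: "G \<in> forms n d \<Longrightarrow> poly_subst M G \<in> forms k (d * e)"
  by (rule poly_subst_forms[OF _ M])

lemma ev_subst: "G \<in> forms n d \<Longrightarrow> ev (tuple_vec n M v) G = ev v (poly_subst M G)"
  by (rule ev_tuple_vec[OF forms_polys_in])

lemma map_line: "v \<in> homog_coords k \<Longrightarrow> tuple_map k n M (line v) = line (tuple_vec n M v)"
  by (rule tuple_map_line[OF M])

lemma fraction_pullback:
  assumes v: "v \<in> homog_coords k" "line v \<in> Y" and f: "is_fraction_near n Z U f (tuple_vec n M v) g h"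
  shows "is_fraction_near k Y {p \<in> Y. tuple_map k n M p \<in> U} (f \<circ> tuple_map k n M) v (poly_subst M g) (poly_subst M h)"
proof -
  obtain d where d: "g \<in> forms n d" "h \<in> forms n d" using f by (auto simp: is_fraction_near_def)
  show ?thesis
    unfolding is_fraction_near_def
  proof (intro conjI ballI impI)
    show "\<exists>d. poly_subst M g \<in> forms k d \<and> poly_subst M h \<in> forms k d" using d subst_forms by blast
    show "ev v (poly_subst M h) \<noteq> 0" using f ev_subst[OF d(2)] by (auto simp: is_fraction_near_def)
    fix w assume w: "w \<in> homog_coords k" "line w \<in> Y" "ev w (poly_subst M h) \<noteq> 0"
    have "line (tuple_vec n M w) \<in> U \<and> f (line (tuple_vec n M w)) = ev w (poly_subst M g) / ev w (poly_subst M h)"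
      using f maps[OF w(1,2)] w(3) ev_subst d unfolding is_fraction_near_def by metis
    then show "line w \<in> {p \<in> Y. tuple_map k n M p \<in> U}"
      "(f \<circ> tuple_map k n M) (line w) = ev w (poly_subst M g) / ev w (poly_subst M h)"
      using w map_line by auto
  qed
qed

lemma is_morphism: "morphism (proj_variety k Y) (proj_variety n Z) (tuple_map k n M)"
proof -
  have mapsto: "tuple_map k n M p \<in> Z" if "p \<in> Y" for p
    using that Y maps map_line by (auto simp: proj_space_eq)
  have op: "openin (subtopology (zariski_proj k) Y) {p \<in> Y. tuple_map k n M p \<in> U}"
    if U: "openin (subtopology (zariski_proj n) Z) U" for U
  proof (rule openin_by_principal[OF _ Y])
    fix v assume v: "v \<in> homog_coords k" "line v \<in> {p \<in> Y. tuple_map k n M p \<in> U}"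
    then have "line (tuple_vec n M v) \<in> U" "tuple_vec n M v \<in> homog_coords n" using map_line maps by auto
    from open_local_principal[OF U this(2,1)] obtain F d
      where F: "F \<in> forms n d" "ev (tuple_vec n M v) F \<noteq> 0" "principal n Z F \<subseteq> U" by blast
    have "principal k Y (poly_subst M F) \<subseteq> {p \<in> Y. tuple_map k n M p \<in> U}"
    proof
      fix p assume "p \<in> principal k Y (poly_subst M F)"
      then obtain w where w: "w \<in> homog_coords k" "p = line w" "line w \<in> Y" "ev w (poly_subst M F) \<noteq> 0"
        by (auto simp: principal_def)
      then have "line (tuple_vec n M w) \<in> principal n Z F"
        using maps[OF w(1,3)] ev_subst[OF F(1)] by (auto simp: principal_def)
      then show "p \<in> {p \<in> Y. tuple_map k n M p \<in> U}" using F(3) w map_line by auto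
    qed
    then show "\<exists>F d. F \<in> forms k d \<and> ev v F \<noteq> 0 \<and> principal k Y F \<subseteq> {p \<in> Y. tuple_map k n M p \<in> U}"
      using subst_forms[OF F(1)] F(2) ev_subst[OF F(1)] by auto
  qed auto
  show ?thesis
    unfolding morphism_def ftop_proj_variety continuous_map_def
  proof (intro conjI allI impI)
    show "tuple_map k n M \<in> topspace (subtopology (zariski_proj k) Y) \<rightarrow> topspace (subtopology (zariski_proj n) Z)"
      using mapsto Y Z by (auto simp: topspace_zariski_proj)
    fix U assume "openin (subtopology (zariski_proj n) Z) U"
    from op[OF this] Y show "openin (subtopology (zariski_proj k) Y)
        {x \<in> topspace (subtopology (zariski_proj k) Y). tuple_map k n M x \<in> U}"
      by (simp add: topspace_zariski_proj Int_absorb1)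
  next
    fix V f assume V: "openin (subtopology (zariski_proj n) Z) V \<and> regular (proj_variety n Z) V f"
    then have VZ: "V \<subseteq> Z" using openin_subset[of "subtopology (zariski_proj n) Z" V] by auto
    have "regular (proj_variety k Y) {x \<in> Y. tuple_map k n M x \<in> V} (f \<circ> tuple_map k n M)"
      unfolding regular_proj_iff[OF Y Collect_restrict]
    proof (intro ballI impI)
      fix v assume v: "v \<in> homog_coords k" "line v \<in> {x \<in> Y. tuple_map k n M x \<in> V}"
      then have "line (tuple_vec n M v) \<in> V" "tuple_vec n M v \<in> homog_coords n" using map_line maps by auto
      then obtain g h where "is_fraction_near n Z V f (tuple_vec n M v) g h"
        using V regular_proj_iff[OF Z VZ] by blast
      then show "\<exists>g h. is_fraction_near k Y {x \<in> Y. tuple_map k n M x \<in> V} (f \<circ> tuple_map k n M) v g h"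
        using fraction_pullback v by blast
    qed
    then show "regular (proj_variety k Y) {x \<in> topspace (subtopology (zariski_proj k) Y). tuple_map k n M x \<in> V} (f \<circ> tuple_map k n M)"
      using Y by (simp add: topspace_zariski_proj Int_absorb1)
  qed
qed

end

section \<open>The Jacobian condition\<close>

text \<open>A maximal independent set of columns has \<open>l\<close> elements and hence is a basis,
  so that the column space contains all unit vectors.\<close>

lemma full_rank_right_inverse:
  fixes A :: "complex mat"
  assumes A: "A \<in> carrier_mat l m" and r: "vec_space.rank l A = l"
  shows "\<exists>B. \<forall>k<l. B k \<in> carrier_vec m \<and> A *\<^sub>v B k = unit_vec l k"
proof -
  interpret V: vec_space "TYPE(complex)" l .
  obtain S where S: "maximal S (\<lambda>T. T \<subseteq> set (cols A) \<and> V.lin_indpt T)" "finite S"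
    using maximal_exists_superset[of "set (cols A)" "\<lambda>T. T \<subseteq> set (cols A) \<and> V.lin_indpt T" "{}"]
      V.finite_lin_indpt2[of "{}"] by auto
  have cS: "card S = l" using V.rank_card_indpt[OF A S(1)] r by simp
  have colsc: "set (cols A) \<subseteq> carrier_vec l" using cols_dim A by blast
  have Sc: "S \<subseteq> set (cols A)" "V.lin_indpt S" using S(1) by (auto simp: maximal_def)
  have "V.basis S" using Sc colsc S(2) cS by (intro V.dim_li_is_basis) (auto simp: V.dim_is_n)
  then have "carrier_vec l = V.span S" by (simp add: V.basis_def)
  also have "\<dots> \<subseteq> V.col_space A" unfolding V.col_space_def using Sc(1) colsc by (intro V.span_is_monotone) auto
  finally have sub: "carrier_vec l \<subseteq> V.col_space A" .
  have "\<exists>b. b \<in> carrier_vec m \<and> A *\<^sub>v b = unit_vec l k" if "k < l" for k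
  proof -
    have "unit_vec l k \<in> V.col_space A" using sub by auto
    then show ?thesis using V.col_space_eq[OF A] A by auto
  qed
  then show ?thesis by metis
qed

text \<open>At a point \<open>v\<close> of a nonsingular complete intersection, \<open>B k\<close> is a tangent vector of the
  ambient affine space along which \<open>F\<^sub>k\<close> has derivative one and the other equations have
  derivative zero.\<close>

definition jacobian_right_inverse ::
    "nat \<Rightarrow> nat \<Rightarrow> (nat \<Rightarrow> nat cpoly) \<Rightarrow> (nat \<Rightarrow> complex) \<Rightarrow> (nat \<Rightarrow> nat \<Rightarrow> complex) \<Rightarrow> bool" where
  "jacobian_right_inverse n l F x B \<longleftrightarrow> (\<forall>i<l. \<forall>k<l.
     (\<Sum>j\<le>n. poly_eval x (partial_deriv j (F i)) * B k j) = (if i = k then 1 else 0))"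

lemma jacobian_rank_right_inverse:
  assumes "vec_space.rank (length Fs) (jacobian n Fs v) = length Fs"
  shows "\<exists>B. jacobian_right_inverse n (length Fs) (\<lambda>i. Fs ! i) (\<lambda>i. v $ i) B"
proof -
  let ?l = "length Fs"
  have J: "jacobian n Fs v \<in> carrier_mat ?l (Suc n)" by (simp add: jacobian_def)
  from full_rank_right_inverse[OF J assms] obtain b where b: "\<And>k. k < ?l \<Longrightarrow> b k \<in> carrier_vec (Suc n)"
    "\<And>k. k < ?l \<Longrightarrow> jacobian n Fs v *\<^sub>v b k = unit_vec ?l k" by metis
  have "(\<Sum>j\<le>n. ev v (partial_deriv j (Fs ! i)) * b k $ j) = (if i = k then 1 else 0)" if "i < ?l" "k < ?l" for i k
  proof -
    have "(jacobian n Fs v *\<^sub>v b k) $ i = (\<Sum>j\<le>n. ev v (partial_deriv j (Fs ! i)) * b k $ j)"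
      using that b(1)[OF that(2)] by (simp add: jacobian_def scalar_prod_def atLeast0LessThan lessThan_Suc_atMost)
    then show ?thesis using b(2)[OF that(2)] that by simp
  qed
  then show ?thesis by (intro exI[of _ "\<lambda>k j. b k $ j"]) (simp add: jacobian_right_inverse_def)
qed

text \<open>Pairing a relation between the gradients with \<open>B k\<close> isolates the
  coefficient \<open>c k\<close>.\<close>

lemma jacobian_right_inverse_independent:
  assumes B: "jacobian_right_inverse n l F x B"
    and c: "\<forall>j\<le>n. (\<Sum>i<l. c i * poly_eval x (partial_deriv j (F i))) = 0"
  shows "\<forall>k<l. c k = (0::complex)"
proof (intro allI impI)
  fix k assume k: "k < l"
  have "0 = (\<Sum>j\<le>n. (\<Sum>i<l. c i * poly_eval x (partial_deriv j (F i))) * B k j)" using c by simp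
  also have "\<dots> = (\<Sum>i<l. c i * (\<Sum>j\<le>n. poly_eval x (partial_deriv j (F i)) * B k j))"
    unfolding sum_distrib_left sum_distrib_right by (subst sum.swap) (simp add: mult_ac)
  also have "\<dots> = (\<Sum>i<l. if i = k then c i else 0)"
    using B k by (intro sum.cong) (auto simp: jacobian_right_inverse_def)
  also have "\<dots> = c k" using k by simp
  finally show "c k = 0" by simp
qed

section \<open>Tangent vectors as derivations\<close>

definition dir_deriv :: "nat \<Rightarrow> complex vec \<Rightarrow> (nat \<Rightarrow> complex) \<Rightarrow> nat cpoly \<Rightarrow> complex" where
  "dir_deriv n v w G = (\<Sum>j\<le>n. ev v (partial_deriv j G) * w j)"

lemma dir_deriv_add: "dir_deriv n v w (F + G) = dir_deriv n v w F + dir_deriv n v w G"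
  by (simp add: dir_deriv_def partial_deriv_add poly_eval_homs distrib_right sum.distrib)

lemma dir_deriv_diff: "dir_deriv n v w (F - G) = dir_deriv n v w F - dir_deriv n v w G"
  by (simp add: dir_deriv_def partial_deriv_diff poly_eval_homs left_diff_distrib sum_subtractf)

lemma dir_deriv_mult: "dir_deriv n v w (F * G) = dir_deriv n v w F * ev v G + ev v F * dir_deriv n v w G"
proof -
  have "dir_deriv n v w (F * G) = (\<Sum>j\<le>n. ev v (partial_deriv j F) * w j * ev v G + ev v F * (ev v (partial_deriv j G) * w j))"
    unfolding dir_deriv_def by (intro sum.cong) (auto simp: partial_deriv_mult poly_eval_homs algebra_simps)
  then show ?thesis by (simp add: dir_deriv_def sum.distrib sum_distrib_left sum_distrib_right)
qed

lemma dir_deriv_Cst [simp]: "dir_deriv n v w (Cst c) = 0"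
  by (simp add: dir_deriv_def poly_eval_homs)

lemma dir_deriv_Var: "j \<le> n \<Longrightarrow> dir_deriv n v w (Var j) = w j"
  by (simp add: dir_deriv_def partial_deriv_Var if_distrib[where f = "poly_eval _"] poly_eval_homs
    if_distrib[where f = "\<lambda>c. c * _"] sum.delta cong: if_cong)

lemma dir_deriv_add_vec: "dir_deriv n v (\<lambda>j. w j + w' j) G = dir_deriv n v w G + dir_deriv n v w' G"
  by (simp add: dir_deriv_def distrib_left sum.distrib)

lemma dir_deriv_scale:
  assumes G: "G \<in> forms n e" and v: "v \<in> carrier_vec (Suc n)"
  shows "dir_deriv n (c \<cdot>\<^sub>v v) (\<lambda>j. c * w j) G = c ^ e * dir_deriv n v w G"
proof (cases e)
  case 0
  then have "partial_deriv j G = 0" for j using G partial_deriv_forms_0 by blast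
  then show ?thesis by (simp add: dir_deriv_def poly_eval_homs)
next
  case (Suc k)
  have "partial_deriv j G \<in> forms n k" for j using partial_deriv_forms[OF G] Suc by simp
  from ev_smult[OF this v] show ?thesis
    by (simp add: dir_deriv_def Suc sum_distrib_left mult_ac)
qed

section \<open>Derivations at the points of a smooth zero locus\<close>

locale smooth_variety =
  fixes n l :: nat and F :: "nat \<Rightarrow> nat cpoly" and d :: "nat \<Rightarrow> nat" and Z :: "complex vec set set"
  assumes F: "\<And>i. i < l \<Longrightarrow> F i \<in> forms n (d i)"
    and Z: "Z = zero_locus n (F ` {..<l})"
    and right_inverse: "\<And>v. v \<in> homog_coords n \<Longrightarrow> line v \<in> Z \<Longrightarrow>
      \<exists>B. jacobian_right_inverse n l F (\<lambda>i. v $ i) B"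
begin

lemma in_Z: "v \<in> homog_coords n \<Longrightarrow> line v \<in> Z \<longleftrightarrow> (\<forall>i<l. ev v (F i) = 0)"
  unfolding Z by (subst in_zero_locus) (auto simp: form_sys_def intro: F)

lemma Z_subset: "Z \<subseteq> proj_space n"
  unfolding Z by (rule zero_locus_subset)

definition tangent_dir :: "complex vec \<Rightarrow> (nat \<Rightarrow> complex) \<Rightarrow> bool" where
  "tangent_dir v w \<longleftrightarrow> (\<forall>i<l. dir_deriv n v w (F i) = 0)"

text \<open>By smoothness, a tangent direction \<open>w\<close> at \<open>v\<close> is the velocity of curves that satisfy the
  equations to any prescribed order; by the Nullstellensatz, functions vanishing on \<open>Z\<close> vanish
  along such curves to high order.\<close>

lemma tangent_dir_vanishing:
  assumes v: "v \<in> homog_coords n" "line v \<in> Z" and w: "tangent_dir v w"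
    and G: "G \<in> forms n e" and h: "h \<in> forms n e'" "ev v h \<noteq> 0"
    and 0: "\<And>u. u \<in> homog_coords n \<Longrightarrow> line u \<in> Z \<Longrightarrow> ev u h \<noteq> 0 \<Longrightarrow> ev u G = 0"
  shows "dir_deriv n v w G = 0"
proof (rule ccontr)
  assume DG: "dir_deriv n v w G \<noteq> 0"
  obtain a where a: "a \<le> n" "v $ a \<noteq> 0" using v(1) by (auto simp: homog_coords_iff)
  \<comment> \<open>The factor \<open>h\<close> restricts the vanishing of \<open>G\<close> to where
    it is known. The factor \<open>Var a\<close> takes care of the affine solutions of the equations
    that give no point, such as the origin. The product vanishes at all affine solutions, as the
    Nullstellensatz requires.\<close>
  define P where "P = Var a * h * G"
  have "poly_eval u P = 0" if u: "\<forall>i<l. poly_eval u (F i) = 0" for u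
  proof (cases "u a = 0")
    case False
    define u' where "u' = vec (Suc n) u"
    have u': "u' \<in> homog_coords n" using False a(1) by (auto simp: homog_coords_iff u'_def)
    have e: "ev u' H = poly_eval u H" if "H \<in> forms n k" for H k
      by (rule poly_eval_cong_polys_in[OF forms_polys_in[OF that]]) (simp add: u'_def)
    have "line u' \<in> Z" unfolding in_Z[OF u'] using u e[OF F] by simp
    then have "ev u' h = 0 \<or> ev u' G = 0" using 0 u' by blast
    then show ?thesis by (auto simp: P_def poly_eval_homs e[OF h(1)] e[OF G])
  qed (simp add: P_def poly_eval_homs)
  then obtain N A where N: "P ^ N = (\<Sum>i<l. A i * F i)" using nullstellensatz[of l F P] by blast
  obtain B where B: "jacobian_right_inverse n l F (\<lambda>i. v $ i) B" using right_inverse[OF v] by blast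
  have "\<exists>c. \<forall>i<l. monom 1 (N + 2) dvd
    poly_curve (\<lambda>x. [:v $ x, w x:] + monom 1 2 * (\<Sum>k<l. Polynomial.smult (B k x) (c k))) (F i)"
  proof (rule hensel_curve[where I = "{..n}"])
    fix i assume i: "i < l"
    show "F i \<in> polys_in {..n}" using F[OF i] by (rule forms_polys_in)
    show "poly_eval (\<lambda>x. v $ x) (F i) = 0" using in_Z[OF v(1)] v(2) i by simp
    show "(\<Sum>x\<le>n. poly_eval (\<lambda>x. v $ x) (partial_deriv x (F i)) * w x) = 0"
      using w i by (simp add: tangent_dir_def dir_deriv_def)
    fix k assume "k < l"
    then show "(\<Sum>x\<le>n. poly_eval (\<lambda>x. v $ x) (partial_deriv x (F i)) * B k x) = (if i = k then 1 else 0)"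
      using B i by (simp add: jacobian_right_inverse_def)
  qed simp
  then obtain c where c: "\<And>i. i < l \<Longrightarrow> monom 1 (N + 2) dvd
    poly_curve (\<lambda>x. [:v $ x, w x:] + monom 1 2 * (\<Sum>k<l. Polynomial.smult (B k x) (c k))) (F i)" by blast
  define \<gamma> where "\<gamma> = (\<lambda>x. [:v $ x, w x:] + monom 1 2 * (\<Sum>k<l. Polynomial.smult (B k x) (c k)))"
  have \<gamma>0: "coeff (\<gamma> x) 0 = v $ x" and \<gamma>1: "coeff (\<gamma> x) 1 = w x" for x
    by (simp_all add: \<gamma>_def coeff_monom_mult)
  have "monom 1 (N + 2) dvd poly_curve \<gamma> (P ^ N)"
    unfolding N poly_curve_homs using c by (intro dvd_sum dvd_mult) (auto simp: \<gamma>_def)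
  then have dv: "monom 1 (N + 2) dvd poly_curve \<gamma> P ^ N" by (simp add: poly_curve_homs)
  have P: "P \<in> polys_in {..n}" using a(1) forms_polys_in[OF h(1)] forms_polys_in[OF G] by (auto simp: P_def)
  have G0: "ev v G = 0" using 0[OF v h(2)] .
  have P0: "coeff (poly_curve \<gamma> P) 0 = 0" by (simp add: coeff_0_poly_curve \<gamma>0 P_def poly_eval_homs G0)
  have "coeff (poly_curve \<gamma> P) 1 = coeff (pderiv (poly_curve \<gamma> P)) 0" by (simp add: coeff_pderiv)
  also have "\<dots> = (\<Sum>x\<le>n. coeff (poly_curve \<gamma> (partial_deriv x P)) 0 * coeff (pderiv (\<gamma> x)) 0)"
    unfolding pderiv_poly_curve[OF P finite_atMost] by (simp add: coeff_sum coeff_mult_0)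
  also have "\<dots> = dir_deriv n v w P"
    using \<gamma>1 by (simp add: dir_deriv_def coeff_0_poly_curve \<gamma>0 coeff_pderiv)
  also have "\<dots> = v $ a * ev v h * dir_deriv n v w G"
    by (simp add: P_def dir_deriv_mult G0 poly_eval_homs)
  finally have P1: "coeff (poly_curve \<gamma> P) 1 \<noteq> 0" using DG a(2) h(2) by simp
  define p where "p = poly_curve \<gamma> P"
  have "[:0, 1:] dvd p" using P0 by (simp add: p_def flip: poly_0_coeff_0 poly_eq_0_iff_dvd[of _ 0, simplified])
  then obtain q where q: "p = [:0, 1:] * q" by (auto elim: dvdE)
  have q0: "coeff q 0 \<noteq> 0" using P1 unfolding p_def[symmetric] q by simp
  then have "p ^ N \<noteq> 0" and qN: "q ^ N \<noteq> 0" using q by auto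
  \<comment> \<open>Along the curve \<open>P\<close> has a simple zero, so that its
    \<open>N\<close>-th power has order exactly \<open>N\<close>. The curve satisfies the equations,
    hence also this power, to order \<open>N + 2\<close>.\<close>
  have "[:0, 1:] ^ (N + 2) dvd p ^ N" using dv by (simp only: p_def x_as_monom x_pow_n)
  then have "N + 2 \<le> order 0 (p ^ N)" using \<open>p ^ N \<noteq> 0\<close> by (intro order_max) auto
  also have "p ^ N = [:- 0, 1:] ^ N * q ^ N" by (simp only: q power_mult_distrib minus_zero)
  also have "order 0 ([:- 0, 1:] ^ N * q ^ N) = order 0 ([:- 0, 1 :: complex:] ^ N) + order 0 (q ^ N)"
    using qN by (intro order_mult) auto
  also have "order 0 ([:- 0, 1 :: complex:] ^ N) = N" by (rule order_power_n_n)
  also have "order 0 (q ^ N) = 0" using q0 by (intro order_0I) (simp flip: poly_0_coeff_0)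
  finally show False by simp
qed

definition tangent_derivation :: "complex vec \<Rightarrow> (nat \<Rightarrow> complex) \<Rightarrow> (complex vec set \<Rightarrow> complex) \<Rightarrow> complex" where
  "tangent_derivation v w f =
    (if \<exists>g h. is_fraction_near n Z Z f v g h
     then (let (g, h) = (SOME (g, h). is_fraction_near n Z Z f v g h)
           in (dir_deriv n v w g * ev v h - ev v g * dir_deriv n v w h) / (ev v h)\<^sup>2)
     else 0)"

text \<open>For two representations \<open>g / h\<close> and \<open>g' / h'\<close> the form
  \<open>g * h' - g' * h\<close> vanishes on \<open>Z\<close> near the point. Its derivative along a
  tangent direction is therefore zero, and the quotient rule gives the same value for both.\<close>

lemma tangent_derivation_fraction:
  assumes v: "v \<in> homog_coords n" "line v \<in> Z" and w: "tangent_dir v w"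
    and f: "is_fraction_near n Z Z f v g h"
  shows "tangent_derivation v w f = (dir_deriv n v w g * ev v h - ev v g * dir_deriv n v w h) / (ev v h)\<^sup>2"
proof -
  have ex: "\<exists>x. case x of (g, h) \<Rightarrow> is_fraction_near n Z Z f v g h" using f by auto
  obtain g' h' where gh': "(SOME (g, h). is_fraction_near n Z Z f v g h) = (g', h')" by fastforce
  have f': "is_fraction_near n Z Z f v g' h'" using someI_ex[OF ex] unfolding gh' by simp
  obtain e e' where e: "g \<in> forms n e" "h \<in> forms n e" "g' \<in> forms n e'" "h' \<in> forms n e'"
    using f f' by (auto simp: is_fraction_near_def)
  have nz: "ev v h \<noteq> 0" "ev v h' \<noteq> 0" using f f' by (auto simp: is_fraction_near_def)
  let ?G = "g * h' - g' * h"
  have G0: "ev u ?G = 0" if u: "u \<in> homog_coords n" "line u \<in> Z" "ev u (h * h') \<noteq> 0" for u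
  proof -
    have "f (line u) = ev u g / ev u h" "f (line u) = ev u g' / ev u h'" "ev u h \<noteq> 0" "ev u h' \<noteq> 0"
      using u f f' by (auto simp: is_fraction_near_def poly_eval_homs)
    then have "ev u g / ev u h = ev u g' / ev u h'" by simp
    then show ?thesis using \<open>ev u h \<noteq> 0\<close> \<open>ev u h' \<noteq> 0\<close> by (simp add: poly_eval_homs frac_eq_eq)
  qed
  have "?G \<in> forms n (e + e')" using e forms_mult[of g n e h' e'] forms_mult[of g' n e' h e] by (auto simp: add.commute)
  moreover have "h * h' \<in> forms n (e + e')" using e by (intro forms_mult)
  moreover have "ev v (h * h') \<noteq> 0" using nz by (simp add: poly_eval_homs)
  ultimately have "dir_deriv n v w ?G = 0" using tangent_dir_vanishing[OF v w _ _ _ G0] by blast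
  then have D: "dir_deriv n v w g * ev v h' + ev v g * dir_deriv n v w h' = dir_deriv n v w g' * ev v h + ev v g' * dir_deriv n v w h"
    by (simp add: dir_deriv_diff dir_deriv_mult)
  have E: "ev v g * ev v h' = ev v g' * ev v h" using G0[OF v] nz by (simp add: poly_eval_homs)
  have alg: "(Dg' * h' - g' * Dh') / h'\<^sup>2 = (Dg * h - g * Dh) / h\<^sup>2"
    if "Dg * h' + g * Dh' = Dg' * h + g' * Dh" "g * h' = g' * h" "h \<noteq> 0" "h' \<noteq> 0" for g h g' h' Dg Dh Dg' Dh' :: complex
  proof -
    have "(Dg' * h' - g' * Dh') * h\<^sup>2 = h' * h * (Dg' * h) - (g' * h) * h * Dh'" by (simp add: power2_eq_square algebra_simps)
    also have "\<dots> = h' * h * (Dg * h' + g * Dh' - g' * Dh) - (g * h') * h * Dh'" using that by (simp add: algebra_simps)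
    also have "\<dots> = (h' * h' * Dg * h) - h' * (g' * h) * Dh" by (simp add: algebra_simps)
    also have "\<dots> = (Dg * h - g * Dh) * h'\<^sup>2" unfolding that(2)[symmetric] by (simp add: power2_eq_square algebra_simps)
    finally show ?thesis using that by (simp add: frac_eq_eq)
  qed
  have "tangent_derivation v w f = (dir_deriv n v w g' * ev v h' - ev v g' * dir_deriv n v w h') / (ev v h')\<^sup>2"
    using f unfolding tangent_derivation_def gh' by auto
  also have "\<dots> = (dir_deriv n v w g * ev v h - ev v g * dir_deriv n v w h) / (ev v h)\<^sup>2"
    by (rule alg[OF D E nz])
  finally show ?thesis .
qed

lemma fraction_add:
  assumes "is_fraction_near n Z Z f v g h" "is_fraction_near n Z Z f' v g' h'"
  shows "is_fraction_near n Z Z (\<lambda>p. f p + f' p) v (g * h' + g' * h) (h * h')"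
proof -
  obtain e e' where e: "g \<in> forms n e" "h \<in> forms n e" "g' \<in> forms n e'" "h' \<in> forms n e'"
    using assms by (auto simp: is_fraction_near_def)
  have "g * h' + g' * h \<in> forms n (e + e')" using e forms_mult[of g n e h' e'] forms_mult[of g' n e' h e] by (auto simp: add.commute)
  moreover have "h * h' \<in> forms n (e + e')" using e by (intro forms_mult)
  ultimately show ?thesis using assms
    by (auto simp: is_fraction_near_def poly_eval_homs add_frac_eq)
qed

lemma fraction_mult:
  assumes "is_fraction_near n Z Z f v g h" "is_fraction_near n Z Z f' v g' h'"
  shows "is_fraction_near n Z Z (\<lambda>p. f p * f' p) v (g * g') (h * h')"
proof -
  obtain e e' where e: "g \<in> forms n e" "h \<in> forms n e" "g' \<in> forms n e'" "h' \<in> forms n e'"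
    using assms by (auto simp: is_fraction_near_def)
  have "g * g' \<in> forms n (e + e')" "h * h' \<in> forms n (e + e')" using e by (auto intro: forms_mult)
  then show ?thesis using assms by (auto simp: is_fraction_near_def poly_eval_homs)
qed

lemma fraction_const: "is_fraction_near n Z Z (\<lambda>p. c) v (Cst c) 1"
  by (auto simp: is_fraction_near_def poly_eval_homs)

lemma fraction_cong:
  assumes f: "is_fraction_near n Z Z f v g h" and k: "k \<in> forms n e" "ev v k \<noteq> 0"
    and eq: "\<And>p. p \<in> principal n Z k \<Longrightarrow> f p = f' p"
  shows "is_fraction_near n Z Z f' v (g * k) (h * k)"
proof -
  obtain e' where e: "g \<in> forms n e'" "h \<in> forms n e'" using f by (auto simp: is_fraction_near_def)
  have "g * k \<in> forms n (e' + e)" "h * k \<in> forms n (e' + e)" using e k by (auto intro: forms_mult)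
  moreover have "f' (line w) = f (line w)" if "w \<in> homog_coords n" "line w \<in> Z" "ev w k \<noteq> 0" for w
    using that by (intro eq[symmetric]) (auto simp: principal_def)
  ultimately show ?thesis using f k(2) by (auto simp: is_fraction_near_def poly_eval_homs)
qed

lemma near_iff: "v \<in> homog_coords n \<Longrightarrow> line v \<in> Z \<Longrightarrow>
    regular_near (proj_variety n Z) (line v) f \<longleftrightarrow> (\<exists>g h. is_fraction_near n Z Z f v g h)"
  by (rule regular_near_iff[OF Z_subset])

lemma tangent_derivation_tangent_space:
  assumes v: "v \<in> homog_coords n" "line v \<in> Z" and w: "tangent_dir v w"
  shows "tangent_derivation v w \<in> tangent_space (proj_variety n Z) (line v)"
proof -
  note td = tangent_derivation_fraction[OF v w]
  let ?R = "\<lambda>f. \<exists>g h. is_fraction_near n Z Z f v g h"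
  have val: "f (line v) = ev v g / ev v h \<and> ev v h \<noteq> 0" if "is_fraction_near n Z Z f v g h" for f g h
    using that v by (auto simp: is_fraction_near_def)
  have 1: "tangent_derivation v w (\<lambda>p. f p + f' p) = tangent_derivation v w f + tangent_derivation v w f' \<and>
      tangent_derivation v w (\<lambda>p. f p * f' p) = f (line v) * tangent_derivation v w f' + f' (line v) * tangent_derivation v w f"
    if "?R f" "?R f'" for f f'
  proof -
    obtain g h where "is_fraction_near n Z Z f v g h" using \<open>?R f\<close> by blast
    moreover obtain g' h' where "is_fraction_near n Z Z f' v g' h'" using \<open>?R f'\<close> by blast
    ultimately have gh: "is_fraction_near n Z Z f v g h" "is_fraction_near n Z Z f' v g' h'" .
    have nz: "ev v h \<noteq> 0" "ev v h' \<noteq> 0" using val[OF gh(1)] val[OF gh(2)] by auto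
    have g0: "ev v g = f (line v) * ev v h" "ev v g' = f' (line v) * ev v h'"
      using val[OF gh(1)] val[OF gh(2)] by auto
    show ?thesis
      unfolding td[OF fraction_add[OF gh]] td[OF fraction_mult[OF gh]] td[OF gh(1)] td[OF gh(2)]
      unfolding dir_deriv_add dir_deriv_mult poly_eval_homs g0 power2_eq_square using nz
      by (simp add: field_simps)
  qed
  have 2: "tangent_derivation v w (\<lambda>p. c * f p) = c * tangent_derivation v w f" if "?R f" for c f
  proof -
    obtain g h where gh: "is_fraction_near n Z Z f v g h" using \<open>?R f\<close> by blast
    show ?thesis unfolding td[OF fraction_mult[OF fraction_const gh]] td[OF gh]
      using val[OF gh] by (simp add: dir_deriv_mult poly_eval_homs divide_simps) (simp add: algebra_simps)
  qed
  have 3: "tangent_derivation v w f = tangent_derivation v w f'"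
    if R: "?R f" and V: "openin (ftop (proj_variety n Z)) V" "line v \<in> V" "\<forall>p\<in>V. f p = f' p" for f f' V
  proof -
    obtain g h where gh: "is_fraction_near n Z Z f v g h" using R by blast
    from open_local_principal[OF V(1)[unfolded ftop_proj_variety] v(1) V(2)] obtain k e
      where k: "k \<in> forms n e" "ev v k \<noteq> 0" "principal n Z k \<subseteq> V" by blast
    have "is_fraction_near n Z Z f v (g * k) (h * k)" by (rule fraction_cong[OF gh k(1,2)]) simp
    moreover have "is_fraction_near n Z Z f' v (g * k) (h * k)"
      by (rule fraction_cong[OF gh k(1,2)]) (use k(3) V(3) in auto)
    ultimately show ?thesis using td by metis
  qed
  have 4: "tangent_derivation v w f = 0" if "\<not> ?R f" for f using that by (simp add: tangent_derivation_def)
  show ?thesis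
    unfolding tangent_space_def near_iff[OF v] using 1 2 3 4 by blast
qed

lemma tangent_derivation_add:
  assumes v: "v \<in> homog_coords n" "line v \<in> Z" and w: "tangent_dir v w" "tangent_dir v w'"
  shows "tangent_derivation v (\<lambda>j. w j + w' j) f = tangent_derivation v w f + tangent_derivation v w' f"
proof (cases "\<exists>g h. is_fraction_near n Z Z f v g h")
  case True
  then obtain g h where gh: "is_fraction_near n Z Z f v g h" by blast
  have "tangent_dir v (\<lambda>j. w j + w' j)" using w by (simp add: tangent_dir_def dir_deriv_add_vec)
  from tangent_derivation_fraction[OF v this gh] show ?thesis
    unfolding tangent_derivation_fraction[OF v w(1) gh] tangent_derivation_fraction[OF v w(2) gh]
    by (simp add: dir_deriv_add_vec add_divide_distrib[symmetric] algebra_simps)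
qed (simp add: tangent_derivation_def)

lemma tangent_dir_scale:
  assumes "v \<in> carrier_vec (Suc n)" "tangent_dir v w"
  shows "tangent_dir (c \<cdot>\<^sub>v v) (\<lambda>j. c * w j)"
  using assms dir_deriv_scale[OF F] by (simp add: tangent_dir_def)

text \<open>Point and direction are rescaled together; this is the ambiguity left by the choice of a
  vector on a line, and fractions of forms of equal degree do not see it.\<close>

lemma tangent_derivation_scale:
  assumes v: "v \<in> homog_coords n" "line v \<in> Z" and w: "tangent_dir v w" and c: "c \<noteq> 0"
  shows "tangent_derivation (c \<cdot>\<^sub>v v) (\<lambda>j. c * w j) f = tangent_derivation v w f"
proof -
  note vc = homog_coords_carrier[OF v(1)]
  have *: "is_fraction_near n Z Z f (c \<cdot>\<^sub>v v) g h \<longleftrightarrow> is_fraction_near n Z Z f v g h" for g h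
    using c by (auto simp: is_fraction_near_def ev_smult[OF _ vc])
  show ?thesis
  proof (cases "\<exists>g h. is_fraction_near n Z Z f v g h")
    case True
    then obtain g h where gh: "is_fraction_near n Z Z f v g h" by blast
    then obtain e where e: "g \<in> forms n e" "h \<in> forms n e" and nz: "ev v h \<noteq> 0" by (auto simp: is_fraction_near_def)
    have cv: "c \<cdot>\<^sub>v v \<in> homog_coords n" "line (c \<cdot>\<^sub>v v) \<in> Z" using v c by (auto simp: line_smult homog_coords_smult)
    show ?thesis
      unfolding tangent_derivation_fraction[OF v w gh]
        tangent_derivation_fraction[OF cv tangent_dir_scale[OF vc w] gh[folded *]]
        ev_smult[OF e(1) vc] ev_smult[OF e(2) vc] dir_deriv_scale[OF e(1) vc] dir_deriv_scale[OF e(2) vc]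
      using c nz by (simp add: field_simps power2_eq_square)
  qed (simp add: tangent_derivation_def *)
qed

end

section \<open>Affine coordinates and derivations\<close>

definition affine_coord :: "nat \<Rightarrow> nat \<Rightarrow> nat \<Rightarrow> complex vec set \<Rightarrow> complex" where
  "affine_coord n a j p = (let v = (SOME v. v \<in> homog_coords n \<and> line v = p) in v $ j / v $ a)"

lemma affine_coord_line:
  assumes v: "v \<in> homog_coords n" and "a \<le> n" "j \<le> n"
  shows "affine_coord n a j (line v) = v $ j / v $ a"
proof -
  define u where "u = (SOME u. u \<in> homog_coords n \<and> line u = line v)"
  have "u \<in> homog_coords n \<and> line u = line v" unfolding u_def by (rule someI[of _ v]) (simp add: v)
  then obtain c where c: "c \<noteq> 0" "u = c \<cdot>\<^sub>v v" using line_eqD by metis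
  have "affine_coord n a j (line v) = u $ j / u $ a" by (simp add: affine_coord_def Let_def flip: u_def)
  then show ?thesis using c assms homog_coords_carrier[OF v] by simp
qed

context smooth_variety
begin

lemma fraction_affine_coord:
  assumes "a \<le> n" "j \<le> n" "v $ a \<noteq> 0"
  shows "is_fraction_near n Z Z (affine_coord n a j) v (Var j) (Var a)"
  using assms by (auto simp: is_fraction_near_def affine_coord_line intro!: exI[of _ 1])

lemma regular_affine_coord:
  assumes "a \<le> n" "j \<le> n"
  shows "regular (proj_variety n Z) (principal n Z (Var a)) (affine_coord n a j)"
  unfolding regular_proj_iff[OF Z_subset principal_subset]
proof (intro ballI impI exI)
  fix v assume v: "v \<in> homog_coords n" "line v \<in> principal n Z (Var a)"
  have "Var a \<in> forms n 1" using assms(1) by (rule forms_Var)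
  from in_principal[OF this] v have "v $ a \<noteq> 0" by auto
  then show "is_fraction_near n Z (principal n Z (Var a)) (affine_coord n a j) v (Var j) (Var a)"
    using assms in_principal[OF \<open>Var a \<in> forms n 1\<close>]
    by (auto simp: is_fraction_near_def affine_coord_line intro!: exI[of _ 1])
qed

lemma tangent_derivation_affine_coord:
  assumes v: "v \<in> homog_coords n" "line v \<in> Z" and w: "tangent_dir v w"
    and "a \<le> n" "j \<le> n" "v $ a \<noteq> 0"
  shows "tangent_derivation v w (affine_coord n a j) = (w j * v $ a - v $ j * w a) / (v $ a)\<^sup>2"
  using assms by (simp add: tangent_derivation_fraction[OF v w fraction_affine_coord] dir_deriv_Var)

context
  fixes v D assumes v: "v \<in> homog_coords n" "line v \<in> Z"
    and D: "D \<in> tangent_space (proj_variety n Z) (line v)"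
begin

abbreviation (input) "near f \<equiv> regular_near (proj_variety n Z) (line v) f"

lemma derivation:
  "near f \<Longrightarrow> near g \<Longrightarrow> D (\<lambda>p. f p + g p) = D f + D g"
  "near f \<Longrightarrow> near g \<Longrightarrow> D (\<lambda>p. f p * g p) = f (line v) * D g + g (line v) * D f"
  "near f \<Longrightarrow> D (\<lambda>p. c * f p) = c * D f"
  "near f \<Longrightarrow> near g \<Longrightarrow> openin (ftop (proj_variety n Z)) V \<Longrightarrow> line v \<in> V \<Longrightarrow>
    (\<And>p. p \<in> V \<Longrightarrow> f p = g p) \<Longrightarrow> D f = D g"
proof -
  note D' = D[unfolded tangent_space_def mem_Collect_eq]
  show "near f \<Longrightarrow> near g \<Longrightarrow> D (\<lambda>p. f p + g p) = D f + D g"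
    "near f \<Longrightarrow> near g \<Longrightarrow> D (\<lambda>p. f p * g p) = f (line v) * D g + g (line v) * D f"
    using D'[THEN conjunct1] by auto
  show "near f \<Longrightarrow> D (\<lambda>p. c * f p) = c * D f" using D'[THEN conjunct2, THEN conjunct1] by blast
  show "near f \<Longrightarrow> near g \<Longrightarrow> openin (ftop (proj_variety n Z)) V \<Longrightarrow> line v \<in> V \<Longrightarrow>
    (\<And>p. p \<in> V \<Longrightarrow> f p = g p) \<Longrightarrow> D f = D g"
    using D'[THEN conjunct2, THEN conjunct2, THEN conjunct1] by blast
qed

lemma near_const: "near (\<lambda>p. c)"
  using near_iff[OF v] fraction_const by blast

lemma derivation_const: "D (\<lambda>p. c) = 0"
proof -
  have "D (\<lambda>p. 1) = 0" using derivation(2)[OF near_const near_const, of 1 1] by simp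
  then show ?thesis using derivation(3)[OF near_const, of c 1] by simp
qed

lemma near_affine_coord: "a \<le> n \<Longrightarrow> j \<le> n \<Longrightarrow> v $ a \<noteq> 0 \<Longrightarrow> near (affine_coord n a j)"
  using near_iff[OF v] fraction_affine_coord by blast

lemma derivation_chain_rule:
  assumes a: "a \<le> n" "v $ a \<noteq> 0" and P: "P \<in> polys_in {..n}"
  shows "near (\<lambda>p. poly_eval (\<lambda>j. affine_coord n a j p) P) \<and>
    D (\<lambda>p. poly_eval (\<lambda>j. affine_coord n a j p) P) =
      (\<Sum>j\<le>n. poly_eval (\<lambda>j. affine_coord n a j (line v)) (partial_deriv j P) * D (affine_coord n a j))"
  using P
proof (induction rule: polys_in_induct)
  case (Cst c)
  then show ?case by (simp add: near_const derivation_const poly_eval_homs)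
next
  case (Var x)
  have "(\<Sum>j\<le>n. poly_eval (\<lambda>j. affine_coord n a j (line v)) (partial_deriv j (Var x)) * D (affine_coord n a j))
    = (\<Sum>j\<le>n. if j = x then D (affine_coord n a j) else 0)"
    by (intro sum.cong) (auto simp: partial_deriv_Var poly_eval_homs)
  also have "\<dots> = D (affine_coord n a x)" using Var by simp
  finally show ?case using near_affine_coord[OF a(1) _ a(2)] Var by simp
next
  case (add P Q)
  have "near (\<lambda>p. poly_eval (\<lambda>j. affine_coord n a j p) P + poly_eval (\<lambda>j. affine_coord n a j p) Q)"
    using add near_iff[OF v] fraction_add by meson
  then show ?case using add derivation(1)
    by (simp add: poly_eval_homs partial_deriv_add distrib_right sum.distrib)
next
  case (mult P Q)
  have "near (\<lambda>p. poly_eval (\<lambda>j. affine_coord n a j p) P * poly_eval (\<lambda>j. affine_coord n a j p) Q)"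
    using mult near_iff[OF v] fraction_mult by meson
  moreover have "(\<Sum>j\<le>n. poly_eval (\<lambda>j. affine_coord n a j (line v)) (partial_deriv j (P * Q)) * D (affine_coord n a j)) =
    (\<Sum>j\<le>n. poly_eval (\<lambda>j. affine_coord n a j (line v)) P * (poly_eval (\<lambda>j. affine_coord n a j (line v)) (partial_deriv j Q) * D (affine_coord n a j))
     + poly_eval (\<lambda>j. affine_coord n a j (line v)) Q * (poly_eval (\<lambda>j. affine_coord n a j (line v)) (partial_deriv j P) * D (affine_coord n a j)))"
    by (intro sum.cong) (auto simp: partial_deriv_mult poly_eval_homs algebra_simps)
  ultimately show ?case using mult derivation(2)
    by (simp add: poly_eval_homs sum.distrib sum_distrib_left)
qed

text \<open>Written in affine coordinates, the equations are functions that vanish identically on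
  \<open>Z\<close>. By the chain rule, the derivatives of the coordinates satisfy the linearized
  equations. This is the passage from abstract derivations back to vectors.\<close>

lemma derivation_tangent_dir:
  assumes a: "a \<le> n" "v $ a \<noteq> 0"
  shows "tangent_dir v (\<lambda>j. D (affine_coord n a j))"
  unfolding tangent_dir_def
proof (intro allI impI)
  fix i assume i: "i < l"
  have Fp: "F i \<in> polys_in {..n}" using forms_polys_in[OF F[OF i]] .
  have aff: "poly_eval (\<lambda>j. affine_coord n a j (line u)) G = (1 / u $ a) ^ e * ev u G"
    if "u \<in> homog_coords n" "G \<in> forms n e" for u G e
  proof -
    have "poly_eval (\<lambda>j. affine_coord n a j (line u)) G = poly_eval (\<lambda>j. 1 / u $ a * u $ j) G"
      using that affine_coord_line[OF that(1) a(1)]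
      by (intro poly_eval_cong_polys_in[OF forms_polys_in[OF that(2)]]) auto
    then show ?thesis by (simp only: poly_eval_forms_scale[OF that(2)])
  qed
  let ?f = "\<lambda>p. poly_eval (\<lambda>j. affine_coord n a j p) (F i)"
  have "D ?f = D (\<lambda>p. 0)"
  proof (rule derivation(4)[where V = Z])
    show "near ?f" using derivation_chain_rule[OF a Fp] by blast
    show "near (\<lambda>p. 0)" by (rule near_const)
    show "openin (ftop (proj_variety n Z)) Z"
      using openin_topspace[of "ftop (proj_variety n Z)"] by (simp add: topspace_proj_variety[OF Z_subset])
    show "line v \<in> Z" by (rule v(2))
    fix p assume p: "p \<in> Z"
    then obtain u where "u \<in> homog_coords n" "p = line u" using Z_subset by (auto simp: proj_space_eq)
    then show "?f p = 0" using aff[OF _ F[OF i]] in_Z p i by simp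
  qed
  then have 0: "(\<Sum>j\<le>n. poly_eval (\<lambda>j. affine_coord n a j (line v)) (partial_deriv j (F i)) * D (affine_coord n a j)) = 0"
    using derivation_chain_rule[OF a Fp] derivation_const by simp
  have "(1 / v $ a) ^ (d i - 1) * dir_deriv n v (\<lambda>j. D (affine_coord n a j)) (F i) = 0"
    using 0 by (simp add: aff[OF v(1) partial_deriv_forms[OF F[OF i]]] dir_deriv_def sum_distrib_left mult_ac)
  then show "dir_deriv n v (\<lambda>j. D (affine_coord n a j)) (F i) = 0" using a(2) by simp
qed

text \<open>The product rule for the factorization of the coordinate \<open>x_j / x_a\<close> as
  \<open>x_j / x_b\<close> times \<open>x_b / x_a\<close>.\<close>

lemma derivation_change_chart:
  assumes a: "a \<le> n" "v $ a \<noteq> 0" and b: "b \<le> n" "v $ b \<noteq> 0" and j: "j \<le> n"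
  shows "D (affine_coord n a j) = v $ j / v $ b * D (affine_coord n a b) + v $ b / v $ a * D (affine_coord n b j)"
proof -
  have Vb: "Var b \<in> forms n 1" using b(1) by (rule forms_Var)
  have n1: "near (\<lambda>p. affine_coord n b j p * affine_coord n a b p)"
    using fraction_mult[OF fraction_affine_coord[OF b(1) j b(2)] fraction_affine_coord[OF a(1) b(1) a(2)]] near_iff[OF v] by blast
  have "D (affine_coord n a j) = D (\<lambda>p. affine_coord n b j p * affine_coord n a b p)"
  proof (rule derivation(4)[where V = "principal n Z (Var b)", OF near_affine_coord[OF a(1) j a(2)] n1])
    show "openin (ftop (proj_variety n Z)) (principal n Z (Var b))"
      using openin_principal[OF Vb] by (simp add: ftop_proj_variety)
    show "line v \<in> principal n Z (Var b)" using in_principal[OF Vb v(1)] v(2) b by simp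
    fix p assume "p \<in> principal n Z (Var b)"
    then obtain u where "u \<in> homog_coords n" "p = line u" "u $ b \<noteq> 0" by (auto simp: principal_def)
    then show "affine_coord n a j p = affine_coord n b j p * affine_coord n a b p"
      using affine_coord_line a b j by simp
  qed
  also have "\<dots> = affine_coord n b j (line v) * D (affine_coord n a b) + affine_coord n a b (line v) * D (affine_coord n b j)"
    by (rule derivation(2)[OF near_affine_coord[OF b(1) j b(2)] near_affine_coord[OF a(1) b(1) a(2)]])
  finally show ?thesis using affine_coord_line[OF v(1)] a b j by simp
qed

end

end

section \<open>Binary forms\<close>

definition pair_vec :: "complex \<Rightarrow> complex \<Rightarrow> complex vec" where
  "pair_vec s t = vec (Suc 1) (\<lambda>i. if i = 0 then s else t)"

lemma pair_vec_index [simp]: "pair_vec s t $ 0 = s" "pair_vec s t $ 1 = t" "pair_vec s t $ Suc 0 = t"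
  by (simp_all add: pair_vec_def)

lemma pair_vec_homog_coords [simp]: "pair_vec s t \<in> homog_coords 1 \<longleftrightarrow> s \<noteq> 0 \<or> t \<noteq> 0"
  by (auto simp: homog_coords_iff le_Suc_eq pair_vec_def)

lemma pair_vec_homog_coords' [simp]: "pair_vec s t \<in> homog_coords (Suc 0) \<longleftrightarrow> s \<noteq> 0 \<or> t \<noteq> 0"
  using pair_vec_homog_coords by simp

definition dehomog :: "nat cpoly \<Rightarrow> complex poly" where
  "dehomog = poly_curve (\<lambda>i. if i = 0 then [:0, 1:] else 1)"

definition homogenize :: "nat \<Rightarrow> complex poly \<Rightarrow> nat cpoly" where
  "homogenize D p = (\<Sum>i\<le>D. Cst (coeff p i) * (Var 0 ^ i * Var 1 ^ (D - i)))"

interpretation dehomog: comm_ring_hom dehomog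
  unfolding dehomog_def by (rule poly_curve.comm_ring_hom_axioms)

lemmas dehomog_homs = dehomog.hom_zero dehomog.hom_one dehomog.hom_add dehomog.hom_mult
  dehomog.hom_uminus dehomog.hom_minus dehomog.hom_sum dehomog.hom_prod dehomog.hom_power

lemma const_times_X_power: "[:c:] * [:0, 1:] ^ k = monom (c :: complex) k"
proof -
  have "[:c:] * [:0, 1:] ^ k = Polynomial.smult c ([:0, 1:] ^ k)" by simp
  then show ?thesis by (simp only: x_as_monom x_pow_n smult_monom mult_1_right)
qed

lemma dehomog_Cst [simp]: "dehomog (Cst c) = [:c:]"
  and dehomog_Var_0: "dehomog (Var 0) = [:0, 1:]"
  and dehomog_Var_1: "dehomog (Var 1) = 1"
  by (simp_all add: dehomog_def)

lemma homogenize_forms: "homogenize D p \<in> forms 1 D"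
  unfolding homogenize_def
proof (intro forms_sum forms_Cst_mult)
  fix i assume "i \<in> {..D}"
  have "Var 0 ^ i * Var 1 ^ (D - i) \<in> forms 1 (i * 1 + (D - i) * 1)"
    by (intro forms_mult forms_power forms_Var) auto
  then show "Var 0 ^ i * Var 1 ^ (D - i) \<in> forms 1 D" using \<open>i \<in> {..D}\<close> by simp
qed

lemma dehomog_homogenize: "degree p \<le> D \<Longrightarrow> dehomog (homogenize D p) = p"
proof -
  assume "degree p \<le> D"
  have "dehomog (homogenize D p) = (\<Sum>i\<le>D. monom (coeff p i) i)"
    unfolding homogenize_def dehomog_homs dehomog_Cst dehomog_Var_0 dehomog_Var_1
    by (simp only: power_one mult_1_right const_times_X_power)
  also have "\<dots> = p" by (rule poly_as_sum_of_monoms'[OF \<open>degree p \<le> D\<close>])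
  finally show ?thesis .
qed

lemma poly_dehomog: "F \<in> forms 1 D \<Longrightarrow> poly (dehomog F) s = poly_eval (\<lambda>i. if i = 0 then s else 1) F"
  by (simp add: dehomog_def poly_poly_curve if_distrib[where f = "\<lambda>p. poly p s"] cong: if_cong)

lemma binary_total_deg:
  assumes "F \<in> forms 1 D" "m \<in> Poly_Mapping.keys F"
  shows "Poly_Mapping.lookup m 0 + Poly_Mapping.lookup m 1 = D"
proof -
  have "Poly_Mapping.keys m \<subseteq> {..1}" "total_deg m = D" using forms_single_key[OF assms] by auto
  then have "(\<Sum>i\<le>1. Poly_Mapping.lookup m i) = D" using total_deg_superset[of "{..1}" m] by simp
  then show ?thesis by simp
qed

lemma gev_binary:
  assumes "F \<in> forms 1 D"
  shows "gev h a F = (\<Sum>m\<in>Poly_Mapping.keys F. h (Poly_Mapping.lookup F m) *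
    (a 0 ^ Poly_Mapping.lookup m 0 * a 1 ^ Poly_Mapping.lookup m 1))"
  unfolding gev_def
proof (intro sum.cong refl arg_cong2[of _ _ _ _ "(*)"])
  fix m assume "m \<in> Poly_Mapping.keys F"
  then have "Poly_Mapping.keys m \<subseteq> {..1}" using forms_single_key[OF assms] by auto
  then have "powprod a m = (\<Prod>i\<le>1. a i ^ Poly_Mapping.lookup m i)" by (intro powprod_superset) auto
  then show "powprod a m = a 0 ^ Poly_Mapping.lookup m 0 * a 1 ^ Poly_Mapping.lookup m 1" by simp
qed

lemma dehomog_sum:
  assumes "F \<in> forms 1 D"
  shows "dehomog F = (\<Sum>m\<in>Poly_Mapping.keys F. monom (Poly_Mapping.lookup F m) (Poly_Mapping.lookup m 0))"
  unfolding dehomog_def poly_curve_def gev_binary[OF assms]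
  by (simp only: if_True if_False one_neq_zero power_one mult_1_right const_times_X_power refl cong: if_cong)

lemma degree_dehomog: "F \<in> forms 1 D \<Longrightarrow> degree (dehomog F) \<le> D"
  unfolding dehomog_sum
proof (rule degree_sum_le)
  fix m assume F: "F \<in> forms 1 D" "m \<in> Poly_Mapping.keys F"
  have "degree (monom (Poly_Mapping.lookup F m) (Poly_Mapping.lookup m 0)) \<le> Poly_Mapping.lookup m 0"
    by (rule degree_monom_le)
  then show "degree (monom (Poly_Mapping.lookup F m) (Poly_Mapping.lookup m 0)) \<le> D"
    using binary_total_deg[OF F] by simp
qed simp

text \<open>The chart used by \<open>dehomog\<close> misses the point \<open>(1 : 0)\<close>; the
  value there is kept as the coefficient of the nominal degree \<open>D\<close>, which may exceed
  the actual degree.\<close>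

lemma coeff_dehomog_top:
  assumes "F \<in> forms 1 D"
  shows "coeff (dehomog F) D = poly_eval (\<lambda>i. if i = 0 then 1 else 0) F"
  unfolding dehomog_sum[OF assms] poly_eval_gev gev_binary[OF assms] coeff_sum
proof (intro sum.cong refl)
  fix m assume "m \<in> Poly_Mapping.keys F"
  then have "Poly_Mapping.lookup m 0 = D \<longleftrightarrow> Poly_Mapping.lookup m 1 = 0" using binary_total_deg[OF assms] by fastforce
  then show "coeff (monom (Poly_Mapping.lookup F m) (Poly_Mapping.lookup m 0)) D = Poly_Mapping.lookup F m *
      ((if 0 = (0::nat) then 1 else 0) ^ Poly_Mapping.lookup m 0 * (if 1 = (0::nat) then 1 else 0) ^ Poly_Mapping.lookup m 1)"
    by (simp add: power_0_left)
qed

lemma ev_binary: "F \<in> forms 1 D \<Longrightarrow> ev v F = poly_eval (\<lambda>i. if i = 0 then v $ 0 else v $ 1) F"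
  by (rule poly_eval_cong_polys_in[OF forms_polys_in]) (auto simp: le_Suc_eq)

lemma ev_dehomog:
  assumes F: "F \<in> forms 1 D" and v: "v $ 1 \<noteq> 0"
  shows "ev v F = (v $ 1) ^ D * poly (dehomog F) (v $ 0 / v $ 1)"
proof -
  have "ev v F = poly_eval (\<lambda>i. v $ 1 * (if i = 0 then v $ 0 / v $ 1 else 1)) F"
    unfolding ev_binary[OF F] using v by (intro arg_cong2[of _ _ _ _ poly_eval]) auto
  then show ?thesis by (simp only: poly_eval_forms_scale[OF F] poly_dehomog[OF F])
qed

lemma ev_dehomog_infinity:
  assumes F: "F \<in> forms 1 D" and v: "v $ 1 = 0"
  shows "ev v F = (v $ 0) ^ D * coeff (dehomog F) D"
proof -
  have "ev v F = poly_eval (\<lambda>i. v $ 0 * (if i = 0 then 1 else 0)) F"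
    unfolding ev_binary[OF F] using v by (intro arg_cong2[of _ _ _ _ poly_eval]) auto
  then show ?thesis by (simp only: poly_eval_forms_scale[OF F] coeff_dehomog_top[OF F])
qed

lemma ev_eq_if_dehomog_eq:
  assumes "F \<in> forms 1 D" "G \<in> forms 1 D" "dehomog F = dehomog G"
  shows "ev v F = ev v G"
  using assms by (cases "v $ 1 = 0") (simp_all add: ev_dehomog ev_dehomog_infinity)

lemma dehomog_eq_0_iff:
  assumes F: "F \<in> forms 1 D"
  shows "dehomog F = 0 \<longleftrightarrow> (\<forall>v\<in>homog_coords 1. ev v F = 0)"
proof
  assume "dehomog F = 0"
  then show "\<forall>v\<in>homog_coords 1. ev v F = 0"
    using ev_eq_if_dehomog_eq[OF F forms_0] by (simp add: dehomog_homs poly_eval_homs)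
next
  assume 0: "\<forall>v\<in>homog_coords 1. ev v F = 0"
  have "poly (dehomog F) s = 0" for s
  proof -
    let ?v = "pair_vec s 1"
    have "?v \<in> homog_coords 1" by simp
    then have "ev ?v F = 0" using 0 by blast
    then show ?thesis using ev_dehomog[OF F, of ?v] by simp
  qed
  then show "dehomog F = 0" by (simp add: poly_eq_poly_eq_iff[symmetric] fun_eq_iff)
qed

section \<open>Zeros and divisibility of binary forms\<close>

definition nonzero_form :: "nat cpoly \<Rightarrow> bool" where
  "nonzero_form F \<longleftrightarrow> dehomog F \<noteq> 0"

lemma nonzero_form_mult: "nonzero_form F \<Longrightarrow> nonzero_form G \<Longrightarrow> nonzero_form (F * G)"
  by (simp add: nonzero_form_def dehomog_homs)

lemma nonzero_form_iff: "F \<in> forms 1 D \<Longrightarrow> nonzero_form F \<longleftrightarrow> (\<exists>v\<in>homog_coords 1. ev v F \<noteq> 0)"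
  by (simp add: nonzero_form_def dehomog_eq_0_iff)

text \<open>The product with \<open>k\<close> vanishes everywhere, and polynomials in one variable
  have no zero divisors. This takes the place of density of open sets.\<close>

lemma generic_identity:
  assumes F: "F \<in> forms 1 D" and k: "k \<in> forms 1 e" "nonzero_form k"
    and 0: "\<And>v. v \<in> homog_coords 1 \<Longrightarrow> ev v k \<noteq> 0 \<Longrightarrow> ev v F = 0"
  shows "v \<in> homog_coords 1 \<Longrightarrow> ev v F = 0"
proof -
  have "F * k \<in> forms 1 (D + e)" using F k by (intro forms_mult)
  moreover have "\<forall>v\<in>homog_coords 1. ev v (F * k) = 0" using 0 by (auto simp: poly_eval_homs)
  ultimately have "dehomog (F * k) = 0" using dehomog_eq_0_iff by blast
  then have "dehomog F = 0" using k(2) by (simp add: nonzero_form_def dehomog_homs)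
  then show "v \<in> homog_coords 1 \<Longrightarrow> ev v F = 0" using dehomog_eq_0_iff[OF F] by blast
qed

definition linear_form :: "complex vec \<Rightarrow> nat cpoly" where
  "linear_form u = Cst (u $ 1) * Var 0 - Cst (u $ 0) * Var 1"

lemma linear_form_forms: "linear_form u \<in> forms 1 1"
  unfolding linear_form_def by (intro forms_diff forms_Cst_mult forms_Var) auto

lemma nonzero_linear_form: "u \<in> homog_coords 1 \<Longrightarrow> nonzero_form (linear_form u)"
  by (auto simp: nonzero_form_def linear_form_def dehomog_homs dehomog_Var_0 dehomog_Var_1[unfolded One_nat_def]
    dehomog_Var_1 homog_coords_iff le_Suc_eq)

text \<open>In the chart this is division by a root. At the point at infinity the linear form
  becomes a nonzero constant, and the factorization only says that the degree is one less than the
  nominal one.\<close>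

lemma binary_form_factor:
  assumes F: "F \<in> forms 1 (Suc D)" and u: "u \<in> homog_coords 1" "ev u F = 0"
  shows "\<exists>G\<in>forms 1 D. \<forall>v. ev v F = ev v (linear_form u * G)"
proof -
  have lf: "dehomog (linear_form u) = [:- (u $ 0), u $ 1:]"
    by (simp add: linear_form_def dehomog_homs dehomog_Var_0 dehomog_Var_1 dehomog_Var_1[unfolded One_nat_def])
  have "\<exists>q. degree q \<le> D \<and> dehomog F = [:- (u $ 0), u $ 1:] * q"
  proof (cases "u $ 1 = 0")
    case True
    then have u0: "u $ 0 \<noteq> 0" using u(1) by (auto simp: homog_coords_iff le_Suc_eq)
    then have "coeff (dehomog F) (Suc D) = 0" using ev_dehomog_infinity[OF F True] u(2) by simp
    moreover have "degree (dehomog F) \<le> Suc D" by (rule degree_dehomog[OF F])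
    ultimately have "degree (dehomog F) \<le> D" by (metis degree_le le_Suc_eq leading_coeff_0_iff degree_0 le0)
    then show ?thesis using u0 True
      by (intro exI[of _ "Polynomial.smult (- 1 / u $ 0) (dehomog F)"]) auto
  next
    case False
    have "poly (dehomog F) (u $ 0 / u $ 1) = 0" using ev_dehomog[OF F False] u(2) False by simp
    then obtain q where q: "dehomog F = [:- (u $ 0 / u $ 1), 1:] * q" by (auto simp: poly_eq_0_iff_dvd elim: dvdE)
    have "degree q \<le> D"
    proof (cases "q = 0")
      case False
      then have "degree (dehomog F) = Suc (degree q)" unfolding q
        using degree_mult_eq[of "[:- (u $ 0 / u $ 1), 1:]" q] by (simp del: mult_pCons_left)
      then show ?thesis using degree_dehomog[OF F] by simp
    qed simp
    moreover have "[:- (u $ 0), u $ 1:] * Polynomial.smult (1 / u $ 1) q = dehomog F"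
    proof -
      have "[:- (u $ 0), u $ 1:] = Polynomial.smult (u $ 1) [:- (u $ 0 / u $ 1), 1:]" using False by simp
      then show ?thesis unfolding q using False by (simp del: mult_pCons_left smult_pCons)
    qed
    ultimately show ?thesis by (intro exI[of _ "Polynomial.smult (1 / u $ 1) q"]) auto
  qed
  then obtain q where q: "degree q \<le> D" "dehomog F = [:- (u $ 0), u $ 1:] * q" by blast
  have G: "homogenize D q \<in> forms 1 D" by (rule homogenize_forms)
  have "linear_form u * homogenize D q \<in> forms 1 (Suc D)" using forms_mult[OF linear_form_forms G] by simp
  moreover have "dehomog F = dehomog (linear_form u * homogenize D q)"
    by (simp only: dehomog_homs lf q(2) dehomog_homogenize[OF q(1)])
  ultimately show ?thesis using ev_eq_if_dehomog_eq[OF F] G by blast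
qed

lemma binary_form_zero:
  assumes F: "F \<in> forms 1 (Suc D)"
  shows "\<exists>u\<in>homog_coords 1. ev u F = 0"
proof (cases "coeff (dehomog F) (Suc D) = 0")
  case True
  let ?v = "pair_vec 1 0"
  have "?v \<in> homog_coords 1" by simp
  moreover have "ev ?v F = 0" using ev_dehomog_infinity[OF F, of ?v] True by simp
  ultimately show ?thesis by blast
next
  case False
  then have "Suc D \<le> degree (dehomog F)" by (rule le_degree)
  then obtain s where s: "poly (dehomog F) s = 0" using fundamental_theorem_of_algebra_alt[of "dehomog F"]
    by (metis degree_pCons_0 not_less_eq_eq zero_le)
  let ?v = "pair_vec s 1"
  have "?v \<in> homog_coords 1" by simp
  moreover have "ev ?v F = 0" using ev_dehomog[OF F, of ?v] s by simp
  ultimately show ?thesis by blast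
qed

lemma forms_degree_0: "F \<in> forms n 0 \<Longrightarrow> \<exists>c. F = Cst c"
proof -
  assume F: "F \<in> forms n 0"
  have "m = 0" if "m \<in> Poly_Mapping.keys F" for m
    using forms_single_key[OF F that] by (intro poly_mapping_eqI) (auto simp: total_deg_def in_keys_iff)
  then have "F = Cst (Poly_Mapping.lookup F 0)"
    by (intro poly_mapping_eqI) (auto simp: Cst_def lookup_single when_def in_keys_iff)
  then show ?thesis by blast
qed

text \<open>A homogeneous function of degree \<open>N\<close> that is locally a quotient of forms is a form: a
  quotient representation with denominator of minimal degree has constant denominator.\<close>

lemma global_section_form:
  fixes \<phi> :: "complex vec \<Rightarrow> complex"
  assumes loc: "\<And>u. u \<in> homog_coords 1 \<Longrightarrow> \<exists>D a h. a \<in> forms 1 (D + N) \<and> h \<in> forms 1 D \<and> ev u h \<noteq> 0 \<and>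
    (\<forall>v\<in>homog_coords 1. ev v h \<noteq> 0 \<longrightarrow> \<phi> v * ev v h = ev v a)"
  shows "\<exists>P\<in>forms 1 N. \<forall>v\<in>homog_coords 1. \<phi> v = ev v P"
proof -
  \<comment> \<open>The identity is required only off the zeros of an auxiliary form
    \<open>k\<close>. Cancelling a linear factor then costs no more than enlarging
    \<open>k\<close>.\<close>
  define Q where "Q D \<longleftrightarrow> (\<exists>a h k e. a \<in> forms 1 (D + N) \<and> h \<in> forms 1 D \<and> nonzero_form h \<and> k \<in> forms 1 e \<and>
    nonzero_form k \<and> (\<forall>v\<in>homog_coords 1. ev v k \<noteq> 0 \<longrightarrow> \<phi> v * ev v h = ev v a))" for D
  let ?u = "pair_vec 1 1 :: complex vec"
  have "?u \<in> homog_coords 1" by simp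
  from loc[OF this] this have "\<exists>D. Q D" unfolding Q_def using nonzero_form_iff by metis
  define D where "D = (LEAST D. Q D)"
  have "Q D" unfolding D_def using \<open>\<exists>D. Q D\<close> by (rule LeastI_ex)
  then obtain a h k e where a: "a \<in> forms 1 (D + N)" and h: "h \<in> forms 1 D" "nonzero_form h"
    and k: "k \<in> forms 1 e" "nonzero_form k"
    and \<phi>: "\<And>v. v \<in> homog_coords 1 \<Longrightarrow> ev v k \<noteq> 0 \<Longrightarrow> \<phi> v * ev v h = ev v a" by (auto simp: Q_def)
  have comp: "ev v (a * h') = ev v (a' * h)" if a': "a' \<in> forms 1 (D' + N)" and h': "h' \<in> forms 1 D'" "nonzero_form h'"
    and \<phi>': "\<And>v. v \<in> homog_coords 1 \<Longrightarrow> ev v h' \<noteq> 0 \<Longrightarrow> \<phi> v * ev v h' = ev v a'" and v: "v \<in> homog_coords 1" for a' h' D' v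
  proof -
    have "ev v (a * h' - a' * h) = 0"
    proof (rule generic_identity[OF _ _ _ _ v])
      have "a * h' \<in> forms 1 (D + N + D')" "a' * h \<in> forms 1 (D' + N + D)" using a h a' h' by (auto intro: forms_mult)
      then show "a * h' - a' * h \<in> forms 1 (D + N + D')" by (intro forms_diff) (simp_all add: add_ac)
      show "k * h' \<in> forms 1 (e + D')" using k h' by (intro forms_mult)
      show "nonzero_form (k * h')" using k h' by (intro nonzero_form_mult)
      fix w assume w: "w \<in> homog_coords 1" "ev w (k * h') \<noteq> 0"
      then have "ev w k \<noteq> 0" "ev w h' \<noteq> 0" by (auto simp: poly_eval_homs)
      then have "ev w a = \<phi> w * ev w h" "ev w a' = \<phi> w * ev w h'" using \<phi> \<phi>' w(1) by auto
      then show "ev w (a * h' - a' * h) = 0" by (simp add: poly_eval_homs)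
    qed
    then show ?thesis by (simp add: poly_eval_homs)
  qed
  have "D = 0"
  proof (rule ccontr)
    assume "D \<noteq> 0"
    then obtain D0 where D0: "D = Suc D0" by (cases D) auto
    \<comment> \<open>A denominator of positive degree has a zero \<open>u\<close>. Comparison with
      a representation that is defined at \<open>u\<close> shows that the numerator vanishes there
      too, so that a linear factor cancels, against minimality of \<open>D\<close>.\<close>
    obtain u where u: "u \<in> homog_coords 1" "ev u h = 0" using binary_form_zero h(1) D0 by blast
    from loc[OF u(1)] obtain D' a' h' where a': "a' \<in> forms 1 (D' + N)" "h' \<in> forms 1 D'" "ev u h' \<noteq> 0"
      "\<And>v. v \<in> homog_coords 1 \<Longrightarrow> ev v h' \<noteq> 0 \<Longrightarrow> \<phi> v * ev v h' = ev v a'" by blast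
    have "nonzero_form h'" using nonzero_form_iff[OF a'(2)] u(1) a'(3) by blast
    from comp[OF a'(1,2) this a'(4) u(1)] have "ev u a = 0" using u(2) a'(3) by (simp add: poly_eval_homs)
    moreover have "a \<in> forms 1 (Suc (D0 + N))" using a D0 by simp
    ultimately obtain a1 where a1: "a1 \<in> forms 1 (D0 + N)" "\<And>v. ev v a = ev v (linear_form u * a1)"
      using binary_form_factor u(1) by meson
    have "h \<in> forms 1 (Suc D0)" using h D0 by simp
    then obtain h1 where h1: "h1 \<in> forms 1 D0" "\<And>v. ev v h = ev v (linear_form u * h1)"
      using binary_form_factor u by meson
    have "nonzero_form h1" using h nonzero_form_iff[OF h(1)] nonzero_form_iff[OF h1(1)] h1(2)
      by (auto simp: poly_eval_homs)
    moreover have "\<phi> v * ev v h1 = ev v a1" if "v \<in> homog_coords 1" "ev v (k * linear_form u) \<noteq> 0" for v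
      using \<phi>[OF that(1)] that(2) unfolding a1(2) h1(2) by (simp add: poly_eval_homs)
    moreover have "k * linear_form u \<in> forms 1 (e + 1)" using k linear_form_forms by (intro forms_mult)
    moreover have "nonzero_form (k * linear_form u)" using k nonzero_linear_form[OF u(1)] by (intro nonzero_form_mult)
    ultimately have "Q D0" unfolding Q_def using a1(1) h1(1) by blast
    then have "D \<le> D0" unfolding D_def by (rule Least_le)
    then show False using D0 by simp
  qed
  then obtain c where c: "h = Cst c" using forms_degree_0 h(1) by blast
  have c0: "c \<noteq> 0" using h(2) c by (auto simp: nonzero_form_def)
  have "Cst (1 / c) * a \<in> forms 1 N" using a \<open>D = 0\<close> by (intro forms_Cst_mult) simp
  moreover have "\<phi> v = ev v (Cst (1 / c) * a)" if v: "v \<in> homog_coords 1" for v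
  proof -
    from loc[OF v] obtain D' a' h' where a': "a' \<in> forms 1 (D' + N)" "h' \<in> forms 1 D'" "ev v h' \<noteq> 0"
      "\<And>v. v \<in> homog_coords 1 \<Longrightarrow> ev v h' \<noteq> 0 \<Longrightarrow> \<phi> v * ev v h' = ev v a'" by blast
    have "nonzero_form h'" using nonzero_form_iff[OF a'(2)] v a'(3) by blast
    from comp[OF a'(1,2) this a'(4) v] have "ev v a * ev v h' = \<phi> v * ev v h' * c"
      using a'(4)[OF v a'(3)] c by (simp add: poly_eval_homs)
    then show ?thesis using a'(3) c0 by (simp add: poly_eval_homs field_simps)
  qed
  ultimately show ?thesis by blast
qed

section \<open>Exactness of exterior multiplication by a nowhere vanishing tuple\<close>

lemma polys_bezout:
  fixes m :: "nat \<Rightarrow> complex poly"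
  assumes "\<And>s. \<exists>j\<le>n. poly (m j) s \<noteq> 0"
  shows "\<exists>q. (\<Sum>j\<le>n. q j * m j) = 1"
proof -
  define J where "J = {\<Sum>i<Suc n. A i * m i | A. True}"
  have J: "ring_ideal J" unfolding J_def by (rule ring_ideal_generated)
  have mJ: "m j \<in> J" if "j \<le> n" for j
  proof -
    have "(\<Sum>i<Suc n. (if i = j then 1 else 0) * m i) = m j"
      using that by (simp only: if_distrib[where f = "\<lambda>c. c * _"] mult_1 mult_zero_left)
        (simp add: sum.delta less_Suc_eq_le del: sum.lessThan_Suc)
    then show ?thesis unfolding J_def by (intro CollectI exI[of _ "\<lambda>i. if i = j then 1 else 0"]) simp
  qed
  obtain j0 where j0: "j0 \<le> n" "m j0 \<noteq> 0" using assms[of 0] by (metis poly_0)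
  \<comment> \<open>An element of least degree in the ideal divides all \<open>m j\<close>; a root
    of it would be a common root, so that it is a constant.\<close>
  define N where "N = (LEAST N. \<exists>g\<in>J. g \<noteq> 0 \<and> degree g = N)"
  have "\<exists>N. \<exists>g\<in>J. g \<noteq> 0 \<and> degree g = N" using mJ j0 by blast
  from LeastI_ex[OF this] obtain g where g: "g \<in> J" "g \<noteq> 0" "degree g = N" unfolding N_def by blast
  have dv: "g dvd m j" if "j \<le> n" for j
  proof (rule ccontr)
    assume "\<not> g dvd m j"
    then have r: "m j mod g \<noteq> 0" by (simp add: dvd_eq_mod_eq_0)
    have "m j mod g = m j - (m j div g) * g" by (simp add: minus_div_mult_eq_mod)
    also have "\<dots> \<in> J" using mJ[OF that] g(1) J by (intro ring_idealD)
    finally have "N \<le> degree (m j mod g)" unfolding N_def using r by (intro Least_le) blast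
    then show False using degree_mod_less'[OF g(2) r] g(3) by simp
  qed
  have "degree g = 0"
  proof (rule ccontr)
    assume "degree g \<noteq> 0"
    then obtain s where "poly g s = 0" using fundamental_theorem_of_algebra_alt[of g] by (metis degree_pCons_0)
    then have "poly (m j) s = 0" if "j \<le> n" for j using dv[OF that] by (metis dvdE poly_mult mult_zero_left)
    then show False using assms[of s] by auto
  qed
  then obtain c where c: "g = [:c:]" "c \<noteq> 0" using g(2) by (metis degree_eq_zeroE pCons_0_0)
  have "[:1 / c:] * g \<in> J" using g(1) J by (intro ring_idealD)
  then have "1 \<in> J" using c by (simp add: one_pCons)
  then obtain A where "1 = (\<Sum>i<Suc n. A i * m i)" unfolding J_def by blast
  then show ?thesis by (intro exI[of _ A]) (simp only: lessThan_Suc_atMost)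
qed

text \<open>Koszul exactness: \<open>V\<close> behaves like a bivector with zero exterior product
  with \<open>M\<close>, hence is the exterior product of some \<open>w\<close> with
  \<open>M\<close>. In the chart, contraction with coefficients \<open>q\<close> such that the sum
  of the \<open>q j * m j\<close> is 1 produces such a \<open>w\<close>. It is unique up to
  multiples of \<open>m\<close>, and this freedom is used to bring the degrees down to
  \<open>E\<close>, so that it extends over the point at infinity.\<close>

lemma wedge_decomposition:
  fixes n E :: nat
  assumes M: "\<And>j. j \<le> n \<Longrightarrow> M j \<in> forms 1 E"
    and nz: "\<And>v. v \<in> homog_coords 1 \<Longrightarrow> \<exists>j\<le>n. ev v (M j) \<noteq> 0"
    and V: "\<And>j k. j \<le> n \<Longrightarrow> k \<le> n \<Longrightarrow> V j k \<in> forms 1 (2 * E)"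
    and cyc: "\<And>i j k v. i \<le> n \<Longrightarrow> j \<le> n \<Longrightarrow> k \<le> n \<Longrightarrow> v \<in> homog_coords 1 \<Longrightarrow>
      ev v (V j k) * ev v (M i) + ev v (V k i) * ev v (M j) + ev v (V i j) * ev v (M k) = 0"
    and anti: "\<And>j k v. j \<le> n \<Longrightarrow> k \<le> n \<Longrightarrow> v \<in> homog_coords 1 \<Longrightarrow> ev v (V j k) = - ev v (V k j)"
  shows "\<exists>w. \<forall>j\<le>n. w j \<in> forms 1 E \<and> (\<forall>k\<le>n. \<forall>v\<in>homog_coords 1.
    ev v (V j k) = ev v (w j) * ev v (M k) - ev v (w k) * ev v (M j))"
proof -
  define m where "m j = dehomog (M j)" for j
  define \<nu> where "\<nu> j k = dehomog (V j k)" for j k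
  have cyc': "\<nu> j k * m i + \<nu> k i * m j + \<nu> i j * m k = 0" if ijk: "i \<le> n" "j \<le> n" "k \<le> n" for i j k
  proof -
    have "V j k * M i + V k i * M j + V i j * M k \<in> forms 1 (2 * E + E)"
      using ijk M V by (intro forms_add forms_mult)
    then have "dehomog (V j k * M i + V k i * M j + V i j * M k) = 0"
      using cyc[OF ijk] dehomog_eq_0_iff by (simp add: poly_eval_homs)
    then show ?thesis by (simp add: dehomog_homs m_def \<nu>_def)
  qed
  have anti': "\<nu> k j = - \<nu> j k" if jk: "j \<le> n" "k \<le> n" for j k
  proof -
    have "V j k + V k j \<in> forms 1 (2 * E)" using jk V by (intro forms_add)
    then have "dehomog (V j k + V k j) = 0" using anti[OF jk] dehomog_eq_0_iff by (simp add: poly_eval_homs)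
    then show ?thesis by (simp add: dehomog_homs \<nu>_def add_eq_0_iff2)
  qed
  have nzm: "\<exists>j\<le>n. poly (m j) s \<noteq> 0" for s
  proof -
    let ?v = "pair_vec s 1"
    have "?v \<in> homog_coords 1" by simp
    then obtain j where "j \<le> n" "ev ?v (M j) \<noteq> 0" using nz by blast
    then show ?thesis using ev_dehomog[OF M, of j ?v] by (auto simp: m_def)
  qed
  obtain q where q: "(\<Sum>j\<le>n. q j * m j) = 1" using polys_bezout[of n m, OF nzm] by blast
  define w0 where "w0 j = (\<Sum>i\<le>n. \<nu> j i * q i)" for j
  have w0: "w0 j * m k - w0 k * m j = \<nu> j k" if jk: "j \<le> n" "k \<le> n" for j k
  proof -
    have "w0 j * m k - w0 k * m j = (\<Sum>i\<le>n. q i * (\<nu> j i * m k - \<nu> k i * m j))"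
      unfolding w0_def sum_distrib_left sum_distrib_right sum_subtractf[symmetric]
      by (intro sum.cong) (auto simp: algebra_simps)
    also have "\<dots> = (\<Sum>i\<le>n. q i * (\<nu> j k * m i))"
    proof (intro sum.cong refl arg_cong2[of _ _ _ _ "(*)"])
      fix i assume i: "i \<in> {..n}"
      then have "i \<le> n" by simp
      have eq: "\<nu> j i * m k - \<nu> k i * m j = \<nu> j k * m i - (\<nu> j k * m i + \<nu> k i * m j + \<nu> i j * m k)"
        using anti'[of i j] jk i by (simp add: algebra_simps)
      then show "\<nu> j i * m k - \<nu> k i * m j = \<nu> j k * m i"
        unfolding eq cyc'[OF \<open>i \<le> n\<close> jk] by simp
    qed
    also have "\<dots> = \<nu> j k * (\<Sum>i\<le>n. q i * m i)" by (simp add: sum_distrib_left mult_ac)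
    finally show ?thesis using q by simp
  qed
  let ?e = "pair_vec 1 0 :: complex vec"
  have "?e \<in> homog_coords 1" by simp
  \<comment> \<open>Since \<open>M\<close> does not vanish at infinity, some component has full
    degree \<open>E\<close>. Reducing the corresponding \<open>w0 b\<close> modulo it bounds one
    degree, and the relations with index \<open>b\<close> bound all others.\<close>
  then obtain b where b: "b \<le> n" "ev ?e (M b) \<noteq> 0" using nz by blast
  then have "coeff (m b) E \<noteq> 0" using ev_dehomog_infinity[OF M, of b ?e] by (simp add: m_def)
  then have mb: "degree (m b) = E" "m b \<noteq> 0"
    using degree_dehomog[OF M[OF b(1)]] le_degree[of "m b" E] by (auto simp: m_def)
  define w where "w j = w0 j - (w0 b div m b) * m j" for j
  have w: "w j * m k - w k * m j = \<nu> j k" if jk: "j \<le> n" "k \<le> n" for j k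
    using w0[OF jk] by (simp add: w_def algebra_simps)
  have wb: "degree (w b) \<le> E"
  proof -
    have "w b = w0 b mod m b" by (simp add: w_def minus_div_mult_eq_mod)
    then show ?thesis using degree_mod_less'[of "m b" "w0 b"] mb by (cases "w b = 0") auto
  qed
  have dw: "degree (w j) \<le> E" if j: "j \<le> n" for j
  proof (cases "w j = 0")
    case False
    have "w j * m b = \<nu> j b + w b * m j" using w[OF j b(1)] by (simp add: algebra_simps)
    moreover have "degree (\<nu> j b) \<le> 2 * E" unfolding \<nu>_def by (rule degree_dehomog[OF V[OF j b(1)]])
    moreover have "degree (w b * m j) \<le> 2 * E"
      using degree_mult_le[of "w b" "m j"] wb degree_dehomog[OF M[OF j]] by (simp add: m_def)
    ultimately have "degree (w j * m b) \<le> 2 * E" by (simp add: degree_add_le)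
    then show ?thesis using degree_mult_eq[OF False mb(2)] mb(1) by simp
  qed simp
  have "ev v (V j k) = ev v (homogenize E (w j)) * ev v (M k) - ev v (homogenize E (w k)) * ev v (M j)"
    if jk: "j \<le> n" "k \<le> n" for j k v
  proof -
    let ?G = "homogenize E (w j) * M k - homogenize E (w k) * M j"
    have "?G \<in> forms 1 (E + E)" using jk M homogenize_forms by (intro forms_diff forms_mult)
    then have "?G \<in> forms 1 (2 * E)" by (simp add: mult_2)
    moreover have "dehomog (V j k) = dehomog ?G"
      using w[OF jk] by (simp add: dehomog_homs dehomog_homogenize dw jk m_def \<nu>_def)
    ultimately have "ev v (V j k) = ev v ?G" using ev_eq_if_dehomog_eq[OF V[OF jk]] by blast
    then show ?thesis by (simp add: poly_eval_homs)
  qed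
  then show ?thesis using homogenize_forms by (intro exI[of _ "\<lambda>j. homogenize E (w j)"]) auto
qed

section \<open>Consequences of convexity\<close>

declare One_nat_def [simp del]

text \<open>The degree of an entry is split into a row part and a column part. The column part
  accounts for the one column that Cramer's rule replaces by entries of a different degree.\<close>

lemma det_forms:
  assumes A: "A \<in> carrier_mat m m"
    and f: "\<And>i k. i < m \<Longrightarrow> k < m \<Longrightarrow> A $$ (i, k) \<in> forms n (e i + c k)"
  shows "det A \<in> forms n (sum e {0..<m} + sum c {0..<m})"
  unfolding det_def'[OF A]
proof (rule forms_sum)
  fix p assume "p \<in> {p. p permutes {0..<m}}"
  then have p: "p permutes {0..<m}" by simp
  have "(\<Prod>i = 0..<m. A $$ (i, p i)) \<in> forms n (\<Sum>i = 0..<m. e i + c (p i))"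
    using permutes_in_image[OF p] by (intro forms_prod f) auto
  also have "(\<Sum>i = 0..<m. e i + c (p i)) = sum e {0..<m} + sum c {0..<m}"
    using sum.permute[OF p, of c] by (simp add: sum.distrib comp_def)
  finally have *: "(\<Prod>i = 0..<m. A $$ (i, p i)) \<in> forms n (sum e {0..<m} + sum c {0..<m})" .
  then show "signof p * (\<Prod>i = 0..<m. A $$ (i, p i)) \<in> forms n (sum e {0..<m} + sum c {0..<m})"
    by (auto simp: sign_def)
qed

text \<open>Cramer's rule without denominators: both sides are polynomial in the entries and can be
  read as values of forms.\<close>

lemma cramer_solution:
  fixes A :: "complex mat"
  assumes A: "A \<in> carrier_mat m m" and b: "b \<in> carrier_vec m" and i: "i < m" and nz: "det A \<noteq> 0"
  shows "(\<Sum>k<m. A $$ (i, k) * det (replace_col A b k)) = b $ i * det A"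
proof -
  define x where "x = (1 / det A) \<cdot>\<^sub>v (adj_mat A *\<^sub>v b)"
  have adj: "adj_mat A \<in> carrier_mat m m" "A * adj_mat A = det A \<cdot>\<^sub>m 1\<^sub>m m" using adj_mat[OF A] by auto
  have x: "x \<in> carrier_vec m" using adj b by (auto simp: x_def)
  have "A *\<^sub>v x = (1 / det A) \<cdot>\<^sub>v (A *\<^sub>v (adj_mat A *\<^sub>v b))"
    unfolding x_def using A adj b by (intro mult_mat_vec) auto
  also have "A *\<^sub>v (adj_mat A *\<^sub>v b) = (det A \<cdot>\<^sub>m 1\<^sub>m m) *\<^sub>v b" using A adj b by (simp flip: assoc_mult_mat_vec)
  also have "\<dots> = det A \<cdot>\<^sub>v b"
    using b by (intro eq_vecI) (auto simp: scalar_prod_def if_distrib[where f = "\<lambda>z. z * _"]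
      if_distrib[where f = "\<lambda>z. _ * z"] sum.delta cong: if_cong)
  finally have Ax: "A *\<^sub>v x = b" using nz by (simp add: smult_smult_assoc)
  have c: "det (replace_col A b k) = x $ k * det A" if "k < m" for k
    using cramer_lemma_mat[OF A x that] Ax by simp
  have "(\<Sum>k<m. A $$ (i, k) * det (replace_col A b k)) = (\<Sum>k<m. A $$ (i, k) * x $ k) * det A"
    unfolding sum_distrib_right by (intro sum.cong) (auto simp: c)
  also have "(\<Sum>k<m. A $$ (i, k) * x $ k) = (A *\<^sub>v x) $ i"
    using A x i by (simp add: scalar_prod_def atLeast0LessThan)
  finally show ?thesis using Ax by simp
qed

section \<open>Local lifts along a rational curve, and sections of the pulled-back tangent
  sheaf\<close>

locale rational_curve_in = smooth_variety +
  fixes E :: nat and M :: "nat \<Rightarrow> nat cpoly"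
  assumes d1: "\<And>i. i < l \<Longrightarrow> 1 \<le> d i"
    and M: "\<And>j. j \<le> n \<Longrightarrow> M j \<in> forms 1 E"
    and nz: "\<And>v. v \<in> homog_coords 1 \<Longrightarrow> tuple_vec n M v \<in> homog_coords n"
    and on_Z: "\<And>v i. v \<in> homog_coords 1 \<Longrightarrow> i < l \<Longrightarrow> ev (tuple_vec n M v) (F i) = 0"
begin

abbreviation "Y \<equiv> tuple_vec n M"
abbreviation "\<mu> \<equiv> tuple_map 1 n M"
abbreviation "J i j \<equiv> poly_subst M (partial_deriv j (F i))"
abbreviation "P1_points \<equiv> proj_space 1"

lemma line_Y: "v \<in> homog_coords 1 \<Longrightarrow> line (Y v) \<in> Z"
  using in_Z nz on_Z by blast

sublocale form_map 1 n E M P1_points Z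
  by unfold_locales (use M nz line_Y Z_subset in auto)

lemma J_forms: "i < l \<Longrightarrow> J i j \<in> forms 1 ((d i - 1) * E)"
  by (intro subst_forms partial_deriv_forms F)

lemma ev_J: "i < l \<Longrightarrow> ev (Y v) (partial_deriv j (F i)) = ev v (J i j)"
  by (rule ev_subst[OF partial_deriv_forms[OF F]])

lemma dir_deriv_Y: "i < l \<Longrightarrow> dir_deriv n (Y v) w (F i) = (\<Sum>j\<le>n. ev v (J i j) * w j)"
  by (simp add: dir_deriv_def ev_J)

text \<open>The right inverse \<open>B\<close> of the Jacobian at \<open>Y u\<close> is kept
  constant. The product of the Jacobian with \<open>B\<close> is a square matrix of forms and is the
  identity at \<open>u\<close>, so its determinant \<open>h\<close> is nonzero there; Cramer's rule
  solves the system wherever \<open>h\<close> is nonzero.\<close>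

lemma local_solution:
  assumes p: "\<And>i. i < l \<Longrightarrow> p i \<in> forms 1 (d i * E)" and u: "u \<in> homog_coords 1"
  shows "\<exists>D h a. h \<in> forms 1 D \<and> (\<forall>j\<le>n. a j \<in> forms 1 (D + E)) \<and> ev u h \<noteq> 0 \<and>
    (\<forall>v\<in>homog_coords 1. ev v h \<noteq> 0 \<longrightarrow> (\<forall>i<l. (\<Sum>j\<le>n. ev v (J i j) * ev v (a j)) = ev v (p i) * ev v h))"
proof -
  obtain B where B: "jacobian_right_inverse n l F (\<lambda>i. Y u $ i) B"
    using right_inverse[OF nz[OF u] line_Y[OF u]] by blast
  define A where "A = mat l l (\<lambda>(i, k). \<Sum>j\<le>n. Cst (B k j) * J i j)"
  define e where "e i = (d i - 1) * E" for i
  define D where "D = sum e {0..<l}"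
  define h where "h = det A"
  define b where "b = vec l p"
  define x where "x k = det (replace_col A b k)" for k
  define a where "a j = (\<Sum>k<l. Cst (B k j) * x k)" for j
  have A: "A \<in> carrier_mat l l" by (simp add: A_def)
  have Af: "A $$ (i, k) \<in> forms 1 (e i)" if "i < l" "k < l" for i k
    using that J_forms[OF that(1)] by (auto simp: A_def e_def intro!: forms_sum forms_Cst_mult)
  have h: "h \<in> forms 1 D" using det_forms[OF A, of 1 e "\<lambda>_. 0"] Af by (simp add: h_def D_def)
  have xf: "x k \<in> forms 1 (D + E)" if k: "k < l" for k
  proof -
    have "det (replace_col A b k) \<in> forms 1 (sum e {0..<l} + sum (\<lambda>j. if j = k then E else 0) {0..<l})"
    proof (rule det_forms)
      show "replace_col A b k \<in> carrier_mat l l" using A by (auto simp: replace_col_def)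
      fix i j assume ij: "i < l" "j < l"
      have "d i * E = e i + E" using d1[OF ij(1)] by (cases "d i") (simp_all add: e_def)
      then show "replace_col A b k $$ (i, j) \<in> forms 1 (e i + (if j = k then E else 0))"
        using A ij Af[OF ij] p[OF ij(1)] by (simp add: replace_col_def b_def)
    qed
    also have "sum (\<lambda>j. if j = k then E else 0) {0..<l} = E" using k by simp
    finally show ?thesis by (simp add: x_def D_def)
  qed
  have evA: "map_mat (ev v) A = mat l l (\<lambda>(i, k). \<Sum>j\<le>n. B k j * ev v (J i j))" for v
    by (intro eq_matI) (auto simp: A_def poly_eval_homs)
  have evh: "ev v h = det (map_mat (ev v) A)" for v
    unfolding h_def by (rule poly_eval.hom_det[symmetric])
  have evx: "ev v (x k) = det (replace_col (map_mat (ev v) A) (map_vec (ev v) b) k)" if "k < l" for v k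
  proof -
    have "ev v (x k) = det (map_mat (ev v) (replace_col A b k))"
      unfolding x_def by (rule poly_eval.hom_det[symmetric])
    also have "map_mat (ev v) (replace_col A b k) = replace_col (map_mat (ev v) A) (map_vec (ev v) b) k"
      using A by (intro eq_matI) (auto simp: replace_col_def b_def)
    finally show ?thesis .
  qed
  have "map_mat (ev u) A = 1\<^sub>m l"
  proof (rule eq_matI)
    fix i k assume "i < dim_row (1\<^sub>m l :: complex mat)" "k < dim_col (1\<^sub>m l :: complex mat)"
    then have ik: "i < l" "k < l" by auto
    then have "(\<Sum>j\<le>n. ev (Y u) (partial_deriv j (F i)) * B k j) = (if i = k then 1 else 0)"
      using B by (simp add: jacobian_right_inverse_def)
    then show "map_mat (ev u) A $$ (i, k) = 1\<^sub>m l $$ (i, k)"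
      unfolding evA using ik by (simp add: ev_J mult.commute)
  qed (simp_all add: A_def)
  then have hu: "ev u h \<noteq> 0" by (simp add: evh)
  have "(\<Sum>j\<le>n. ev v (J i j) * ev v (a j)) = ev v (p i) * ev v h" if v: "ev v h \<noteq> 0" and i: "i < l" for v i
  proof -
    let ?A = "map_mat (ev v) A" and ?b = "map_vec (ev v) b"
    have "(\<Sum>j\<le>n. ev v (J i j) * ev v (a j)) = (\<Sum>j\<le>n. \<Sum>k<l. B k j * ev v (J i j) * ev v (x k))"
      by (simp add: a_def poly_eval_homs sum_distrib_left mult_ac)
    also have "\<dots> = (\<Sum>k<l. (\<Sum>j\<le>n. B k j * ev v (J i j)) * ev v (x k))"
      by (subst sum.swap) (simp add: sum_distrib_right)
    also have "\<dots> = (\<Sum>k<l. ?A $$ (i, k) * det (replace_col ?A ?b k))"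
      using i by (intro sum.cong) (auto simp: evx evA)
    also have "\<dots> = ?b $ i * det ?A"
      using A i v by (intro cramer_solution) (auto simp: evh b_def)
    finally show ?thesis using i by (simp add: b_def evh)
  qed
  moreover have "a j \<in> forms 1 (D + E)" for j
    unfolding a_def using xf by (intro forms_sum forms_Cst_mult) auto
  ultimately show ?thesis using h hu by blast
qed

definition rep :: "complex vec set \<Rightarrow> complex vec" where
  "rep t = (SOME v. v \<in> homog_coords 1 \<and> line v = t)"

lemma rep_line: "v \<in> homog_coords 1 \<Longrightarrow> \<exists>c. c \<noteq> 0 \<and> rep (line v) = c \<cdot>\<^sub>v v"
proof -
  assume v: "v \<in> homog_coords 1"
  have "rep (line v) \<in> homog_coords 1 \<and> line (rep (line v)) = line v"
    unfolding rep_def by (rule someI[of _ v]) (simp add: v)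
  then show ?thesis using line_eqD by metis
qed

text \<open>The section of the pulled back tangent sheaf induced by a tuple of rational functions
  \<open>A\<^sub>j / H\<close>, homogeneous of the same degree as \<open>\<mu>\<close>.\<close>

definition rational_section ::
    "(nat \<Rightarrow> nat cpoly) \<Rightarrow> nat cpoly \<Rightarrow> complex vec set set \<Rightarrow> complex vec set \<Rightarrow> (complex vec set \<Rightarrow> complex) \<Rightarrow> complex" where
  "rational_section A H U t =
    (if t \<in> U then tangent_derivation (Y (rep t)) (\<lambda>j. ev (rep t) (A j) / ev (rep t) H) else 0)"

lemma Y_smult: "v \<in> homog_coords 1 \<Longrightarrow> Y (c \<cdot>\<^sub>v v) = c ^ E \<cdot>\<^sub>v Y v"
  using ev_smult[OF M homog_coords_carrier]
  by (intro eq_vecI) (auto simp: tuple_vec_def less_Suc_eq_le)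

context
  fixes A H D U
  assumes A: "\<And>j. j \<le> n \<Longrightarrow> A j \<in> forms 1 (D + E)" and H: "H \<in> forms 1 D"
    and tan: "\<And>v i. v \<in> homog_coords 1 \<Longrightarrow> ev v H \<noteq> 0 \<Longrightarrow> i < l \<Longrightarrow> (\<Sum>j\<le>n. ev v (J i j) * ev v (A j)) = 0"
    and U: "U = principal 1 P1_points H"
begin

lemma tangent_dir_ratio:
  assumes "v \<in> homog_coords 1" "ev v H \<noteq> 0"
  shows "tangent_dir (Y v) (\<lambda>j. ev v (A j) / ev v H)"
  unfolding tangent_dir_def
proof (intro allI impI)
  fix i assume i: "i < l"
  have "(\<Sum>j\<le>n. ev v (J i j) * (ev v (A j) / ev v H)) = (\<Sum>j\<le>n. ev v (J i j) * ev v (A j)) / ev v H"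
    by (simp add: sum_divide_distrib)
  then show "dir_deriv n (Y v) (\<lambda>j. ev v (A j) / ev v H) (F i) = 0"
    using tan[OF assms i] by (simp add: dir_deriv_Y[OF i])
qed

lemma tangent_derivation_cong: "(\<And>j. j \<le> n \<Longrightarrow> w j = w' j) \<Longrightarrow> tangent_derivation v w f = tangent_derivation v w' f"
proof -
  assume "\<And>j. j \<le> n \<Longrightarrow> w j = w' j"
  then have "dir_deriv n v w = dir_deriv n v w'" by (auto simp: dir_deriv_def fun_eq_iff)
  then show ?thesis by (simp add: tangent_derivation_def)
qed

lemma rational_section_line:
  assumes v: "v \<in> homog_coords 1" "line v \<in> U"
  shows "rational_section A H U (line v) f = tangent_derivation (Y v) (\<lambda>j. ev v (A j) / ev v H) f"
proof -
  have Hv: "ev v H \<noteq> 0" using v in_principal[OF H v(1)] U by blast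
  obtain c where c: "c \<noteq> 0" "rep (line v) = c \<cdot>\<^sub>v v" using rep_line[OF v(1)] by blast
  have r: "ev (c \<cdot>\<^sub>v v) (A j) / ev (c \<cdot>\<^sub>v v) H = c ^ E * (ev v (A j) / ev v H)" if "j \<le> n" for j
    using c(1) ev_smult[OF A[OF that] homog_coords_carrier[OF v(1)]] ev_smult[OF H homog_coords_carrier[OF v(1)]]
    by (simp add: power_add)
  have "rational_section A H U (line v) f = tangent_derivation (c ^ E \<cdot>\<^sub>v Y v) (\<lambda>j. ev (c \<cdot>\<^sub>v v) (A j) / ev (c \<cdot>\<^sub>v v) H) f"
    using v(2) by (simp add: rational_section_def c Y_smult[OF v(1)])
  also have "\<dots> = tangent_derivation (c ^ E \<cdot>\<^sub>v Y v) (\<lambda>j. c ^ E * (ev v (A j) / ev v H)) f"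
    by (rule tangent_derivation_cong) (rule r)
  also have "\<dots> = tangent_derivation (Y v) (\<lambda>j. ev v (A j) / ev v H) f"
    by (rule tangent_derivation_scale[OF nz[OF v(1)] line_Y[OF v(1)] tangent_dir_ratio[OF v(1) Hv]]) (simp add: c(1))
  finally show ?thesis .
qed

lemma rational_section_pullback: "rational_section A H U \<in> pullback_tangent P1 (proj_variety n Z) \<mu> U"
  unfolding pullback_tangent_def
proof (intro CollectI conjI ballI allI impI)
  have Usub: "U \<subseteq> P1_points" using U principal_subset by blast
  fix t assume t: "t \<in> U"
  then obtain v where v: "v \<in> homog_coords 1" "t = line v" using Usub by (auto simp: proj_space_eq)
  have Hv: "ev v H \<noteq> 0" using v t in_principal[OF H v(1)] U by blast
  have "rational_section A H U t = tangent_derivation (Y v) (\<lambda>j. ev v (A j) / ev v H)"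
    using rational_section_line[OF v(1)] v(2) t by auto
  then show "rational_section A H U t \<in> tangent_space (proj_variety n Z) (\<mu> t)"
    using tangent_derivation_tangent_space[OF nz[OF v(1)] line_Y[OF v(1)] tangent_dir_ratio[OF v(1) Hv]]
    by (simp add: v(2) map_line[OF v(1)])
next
  fix t assume "t \<notin> U" then show "rational_section A H U t = 0" by (auto simp: rational_section_def)
next
  fix V f assume V: "openin (ftop (proj_variety n Z)) V \<and> regular (proj_variety n Z) V f"
  have VZ: "V \<subseteq> Z" using V openin_subset[of "ftop (proj_variety n Z)" V] by (auto simp: ftop_proj_variety)
  let ?W = "{t \<in> U. \<mu> t \<in> V}"
  have Wsub: "?W \<subseteq> P1_points" using U principal_subset by blast
  show "regular P1 ?W (\<lambda>t. rational_section A H U t f)"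
    unfolding P1_def regular_proj_iff[OF order_refl Wsub]
  proof (intro ballI impI)
    fix u assume u: "u \<in> homog_coords 1" "line u \<in> ?W"
    then have "line (Y u) \<in> V" by (simp add: map_line)
    then obtain g h where gh: "is_fraction_near n Z V f (Y u) g h"
      using V nz[OF u(1)] regular_proj_iff[OF Z_subset VZ] by blast
    then obtain e where e: "g \<in> forms n e" "h \<in> forms n e" by (auto simp: is_fraction_near_def)
    define S where "S G = poly_subst M G" for G
    define N where "N = (\<Sum>j\<le>n. (S (partial_deriv j g) * S h - S g * S (partial_deriv j h)) * A j)"
    define Q where "Q = S h * S h * H"
    have Q: "Q \<in> forms 1 (e * E + e * E + D)"
      unfolding Q_def S_def using e H by (intro forms_mult subst_forms)
    \<comment> \<open>The quotient rule loses one degree in \<open>g\<close> or \<open>h\<close> and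
      gains the degree of \<open>A j\<close>. For \<open>e = 0\<close> the subtraction would be
      truncated, but then all derivatives are zero.\<close>
    have N: "N \<in> forms 1 (e * E + e * E + D)"
    proof (cases e)
      case 0
      then have "partial_deriv j g = 0" "partial_deriv j h = 0" for j using e partial_deriv_forms_0 by blast+
      then show ?thesis by (simp add: N_def S_def poly_subst_homs)
    next
      case (Suc k)
      have "(S (partial_deriv j g) * S h - S g * S (partial_deriv j h)) * A j \<in> forms 1 ((k * E + e * E) + (D + E))" if "j \<le> n" for j
      proof -
        have k: "partial_deriv j g \<in> forms n k" "partial_deriv j h \<in> forms n k"
          using partial_deriv_forms[OF e(1)] partial_deriv_forms[OF e(2)] Suc by auto
        have "S (partial_deriv j g) * S h \<in> forms 1 (k * E + e * E)"
          unfolding S_def using e k by (intro forms_mult subst_forms)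
        moreover have "S g * S (partial_deriv j h) \<in> forms 1 (k * E + e * E)"
          unfolding S_def using forms_mult[OF subst_forms[OF e(1)] subst_forms[OF k(2)]] by (simp add: add.commute)
        ultimately show ?thesis using A[OF that] by (rule forms_mult[OF forms_diff])
      qed
      moreover have "(k * E + e * E) + (D + E) = e * E + e * E + D" using Suc by simp
      ultimately show ?thesis unfolding N_def by (intro forms_sum) auto
    qed
    have "is_fraction_near 1 P1_points ?W (\<lambda>t. rational_section A H U t f) u N Q"
      unfolding is_fraction_near_def
    proof (intro conjI ballI impI)
      show "\<exists>d. N \<in> forms 1 d \<and> Q \<in> forms 1 d" using N Q by blast
      have "ev u H \<noteq> 0" using u in_principal[OF H u(1)] U by blast
      then show "ev u Q \<noteq> 0" using gh ev_subst[OF e(2)] by (auto simp: Q_def S_def poly_eval_homs is_fraction_near_def)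
      fix v assume v: "v \<in> homog_coords 1" "line v \<in> P1_points" "ev v Q \<noteq> 0"
      then have nzv: "ev v H \<noteq> 0" "ev (Y v) h \<noteq> 0"
        using ev_subst[OF e(2)] by (auto simp: Q_def S_def poly_eval_homs)
      have vU: "line v \<in> U" unfolding U using in_principal[OF H v(1)] v nzv by blast
      have "line (Y v) \<in> V" using gh nz[OF v(1)] line_Y[OF v(1)] nzv(2) by (auto simp: is_fraction_near_def)
      then show "line v \<in> ?W" using vU map_line[OF v(1)] by simp
      have fr: "is_fraction_near n Z Z f (Y v) g h"
        using is_fraction_near_mono[OF gh VZ] nzv(2) by (auto simp: is_fraction_near_def)
      have dd: "dir_deriv n (Y v) (\<lambda>j. ev v (A j) / ev v H) G = (\<Sum>j\<le>n. ev v (S (partial_deriv j G)) * ev v (A j)) / ev v H"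
        if "G \<in> forms n e" for G
        using ev_subst[OF partial_deriv_forms[OF that]] by (simp add: dir_deriv_def S_def sum_divide_distrib)
      have ee: "ev (Y v) g = ev v (S g)" "ev (Y v) h = ev v (S h)" using ev_subst e by (auto simp: S_def)
      have evN: "ev v N = (\<Sum>j\<le>n. ev v (S (partial_deriv j g)) * ev v (A j)) * ev v (S h)
          - ev v (S g) * (\<Sum>j\<le>n. ev v (S (partial_deriv j h)) * ev v (A j))"
        unfolding N_def poly_eval_homs sum_distrib_left sum_distrib_right sum_subtractf[symmetric]
        by (intro sum.cong) (auto simp: algebra_simps)
      have "rational_section A H U (line v) f =
        (dir_deriv n (Y v) (\<lambda>j. ev v (A j) / ev v H) g * ev (Y v) h - ev (Y v) g * dir_deriv n (Y v) (\<lambda>j. ev v (A j) / ev v H) h) / (ev (Y v) h)\<^sup>2"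
        unfolding rational_section_line[OF v(1) vU]
        by (rule tangent_derivation_fraction[OF nz[OF v(1)] line_Y[OF v(1)] tangent_dir_ratio[OF v(1) nzv(1)] fr])
      also have "\<dots> = ev v N / ev v Q"
        unfolding dd[OF e(1)] dd[OF e(2)] ee evN Q_def poly_eval_homs power2_eq_square
        using nzv ee by (simp add: field_simps)
      finally show "rational_section A H U (line v) f = ev v N / ev v Q" .
    qed
    then show "\<exists>g h. is_fraction_near 1 P1_points ?W (\<lambda>t. rational_section A H U t f) u g h" by blast
  qed
qed

end

lemma section_coord_fraction:
  assumes b: "b \<in> pullback_tangent P1 (proj_variety n Z) \<mu> U" and U: "U \<subseteq> P1_points"
    and u: "u \<in> homog_coords 1" "line u \<in> U" and a: "a \<le> n" "ev u (M a) \<noteq> 0" and j: "j \<le> n"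
  shows "\<exists>D g h. g \<in> forms 1 D \<and> h \<in> forms 1 D \<and> ev u h \<noteq> 0 \<and> (\<forall>v\<in>homog_coords 1. ev v h \<noteq> 0 \<longrightarrow>
    line v \<in> U \<and> ev v (M a) \<noteq> 0 \<and> b (line v) (affine_coord n a j) = ev v g / ev v h)"
proof -
  let ?V = "principal n Z (Var a)"
  have Va: "Var a \<in> forms n 1" using a(1) by (rule forms_Var)
  have pr: "line (Y v) \<in> ?V \<longleftrightarrow> ev v (M a) \<noteq> 0" if "v \<in> homog_coords 1" for v
    using in_principal[OF Va nz[OF that]] line_Y[OF that] a(1) by (simp add: tuple_vec_index)
  have W: "{t \<in> U. \<mu> t \<in> ?V} \<subseteq> P1_points" using U by auto
  have "regular P1 {t \<in> U. \<mu> t \<in> ?V} (\<lambda>t. b t (affine_coord n a j))"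
    using b regular_affine_coord[OF a(1) j] openin_principal[OF Va, of Z]
    unfolding pullback_tangent_def by (auto simp: ftop_proj_variety)
  moreover have "line u \<in> {t \<in> U. \<mu> t \<in> ?V}" using u a pr[OF u(1)] by (simp add: map_line)
  ultimately obtain g h where gh: "is_fraction_near 1 P1_points {t \<in> U. \<mu> t \<in> ?V} (\<lambda>t. b t (affine_coord n a j)) u g h"
    unfolding P1_def regular_proj_iff[OF order_refl W] using u(1) by blast
  then obtain D where "g \<in> forms 1 D" "h \<in> forms 1 D" "ev u h \<noteq> 0" by (auto simp: is_fraction_near_def)
  moreover have "line v \<in> U \<and> ev v (M a) \<noteq> 0 \<and> b (line v) (affine_coord n a j) = ev v g / ev v h"
    if v: "v \<in> homog_coords 1" "ev v h \<noteq> 0" for v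
  proof -
    have "line v \<in> P1_points" using v(1) by (auto simp: proj_space_eq)
    then show ?thesis using gh v pr[OF v(1)] map_line[OF v(1)] by (auto simp: is_fraction_near_def)
  qed
  ultimately show ?thesis by blast
qed

end

lemma principal_mult:
  assumes "F \<in> forms n d" "G \<in> forms n e"
  shows "principal n Z (F * G) = principal n Z F \<inter> principal n Z G"
proof -
  have "line v \<in> principal n Z (F * G) \<longleftrightarrow> line v \<in> principal n Z F \<inter> principal n Z G" if "v \<in> homog_coords n" for v
    using in_principal[OF forms_mult[OF assms] that] in_principal[OF assms(1) that] in_principal[OF assms(2) that]
    by (auto simp: poly_eval_homs)
  then show ?thesis by (auto simp: principal_def[of n Z "F * G"] principal_def[of n Z F])
qed

context rational_curve_in
begin

text \<open>The obstruction to lifting \<open>p\<close> is a class in \<open>H\<^sup>1(\<mu>\<^sup>*T\<^sub>Z)\<close>: local lifts exist by the Jacobian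
  condition, and their differences form a cocycle. When it is a coboundary, the corrected local
  lifts agree up to multiples of \<open>Y\<close>, so that their exterior products with \<open>Y\<close> glue.\<close>

theorem convex_surjective:
  assumes conv: "convex_variety (proj_variety n Z)"
    and p: "\<And>i. i < l \<Longrightarrow> p i \<in> forms 1 (d i * E)"
  shows "\<exists>w. (\<forall>j\<le>n. w j \<in> forms 1 E) \<and>
    (\<forall>v\<in>homog_coords 1. \<forall>i<l. (\<Sum>j\<le>n. ev v (J i j) * ev v (w j)) = ev v (p i))"
proof -
  let ?X = "proj_variety n Z"
  define good where "good D h a \<longleftrightarrow> h \<in> forms 1 D \<and> (\<forall>j\<le>n. a j \<in> forms 1 (D + E)) \<and>
    (\<forall>v\<in>homog_coords 1. ev v h \<noteq> 0 \<longrightarrow> (\<forall>i<l. (\<Sum>j\<le>n. ev v (J i j) * ev v (a j)) = ev v (p i) * ev v h))"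
    for D h a
  \<comment> \<open>The members of a cover are plain open sets in \<open>H1_vanishes\<close>. The
    cover therefore consists of all sets that carry some local lift, and one lift is chosen for each
    of them.\<close>
  define \<U> where "\<U> = {principal 1 P1_points h | h. \<exists>D a. good D h a}"
  have "\<forall>U\<in>\<U>. \<exists>D h a. good D h a \<and> U = principal 1 P1_points h" by (auto simp: \<U>_def)
  then obtain D h a where Dha: "\<And>U. U \<in> \<U> \<Longrightarrow> good (D U) (h U) (a U)" "\<And>U. U \<in> \<U> \<Longrightarrow> U = principal 1 P1_points (h U)"
    by metis
  have h: "h U \<in> forms 1 (D U)" and a: "\<And>j. j \<le> n \<Longrightarrow> a U j \<in> forms 1 (D U + E)"
    and sol: "\<And>v i. v \<in> homog_coords 1 \<Longrightarrow> ev v (h U) \<noteq> 0 \<Longrightarrow> i < l \<Longrightarrow>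
      (\<Sum>j\<le>n. ev v (J i j) * ev v (a U j)) = ev v (p i) * ev v (h U)" if "U \<in> \<U>" for U
    using Dha(1)[OF that] by (auto simp: good_def)
  have inU: "line v \<in> U \<longleftrightarrow> ev v (h U) \<noteq> 0" if "U \<in> \<U>" "v \<in> homog_coords 1" for U v
    using in_principal[OF h[OF that(1)] that(2), of P1_points] Dha(2)[OF that(1)] that(2) by (auto simp: proj_space_eq)
  have Usub: "U \<subseteq> P1_points" if "U \<in> \<U>" for U using Dha(2)[OF that] principal_subset by metis
  have cover: "\<exists>U\<in>\<U>. line v \<in> U" if v: "v \<in> homog_coords 1" for v
  proof -
    obtain D' h' a' where 1: "good D' h' a'" "ev v h' \<noteq> 0" using local_solution[OF p v] unfolding good_def by blast
    then have "line v \<in> principal 1 P1_points h'" using v by (auto simp: principal_def proj_space_eq)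
    then show ?thesis using 1 unfolding \<U>_def by blast
  qed
  \<comment> \<open>\<open>A U V\<close> over \<open>H U V\<close> is the difference of the lifts on
    \<open>V\<close> and \<open>U\<close>. Both solve the same inhomogeneous system, so that the
    difference is a tangent direction.\<close>
  define A where "A U V j = a V j * h U - a U j * h V" for U V j
  define H where "H U V = h U * h V" for U V
  define c where "c U V = rational_section (A U V) (H U V) (U \<inter> V)" for U V
  have Aform: "A U V j \<in> forms 1 (D U + D V + E)" if "U \<in> \<U>" "V \<in> \<U>" "j \<le> n" for U V j
    using forms_mult[OF a[OF that(2,3)] h[OF that(1)]] forms_mult[OF a[OF that(1,3)] h[OF that(2)]]
    unfolding A_def by (intro forms_diff) (simp_all add: add_ac)
  have Hform: "H U V \<in> forms 1 (D U + D V)" if "U \<in> \<U>" "V \<in> \<U>" for U V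
    unfolding H_def using h that by (intro forms_mult)
  have tan: "(\<Sum>j\<le>n. ev v (J i j) * ev v (A U V j)) = 0"
    if "U \<in> \<U>" "V \<in> \<U>" "v \<in> homog_coords 1" "ev v (H U V) \<noteq> 0" "i < l" for U V v i
  proof -
    have nzUV: "ev v (h U) \<noteq> 0" "ev v (h V) \<noteq> 0" using that(4) by (auto simp: H_def poly_eval_homs)
    have "(\<Sum>j\<le>n. ev v (J i j) * ev v (A U V j)) =
      (\<Sum>j\<le>n. ev v (J i j) * ev v (a V j)) * ev v (h U) - (\<Sum>j\<le>n. ev v (J i j) * ev v (a U j)) * ev v (h V)"
      unfolding A_def poly_eval_homs sum_distrib_right sum_subtractf[symmetric]
      by (intro sum.cong) (auto simp: algebra_simps)
    then show ?thesis using sol[OF that(1,3) nzUV(1) that(5)] sol[OF that(2,3) nzUV(2) that(5)] by simp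
  qed
  have UV: "U \<inter> V = principal 1 P1_points (H U V)" if "U \<in> \<U>" "V \<in> \<U>" for U V
    unfolding H_def principal_mult[OF h[OF that(1)] h[OF that(2)]] using Dha(2) that by metis
  note ctx = Aform Hform tan UV
  have cmem: "c U V \<in> pullback_tangent P1 ?X \<mu> (U \<inter> V)" if "U \<in> \<U>" "V \<in> \<U>" for U V
    unfolding c_def by (rule rational_section_pullback[OF ctx(1)[OF that] ctx(2)[OF that] ctx(3)[OF that] ctx(4)[OF that]])
  define w where "w U v j = ev v (a U j) / ev v (h U)" for U v j
  have cline: "c U V (line v) f = tangent_derivation (Y v) (\<lambda>j. w V v j - w U v j) f"
    if "U \<in> \<U>" "V \<in> \<U>" "v \<in> homog_coords 1" "line v \<in> U" "line v \<in> V" for U V v f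
  proof -
    have nzv: "ev v (h U) \<noteq> 0" "ev v (h V) \<noteq> 0" using inU that by auto
    have "line v \<in> U \<inter> V" using that by auto
    have "c U V (line v) f = tangent_derivation (Y v) (\<lambda>j. ev v (A U V j) / ev v (H U V)) f"
      unfolding c_def
      by (rule rational_section_line[OF ctx(1)[OF that(1,2)] ctx(2)[OF that(1,2)] ctx(3)[OF that(1,2)]
          ctx(4)[OF that(1,2)] that(3) \<open>line v \<in> U \<inter> V\<close>])
    also have "(\<lambda>j. ev v (A U V j) / ev v (H U V)) = (\<lambda>j. w V v j - w U v j)"
      using nzv by (auto simp: A_def H_def w_def poly_eval_homs field_simps)
    finally show ?thesis .
  qed
  have tand: "tangent_dir (Y v) (\<lambda>j. w V v j - w U v j)"
    if "U \<in> \<U>" "V \<in> \<U>" "v \<in> homog_coords 1" "line v \<in> U" "line v \<in> V" for U V v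
  proof -
    have nzv: "ev v (h U) \<noteq> 0" "ev v (h V) \<noteq> 0" using inU that by auto
    have "(\<lambda>j. ev v (A U V j) / ev v (H U V)) = (\<lambda>j. w V v j - w U v j)"
      using nzv by (auto simp: A_def H_def w_def poly_eval_homs field_simps)
    moreover have "ev v (H U V) \<noteq> 0" using nzv by (simp add: H_def poly_eval_homs)
    ultimately show ?thesis
      using tangent_dir_ratio[OF ctx(1)[OF that(1,2)] ctx(2)[OF that(1,2)] ctx(3)[OF that(1,2)]
          ctx(4)[OF that(1,2)] that(3)] by simp
  qed
  have "morphism P1 ?X \<mu>" using is_morphism by (simp add: P1_def)
  then have "H1_vanishes (ftop P1) (pullback_tangent P1 ?X \<mu>)"
    using conv by (simp add: convex_variety_def unobstructed_def)
  moreover have "\<forall>U\<in>\<U>. openin (ftop P1) U"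
    using Dha(2) openin_principal[OF h] by (metis P1_def ftop_proj_variety)
  moreover have "\<Union>\<U> = topspace (ftop P1)"
  proof -
    have "topspace (ftop P1) = P1_points" by (simp add: P1_def topspace_proj_variety)
    moreover have "\<Union>\<U> \<subseteq> P1_points" by (intro Union_least Usub)
    moreover have "P1_points \<subseteq> \<Union>\<U>"
    proof
      fix t assume "t \<in> P1_points"
      then obtain v where v: "v \<in> homog_coords 1" "t = line v" by (auto simp: proj_space_eq)
      then show "t \<in> \<Union>\<U>" using cover[OF v(1)] by blast
    qed
    ultimately show ?thesis by simp
  qed
  moreover have "\<forall>U\<in>\<U>. \<forall>V\<in>\<U>. c U V \<in> pullback_tangent P1 ?X \<mu> (U \<inter> V)" using cmem by blast
  moreover have "\<forall>U\<in>\<U>. \<forall>V\<in>\<U>. \<forall>W\<in>\<U>. \<forall>t\<in>U \<inter> V \<inter> W. c U V t + c V W t = c U W t"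
  proof (intro ballI)
    fix U V W t assume UVW: "U \<in> \<U>" "V \<in> \<U>" "W \<in> \<U>" and t: "t \<in> U \<inter> V \<inter> W"
    have "t \<in> P1_points" using Usub[OF UVW(1)] t by blast
    then obtain v where v: "v \<in> homog_coords 1" "t = line v" by (auto simp: proj_space_eq)
    have l: "line v \<in> U" "line v \<in> V" "line v \<in> W" using t v by auto
    have "c U W (line v) f = c U V (line v) f + c V W (line v) f" for f
    proof -
      have "(\<lambda>j. w W v j - w U v j) = (\<lambda>j. (w V v j - w U v j) + (w W v j - w V v j))" by auto
      then show ?thesis
        using tangent_derivation_add[OF nz[OF v(1)] line_Y[OF v(1)] tand[OF UVW(1,2) v(1) l(1,2)] tand[OF UVW(2,3) v(1) l(2,3)], of f]
        by (simp add: cline UVW v(1) l)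
    qed
    then show "c U V t + c V W t = c U W t" by (simp add: v(2) fun_eq_iff)
  qed
  ultimately have "\<exists>b. (\<forall>U\<in>\<U>. b U \<in> pullback_tangent P1 ?X \<mu> U) \<and>
      (\<forall>U\<in>\<U>. \<forall>V\<in>\<U>. \<forall>t\<in>U \<inter> V. c U V t = b V t - b U t)"
    unfolding H1_vanishes_def by blast
  then obtain b where b: "\<And>U. U \<in> \<U> \<Longrightarrow> b U \<in> pullback_tangent P1 ?X \<mu> U"
    and cb: "\<And>U V t. U \<in> \<U> \<Longrightarrow> V \<in> \<U> \<Longrightarrow> t \<in> U \<Longrightarrow> t \<in> V \<Longrightarrow> c U V t = b V t - b U t" by blast
  have bt: "b U (line v) \<in> tangent_space ?X (line (Y v))" if "U \<in> \<U>" "v \<in> homog_coords 1" "line v \<in> U" for U v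
    using b[OF that(1)] that(3) map_line[OF that(2)] by (auto simp: pullback_tangent_def)
  \<comment> \<open>The lift minus the vector given by the derivation \<open>b U\<close>. For a
    direction \<open>w\<close> the derivation of \<open>x_j / x_e\<close>, multiplied by
    \<open>x_e\<close>, is \<open>w_j - (x_j / x_e) * w_e\<close>; hence the factor
    \<open>ev v (M e)\<close>, and the ambiguity by multiples of the point.\<close>
  define x where "x U e j v = w U v j - ev v (M e) * b U (line v) (affine_coord n e j)" for U e j v
  define \<Phi> where "\<Phi> U e j k v = x U e j v * ev v (M k) - x U e k v * ev v (M j)" for U e j k v
  have x_cover: "\<exists>\<kappa>. \<forall>j\<le>n. x V e j v = x U e j v + \<kappa> * ev v (M j)"
    if UV: "U \<in> \<U>" "V \<in> \<U>" and v: "v \<in> homog_coords 1" "line v \<in> U" "line v \<in> V" and e: "e \<le> n" "ev v (M e) \<noteq> 0" for U V v e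
  proof (intro exI[of _ "(w V v e - w U v e) / ev v (M e)"] allI impI)
    fix j assume j: "j \<le> n"
    have Ye: "Y v $ e = ev v (M e)" "Y v $ j = ev v (M j)" using e j by (simp_all add: tuple_vec_index)
    have "b V (line v) (affine_coord n e j) - b U (line v) (affine_coord n e j) = c U V (line v) (affine_coord n e j)"
      using cb[OF UV v(2,3)] by simp
    also have "\<dots> = ((w V v j - w U v j) * ev v (M e) - ev v (M j) * (w V v e - w U v e)) / (ev v (M e))\<^sup>2"
      using tangent_derivation_affine_coord[OF nz[OF v(1)] line_Y[OF v(1)] tand[OF UV v] e(1) j] e(2)
      by (simp add: cline UV v Ye)
    finally have "ev v (M e) * b V (line v) (affine_coord n e j) = ev v (M e) * b U (line v) (affine_coord n e j) +
      ((w V v j - w U v j) * ev v (M e) - ev v (M j) * (w V v e - w U v e)) / ev v (M e)"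
      using e(2) by (simp add: field_simps power2_eq_square)
    then show "x V e j v = x U e j v + (w V v e - w U v e) / ev v (M e) * ev v (M j)"
      unfolding x_def using e(2) by (simp add: diff_divide_distrib) (simp add: algebra_simps diff_divide_distrib)
  qed
  have x_chart: "\<exists>\<kappa>. \<forall>j\<le>n. x U e j v = x U e' j v + \<kappa> * ev v (M j)"
    if U: "U \<in> \<U>" and v: "v \<in> homog_coords 1" "line v \<in> U" and e: "e \<le> n" "ev v (M e) \<noteq> 0" "e' \<le> n" "ev v (M e') \<noteq> 0" for U v e e'
  proof (intro exI[of _ "- ev v (M e) / ev v (M e') * b U (line v) (affine_coord n e e')"] allI impI)
    fix j assume j: "j \<le> n"
    have "b U (line v) (affine_coord n e j) = ev v (M j) / ev v (M e') * b U (line v) (affine_coord n e e')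
      + ev v (M e') / ev v (M e) * b U (line v) (affine_coord n e' j)"
      using derivation_change_chart[OF nz[OF v(1)] line_Y[OF v(1)] bt[OF U v] e(1) _ e(3) _ j] e j
      by (simp add: tuple_vec_index)
    then show "x U e j v = x U e' j v + - ev v (M e) / ev v (M e') * b U (line v) (affine_coord n e e') * ev v (M j)"
      unfolding x_def using e by (simp add: field_simps)
  qed
  have indep: "\<Phi> U e j k v = \<Phi> V e' j k v"
    if UV: "U \<in> \<U>" "V \<in> \<U>" and v: "v \<in> homog_coords 1" "line v \<in> U" "line v \<in> V"
      and e: "e \<le> n" "ev v (M e) \<noteq> 0" "e' \<le> n" "ev v (M e') \<noteq> 0" and jk: "j \<le> n" "k \<le> n" for U V v e e' j k
  proof -
    obtain \<kappa> where \<kappa>: "\<And>j. j \<le> n \<Longrightarrow> x V e j v = x U e j v + \<kappa> * ev v (M j)" using x_cover[OF UV v e(1,2)] by blast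
    obtain \<kappa>' where \<kappa>': "\<And>j. j \<le> n \<Longrightarrow> x V e j v = x V e' j v + \<kappa>' * ev v (M j)" using x_chart[OF UV(2) v(1,3) e] by blast
    have "\<Phi> U e j k v = \<Phi> V e j k v" unfolding \<Phi>_def \<kappa>[OF jk(1)] \<kappa>[OF jk(2)] by (simp add: algebra_simps)
    also have "\<dots> = \<Phi> V e' j k v" unfolding \<Phi>_def \<kappa>'[OF jk(1)] \<kappa>'[OF jk(2)] by (simp add: algebra_simps)
    finally show ?thesis .
  qed
  have ex: "\<exists>U e. U \<in> \<U> \<and> line v \<in> U \<and> e \<le> n \<and> ev v (M e) \<noteq> 0" if v: "v \<in> homog_coords 1" for v
  proof -
    obtain e where "e \<le> n" "ev v (M e) \<noteq> 0" using nz[OF v] by (auto simp: homog_coords_iff tuple_vec_index)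
    then show ?thesis using cover[OF v] by blast
  qed
  then obtain U0 e0 where U0: "\<And>v. v \<in> homog_coords 1 \<Longrightarrow> U0 v \<in> \<U> \<and> line v \<in> U0 v \<and> e0 v \<le> n \<and> ev v (M (e0 v)) \<noteq> 0"
    by metis
  define \<phi> where "\<phi> j k v = \<Phi> (U0 v) (e0 v) j k v" for j k v
  have \<phi>: "\<phi> j k v = \<Phi> U e j k v" if "U \<in> \<U>" "v \<in> homog_coords 1" "line v \<in> U" "e \<le> n" "ev v (M e) \<noteq> 0" "j \<le> n" "k \<le> n" for U e j k v
    unfolding \<phi>_def using U0[OF that(2)] that by (intro indep) auto
  \<comment> \<open>The common denominator is that of the lift times those of the two coordinate
    derivatives. The excess of degree \<open>2 * E\<close> comes from the lift and from
    \<open>M\<close>, each contributing \<open>E\<close>.\<close>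
  have "\<exists>P\<in>forms 1 (2 * E). \<forall>v\<in>homog_coords 1. \<phi> j k v = ev v P" if jk: "j \<le> n" "k \<le> n" for j k
  proof (rule global_section_form)
    fix u assume u: "u \<in> homog_coords 1"
    obtain U e where U: "U \<in> \<U>" "line u \<in> U" and e: "e \<le> n" "ev u (M e) \<noteq> 0" using ex[OF u] by blast
    obtain D1 g1 h1 where 1: "g1 \<in> forms 1 D1" "h1 \<in> forms 1 D1" "ev u h1 \<noteq> 0"
      "\<And>v. v \<in> homog_coords 1 \<Longrightarrow> ev v h1 \<noteq> 0 \<Longrightarrow>
        line v \<in> U \<and> ev v (M e) \<noteq> 0 \<and> b U (line v) (affine_coord n e j) = ev v g1 / ev v h1"
      using section_coord_fraction[OF b[OF U(1)] Usub[OF U(1)] u U(2) e jk(1)] by blast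
    obtain D2 g2 h2 where 2: "g2 \<in> forms 1 D2" "h2 \<in> forms 1 D2" "ev u h2 \<noteq> 0"
      "\<And>v. v \<in> homog_coords 1 \<Longrightarrow> ev v h2 \<noteq> 0 \<Longrightarrow>
        line v \<in> U \<and> ev v (M e) \<noteq> 0 \<and> b U (line v) (affine_coord n e k) = ev v g2 / ev v h2"
      using section_coord_fraction[OF b[OF U(1)] Usub[OF U(1)] u U(2) e jk(2)] by blast
    define num where "num = (a U j * h1 - M e * g1 * h U) * h2 * M k - (a U k * h2 - M e * g2 * h U) * h1 * M j"
    have "(a U j * h1 - M e * g1 * h U) * h2 * M k \<in> forms 1 (D U + E + D1 + D2 + E)"
    proof (intro forms_mult[OF forms_mult[OF forms_diff]] M jk 2)
      show "a U j * h1 \<in> forms 1 (D U + E + D1)" using a[OF U(1) jk(1)] 1 by (intro forms_mult)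
      have "M e * g1 * h U \<in> forms 1 (E + D1 + D U)" using M e 1 h[OF U(1)] by (intro forms_mult) auto
      then show "M e * g1 * h U \<in> forms 1 (D U + E + D1)" by (simp add: add_ac)
    qed
    moreover have "(a U k * h2 - M e * g2 * h U) * h1 * M j \<in> forms 1 (D U + E + D2 + D1 + E)"
    proof (intro forms_mult[OF forms_mult[OF forms_diff]] M jk 1)
      show "a U k * h2 \<in> forms 1 (D U + E + D2)" using a[OF U(1) jk(2)] 2 by (intro forms_mult)
      have "M e * g2 * h U \<in> forms 1 (E + D2 + D U)" using M e 2 h[OF U(1)] by (intro forms_mult) auto
      then show "M e * g2 * h U \<in> forms 1 (D U + E + D2)" by (simp add: add_ac)
    qed
    ultimately have "num \<in> forms 1 (D U + D1 + D2 + 2 * E)"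
      unfolding num_def by (intro forms_diff) (simp_all add: add_ac mult_2)
    moreover have "h U * h1 * h2 \<in> forms 1 (D U + D1 + D2)" using h[OF U(1)] 1 2 by (intro forms_mult)
    moreover have "ev u (h U * h1 * h2) \<noteq> 0" using inU[OF U(1) u] U(2) 1 2 by (simp add: poly_eval_homs)
    moreover have "\<phi> j k v * ev v (h U * h1 * h2) = ev v num" if v: "v \<in> homog_coords 1" "ev v (h U * h1 * h2) \<noteq> 0" for v
    proof -
      have nzv: "ev v (h U) \<noteq> 0" "ev v h1 \<noteq> 0" "ev v h2 \<noteq> 0" using v(2) by (auto simp: poly_eval_homs)
      have g: "ev v g1 = b U (line v) (affine_coord n e j) * ev v h1" "ev v g2 = b U (line v) (affine_coord n e k) * ev v h2"
        using 1(4)[OF v(1) nzv(2)] 2(4)[OF v(1) nzv(3)] nzv by simp_all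
      have "\<phi> j k v = \<Phi> U e j k v" using 1(4)[OF v(1) nzv(2)] U(1) v(1) e(1) jk by (intro \<phi>) auto
      also have "\<dots> * ev v (h U * h1 * h2) = ev v num"
        unfolding \<Phi>_def x_def w_def num_def poly_eval_homs g using nzv(1) by (simp add: field_simps)
      finally show ?thesis .
    qed
    ultimately show "\<exists>D a h. a \<in> forms 1 (D + 2 * E) \<and> h \<in> forms 1 D \<and> ev u h \<noteq> 0 \<and>
      (\<forall>v\<in>homog_coords 1. ev v h \<noteq> 0 \<longrightarrow> \<phi> j k v * ev v h = ev v a)" by blast
  qed
  then obtain V where V: "\<And>j k. j \<le> n \<Longrightarrow> k \<le> n \<Longrightarrow> V j k \<in> forms 1 (2 * E)"
    "\<And>j k v. j \<le> n \<Longrightarrow> k \<le> n \<Longrightarrow> v \<in> homog_coords 1 \<Longrightarrow> \<phi> j k v = ev v (V j k)" by metis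
  have "\<exists>w. \<forall>j\<le>n. w j \<in> forms 1 E \<and> (\<forall>k\<le>n. \<forall>v\<in>homog_coords 1.
    ev v (V j k) = ev v (w j) * ev v (M k) - ev v (w k) * ev v (M j))"
  proof (rule wedge_decomposition[OF M _ V(1)])
    show "\<exists>j\<le>n. ev v (M j) \<noteq> 0" if "v \<in> homog_coords 1" for v
      using nz[OF that] by (auto simp: homog_coords_iff tuple_vec_index)
    show "ev v (V j k) * ev v (M i) + ev v (V k i) * ev v (M j) + ev v (V i j) * ev v (M k) = 0"
      if "i \<le> n" "j \<le> n" "k \<le> n" "v \<in> homog_coords 1" for i j k v
      using that by (simp add: V(2)[symmetric] \<phi>_def \<Phi>_def algebra_simps)
    show "ev v (V j k) = - ev v (V k j)" if "j \<le> n" "k \<le> n" "v \<in> homog_coords 1" for j k v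
      using that by (simp add: V(2)[symmetric] \<phi>_def \<Phi>_def)
  qed
  then obtain W where W: "\<And>j. j \<le> n \<Longrightarrow> W j \<in> forms 1 E"
    "\<And>j k v. j \<le> n \<Longrightarrow> k \<le> n \<Longrightarrow> v \<in> homog_coords 1 \<Longrightarrow>
      ev v (V j k) = ev v (W j) * ev v (M k) - ev v (W k) * ev v (M j)" by blast
  have "(\<Sum>j\<le>n. ev v (J i j) * ev v (W j)) = ev v (p i)" if v: "v \<in> homog_coords 1" and i: "i < l" for v i
  proof -
    obtain U e where U: "U \<in> \<U>" "line v \<in> U" and e: "e \<le> n" "ev v (M e) \<noteq> 0" using ex[OF v] by blast
    have JM: "(\<Sum>j\<le>n. ev v (J i j) * ev v (M j)) = 0"
    proof -
      have "(\<Sum>j\<le>n. ev v (J i j) * ev v (M j)) = (\<Sum>j\<le>n. Y v $ j * ev (Y v) (partial_deriv j (F i)))"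
        by (intro sum.cong) (auto simp: ev_J[OF i] tuple_vec_index)
      also have "\<dots> = 0" using euler_forms[OF F[OF i]] on_Z[OF v i] by simp
      finally show ?thesis .
    qed
    have Jw: "(\<Sum>j\<le>n. ev v (J i j) * w U v j) = ev v (p i)"
    proof -
      have "ev v (h U) \<noteq> 0" using inU[OF U(1) v] U(2) by simp
      then show ?thesis using sol[OF U(1) v _ i] by (simp add: w_def flip: sum_divide_distrib)
    qed
    have Jb: "(\<Sum>j\<le>n. ev v (J i j) * b U (line v) (affine_coord n e j)) = 0"
    proof -
      have "Y v $ e \<noteq> 0" using e by (simp add: tuple_vec_index)
      from derivation_tangent_dir[OF nz[OF v] line_Y[OF v] bt[OF U(1) v U(2)] e(1) this]
      show ?thesis using i by (simp add: tangent_dir_def dir_deriv_Y)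
    qed
    have "(\<Sum>j\<le>n. ev v (J i j) * x U e j v) =
      (\<Sum>j\<le>n. ev v (J i j) * w U v j) - ev v (M e) * (\<Sum>j\<le>n. ev v (J i j) * b U (line v) (affine_coord n e j))"
      unfolding x_def sum_distrib_left sum_subtractf[symmetric] by (intro sum.cong) (auto simp: algebra_simps)
    then have Jx: "(\<Sum>j\<le>n. ev v (J i j) * x U e j v) = ev v (p i)" using Jw Jb by simp
    \<comment> \<open>The Jacobian is applied to column \<open>e\<close> of the bivector in two
      ways, through the global \<open>W\<close> and through the local \<open>x\<close>. The terms
      with the point itself drop out by \<open>JM\<close>, and \<open>ev v (M e)\<close> can be
      cancelled.\<close>
    have "(\<Sum>j\<le>n. ev v (J i j) * ev v (V j e)) = (\<Sum>j\<le>n. ev v (J i j) * ev v (W j)) * ev v (M e) -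
      ev v (W e) * (\<Sum>j\<le>n. ev v (J i j) * ev v (M j))"
      unfolding sum_distrib_left sum_distrib_right sum_subtractf[symmetric]
      by (intro sum.cong refl) (simp add: W(2)[OF _ e(1) v], simp add: algebra_simps)
    moreover have "(\<Sum>j\<le>n. ev v (J i j) * ev v (V j e)) = (\<Sum>j\<le>n. ev v (J i j) * x U e j v) * ev v (M e) -
      x U e e v * (\<Sum>j\<le>n. ev v (J i j) * ev v (M j))"
      unfolding sum_distrib_left sum_distrib_right sum_subtractf[symmetric]
      by (intro sum.cong refl)
        (simp add: V(2)[OF _ e(1) v, symmetric] \<phi>[OF U(1) v U(2) e _ e(1)] \<Phi>_def, simp add: algebra_simps)
    ultimately have "(\<Sum>j\<le>n. ev v (J i j) * ev v (W j)) * ev v (M e) = ev v (p i) * ev v (M e)"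
      using JM Jx by auto
    then show ?thesis using e(2) by simp
  qed
  then show ?thesis using W(1) by blast
qed

end

section \<open>Twisting down by double covers\<close>

text \<open>In the decomposition of \<open>p\<close> as \<open>p0 (s^2) + s * p1 (s^2)\<close> this
  is \<open>p1\<close>. Geometrically it is the projection onto the summand O(-1) of the direct
  image of O under the squaring map. The bound \<open>degree p\<close> on the summation is generous;
  all further coefficients vanish.\<close>

definition odd_part :: "complex poly \<Rightarrow> complex poly" where
  "odd_part p = (\<Sum>k\<le>degree p. monom (coeff p (2 * k + 1)) k)"

lemma coeff_odd_part: "coeff (odd_part p) k = coeff p (2 * k + 1)"
proof -
  have "coeff (odd_part p) k = (\<Sum>i\<le>degree p. if i = k then coeff p (2 * k + 1) else 0)"
    unfolding odd_part_def coeff_sum by (intro sum.cong) auto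
  also have "\<dots> = coeff p (2 * k + 1)" by (auto simp: coeff_eq_0)
  finally show ?thesis .
qed

lemma odd_part_add: "odd_part (p + q) = odd_part p + odd_part q"
  and odd_part_smult: "odd_part (Polynomial.smult c p) = Polynomial.smult c (odd_part p)"
  and odd_part_0: "odd_part 0 = 0"
  by (intro poly_eqI; simp add: coeff_odd_part)+

lemma odd_part_sum: "odd_part (\<Sum>i\<in>A. f i) = (\<Sum>i\<in>A. odd_part (f i))"
  by (induction A rule: infinite_finite_induct) (simp_all add: odd_part_add odd_part_0)

lemma odd_part_X2: "odd_part (monom 1 2 * p) = [:0, 1:] * odd_part p"
  by (intro poly_eqI) (auto simp: coeff_odd_part coeff_monom_mult coeff_pCons numeral_2_eq_2 One_nat_def split: nat.splits)

text \<open>Taking odd parts is linear over the polynomials in the square of the variable, that is,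
  over functions on the base of the double cover.\<close>

lemma odd_part_pcompose: "odd_part (pcompose a (monom 1 2) * p) = a * odd_part p"
proof (induction a)
  case (pCons c a)
  have "pcompose (pCons c a) (monom 1 2) * p = Polynomial.smult c p + monom 1 2 * (pcompose a (monom 1 2) * p)"
    by (simp add: pcompose_pCons algebra_simps)
  then show ?case by (simp add: odd_part_add odd_part_smult odd_part_X2 pCons)
qed (simp add: odd_part_0)

lemma odd_part_X: "odd_part [:0, 1:] = 1"
  by (intro poly_eqI) (auto simp: coeff_odd_part coeff_pCons split: nat.splits)

definition square_vars :: "nat \<Rightarrow> nat cpoly" where
  "square_vars i = Var i ^ 2"

lemma square_vars_forms: "i \<le> n \<Longrightarrow> square_vars i \<in> forms n 2"
  using forms_power[OF forms_Var, of i n 2] by (simp add: square_vars_def)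

lemma dehomog_square: "F \<in> forms 1 D \<Longrightarrow> dehomog (poly_subst square_vars F) = pcompose (dehomog F) (monom 1 2)"
proof -
  assume F: "F \<in> forms 1 D"
  have "dehomog (poly_subst square_vars F) = poly_curve (\<lambda>i. if i = 0 then monom 1 2 else 1) F"
    unfolding dehomog_def poly_curve_subst
    by (rule arg_cong2[of _ _ _ _ poly_curve]) (auto simp: square_vars_def poly_curve_homs x_as_monom monom_power)
  moreover have "pcompose (dehomog F) (monom 1 2) = poly_curve (\<lambda>i. if i = 0 then monom 1 2 else 1) F"
    unfolding dehomog_def poly_curve_def
    by (subst hom_gev[OF pcompose_hom.comm_ring_hom_axioms])
      (rule arg_cong2[of _ _ _ _ "\<lambda>x y. gev x y F"]; auto simp: pcompose_pCons fun_eq_iff)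
  ultimately show ?thesis by simp
qed

lemma poly_subst_compose: "poly_subst \<sigma> (poly_subst \<tau> G) = poly_subst (\<lambda>j. poly_subst \<sigma> (\<tau> j)) G"
  unfolding poly_subst_def
  by (subst hom_gev[OF gev_hom[OF hom_Cst]]) (simp add: gev_Cst[OF hom_Cst])

definition square_vec :: "complex vec \<Rightarrow> complex vec" where
  "square_vec v = vec (Suc 1) (\<lambda>i. (v $ i)\<^sup>2)"

lemma square_vec_homog_coords: "v \<in> homog_coords 1 \<Longrightarrow> square_vec v \<in> homog_coords 1"
  by (auto simp: homog_coords_iff square_vec_def)

lemma ev_square: "F \<in> forms 1 D \<Longrightarrow> ev v (poly_subst square_vars F) = ev (square_vec v) F"
  unfolding poly_eval_subst
  by (rule poly_eval_cong_polys_in[OF forms_polys_in]) (auto simp: square_vars_def poly_eval_homs square_vec_def)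

lemma fun_sum_apply: "(\<Sum>x\<in>A. f x) j = (\<Sum>x\<in>A. f x j)" for f :: "'a \<Rightarrow> 'b \<Rightarrow> 'c::comm_monoid_add"
  by (induction A rule: infinite_finite_induct) auto

context rational_curve_in
begin

abbreviation "JJ i j \<equiv> dehomog (J i j)"

text \<open>The right-hand side \<open>q (s^2) * s\<close> is lifted along the curve composed with
  squaring, which convexity also covers. The Jacobian there depends only on \<open>s^2\<close>, so
  the odd parts of the lift solve the original system. A lift of degree at most \<open>2 * E\<close>
  has odd part of degree less than \<open>E\<close>, which is the twist.\<close>

theorem convex_surjective_twist:
  assumes conv: "convex_variety (proj_variety n Z)" and E: "1 \<le> E"
    and q: "\<And>i k. i < l \<Longrightarrow> d i * E \<le> k \<Longrightarrow> coeff (q i) k = 0"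
  shows "\<exists>u. (\<forall>j\<le>n. \<forall>k\<ge>E. coeff (u j) k = 0) \<and> (\<forall>i<l. (\<Sum>j\<le>n. JJ i j * u j) = q i)"
proof -
  define M2 where "M2 j = poly_subst square_vars (M j)" for j
  have tv: "tuple_vec n M2 v = Y (square_vec v)" if v: "v \<in> homog_coords 1" for v
    using ev_square[OF M] by (intro eq_vecI) (auto simp: tuple_vec_def M2_def less_Suc_eq_le)
  interpret D: rational_curve_in n l F d Z "2 * E" M2
  proof
    show "M2 j \<in> forms 1 (2 * E)" if "j \<le> n" for j
      unfolding M2_def using poly_subst_forms[OF M[OF that] square_vars_forms] by (simp add: mult.commute)
    show "ev (tuple_vec n M2 v) (F i) = 0" if "v \<in> homog_coords 1" "i < l" for v i
      using tv nz on_Z that square_vec_homog_coords by auto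
    show "tuple_vec n M2 v \<in> homog_coords n" if "v \<in> homog_coords 1" for v
      using tv nz that square_vec_homog_coords by auto
  qed (rule d1)
  have J2: "dehomog (D.J i j) = pcompose (JJ i j) (monom 1 2)" if "i < l" for i j
    using dehomog_square[OF J_forms[OF that], of j] unfolding M2_def poly_subst_compose .
  define p where "p i = pcompose (q i) (monom 1 2) * [:0, 1:]" for i
  have dq: "degree (p i) \<le> d i * (2 * E)" if i: "i < l" for i
  proof (cases "q i = 0")
    case False
    have "degree (q i) < d i * E"
      using q[OF i, of "degree (q i)"] False by (meson leading_coeff_0_iff not_less)
    have dX: "degree (monom (1::complex) 2) = 2" by (rule degree_monom_eq) simp
    have "degree (p i) \<le> degree (pcompose (q i) (monom 1 2)) + degree [:0, 1 :: complex:]"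
      unfolding p_def by (rule degree_mult_le)
    also have "\<dots> \<le> degree (q i) * 2 + 1"
      using degree_pcompose_le[of "q i" "monom 1 2"] unfolding dX by (simp add: One_nat_def)
    finally have "degree (p i) \<le> degree (q i) * 2 + 1" .
    then show ?thesis using \<open>degree (q i) < d i * E\<close> by simp
  qed (simp add: p_def)
  have "\<exists>w. (\<forall>j\<le>n. w j \<in> forms 1 (2 * E)) \<and> (\<forall>v\<in>homog_coords 1. \<forall>i<l.
    (\<Sum>j\<le>n. ev v (D.J i j) * ev v (w j)) = ev v (homogenize (d i * (2 * E)) (p i)))"
    by (rule D.convex_surjective[OF conv]) (rule homogenize_forms)
  then obtain w where w: "\<And>j. j \<le> n \<Longrightarrow> w j \<in> forms 1 (2 * E)"
    "\<And>v i. v \<in> homog_coords 1 \<Longrightarrow> i < l \<Longrightarrow>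
      (\<Sum>j\<le>n. ev v (D.J i j) * ev v (w j)) = ev v (homogenize (d i * (2 * E)) (p i))" by blast
  have eq: "(\<Sum>j\<le>n. pcompose (JJ i j) (monom 1 2) * dehomog (w j)) = p i" if i: "i < l" for i
  proof -
    let ?G = "(\<Sum>j\<le>n. D.J i j * w j) - homogenize (d i * (2 * E)) (p i)"
    have "D.J i j * w j \<in> forms 1 (d i * (2 * E))" if "j \<le> n" for j
    proof -
      have "(d i - 1) * (2 * E) + 2 * E = d i * (2 * E)" using d1[OF i] by (cases "d i") auto
      then show ?thesis using forms_mult[OF D.J_forms[OF i] w(1)[OF that]] by metis
    qed
    then have "?G \<in> forms 1 (d i * (2 * E))" using homogenize_forms by (intro forms_diff forms_sum) auto
    moreover have "\<forall>v\<in>homog_coords 1. ev v ?G = 0" using w(2) i by (simp add: poly_eval_homs)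
    ultimately have "dehomog ?G = 0" using dehomog_eq_0_iff by blast
    then show ?thesis by (simp add: dehomog_homs J2[OF i] dehomog_homogenize[OF dq[OF i]])
  qed
  define u where "u j = odd_part (dehomog (w j))" for j
  have "(\<Sum>j\<le>n. JJ i j * u j) = q i" if i: "i < l" for i
  proof -
    have "(\<Sum>j\<le>n. JJ i j * u j) = odd_part (p i)"
      unfolding eq[OF i, symmetric] odd_part_sum odd_part_pcompose u_def ..
    also have "\<dots> = q i" unfolding p_def odd_part_pcompose odd_part_X by simp
    finally show ?thesis .
  qed
  moreover have "coeff (u j) k = 0" if "j \<le> n" "E \<le> k" for j k
    using degree_dehomog[OF w(1)[OF that(1)]] that(2) by (simp add: u_def coeff_odd_part coeff_eq_0)
  ultimately show ?thesis by blast
qed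

text \<open>The surjective map of the twisted-down bundles has the velocity of the curve in its kernel,
  so its source has strictly larger dimension than its target.\<close>

theorem convex_degree_bound:
  assumes conv: "convex_variety (proj_variety n Z)" and E: "1 \<le> E"
  shows "(\<Sum>i<l. d i) \<le> n"
proof (rule ccontr)
  assume big: "\<not> ?thesis"
  define m where "m = (\<lambda>j. dehomog (M j))"
  have JJ: "JJ i j = poly_curve m (partial_deriv j (F i))" for i j
    by (simp only: dehomog_def poly_curve_subst m_def)
  have Fm: "poly_curve m (F i) = 0" if i: "i < l" for i
  proof -
    have "poly_subst M (F i) \<in> forms 1 (d i * E)" by (rule subst_forms[OF F[OF i]])
    moreover have "\<forall>v\<in>homog_coords 1. ev v (poly_subst M (F i)) = 0"
    proof
      fix v :: "complex vec" assume "v \<in> homog_coords 1"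
      then show "ev v (poly_subst M (F i)) = 0" using on_Z[of v i] ev_subst[OF F[OF i], of v] i by simp
    qed
    ultimately have "dehomog (poly_subst M (F i)) = 0" using dehomog_eq_0_iff by blast
    then show ?thesis by (simp only: dehomog_def poly_curve_subst m_def)
  qed
  have dm: "degree (m j) \<le> E" if "j \<le> n" for j unfolding m_def by (rule degree_dehomog[OF M[OF that]])
  have "\<exists>\<kappa>. (\<forall>j\<le>n. \<forall>k\<ge>E. coeff (\<kappa> j) k = 0) \<and> (\<forall>i<l. (\<Sum>j\<le>n. JJ i j * \<kappa> j) = 0) \<and> (\<exists>j\<le>n. \<kappa> j \<noteq> 0)"
  proof (cases "\<exists>j\<le>n. pderiv (m j) \<noteq> 0")
    case True
    have "(\<Sum>j\<le>n. JJ i j * pderiv (m j)) = 0" if "i < l" for i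
      using pderiv_poly_curve[OF forms_polys_in[OF F[OF that]] finite_atMost, of m] Fm[OF that] by (simp add: JJ)
    moreover have "coeff (pderiv (m j)) k = 0" if "j \<le> n" "E \<le> k" for j k
      using dm[OF that(1)] that(2) by (simp add: coeff_pderiv coeff_eq_0)
    ultimately show ?thesis using True by (intro exI[of _ "\<lambda>j. pderiv (m j)"]) blast
  next
    case False
    \<comment> \<open>With zero velocity in the chart the kernel element is the tuple
      \<open>m\<close> itself: Euler's identity puts it in the kernel, and its degree 0 is below
      \<open>E\<close>.\<close>
    then have const: "degree (m j) = 0" if "j \<le> n" for j using that pderiv_eq_0_iff[of "m j"] by blast
    have "Y (pair_vec 0 1) \<in> homog_coords n" by (rule nz) simp
    then obtain j where j: "j \<le> n" "ev (pair_vec 0 1) (M j) \<noteq> 0"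
      by (auto simp: homog_coords_iff tuple_vec_index)
    then have "m j \<noteq> 0" using ev_dehomog[OF M[OF j(1)], of "pair_vec 0 1"] by (auto simp: m_def)
    moreover have "(\<Sum>j\<le>n. JJ i j * m j) = 0" if i: "i < l" for i
    proof -
      have "poly (\<Sum>j\<le>n. JJ i j * m j) s = 0" for s
      proof -
        have "poly (\<Sum>j\<le>n. JJ i j * m j) s =
          (\<Sum>j\<le>n. poly (m j) s * poly_eval (\<lambda>j. poly (m j) s) (partial_deriv j (F i)))"
          by (simp add: JJ poly_sum poly_poly_curve mult.commute)
        also have "\<dots> = of_nat (d i) * poly (poly_curve m (F i)) s"
          unfolding euler_forms[OF F[OF i]] poly_poly_curve ..
        finally show ?thesis using Fm[OF i] by simp
      qed
      then show ?thesis by (simp add: poly_eq_poly_eq_iff[symmetric] fun_eq_iff)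
    qed
    moreover have "coeff (m j) k = 0" if "j \<le> n" "E \<le> k" for j k
      using const[OF that(1)] that(2) E by (simp add: coeff_eq_0)
    ultimately show ?thesis using j(1) by (intro exI[of _ m]) blast
  qed
  then obtain \<kappa> where \<kappa>: "\<And>j k. j \<le> n \<Longrightarrow> E \<le> k \<Longrightarrow> coeff (\<kappa> j) k = 0"
    "\<And>i. i < l \<Longrightarrow> (\<Sum>j\<le>n. JJ i j * \<kappa> j) = 0" "\<exists>j\<le>n. \<kappa> j \<noteq> 0" by blast
  \<comment> \<open>A basis of the target: the monomial of degree \<open>k\<close> in component
    \<open>i\<close>, for \<open>k < d i * E\<close>.\<close>
  define L where "L = (SIGMA i:{..<l}. {..<d i * E})"
  have "\<forall>x\<in>L. \<exists>u. (\<forall>j\<le>n. \<forall>k\<ge>E. coeff (u j) k = 0) \<and>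
      (\<forall>i<l. (\<Sum>j\<le>n. JJ i j * u j) = (if i = fst x then monom 1 (snd x) else 0))"
  proof
    fix x assume "x \<in> L"
    then show "\<exists>u. (\<forall>j\<le>n. \<forall>k\<ge>E. coeff (u j) k = 0) \<and>
      (\<forall>i<l. (\<Sum>j\<le>n. JJ i j * u j) = (if i = fst x then monom 1 (snd x) else 0))"
      by (intro convex_surjective_twist[OF conv E]) (auto simp: L_def)
  qed
  from bchoice[OF this] obtain u where u': "\<forall>x\<in>L. (\<forall>j\<le>n. \<forall>k\<ge>E. coeff (u x j) k = 0) \<and>
      (\<forall>i<l. (\<Sum>j\<le>n. JJ i j * u x j) = (if i = fst x then monom 1 (snd x) else 0))" ..
  have u: "\<And>x j k. x \<in> L \<Longrightarrow> j \<le> n \<Longrightarrow> E \<le> k \<Longrightarrow> coeff (u x j) k = 0"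
    "\<And>x i. x \<in> L \<Longrightarrow> i < l \<Longrightarrow> (\<Sum>j\<le>n. JJ i j * u x j) = (if i = fst x then monom 1 (snd x) else 0)"
    using u' by auto
  \<comment> \<open>Lifts of all basis vectors together with the kernel element. They would be
    independent, which is one vector too many for a space of dimension \<open>(n + 1) * E\<close> if
    the sum of the degrees exceeded \<open>n\<close>. Components beyond \<open>n\<close> are set to
    zero so that these functions lie in the span of \<open>B\<close>.\<close>
  define r where "r = (\<lambda>x. case x of None \<Rightarrow> (\<lambda>j. if j \<le> n then \<kappa> j else 0) | Some x \<Rightarrow> (\<lambda>j. if j \<le> n then u x j else 0))"
  define T where "T = insert None (Some ` L)"
  define e :: "nat \<times> nat \<Rightarrow> nat \<Rightarrow> complex poly"
    where "e x = (\<lambda>j. if j = fst x then monom 1 (snd x) else 0)" for x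
  define B where "B = e ` ({..n} \<times> {..<E})"
  interpret V: vector_space "\<lambda>c (f :: nat \<Rightarrow> complex poly) j. Polynomial.smult c (f j)"
    by unfold_locales (auto simp: fun_eq_iff smult_add_right smult_add_left)
  have finL: "finite L" by (auto simp: L_def)
  have "card L = (\<Sum>i<l. d i * E)" by (simp add: L_def)
  also have "\<dots> = (\<Sum>i<l. d i) * E" by (simp add: sum_distrib_right)
  finally have cL: "card L = (\<Sum>i<l. d i) * E" .
  have cT: "card T = Suc (card L)" using finL by (simp add: T_def card_image)
  have "card B \<le> card ({..n} \<times> {..<E})" unfolding B_def by (intro card_image_le) simp
  also have "\<dots> = Suc n * E" by (simp add: card_cartesian_product)
  also have "\<dots> \<le> card L" unfolding cL using big by (intro mult_le_mono1) simp
  finally have cB: "card B < card T" using cT by simp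
  have eB: "(\<lambda>j. Polynomial.smult c (e x j)) \<in> V.span B" if "x \<in> {..n} \<times> {..<E}" for x c
  proof -
    have "e x \<in> B" using that by (auto simp: B_def)
    then have "e x \<in> V.span B" by (rule V.span_base)
    then show ?thesis by (rule V.span_scale)
  qed
  have span: "f \<in> V.span B" if f: "\<And>j k. j \<le> n \<Longrightarrow> E \<le> k \<Longrightarrow> coeff (f j) k = 0" "\<And>j. \<not> j \<le> n \<Longrightarrow> f j = 0" for f
  proof -
    define g where "g x = (\<lambda>j. Polynomial.smult (coeff (f (fst x)) (snd x)) (e x j))" for x
    have "f j' = (\<Sum>x\<in>{..n} \<times> {..<E}. g x) j'" for j'
    proof (rule poly_eqI)
      fix k'
      have "coeff ((\<Sum>x\<in>{..n} \<times> {..<E}. g x) j') k' = (\<Sum>x\<in>{..n} \<times> {..<E}. if x = (j', k') then coeff (f j') k' else 0)"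
        unfolding fun_sum_apply coeff_sum by (intro sum.cong) (auto simp: g_def e_def split: if_splits)
      also have "\<dots> = (if (j', k') \<in> {..n} \<times> {..<E} then coeff (f j') k' else 0)" by (simp add: sum.delta)
      also have "\<dots> = coeff (f j') k'" using f by (cases "j' \<le> n") auto
      finally show "coeff (f j') k' = coeff ((\<Sum>x\<in>{..n} \<times> {..<E}. g x) j') k'" by simp
    qed
    then have "f = (\<Sum>x\<in>{..n} \<times> {..<E}. g x)" by (rule ext)
    moreover have "(\<Sum>x\<in>{..n} \<times> {..<E}. g x) \<in> V.span B"
      using eB by (intro V.span_sum) (simp add: g_def)
    ultimately show ?thesis by simp
  qed
  have "\<exists>c. (\<Sum>x\<in>T. (\<lambda>j. Polynomial.smult (c x) (r x j))) = 0 \<and> (\<exists>x\<in>T. c x \<noteq> 0)"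
  proof (rule V.more_vectors_dependent[OF _ _ cB])
    show "finite T" "finite B" using finL by (auto simp: T_def B_def)
    show "r x \<in> V.span B" if "x \<in> T" for x
      using that \<kappa>(1) u(1) by (intro span) (auto simp: T_def r_def)
  qed
  then obtain c where c: "(\<Sum>x\<in>T. (\<lambda>j. Polynomial.smult (c x) (r x j))) = 0" "\<exists>x\<in>T. c x \<noteq> 0" by blast
  have c': "Polynomial.smult (c None) (\<kappa> j) + (\<Sum>x\<in>L. Polynomial.smult (c (Some x)) (u x j)) = 0" if "j \<le> n" for j
  proof -
    have "(\<Sum>x\<in>T. (\<lambda>j. Polynomial.smult (c x) (r x j))) j = 0" using c(1) by simp
    then have "(\<Sum>x\<in>T. Polynomial.smult (c x) (r x j)) = 0" by (simp add: fun_sum_apply)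
    then show ?thesis using finL that by (simp add: T_def sum.reindex r_def)
  qed
  have cS: "c (Some (i, k)) = 0" if ik: "(i, k) \<in> L" for i k
  proof -
    have i: "i < l" using ik by (auto simp: L_def)
    have "0 = (\<Sum>j\<le>n. JJ i j * (Polynomial.smult (c None) (\<kappa> j) + (\<Sum>x\<in>L. Polynomial.smult (c (Some x)) (u x j))))"
      using c' by simp
    also have "\<dots> = Polynomial.smult (c None) (\<Sum>j\<le>n. JJ i j * \<kappa> j) + (\<Sum>x\<in>L. Polynomial.smult (c (Some x)) (\<Sum>j\<le>n. JJ i j * u x j))"
      unfolding distrib_left sum.distrib sum_distrib_left smult_sum2
      by (subst (2) sum.swap) simp
    also have "\<dots> = (\<Sum>x\<in>L. Polynomial.smult (c (Some x)) (if i = fst x then monom 1 (snd x) else 0))"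
      using \<kappa>(2)[OF i] u(2)[OF _ i] by simp
    finally have "0 = coeff (\<Sum>x\<in>L. Polynomial.smult (c (Some x)) (if i = fst x then monom 1 (snd x) else 0)) k" by simp
    also have "\<dots> = (\<Sum>x\<in>L. if x = (i, k) then c (Some (i, k)) else 0)"
      unfolding coeff_sum by (intro sum.cong) auto
    also have "\<dots> = c (Some (i, k))" using finL ik by simp
    finally show ?thesis by simp
  qed
  then have "Polynomial.smult (c None) (\<kappa> j) = 0" if "j \<le> n" for j
  proof -
    have "(\<Sum>x\<in>L. Polynomial.smult (c (Some x)) (u x j)) = 0" using cS by (intro sum.neutral) auto
    then show ?thesis using c'[OF that] by simp
  qed
  then have "c None = 0" using \<kappa>(3) by auto
  then show False using c(2) cS by (auto simp: T_def)
qed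

end

section \<open>From the degree bound to degrees one and two\<close>

context smooth_variety
begin

text \<open>Along the line from \<open>obstructed_line_exists\<close> the twisted map takes constant
  vectors as input. The coefficient of \<open>t\<close> in row \<open>s\<close>, minus the
  combination with \<open>lam\<close> of the constant coefficients of the other rows, vanishes on
  its image but not on the whole target. So the twisted map is not surjective along this
  line.\<close>

theorem convex_degrees:
  assumes conv: "convex_variety (proj_variety n Z)" and d1: "\<And>i. i < l \<Longrightarrow> 1 \<le> d i"
    and sum_d: "(\<Sum>i<l. d i) \<le> n"
  shows "(\<forall>i<l. d i = 1) \<or> (\<exists>s<l. d s = 2 \<and> (\<forall>i<l. i \<noteq> s \<longrightarrow> d i = 1))"
proof (rule ccontr)
  assume no: "\<not> ?thesis"
  then have l0: "{..<l} \<noteq> {}" by auto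
  define D where "D = Max (d ` {..<l})"
  have "D \<in> d ` {..<l}" unfolding D_def using l0 by (intro Max_in) auto
  then obtain s where s: "s < l" "d s = D" by auto
  have ds: "d i \<le> d s" if "i < l" for i using that unfolding s(2) D_def by auto
  have d2: "2 \<le> d s"
  proof (rule ccontr)
    assume "\<not> ?thesis"
    then have "\<forall>i<l. d i = 1" using d1 ds by (metis Suc_1 le_antisym not_less_eq_eq order_trans)
    then show False using no by blast
  qed
  have big: "3 \<le> d s \<or> (\<exists>i<l. i \<noteq> s \<and> d i = d s)"
  proof (rule ccontr)
    assume "\<not> ?thesis"
    then have "d s = 2" "\<forall>i<l. i \<noteq> s \<longrightarrow> d i \<noteq> 2" using d2 by auto
    then have "\<forall>i<l. i \<noteq> s \<longrightarrow> d i = 1" using ds d1 by (metis One_nat_def le_SucE le_antisym numeral_2_eq_2)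
    then show False using no s \<open>d s = 2\<close> by blast
  qed
  have "l < (\<Sum>i<l. d i)"
  proof -
    have "l = (\<Sum>i<l. 1)" by simp
    also have "\<dots> < (\<Sum>i<l. d i)" using d1 s(1) d2 by (intro sum_strict_mono_ex1) (auto intro!: bexI[of _ s])
    finally show ?thesis .
  qed
  then have ln: "l < n" using sum_d by simp
  have smooth: "\<forall>i<l. c i = 0" if x: "\<exists>k\<le>n. x k \<noteq> 0" "\<forall>i<l. poly_eval x (F i) = 0"
    "\<forall>k\<le>n. (\<Sum>i<l. c i * poly_eval x (partial_deriv k (F i))) = 0" for x c
  proof -
    let ?v = "vec (Suc n) x"
    have v: "?v \<in> homog_coords n" using x(1) by (auto simp: homog_coords_iff)
    have e: "poly_eval (\<lambda>i. ?v $ i) G = poly_eval x G" if "G \<in> polys_in {..n}" for G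
      by (rule poly_eval_cong_polys_in[OF that]) simp
    have "line ?v \<in> Z" unfolding in_Z[OF v] using x(2) e[OF forms_polys_in[OF F]] by simp
    from right_inverse[OF v this] obtain B where "jacobian_right_inverse n l F (\<lambda>i. ?v $ i) B" by blast
    then show ?thesis
    proof (rule jacobian_right_inverse_independent)
      show "\<forall>j\<le>n. (\<Sum>i<l. c i * poly_eval (\<lambda>i. ?v $ i) (partial_deriv j (F i))) = 0"
        using x(3) e[OF partial_deriv_polys_in[OF forms_polys_in[OF F]]] by simp
    qed
  qed
  have "\<exists>x y lam. (\<forall>i u v. i < l \<longrightarrow> poly_eval (\<lambda>k. u * x k + v * y k) (F i) = 0) \<and>
    (\<forall>u v. (\<forall>k\<le>n. u * x k + v * y k = 0) \<longrightarrow> u = 0 \<and> v = 0) \<and>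
    (\<forall>k\<le>n. (\<Sum>b\<le>n. poly_eval x (partial_deriv b (partial_deriv k (F s))) * y b) =
      (\<Sum>i\<in>{..<l} - {s}. lam i * poly_eval x (partial_deriv k (F i))))" (is "\<exists>x y lam. ?P x y lam")
  proof (rule obstructed_line_exists[of l F n d s])
    show "\<forall>i<l. c i = 0" if "\<exists>k\<le>n. x k \<noteq> 0" "\<forall>i<l. poly_eval x (F i) = 0"
      "\<forall>k\<le>n. (\<Sum>i<l. c i * poly_eval x (partial_deriv k (F i))) = 0" for x c
      by (rule smooth[OF that])
    fix x y lam
    assume a: "\<And>i u v. i < l \<Longrightarrow> poly_eval (\<lambda>k. u * x k + v * y k) (F i) = 0"
      "\<And>u v. \<forall>k\<le>n. u * x k + v * y k = 0 \<Longrightarrow> u = 0 \<and> v = 0"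
      "\<And>k. k \<le> n \<Longrightarrow> (\<Sum>b\<le>n. poly_eval x (partial_deriv b (partial_deriv k (F s))) * y b) =
        (\<Sum>i\<in>{..<l} - {s}. lam i * poly_eval x (partial_deriv k (F i)))"
    have "?P x y lam" by (rule conjI, intro allI impI, erule a(1), rule conjI, intro allI impI, erule a(2), intro allI impI, erule a(3))
    then show "\<exists>x y lam. ?P x y lam" by (intro exI)
  qed (fact F d1 ln sum_d s(1) ds d2 big)+
  then obtain x y lam where P: "?P x y lam" by (elim exE)
  have on: "poly_eval (\<lambda>k. u * x k + v * y k) (F i) = 0" if "i < l" for i u v
    using P that by simp
  have ind: "u = 0 \<and> v = 0" if "\<forall>k\<le>n. u * x k + v * y k = 0" for u v
    using P[THEN conjunct2, THEN conjunct1, THEN spec[of _ u], THEN spec[of _ v]] that by (rule mp)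
  have H: "(\<Sum>b\<le>n. poly_eval x (partial_deriv b (partial_deriv k (F s))) * y b) =
      (\<Sum>i\<in>{..<l} - {s}. lam i * poly_eval x (partial_deriv k (F i)))" if "k \<le> n" for k
    using P[THEN conjunct2, THEN conjunct2, rule_format, OF that] .
  define M :: "nat \<Rightarrow> nat cpoly" where "M j = Cst (y j) * Var 0 + Cst (x j) * Var 1" for j
  have tv: "tuple_vec n M v $ j = v $ 1 * x j + v $ 0 * y j" if "j \<le> n" for v j
    using that by (simp add: tuple_vec_index M_def poly_eval_homs)
  interpret rational_curve_in n l F d Z 1 M
  proof
    show "M j \<in> forms 1 1" for j unfolding M_def by (intro forms_add forms_Cst_mult forms_Var) auto
    show "tuple_vec n M v \<in> homog_coords n" if v: "v \<in> homog_coords 1" for v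
    proof (rule ccontr)
      assume "tuple_vec n M v \<notin> homog_coords n"
      then have "\<forall>k\<le>n. v $ 1 * x k + v $ 0 * y k = 0" using tv by (auto simp: homog_coords_iff)
      then have "v $ 1 = 0 \<and> v $ 0 = 0" by (rule ind)
      then show False using v by (auto simp: homog_coords_iff le_Suc_eq One_nat_def)
    qed
    show "ev (tuple_vec n M v) (F i) = 0" if "v \<in> homog_coords 1" "i < l" for v i
    proof -
      have "ev (tuple_vec n M v) (F i) = poly_eval (\<lambda>k. v $ 1 * x k + v $ 0 * y k) (F i)"
        by (rule poly_eval_cong_polys_in[OF forms_polys_in[OF F[OF that(2)]]]) (simp add: tv)
      then show ?thesis using on[OF that(2)] by simp
    qed
  qed (rule d1)
  \<comment> \<open>The element on which that functional is one. It lies in the twisted target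
    because \<open>d s\<close> is at least two.\<close>
  define q where "q i = (if i = s then monom (1::complex) 1 else 0)" for i
  have q: "coeff (q i) k = 0" if "i < l" "d i * 1 \<le> k" for i k
    using that d2 by (auto simp: q_def)
  have "\<exists>u. (\<forall>j\<le>n. \<forall>k\<ge>1. coeff (u j) k = 0) \<and> (\<forall>i<l. (\<Sum>j\<le>n. JJ i j * u j) = q i)"
    by (rule convex_surjective_twist[OF conv order_refl]) (rule q)
  then obtain u
    where u: "\<And>j k. j \<le> n \<Longrightarrow> 1 \<le> k \<Longrightarrow> coeff (u j) k = 0"
      "\<And>i. i < l \<Longrightarrow> (\<Sum>j\<le>n. JJ i j * u j) = q i" by blast
  let ?\<gamma> = "\<lambda>k. [:x k, y k:]"
  have dM: "dehomog (M j) = [:x j, y j:]" for j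
    by (simp add: M_def dehomog_homs dehomog_Var_0 dehomog_Var_1)
  have JJ: "JJ i j = poly_curve ?\<gamma> (partial_deriv j (F i))" for i j
    unfolding dehomog_def poly_curve_subst by (simp add: dM[unfolded dehomog_def])
  have c0: "coeff (JJ i j) 0 = poly_eval x (partial_deriv j (F i))" for i j
    by (simp add: JJ coeff_0_poly_curve)
  have c1: "coeff (JJ i j) 1 = (\<Sum>b\<le>n. poly_eval x (partial_deriv b (partial_deriv j (F i))) * y b)" if "i < l" for i j
  proof -
    have "partial_deriv j (F i) \<in> polys_in {..n}" by (rule partial_deriv_polys_in[OF forms_polys_in[OF F[OF that]]])
    from pderiv_poly_curve[OF this finite_atMost, of ?\<gamma>]
    have "coeff (pderiv (JJ i j)) 0 = (\<Sum>b\<le>n. poly_eval x (partial_deriv b (partial_deriv j (F i))) * y b)"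
      by (simp add: JJ coeff_sum coeff_mult_0 coeff_0_poly_curve pderiv_pCons mult.commute)
    then show ?thesis by (simp add: coeff_pderiv One_nat_def)
  qed
  have uc: "coeff (JJ i j * u j) k = coeff (JJ i j) k * coeff (u j) 0" if "j \<le> n" for i j k
  proof -
    have "u j = [:coeff (u j) 0:]" using u(1)[OF that]
      by (intro poly_eqI) (auto simp: coeff_pCons One_nat_def split: nat.split)
    then have "coeff (JJ i j * u j) k = coeff (JJ i j * [:coeff (u j) 0:]) k" by simp
    then show ?thesis by (simp add: mult.commute)
  qed
  \<comment> \<open>The functional is evaluated on \<open>q\<close> directly, and on the image of
    \<open>u\<close> through the Hessian relation \<open>H\<close>.\<close>
  have "1 = coeff (q s) 1" by (simp add: q_def)
  also have "\<dots> = (\<Sum>j\<le>n. coeff (JJ s j) 1 * coeff (u j) 0)"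
    unfolding u(2)[OF s(1), symmetric] coeff_sum by (intro sum.cong) (auto simp: uc)
  also have "\<dots> = (\<Sum>j\<le>n. (\<Sum>i\<in>{..<l} - {s}. lam i * coeff (JJ i j) 0) * coeff (u j) 0)"
    by (intro sum.cong) (auto simp: c1[OF s(1)] H c0)
  also have "\<dots> = (\<Sum>i\<in>{..<l} - {s}. lam i * (\<Sum>j\<le>n. coeff (JJ i j) 0 * coeff (u j) 0))"
    unfolding sum_distrib_left sum_distrib_right by (subst sum.swap) (simp add: mult_ac)
  also have "\<dots> = (\<Sum>i\<in>{..<l} - {s}. lam i * coeff (q i) 0)"
  proof (intro sum.cong refl arg_cong2[of _ _ _ _ "(*)"])
    fix i assume "i \<in> {..<l} - {s}"
    then have i: "i < l" by simp
    show "(\<Sum>j\<le>n. coeff (JJ i j) 0 * coeff (u j) 0) = coeff (q i) 0"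
      unfolding u(2)[OF i, symmetric] coeff_sum by (intro sum.cong) (auto simp: uc)
  qed
  also have "\<dots> = 0" by (intro sum.neutral) (auto simp: q_def)
  finally show False by simp
qed

end

section \<open>Morphisms from the projective line\<close>

lemma line_eq_iff:
  assumes v: "v \<in> homog_coords n" and w: "w \<in> homog_coords n"
  shows "line v = line w \<longleftrightarrow> (\<forall>i\<le>n. \<forall>j\<le>n. v $ i * w $ j = v $ j * w $ i)"
proof
  assume "line v = line w"
  then obtain c where "v = c \<cdot>\<^sub>v w" using line_eqD v by blast
  then show "\<forall>i\<le>n. \<forall>j\<le>n. v $ i * w $ j = v $ j * w $ i" using w by (auto simp: homog_coords_iff)
next
  assume *: "\<forall>i\<le>n. \<forall>j\<le>n. v $ i * w $ j = v $ j * w $ i"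
  obtain a where a: "a \<le> n" "w $ a \<noteq> 0" using w by (auto simp: homog_coords_iff)
  have eq: "v = (v $ a / w $ a) \<cdot>\<^sub>v w"
    using v w a * by (intro eq_vecI) (auto simp: homog_coords_iff field_simps less_Suc_eq_le)
  have "v $ a / w $ a \<noteq> 0" using v w by (subst (asm) eq) (auto simp: homog_coords_iff)
  then show "line v = line w" using line_smult eq by metis
qed

lemma tuple_vec_zero_iff:
  "tuple_vec n M v \<in> homog_coords n \<longleftrightarrow> (\<exists>j\<le>n. ev v (M j) \<noteq> 0)"
  by (auto simp: homog_coords_iff tuple_vec_index)

context smooth_variety
begin

text \<open>Regularity of the affine coordinates around \<open>f (line u)\<close> makes their
  pull-backs quotients of binary forms; brought to a common denominator they are the components of
  the tuple.\<close>

lemma morphism_P1_local_forms: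
  assumes mor: "morphism P1 (proj_variety n Z) f" and u: "u \<in> homog_coords 1"
  shows "\<exists>D A H. (\<forall>j\<le>n. A j \<in> forms 1 D) \<and> H \<in> forms 1 D \<and> ev u H \<noteq> 0 \<and>
    (\<forall>w\<in>homog_coords 1. ev w H \<noteq> 0 \<longrightarrow> tuple_vec n A w \<in> homog_coords n \<and> line (tuple_vec n A w) = f (line w))"
proof -
  have fZ: "f (line w) \<in> Z" if "w \<in> homog_coords 1" for w
    using mor that Z_subset
    by (auto simp: morphism_def continuous_map_def P1_def ftop_proj_variety topspace_zariski_proj proj_space_eq)
  obtain y where y: "y \<in> homog_coords n" "line y = f (line u)"
    using fZ[OF u] Z_subset by (auto simp: proj_space_eq)
  then obtain a where a: "a \<le> n" "y $ a \<noteq> 0" by (auto simp: homog_coords_iff)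
  have Va: "Var a \<in> forms n 1" using a(1) by (rule forms_Var)
  define U where "U = {x \<in> proj_space 1. f x \<in> principal n Z (Var a)}"
  have reg: "regular (proj_variety 1 (proj_space 1)) U (affine_coord n a j \<circ> f)" if "j \<le> n" for j
  proof -
    have "topspace (ftop P1) = proj_space 1" by (simp add: P1_def topspace_proj_variety)
    then show ?thesis
      using mor openin_principal[OF Va] regular_affine_coord[OF a(1) that]
      by (auto simp: morphism_def ftop_proj_variety U_def P1_def)
  qed
  have Uu: "line u \<in> U"
    using u y a in_principal[OF Va y(1)] fZ[OF u] by (simp add: U_def proj_space_eq)
  have "\<exists>g h. is_fraction_near 1 (proj_space 1) U (affine_coord n a j \<circ> f) u g h" if "j \<le> n" for j
    using reg[OF that] regular_proj_iff[of "proj_space 1" 1 U] u Uu by (auto simp: U_def)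
  then obtain g h where gh: "\<And>j. j \<le> n \<Longrightarrow> is_fraction_near 1 (proj_space 1) U (affine_coord n a j \<circ> f) u (g j) (h j)"
    by metis
  have "\<forall>j. \<exists>e. j \<le> n \<longrightarrow> g j \<in> forms 1 e \<and> h j \<in> forms 1 e" using gh by (auto simp: is_fraction_near_def)
  from choice[OF this] obtain e where e: "\<And>j. j \<le> n \<Longrightarrow> g j \<in> forms 1 (e j)" "\<And>j. j \<le> n \<Longrightarrow> h j \<in> forms 1 (e j)"
    by auto
  define D where "D = (\<Sum>j\<le>n. e j)"
  define H where "H = (\<Prod>j\<le>n. h j)"
  define A where "A j = g j * (\<Prod>i\<in>{..n} - {j}. h i)" for j
  have H: "H \<in> forms 1 D" unfolding H_def D_def by (intro forms_prod) (auto intro: e)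
  have A: "A j \<in> forms 1 D" if "j \<le> n" for j
  proof -
    have "(\<Prod>i\<in>{..n} - {j}. h i) \<in> forms 1 (\<Sum>i\<in>{..n} - {j}. e i)" by (intro forms_prod) (auto intro: e)
    then have "A j \<in> forms 1 (e j + (\<Sum>i\<in>{..n} - {j}. e i))" unfolding A_def using e(1)[OF that] by (intro forms_mult)
    moreover have "D = e j + (\<Sum>i\<in>{..n} - {j}. e i)" unfolding D_def using that by (subst sum.remove[of _ j]) auto
    ultimately show ?thesis by simp
  qed
  have "ev u (h j) \<noteq> 0" if "j \<le> n" for j using gh[OF that] by (simp add: is_fraction_near_def)
  then have Hu: "ev u H \<noteq> 0" by (simp add: H_def poly_eval_homs)
  have loc: "tuple_vec n A w \<in> homog_coords n \<and> line (tuple_vec n A w) = f (line w)"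
    if w: "w \<in> homog_coords 1" "ev w H \<noteq> 0" for w
  proof -
    have hj: "ev w (h j) \<noteq> 0" if "j \<le> n" for j using w(2) that by (auto simp: H_def poly_eval_homs)
    have fr: "line w \<in> U \<and> affine_coord n a j (f (line w)) = ev w (g j) / ev w (h j)" if "j \<le> n" for j
      using gh[OF that] w(1) hj[OF that] by (auto simp: is_fraction_near_def proj_space_eq)
    obtain z where z: "z \<in> homog_coords n" "line z = f (line w)"
      using fZ[OF w(1)] Z_subset by (auto simp: proj_space_eq)
    have "line z \<in> principal n Z (Var a)" using fr[of 0] z(2) by (simp add: U_def)
    then have za: "z $ a \<noteq> 0" using in_principal[OF Va z(1)] by simp
    have "ev w (A j) = ev w H / z $ a * z $ j" if "j \<le> n" for j
    proof -
      have "z $ j / z $ a = ev w (g j) / ev w (h j)"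
        using fr[OF that] affine_coord_line[OF z(1) a(1) that] z(2) by simp
      moreover have "ev w H = ev w (h j) * ev w (\<Prod>i\<in>{..n} - {j}. h i)"
        unfolding H_def using that by (subst prod.remove[of _ j]) (auto simp: poly_eval_homs)
      ultimately show ?thesis using za hj[OF that] by (simp add: A_def poly_eval_homs field_simps)
    qed
    then have "tuple_vec n A w = (ev w H / z $ a) \<cdot>\<^sub>v z"
      using z(1) by (intro eq_vecI) (auto simp: tuple_vec_def homog_coords_iff less_Suc_eq_le)
    moreover have "ev w H / z $ a \<noteq> 0" using w(2) za by simp
    ultimately show ?thesis using homog_coords_smult[OF z(1)] line_smult z(2) by metis
  qed
  show ?thesis
    by (intro exI[of _ D] exI[of _ A] exI[of _ H] conjI allI impI ballI)
      (use A H Hu loc in blast)+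
qed

text \<open>Among the tuples that represent \<open>f\<close> off the zeros of some nonzero form, one
  of least degree has no base points, because a common zero could be divided out. That it agrees
  with \<open>f\<close> everywhere follows by comparison with the local tuples.\<close>

theorem morphism_P1_forms:
  assumes mor: "morphism P1 (proj_variety n Z) f"
  shows "\<exists>E M. (\<forall>j\<le>n. M j \<in> forms 1 E) \<and>
    (\<forall>v\<in>homog_coords 1. tuple_vec n M v \<in> homog_coords n \<and> line (tuple_vec n M v) = f (line v))"
proof -
  define represents where "represents D M k \<longleftrightarrow> (\<forall>j\<le>n. M j \<in> forms 1 D) \<and> (\<exists>e. k \<in> forms 1 e) \<and> nonzero_form k \<and>
    (\<forall>w\<in>homog_coords 1. ev w k \<noteq> 0 \<longrightarrow> tuple_vec n M w \<in> homog_coords n \<and> line (tuple_vec n M w) = f (line w))"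
    for D M k
  have "\<exists>D M k. represents D M k"
  proof -
    have u: "pair_vec 1 1 \<in> homog_coords 1" by simp
    from morphism_P1_local_forms[OF mor u] obtain D A H where
      "\<forall>j\<le>n. A j \<in> forms 1 D" "H \<in> forms 1 D" "ev (pair_vec 1 1) H \<noteq> 0"
      "\<forall>w\<in>homog_coords 1. ev w H \<noteq> 0 \<longrightarrow> tuple_vec n A w \<in> homog_coords n \<and> line (tuple_vec n A w) = f (line w)"
      by blast
    then have "represents D A H" unfolding represents_def using nonzero_form_iff u by blast
    then show ?thesis by blast
  qed
  define E where "E = (LEAST D. \<exists>M k. represents D M k)"
  have "\<exists>M k. represents E M k" unfolding E_def using \<open>\<exists>D M k. represents D M k\<close> by (rule LeastI_ex)
  then obtain M k where Mk: "represents E M k" by blast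
  have least: "E \<le> D" if "represents D M' k'" for D M' k' unfolding E_def using that by (intro Least_le) blast
  have M: "M j \<in> forms 1 E" if "j \<le> n" for j using Mk that by (simp add: represents_def)
  obtain e where k: "k \<in> forms 1 e" "nonzero_form k" using Mk by (auto simp: represents_def)
  have Mw: "tuple_vec n M w \<in> homog_coords n" "line (tuple_vec n M w) = f (line w)"
    if "w \<in> homog_coords 1" "ev w k \<noteq> 0" for w using Mk that by (auto simp: represents_def)
  have nz: "tuple_vec n M u \<in> homog_coords n" if u: "u \<in> homog_coords 1" for u
  proof (rule ccontr)
    assume "\<not> ?thesis"
    then have 0: "ev u (M j) = 0" if "j \<le> n" for j using that by (simp add: tuple_vec_zero_iff)
    show False
    proof (cases E)
      case 0
      obtain w where w: "w \<in> homog_coords 1" "ev w k \<noteq> 0" using k nonzero_form_iff by blast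
      then obtain j where j: "j \<le> n" "ev w (M j) \<noteq> 0" using Mw(1) by (auto simp: tuple_vec_zero_iff)
      obtain c where "M j = Cst c" using forms_degree_0 M[OF j(1)] 0 by blast
      then show False using j(2) \<open>\<And>j. j \<le> n \<Longrightarrow> ev u (M j) = 0\<close>[OF j(1)] by simp
    next
      case (Suc D)
      let ?L = "linear_form u"
      have "\<exists>G\<in>forms 1 D. \<forall>v. ev v (M j) = ev v (?L * G)" if "j \<le> n" for j
        using binary_form_factor[OF _ u 0[OF that]] M[OF that] Suc by simp
      then have "\<forall>j. \<exists>G. j \<le> n \<longrightarrow> G \<in> forms 1 D \<and> (\<forall>v. ev v (M j) = ev v (?L * G))" by blast
      from choice[OF this] obtain G where G: "\<And>j. j \<le> n \<Longrightarrow> G j \<in> forms 1 D"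
        "\<And>j v. j \<le> n \<Longrightarrow> ev v (M j) = ev v (?L * G j)" by auto
      have tv: "tuple_vec n M v = ev v ?L \<cdot>\<^sub>v tuple_vec n G v" for v
        using G(2) by (intro eq_vecI) (auto simp: tuple_vec_def poly_eval_homs less_Suc_eq_le)
      have "represents D G (k * ?L)"
        unfolding represents_def
      proof (intro conjI ballI impI)
        show "\<exists>e. k * ?L \<in> forms 1 e" using forms_mult[OF k(1) linear_form_forms] by blast
        show "nonzero_form (k * ?L)" by (intro nonzero_form_mult k nonzero_linear_form u)
        fix w assume w: "w \<in> homog_coords 1" "ev w (k * ?L) \<noteq> 0"
        then have kw: "ev w k \<noteq> 0" "ev w ?L \<noteq> 0" by (auto simp: poly_eval_homs)
        show "tuple_vec n G w \<in> homog_coords n"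
          using Mw(1)[OF w(1) kw(1)] tuple_vec_zero_iff[of n M w] tuple_vec_zero_iff[of n G w] G(2)
          by (auto simp: poly_eval_homs)
        show "line (tuple_vec n G w) = f (line w)"
          using Mw(2)[OF w(1) kw(1)] line_smult[OF kw(2)] unfolding tv by simp
      qed (use G in auto)
      from least[OF this] Suc show False by simp
    qed
  qed
  have "line (tuple_vec n M u) = f (line u)" if u: "u \<in> homog_coords 1" for u
  proof -
    from morphism_P1_local_forms[OF mor u] obtain D A H where A: "\<And>j. j \<le> n \<Longrightarrow> A j \<in> forms 1 D"
      and H: "H \<in> forms 1 D" "ev u H \<noteq> 0"
      and Aw: "\<And>w. w \<in> homog_coords 1 \<Longrightarrow> ev w H \<noteq> 0 \<Longrightarrow>
        tuple_vec n A w \<in> homog_coords n \<and> line (tuple_vec n A w) = f (line w)"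
      by blast
    have "nonzero_form H" using H u nonzero_form_iff by blast
    then have kH: "k * H \<in> forms 1 (e + D)" "nonzero_form (k * H)" using k H by (auto intro: forms_mult nonzero_form_mult)
    \<comment> \<open>Two vectors span the same line when their minors of size two vanish. These
      minors are forms that vanish generically, and hence also at \<open>u\<close>.\<close>
    have "tuple_vec n M u $ i * tuple_vec n A u $ j = tuple_vec n M u $ j * tuple_vec n A u $ i"
      if ij: "i \<le> n" "j \<le> n" for i j
    proof -
      have "M i * A j - M j * A i \<in> forms 1 (E + D)" using M A ij by (intro forms_diff forms_mult)
      then have "ev u (M i * A j - M j * A i) = 0"
      proof (rule generic_identity[OF _ kH _ u])
        fix w assume w: "w \<in> homog_coords 1" "ev w (k * H) \<noteq> 0"
        then have "ev w k \<noteq> 0" "ev w H \<noteq> 0" by (auto simp: poly_eval_homs)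
        then have "line (tuple_vec n M w) = line (tuple_vec n A w)" using Mw[OF w(1)] Aw[OF w(1)] by simp
        then have "tuple_vec n M w $ i * tuple_vec n A w $ j = tuple_vec n M w $ j * tuple_vec n A w $ i"
          using line_eq_iff[OF nz[OF w(1)]] Aw[OF w(1) \<open>ev w H \<noteq> 0\<close>] ij by blast
        then show "ev w (M i * A j - M j * A i) = 0" using ij by (simp add: tuple_vec_index poly_eval_homs)
      qed
      then show ?thesis using ij by (simp add: tuple_vec_index poly_eval_homs)
    qed
    then have "line (tuple_vec n M u) = line (tuple_vec n A u)"
      using line_eq_iff[OF nz[OF u]] Aw[OF u H(2)] by blast
    then show ?thesis using Aw[OF u H(2)] by simp
  qed
  then show ?thesis using M nz by blast
qed

text \<open>A curve through two distinct points is not constant, so the forms describing it have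
  positive degree; this is what the degree bound asks of the curve.\<close>

theorem convex_rationally_connected_degrees:
  assumes conv: "convex_variety (proj_variety n Z)" and rc: "rationally_connected (proj_variety n Z)"
    and d1: "\<And>i. i < l \<Longrightarrow> 1 \<le> d i" and pq: "p \<in> Z" "q \<in> Z" "p \<noteq> q"
  shows "(\<Sum>i<l. d i) \<le> n \<and> ((\<forall>i<l. d i = 1) \<or> (\<exists>s<l. d s = 2 \<and> (\<forall>i<l. i \<noteq> s \<longrightarrow> d i = 1)))"
proof -
  obtain f where f: "morphism P1 (proj_variety n Z) f" "p \<in> f ` proj_space 1" "q \<in> f ` proj_space 1"
  proof -
    have t: "topspace (ftop (proj_variety n Z)) = Z" "topspace (ftop P1) = proj_space 1"
      using Z_subset by (simp_all add: topspace_proj_variety P1_def)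
    show thesis using rc pq(1,2) that unfolding rationally_connected_def rational_curve_def t by metis
  qed
  obtain E M where M: "\<And>j. j \<le> n \<Longrightarrow> M j \<in> forms 1 E"
    and Mv: "\<And>v. v \<in> homog_coords 1 \<Longrightarrow> tuple_vec n M v \<in> homog_coords n \<and> line (tuple_vec n M v) = f (line v)"
    using morphism_P1_forms[OF f(1)] by blast
  have E: "1 \<le> E"
  proof (rule ccontr)
    assume "\<not> ?thesis"
    then have "E = 0" by simp
    have "ev v (M j) = ev w (M j)" if "j \<le> n" for v w j
      using forms_degree_0[OF M[OF that, unfolded \<open>E = 0\<close>]] by auto
    then have "tuple_vec n M v = tuple_vec n M w" for v w
      unfolding tuple_vec_def by (intro eq_vecI) (auto simp: less_Suc_eq_le)
    then have "f (line v) = f (line w)" if "v \<in> homog_coords 1" "w \<in> homog_coords 1" for v w using Mv that by metis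
    then show False using f pq(3) by (auto simp: proj_space_eq)
  qed
  have fZ: "f (line w) \<in> Z" if "w \<in> homog_coords 1" for w
    using f(1) that Z_subset
    by (auto simp: morphism_def continuous_map_def P1_def ftop_proj_variety topspace_zariski_proj proj_space_eq)
  interpret rational_curve_in n l F d Z E M
  proof
    show "ev (tuple_vec n M v) (F i) = 0" if v: "v \<in> homog_coords 1" and "i < l" for v i
      using in_Z Mv[OF v] fZ[OF v] \<open>i < l\<close> by metis
  qed (use M Mv d1 in auto)
  have "(\<Sum>i<l. d i) \<le> n" by (rule convex_degree_bound[OF conv E])
  then show ?thesis using convex_degrees[OF conv d1] by blast
qed

end

declare One_nat_def [simp]

section \<open>Matrix groups\<close>

abbreviation evm :: "complex mat \<Rightarrow> (nat \<times> nat) cpoly \<Rightarrow> complex" where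
  "evm A F \<equiv> poly_eval (\<lambda>ij. A $$ ij) F"

abbreviation entry_polys :: "nat \<Rightarrow> (nat \<times> nat) cpoly set" where
  "entry_polys m \<equiv> polys_in ({..<m} \<times> {..<m})"

lemma carrier_GL: "A \<in> carrier (GL m) \<longleftrightarrow>
    A \<in> carrier_mat m m \<and> (\<exists>B\<in>carrier_mat m m. A * B = 1\<^sub>m m \<and> B * A = 1\<^sub>m m)"
  by (auto simp: GL_def units_of_carrier Units_def ring_mat_def)

lemma GL_carrier_mat: "A \<in> carrier (GL m) \<Longrightarrow> A \<in> carrier_mat m m"
  by (simp add: carrier_GL)

lemma mult_GL [simp]: "A \<otimes>\<^bsub>GL m\<^esub> B = A * B"
  by (simp add: GL_def units_of_mult ring_mat_def)

lemma one_GL [simp]: "\<one>\<^bsub>GL m\<^esub> = 1\<^sub>m m"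
  by (simp add: GL_def units_of_one ring_mat_def)

lemma group_GL: "group (GL m)"
proof -
  interpret ring "ring_mat TYPE(complex) m ()" by (rule ring_mat)
  show ?thesis unfolding GL_def by (rule units_group)
qed

interpretation GL: group "GL m" for m
  by (rule group_GL)

lemma l_coset_GL: "A <#\<^bsub>GL m\<^esub> P = (\<lambda>B. A * B) ` P"
  by (auto simp: l_coset_def)

lemma openin_zariski_GL_basic: "F \<in> entry_polys m \<Longrightarrow> openin (zariski_GL m) {A \<in> carrier (GL m). evm A F \<noteq> 0}"
  unfolding zariski_GL_def by (intro topology_generated_by_Basis) auto

lemma topspace_zariski_GL [simp]: "topspace (zariski_GL m) = carrier (GL m)"
proof
  show "topspace (zariski_GL m) \<subseteq> carrier (GL m)" by (auto simp: zariski_GL_def)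
  show "carrier (GL m) \<subseteq> topspace (zariski_GL m)"
    using openin_subset[OF openin_zariski_GL_basic[OF polys_in_1]] by (simp add: poly_eval_homs)
qed

lemma zariski_GL_local_basis:
  assumes "openin (zariski_GL m) U" "A \<in> U"
  shows "\<exists>F\<in>entry_polys m. evm A F \<noteq> 0 \<and> (\<forall>B\<in>carrier (GL m). evm B F \<noteq> 0 \<longrightarrow> B \<in> U)"
proof -
  have "generate_topology_on {{A \<in> carrier (GL m). evm A F \<noteq> 0} | F. F \<in> entry_polys m} U"
    using assms(1) by (simp add: zariski_GL_def openin_topology_generated_by_iff)
  then show ?thesis using assms(2)
  proof induction
    case (Int a b)
    then obtain F G where F: "F \<in> entry_polys m" "evm A F \<noteq> 0" "\<forall>B\<in>carrier (GL m). evm B F \<noteq> 0 \<longrightarrow> B \<in> a"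
      and G: "G \<in> entry_polys m" "evm A G \<noteq> 0" "\<forall>B\<in>carrier (GL m). evm B G \<noteq> 0 \<longrightarrow> B \<in> b" by blast
    then show ?case by (intro bexI[of _ "F * G"]) (auto simp: poly_eval_homs)
  next
    case (UN K)
    then obtain k where k: "k \<in> K" "A \<in> k" by blast
    from UN.IH[OF this] k(1) show ?case by blast
  qed auto
qed

lemma closedin_zariski_GL:
  assumes "S \<subseteq> entry_polys m"
  shows "closedin (zariski_GL m) {A \<in> carrier (GL m). \<forall>F\<in>S. evm A F = 0}"
proof -
  have "carrier (GL m) - {A \<in> carrier (GL m). \<forall>F\<in>S. evm A F = 0} = (\<Union>F\<in>S. {A \<in> carrier (GL m). evm A F \<noteq> 0})"
    by auto
  moreover have "openin (zariski_GL m) (\<Union>F\<in>S. {A \<in> carrier (GL m). evm A F \<noteq> 0})"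
    using assms by (intro openin_Union) (auto intro: openin_zariski_GL_basic)
  ultimately show ?thesis by (auto simp: closedin_def)
qed

lemma evm_mult_left:
  assumes "A \<in> carrier_mat m m" "B \<in> carrier_mat m m" "F \<in> entry_polys m"
  shows "evm (A * B) F = evm B (poly_subst (\<lambda>(i, j). \<Sum>k<m. Cst (A $$ (i, k)) * Var (k, j)) F)"
  unfolding poly_eval_subst using assms
  by (intro poly_eval_cong_polys_in[OF assms(3)])
    (auto simp: poly_eval_homs scalar_prod_def atLeast0LessThan)

lemma continuous_left_mult:
  assumes A: "A \<in> carrier (GL m)"
  shows "continuous_map (zariski_GL m) (zariski_GL m) (\<lambda>B. A * B)"
proof -
  have closed: "A * B \<in> carrier (GL m)" if "B \<in> carrier (GL m)" for B
    using GL.m_closed[OF A that] by simp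
  show ?thesis
    unfolding continuous_map_def
  proof (intro conjI allI impI)
    fix U assume U: "openin (zariski_GL m) U"
    show "openin (zariski_GL m) {B \<in> topspace (zariski_GL m). A * B \<in> U}"
    proof (subst openin_subopen, intro ballI)
      fix B assume "B \<in> {B \<in> topspace (zariski_GL m). A * B \<in> U}"
      then have B: "B \<in> carrier (GL m)" "A * B \<in> U" by auto
      obtain F where F: "F \<in> entry_polys m" "evm (A * B) F \<noteq> 0" "\<forall>C\<in>carrier (GL m). evm C F \<noteq> 0 \<longrightarrow> C \<in> U"
        using zariski_GL_local_basis[OF U B(2)] by blast
      define G where "G = poly_subst (\<lambda>(i, j). \<Sum>k<m. Cst (A $$ (i, k)) * Var (k, j)) F"
      have "G \<in> entry_polys m" unfolding G_def by (rule poly_subst_polys_in[OF F(1)]) auto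
      moreover have "evm C G = evm (A * C) F" if "C \<in> carrier (GL m)" for C
        unfolding G_def by (rule evm_mult_left[OF GL_carrier_mat[OF A] GL_carrier_mat[OF that] F(1), symmetric])
      ultimately show "\<exists>T. openin (zariski_GL m) T \<and> B \<in> T \<and> T \<subseteq> {B \<in> topspace (zariski_GL m). A * B \<in> U}"
        using B F(2,3) closed
        by (intro exI[of _ "{C \<in> carrier (GL m). evm C G \<noteq> 0}"]) (auto intro: openin_zariski_GL_basic)
    qed
  qed (use closed in auto)
qed

text \<open>Taken as a connected component because \<open>homogeneous_space\<close> asks for a group
  that is connected as a subset.\<close>

definition identity_component :: "nat \<Rightarrow> complex mat set \<Rightarrow> complex mat set" where
  "identity_component m H = connected_component_of_set (subtopology (zariski_GL m) H) (1\<^sub>m m)"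

context
  fixes m H assumes H: "linear_algebraic_group m H"
begin

private lemma sub: "subgroup H (GL m)"
  using H by (simp add: linear_algebraic_group_def)

private lemma top: "topspace (subtopology (zariski_GL m) H) = H"
  using subgroup.subset[OF sub] by auto

lemma identity_component_subset: "identity_component m H \<subseteq> H"
  using connected_component_of_subset_topspace[of "subtopology (zariski_GL m) H" "1\<^sub>m m"]
  unfolding identity_component_def top .

lemma one_identity_component: "1\<^sub>m m \<in> identity_component m H"
proof -
  have "1\<^sub>m m \<in> H" using subgroup.one_closed[OF sub] by simp
  then show ?thesis
    unfolding identity_component_def mem_Collect_eq connected_component_of_refl top .
qed

lemma connectedin_identity_component: "connectedin (zariski_GL m) (identity_component m H)"
  using connectedin_connected_component_of[of "subtopology (zariski_GL m) H" "1\<^sub>m m"]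
  by (simp add: identity_component_def connectedin_subtopology)

text \<open>For \<open>A\<close> in the component, translation by its inverse gives a connected set
  that contains the identity and hence lies in the component. Closure under \<open>inv A * B\<close>
  yields all subgroup axioms.\<close>

lemma linear_algebraic_group_identity_component: "linear_algebraic_group m (identity_component m H)"
proof -
  let ?G = "identity_component m H"
  have G_carrier: "?G \<subseteq> carrier (GL m)" using identity_component_subset subgroup.subset[OF sub] by blast
  have *: "inv\<^bsub>GL m\<^esub> A * B \<in> ?G" if A: "A \<in> ?G" and B: "B \<in> ?G" for A B
  proof -
    let ?A = "inv\<^bsub>GL m\<^esub> A"
    have AG: "A \<in> H" "?A \<in> H" "?A \<in> carrier (GL m)"
      using A identity_component_subset subgroup.m_inv_closed[OF sub] subgroup.subset[OF sub] by auto
    have "connectedin (zariski_GL m) ((\<lambda>B. ?A * B) ` ?G)"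
      by (rule connectedin_continuous_map_image[OF continuous_left_mult[OF AG(3)] connectedin_identity_component])
    moreover have "(\<lambda>B. ?A * B) ` ?G \<subseteq> H"
      using subgroup.m_closed[OF sub AG(2)] identity_component_subset by auto
    ultimately have "connectedin (subtopology (zariski_GL m) H) ((\<lambda>B. ?A * B) ` ?G)"
      by (simp add: connectedin_subtopology)
    moreover have "1\<^sub>m m \<in> (\<lambda>B. ?A * B) ` ?G"
      using GL.l_inv[of A m] A G_carrier by (intro image_eqI[of _ _ A]) auto
    ultimately have "(\<lambda>B. ?A * B) ` ?G \<subseteq> ?G"
      unfolding identity_component_def by (rule connected_component_of_maximal)
    then show ?thesis using B by blast
  qed
  have inv: "inv\<^bsub>GL m\<^esub> A \<in> ?G" if "A \<in> ?G" for A
    using *[OF that one_identity_component] that G_carrier GL.r_one[of "inv\<^bsub>GL m\<^esub> A" m] by auto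
  have "subgroup ?G (GL m)"
  proof
    show "A \<otimes>\<^bsub>GL m\<^esub> B \<in> ?G" if "A \<in> ?G" "B \<in> ?G" for A B
      using *[OF inv[OF that(1)] that(2)] that G_carrier by (auto simp: GL.inv_inv)
  qed (use G_carrier one_identity_component inv in auto)
  moreover have "closedin (zariski_GL m) ?G"
    using closedin_connected_component_of[of "subtopology (zariski_GL m) H" "1\<^sub>m m"] H
    by (simp add: identity_component_def linear_algebraic_group_def closedin_closed_subtopology)
  ultimately show ?thesis by (simp add: linear_algebraic_group_def)
qed

end

section \<open>Rational curves in matrix groups\<close>

lemma evm_rational_curve:
  assumes "F \<in> entry_polys m"
  shows "\<exists>p k. \<forall>t. poly q t \<noteq> 0 \<longrightarrow>
    evm (mat m m (\<lambda>ij. poly (a ij) t / poly q t)) F = poly p t / poly q t ^ k"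
  using assms
proof (induction rule: polys_in_induct)
  case (Cst c)
  show ?case by (intro exI[of _ "[:c:]"] exI[of _ 0]) simp
next
  case (Var ij)
  then show ?case by (intro exI[of _ "a ij"] exI[of _ 1]) (auto simp: One_nat_def)
next
  case (add F G)
  then obtain p k p' k' where "\<forall>t. poly q t \<noteq> 0 \<longrightarrow>
      evm (mat m m (\<lambda>ij. poly (a ij) t / poly q t)) F = poly p t / poly q t ^ k"
    "\<forall>t. poly q t \<noteq> 0 \<longrightarrow> evm (mat m m (\<lambda>ij. poly (a ij) t / poly q t)) G = poly p' t / poly q t ^ k'" by blast
  then show ?case
    by (intro exI[of _ "p * q ^ k' + p' * q ^ k"] exI[of _ "k + k'"])
      (simp add: poly_eval_homs power_add add_frac_eq)
next
  case (mult F G)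
  then obtain p k p' k' where "\<forall>t. poly q t \<noteq> 0 \<longrightarrow>
      evm (mat m m (\<lambda>ij. poly (a ij) t / poly q t)) F = poly p t / poly q t ^ k"
    "\<forall>t. poly q t \<noteq> 0 \<longrightarrow> evm (mat m m (\<lambda>ij. poly (a ij) t / poly q t)) G = poly p' t / poly q t ^ k'" by blast
  then show ?case
    by (intro exI[of _ "p * p'"] exI[of _ "k + k'"]) (simp add: poly_eval_homs power_add)
qed

text \<open>A rational curve is irreducible, hence connected.\<close>

lemma rational_curve_identity_component:
  fixes a :: "nat \<times> nat \<Rightarrow> complex poly" and q :: "complex poly" and m :: nat
  defines "\<gamma> \<equiv> \<lambda>t. mat m m (\<lambda>ij. poly (a ij) t / poly q t)"
  assumes H: "H \<subseteq> carrier (GL m)" and \<gamma>: "\<And>t. poly q t \<noteq> 0 \<Longrightarrow> \<gamma> t \<in> H"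
    and t0: "poly q t0 \<noteq> 0" "\<gamma> t0 = 1\<^sub>m m" and t1: "poly q t1 \<noteq> 0"
  shows "\<gamma> t1 \<in> identity_component m H"
proof -
  let ?T = "\<gamma> ` {t. poly q t \<noteq> 0}"
  have T: "?T \<subseteq> H" using \<gamma> by auto
  have local_poly: "\<exists>p. p \<noteq> 0 \<and> (\<forall>t. poly q t \<noteq> 0 \<longrightarrow> poly p t \<noteq> 0 \<longrightarrow> \<gamma> t \<in> U)"
    if U: "openin (zariski_GL m) U" "U \<inter> ?T \<noteq> {}" for U
  proof -
    from U(2) obtain s where s: "poly q s \<noteq> 0" "\<gamma> s \<in> U" by blast
    obtain F where F: "F \<in> entry_polys m" "evm (\<gamma> s) F \<noteq> 0" "\<forall>C\<in>carrier (GL m). evm C F \<noteq> 0 \<longrightarrow> C \<in> U"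
      using zariski_GL_local_basis[OF U(1) s(2)] by blast
    obtain p k where p: "\<forall>t. poly q t \<noteq> 0 \<longrightarrow> evm (\<gamma> t) F = poly p t / poly q t ^ k"
      using evm_rational_curve[OF F(1), of q a] unfolding \<gamma>_def by blast
    have "poly p s \<noteq> 0" using p s(1) F(2) by auto
    then have "p \<noteq> 0" by auto
    moreover have "\<gamma> t \<in> U" if t: "poly q t \<noteq> 0" "poly p t \<noteq> 0" for t
    proof -
      have "evm (\<gamma> t) F \<noteq> 0" using p t by simp
      moreover have "\<gamma> t \<in> carrier (GL m)" using \<gamma>[OF t(1)] H by blast
      ultimately show ?thesis using F(3) by blast
    qed
    ultimately show ?thesis by blast
  qed
  have "q \<noteq> 0" using t0 by auto
  have "connectedin (zariski_GL m) ?T"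
    unfolding connectedin
  proof (intro conjI notI)
    show "?T \<subseteq> topspace (zariski_GL m)" using T H by auto
    assume "\<exists>U V. openin (zariski_GL m) U \<and> openin (zariski_GL m) V \<and> ?T \<subseteq> U \<union> V \<and> U \<inter> V \<inter> ?T = {} \<and>
      U \<inter> ?T \<noteq> {} \<and> V \<inter> ?T \<noteq> {}"
    then obtain U V where U: "openin (zariski_GL m) U" "U \<inter> ?T \<noteq> {}"
      and V: "openin (zariski_GL m) V" "V \<inter> ?T \<noteq> {}" and UV: "U \<inter> V \<inter> ?T = {}" by blast
    obtain p where p: "p \<noteq> 0" "\<forall>t. poly q t \<noteq> 0 \<longrightarrow> poly p t \<noteq> 0 \<longrightarrow> \<gamma> t \<in> U" using local_poly[OF U] by blast
    obtain r where r: "r \<noteq> 0" "\<forall>t. poly q t \<noteq> 0 \<longrightarrow> poly r t \<noteq> 0 \<longrightarrow> \<gamma> t \<in> V" using local_poly[OF V] by blast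
    \<comment> \<open>Each of the two open sets contains the curve for all but finitely many
      parameters, so that they cannot separate it.\<close>
    have "q * p * r \<noteq> 0" using p(1) r(1) \<open>q \<noteq> 0\<close> by simp
    then obtain t where "poly (q * p * r) t \<noteq> 0" using poly_all_0_iff_0 by blast
    then have "\<gamma> t \<in> U \<inter> V \<inter> ?T" using p(2) r(2) by auto
    then show False using UV by blast
  qed
  then have "connectedin (subtopology (zariski_GL m) H) ?T" using T by (simp add: connectedin_subtopology)
  moreover have "1\<^sub>m m \<in> ?T" using t0 by (intro image_eqI[of _ _ t0]) auto
  ultimately have "?T \<subseteq> identity_component m H"
    unfolding identity_component_def by (rule connected_component_of_maximal)
  then show ?thesis using t1 by blast
qed

section \<open>Orbits with local sections\<close>

lemma openin_group_principal:
  assumes "F \<in> entry_polys m" "G \<subseteq> carrier (GL m)"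
  shows "openin (subtopology (zariski_GL m) G) {A \<in> G. evm A F \<noteq> 0}"
proof -
  have "{A \<in> G. evm A F \<noteq> 0} = {A \<in> carrier (GL m). evm A F \<noteq> 0} \<inter> G" using assms(2) by auto
  then show ?thesis using openin_zariski_GL_basic[OF assms(1)] by (auto simp: openin_subtopology)
qed

lemma group_local_basis:
  assumes "openin (subtopology (zariski_GL m) G) U" "A \<in> U" "G \<subseteq> carrier (GL m)"
  shows "\<exists>F\<in>entry_polys m. evm A F \<noteq> 0 \<and> (\<forall>B\<in>G. evm B F \<noteq> 0 \<longrightarrow> B \<in> U)"
proof -
  obtain T where T: "openin (zariski_GL m) T" "U = T \<inter> G" using assms(1) by (auto simp: openin_subtopology)
  then obtain F where "F \<in> entry_polys m" "evm A F \<noteq> 0" "\<forall>B\<in>carrier (GL m). evm B F \<noteq> 0 \<longrightarrow> B \<in> T"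
    using zariski_GL_local_basis[OF T(1)] assms(2) by blast
  then show ?thesis using T(2) assms(3) by blast
qed

lemma regular_group_iff:
  assumes G: "G \<subseteq> carrier (GL m)" and U: "U \<subseteq> G"
  shows "regular (group_variety m G) U f \<longleftrightarrow>
    (\<forall>A\<in>U. \<exists>g\<in>entry_polys m. \<exists>h\<in>entry_polys m. evm A h \<noteq> 0 \<and>
      (\<forall>B\<in>G. evm B h \<noteq> 0 \<longrightarrow> B \<in> U \<and> f B = evm B g / evm B h))"
proof
  assume reg: "regular (group_variety m G) U f"
  show "\<forall>A\<in>U. \<exists>g\<in>entry_polys m. \<exists>h\<in>entry_polys m. evm A h \<noteq> 0 \<and>
      (\<forall>B\<in>G. evm B h \<noteq> 0 \<longrightarrow> B \<in> U \<and> f B = evm B g / evm B h)"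
  proof
    fix A assume A: "A \<in> U"
    then obtain V g h where V: "openin (subtopology (zariski_GL m) G) V" "A \<in> V" "V \<subseteq> U"
      and gh: "g \<in> entry_polys m" "h \<in> entry_polys m"
      and f: "\<forall>B\<in>V. evm B h \<noteq> 0 \<and> f B = evm B g / evm B h"
      using reg by (auto simp: group_variety_def)
    obtain k where k: "k \<in> entry_polys m" "evm A k \<noteq> 0" "\<forall>B\<in>G. evm B k \<noteq> 0 \<longrightarrow> B \<in> V"
      using group_local_basis[OF V(1,2) G] by blast
    show "\<exists>g\<in>entry_polys m. \<exists>h\<in>entry_polys m. evm A h \<noteq> 0 \<and>
        (\<forall>B\<in>G. evm B h \<noteq> 0 \<longrightarrow> B \<in> U \<and> f B = evm B g / evm B h)"
    proof (rule bexI[of _ "g * k"], rule bexI[of _ "h * k"], intro conjI ballI impI)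
      show "evm A (h * k) \<noteq> 0" using f V(2) k(2) by (simp add: poly_eval_homs)
      fix B assume B: "B \<in> G" "evm B (h * k) \<noteq> 0"
      then have "evm B k \<noteq> 0" by (simp add: poly_eval_homs)
      then have "B \<in> V" using k(3) B(1) by blast
      then show "B \<in> U" "f B = evm B (g * k) / evm B (h * k)"
        using V(3) f \<open>evm B k \<noteq> 0\<close> by (auto simp: poly_eval_homs)
    qed (use gh k in auto)
  qed
next
  assume R: "\<forall>A\<in>U. \<exists>g\<in>entry_polys m. \<exists>h\<in>entry_polys m. evm A h \<noteq> 0 \<and>
      (\<forall>B\<in>G. evm B h \<noteq> 0 \<longrightarrow> B \<in> U \<and> f B = evm B g / evm B h)"
  show "regular (group_variety m G) U f"
    unfolding group_variety_def fspace.simps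
  proof
    fix A assume A: "A \<in> U"
    then obtain g h where gh: "g \<in> entry_polys m" "h \<in> entry_polys m" "evm A h \<noteq> 0"
      "\<forall>B\<in>G. evm B h \<noteq> 0 \<longrightarrow> B \<in> U \<and> f B = evm B g / evm B h" using R by blast
    then show "\<exists>V g h. openin (subtopology (zariski_GL m) G) V \<and> A \<in> V \<and> V \<subseteq> U \<and>
        g \<in> entry_polys m \<and> h \<in> entry_polys m \<and> (\<forall>B\<in>V. evm B h \<noteq> 0 \<and> f B = evm B g / evm B h)"
      using openin_group_principal[OF gh(2) G] A U
      by (intro exI[of _ "{B \<in> G. evm B h \<noteq> 0}"] exI[of _ g] exI[of _ h]) auto
  qed
qed

lemma closedin_zero_locus:
  assumes "form_sys n S"
  shows "closedin (zariski_proj n) (zero_locus n S)"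
proof -
  have "proj_space n - zero_locus n S = (\<Union>F\<in>S. principal n (proj_space n) F)"
    using in_zero_locus[OF assms] by (auto simp: proj_space_eq principal_def) blast
  moreover have "openin (zariski_proj n) (\<Union>F\<in>S. principal n (proj_space n) F)"
    using assms by (intro openin_Union) (auto simp: form_sys_def intro: openin_principal_proj)
  ultimately show ?thesis using zero_locus_subset by (auto simp: closedin_def topspace_zariski_proj)
qed

lemma GL_homog_coords:
  assumes "A \<in> carrier (GL (Suc n))" "v \<in> homog_coords n"
  shows "A *\<^sub>v v \<in> homog_coords n"
proof -
  obtain B where B: "A \<in> carrier_mat (Suc n) (Suc n)" "B \<in> carrier_mat (Suc n) (Suc n)" "B * A = 1\<^sub>m (Suc n)"
    using assms(1) by (auto simp: carrier_GL)
  have v: "v \<in> carrier_vec (Suc n)" "v \<noteq> 0\<^sub>v (Suc n)" using assms(2) by (auto simp: homog_coords_def)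
  have "A *\<^sub>v v \<noteq> 0\<^sub>v (Suc n)"
  proof
    assume 0: "A *\<^sub>v v = 0\<^sub>v (Suc n)"
    have "v = B *\<^sub>v (A *\<^sub>v v)" using assoc_mult_mat_vec[OF B(2,1) v(1)] B(3) v(1) by simp
    moreover have "B *\<^sub>v 0\<^sub>v (Suc n) = 0\<^sub>v (Suc n)" using B(2) by (intro eq_vecI) auto
    ultimately show False using 0 v(2) by simp
  qed
  then show ?thesis using B(1) v(1) by (simp add: homog_coords_def)
qed

lemma line_mult_mat_vec:
  assumes "A \<in> carrier_mat (Suc n) (Suc n)" "v \<in> homog_coords n" "w \<in> carrier_vec (Suc n)" "line v = line w"
  shows "line (A *\<^sub>v v) = line (A *\<^sub>v w)"
proof -
  obtain c where "c \<noteq> 0" "v = c \<cdot>\<^sub>v w" using line_eqD assms(2,4) by blast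
  then show ?thesis using assms by (simp add: mult_mat_vec line_smult)
qed

definition matrix_section :: "nat \<Rightarrow> (nat \<times> nat \<Rightarrow> nat cpoly) \<Rightarrow> nat cpoly \<Rightarrow> complex vec \<Rightarrow> complex mat" where
  "matrix_section n g h w = mat (Suc n) (Suc n) (\<lambda>ij. ev w (g ij) / ev w h)"

lemma evm_matrix_section:
  assumes "F \<in> entry_polys (Suc n)" and g: "\<forall>i\<le>n. \<forall>j\<le>n. g (i, j) \<in> forms n d" and h: "h \<in> forms n d"
  shows "\<exists>k. \<exists>P\<in>forms n (k * d). \<forall>w. ev w h \<noteq> 0 \<longrightarrow> evm (matrix_section n g h w) F = ev w P / ev w h ^ k"
  using assms(1)
proof (induction rule: polys_in_induct)
  case (Cst c)
  show ?case by (intro exI[of _ 0] bexI[of _ "Cst c"]) (auto intro: forms_Cst)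
next
  case (Var ij)
  then have "g ij \<in> forms n (1 * d)" using g by (cases ij) (auto simp: less_Suc_eq_le)
  then show ?case using Var by (intro exI[of _ 1] bexI[of _ "g ij"]) (auto simp: matrix_section_def)
next
  case (add F G)
  then obtain k P k' P' where P: "P \<in> forms n (k * d)" "P' \<in> forms n (k' * d)"
    "\<forall>w. ev w h \<noteq> 0 \<longrightarrow> evm (matrix_section n g h w) F = ev w P / ev w h ^ k"
    "\<forall>w. ev w h \<noteq> 0 \<longrightarrow> evm (matrix_section n g h w) G = ev w P' / ev w h ^ k'" by blast
  have "P * h ^ k' \<in> forms n (k * d + k' * d)" "P' * h ^ k \<in> forms n (k' * d + k * d)"
    using P h by (auto intro: forms_mult forms_power)
  then have "P * h ^ k' + P' * h ^ k \<in> forms n ((k + k') * d)"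
    by (intro forms_add) (simp_all add: algebra_simps)
  then show ?case using P(3,4)
    by (intro exI[of _ "k + k'"] bexI[of _ "P * h ^ k' + P' * h ^ k"])
      (auto simp: poly_eval_homs power_add add_frac_eq)
next
  case (mult F G)
  then obtain k P k' P' where P: "P \<in> forms n (k * d)" "P' \<in> forms n (k' * d)"
    "\<forall>w. ev w h \<noteq> 0 \<longrightarrow> evm (matrix_section n g h w) F = ev w P / ev w h ^ k"
    "\<forall>w. ev w h \<noteq> 0 \<longrightarrow> evm (matrix_section n g h w) G = ev w P' / ev w h ^ k'" by blast
  have "P * P' \<in> forms n ((k + k') * d)" using forms_mult[OF P(1,2)] by (simp add: algebra_simps)
  then show ?case using P(3,4)
    by (intro exI[of _ "k + k'"] bexI[of _ "P * P'"]) (auto simp: poly_eval_homs power_add)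
qed

text \<open>A local section is a matrix of quotients of forms that carries \<open>p\<close> to the
  moving point. The sections give transitivity, and composing with them shows that the inverse of
  the bijection from cosets to points is a morphism.\<close>

locale orbit_with_sections =
  fixes n :: nat and Z :: "complex vec set set" and G :: "complex mat set" and p :: "complex vec"
  assumes G: "linear_algebraic_group (Suc n) G" and conn: "connectedin (zariski_GL (Suc n)) G"
    and closed: "closedin (zariski_proj n) Z"
    and act: "\<And>A v. A \<in> G \<Longrightarrow> v \<in> homog_coords n \<Longrightarrow> line v \<in> Z \<Longrightarrow> line (A *\<^sub>v v) \<in> Z"
    and p: "p \<in> homog_coords n" "line p \<in> Z"
    and sections: "\<And>v. v \<in> homog_coords n \<Longrightarrow> line v \<in> Z \<Longrightarrow> \<exists>d g h.
      (\<forall>i\<le>n. \<forall>j\<le>n. g (i, j) \<in> forms n d) \<and> h \<in> forms n d \<and> ev v h \<noteq> 0 \<and>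
      (\<forall>w\<in>homog_coords n. line w \<in> Z \<longrightarrow> ev w h \<noteq> 0 \<longrightarrow>
        matrix_section n g h w \<in> G \<and> line (matrix_section n g h w *\<^sub>v p) = line w)"
begin

definition orbit_point :: "complex mat \<Rightarrow> complex vec set" where
  "orbit_point A = line (A *\<^sub>v p)"

definition fiber :: "complex vec set \<Rightarrow> complex mat set" where
  "fiber z = {A \<in> G. orbit_point A = z}"

definition stabilizer :: "complex mat set" where
  "stabilizer = fiber (line p)"

definition base_point :: "complex mat set \<Rightarrow> complex vec set" where
  "base_point C = orbit_point (SOME A. A \<in> C)"

lemma sub: "subgroup G (GL (Suc n))"
  using G by (simp add: linear_algebraic_group_def)

lemma G_GL: "G \<subseteq> carrier (GL (Suc n))"
  by (rule subgroup.subset[OF sub])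

lemma G_mat: "A \<in> G \<Longrightarrow> A \<in> carrier_mat (Suc n) (Suc n)"
  using G_GL GL_carrier_mat by blast

lemma Z_proj: "Z \<subseteq> proj_space n"
  using closedin_subset[OF closed] by (simp add: topspace_zariski_proj)

lemma orbit_homog: "A \<in> G \<Longrightarrow> A *\<^sub>v p \<in> homog_coords n"
  using GL_homog_coords G_GL p(1) by blast

lemma orbit_point_in_Z: "A \<in> G \<Longrightarrow> orbit_point A \<in> Z"
  unfolding orbit_point_def using act p by blast

lemma orbit_point_mult:
  assumes A: "A \<in> G" and B: "B \<in> G" "C \<in> G" "orbit_point B = orbit_point C"
  shows "orbit_point (A * B) = orbit_point (A * C)"
proof -
  have pc: "p \<in> carrier_vec (Suc n)" using p(1) by (rule homog_coords_carrier)
  have "line (A *\<^sub>v (B *\<^sub>v p)) = line (A *\<^sub>v (C *\<^sub>v p))"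
    using line_mult_mat_vec[OF G_mat[OF A] orbit_homog[OF B(1)] homog_coords_carrier[OF orbit_homog[OF B(2)]]] B(3)
    by (simp add: orbit_point_def)
  then show ?thesis
    unfolding orbit_point_def assoc_mult_mat_vec[OF G_mat[OF A] G_mat[OF B(1)] pc]
      assoc_mult_mat_vec[OF G_mat[OF A] G_mat[OF B(2)] pc] .
qed

lemma one_G: "1\<^sub>m (Suc n) \<in> G"
  using subgroup.one_closed[OF sub] by simp

lemma orbit_point_one: "orbit_point (1\<^sub>m (Suc n)) = line p"
  using homog_coords_carrier[OF p(1)] by (simp add: orbit_point_def)

lemma G_mult: "A \<in> G \<Longrightarrow> B \<in> G \<Longrightarrow> A * B \<in> G"
  using subgroup.m_closed[OF sub] by simp

text \<open>Cosets of the stabilizer are from here on treated as fibers of the orbit map, which are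
  indexed by the points of \<open>Z\<close>.\<close>

lemma coset_eq_fiber:
  assumes A: "A \<in> G"
  shows "A <#\<^bsub>GL (Suc n)\<^esub> stabilizer = fiber (orbit_point A)"
proof
  show "A <#\<^bsub>GL (Suc n)\<^esub> stabilizer \<subseteq> fiber (orbit_point A)"
  proof
    fix B assume "B \<in> A <#\<^bsub>GL (Suc n)\<^esub> stabilizer"
    then obtain C where C: "C \<in> G" "orbit_point C = line p" "B = A * C"
      by (auto simp: l_coset_GL stabilizer_def fiber_def)
    have "orbit_point (A * C) = orbit_point (A * 1\<^sub>m (Suc n))"
      by (rule orbit_point_mult[OF A C(1) one_G]) (simp add: C(2) orbit_point_one)
    then show "B \<in> fiber (orbit_point A)" using C A G_mult G_mat[OF A] by (simp add: fiber_def)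
  qed
  show "fiber (orbit_point A) \<subseteq> A <#\<^bsub>GL (Suc n)\<^esub> stabilizer"
  proof
    fix B assume "B \<in> fiber (orbit_point A)"
    then have B: "B \<in> G" "orbit_point B = orbit_point A" by (auto simp: fiber_def)
    let ?A = "inv\<^bsub>GL (Suc n)\<^esub> A"
    have iA: "?A \<in> G" using subgroup.m_inv_closed[OF sub A] .
    have "orbit_point (?A * B) = orbit_point (?A * A)" by (rule orbit_point_mult[OF iA B(1) A B(2)])
    also have "?A * A = 1\<^sub>m (Suc n)" using GL.l_inv[of A "Suc n"] A G_GL by auto
    finally have "?A * B \<in> stabilizer" using G_mult[OF iA B(1)] by (simp add: stabilizer_def fiber_def orbit_point_one)
    moreover have "A * (?A * B) = B"
    proof -
      have "A * (?A * B) = (A * ?A) * B" using G_mat A iA B(1) by (metis assoc_mult_mat)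
      also have "A * ?A = 1\<^sub>m (Suc n)" using GL.r_inv[of A "Suc n"] A G_GL by auto
      finally show ?thesis using G_mat[OF B(1)] by simp
    qed
    ultimately show "B \<in> A <#\<^bsub>GL (Suc n)\<^esub> stabilizer" by (auto simp: l_coset_GL intro: image_eqI[of _ _ "?A * B"])
  qed
qed

lemma subgroup_stabilizer: "subgroup stabilizer (GL (Suc n))"
proof
  show "stabilizer \<subseteq> carrier (GL (Suc n))" using G_GL by (auto simp: stabilizer_def fiber_def)
  show "\<one>\<^bsub>GL (Suc n)\<^esub> \<in> stabilizer" using one_G by (simp add: stabilizer_def fiber_def orbit_point_one)
  show "A \<otimes>\<^bsub>GL (Suc n)\<^esub> B \<in> stabilizer" if "A \<in> stabilizer" "B \<in> stabilizer" for A B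
    using that coset_eq_fiber[of A] by (auto simp: stabilizer_def fiber_def l_coset_GL)
  show "inv\<^bsub>GL (Suc n)\<^esub> A \<in> stabilizer" if A: "A \<in> stabilizer" for A
  proof -
    let ?A = "inv\<^bsub>GL (Suc n)\<^esub> A"
    have AG: "A \<in> G" "orbit_point A = line p" using A by (auto simp: stabilizer_def fiber_def)
    have iA: "?A \<in> G" using subgroup.m_inv_closed[OF sub AG(1)] .
    have "orbit_point (?A * A) = orbit_point (?A * 1\<^sub>m (Suc n))"
      by (rule orbit_point_mult[OF iA AG(1) one_G]) (simp add: AG orbit_point_one)
    moreover have "?A * A = 1\<^sub>m (Suc n)" using GL.l_inv[of A "Suc n"] AG(1) G_GL by auto
    ultimately show ?thesis using iA G_mat[OF iA] by (simp add: stabilizer_def fiber_def orbit_point_one)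
  qed
qed

definition orbit_poly :: "nat cpoly \<Rightarrow> (nat \<times> nat) cpoly" where
  "orbit_poly = poly_subst (\<lambda>i. \<Sum>j\<le>n. Cst (p $ j) * Var (i, j))"

lemma orbit_poly_entry: "F \<in> polys_in {..n} \<Longrightarrow> orbit_poly F \<in> entry_polys (Suc n)"
  unfolding orbit_poly_def by (erule poly_subst_polys_in, intro polys_in_sum polys_in_mult polys_in_Cst polys_in_Var) auto

lemma orbit_index: "A \<in> carrier_mat (Suc n) (Suc n) \<Longrightarrow> i \<le> n \<Longrightarrow> (A *\<^sub>v p) $ i = (\<Sum>j\<le>n. p $ j * A $$ (i, j))"
  using homog_coords_carrier[OF p(1)]
  by (auto simp: scalar_prod_def atLeast0LessThan lessThan_Suc_atMost intro!: sum.cong)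

lemma evm_orbit_poly:
  assumes "A \<in> carrier_mat (Suc n) (Suc n)" "F \<in> polys_in {..n}"
  shows "evm A (orbit_poly F) = ev (A *\<^sub>v p) F"
  unfolding orbit_poly_def poly_eval_subst
  by (intro poly_eval_cong_polys_in[OF assms(2)]) (simp add: poly_eval_homs orbit_index[OF assms(1)])

text \<open>That \<open>A *\<^sub>v p\<close> and \<open>p\<close> span the same line is the
  vanishing of minors of size two, which are linear in the entries of \<open>A\<close>.\<close>

lemma linear_algebraic_group_stabilizer: "linear_algebraic_group (Suc n) stabilizer"
proof -
  define S where "S = (\<lambda>(i, j). orbit_poly (Cst (p $ j) * Var i - Cst (p $ i) * Var j)) ` ({..n} \<times> {..n})"
  have ij: "Cst (p $ j) * Var i - Cst (p $ i) * Var j \<in> polys_in {..n}" if "i \<le> n" "j \<le> n" for i j using that by auto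
  have "stabilizer = G \<inter> {A \<in> carrier (GL (Suc n)). \<forall>F\<in>S. evm A F = 0}"
  proof -
    have "orbit_point A = line p \<longleftrightarrow> (\<forall>F\<in>S. evm A F = 0)" if "A \<in> G" for A
      using line_eq_iff[OF orbit_homog[OF that] p(1)] ij
      by (auto simp: orbit_point_def S_def evm_orbit_poly[OF G_mat[OF that]] poly_eval_homs mult.commute)
    then show ?thesis using G_GL by (auto simp: stabilizer_def fiber_def)
  qed
  moreover have "S \<subseteq> entry_polys (Suc n)" unfolding S_def using orbit_poly_entry ij by auto
  ultimately have "closedin (zariski_GL (Suc n)) stabilizer"
    using closedin_zariski_GL G by (auto simp: linear_algebraic_group_def intro: closedin_Int)
  then show ?thesis using subgroup_stabilizer by (simp add: linear_algebraic_group_def)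
qed

lemma transitive: "z \<in> Z \<Longrightarrow> \<exists>A\<in>G. orbit_point A = z"
proof -
  assume z: "z \<in> Z"
  then obtain v where v: "v \<in> homog_coords n" "z = line v" using Z_proj by (auto simp: proj_space_eq)
  then show ?thesis using sections[OF v(1)] z unfolding orbit_point_def by blast
qed

lemma base_point_fiber: "z \<in> Z \<Longrightarrow> base_point (fiber z) = z"
proof -
  assume "z \<in> Z"
  then obtain A where "A \<in> fiber z" using transitive by (auto simp: fiber_def)
  then have "(SOME A. A \<in> fiber z) \<in> fiber z" by (rule someI)
  then show ?thesis by (simp add: base_point_def fiber_def)
qed

abbreviation "quot \<equiv> quotient_variety (Suc n) G stabilizer"
abbreviation "G_top \<equiv> subtopology (zariski_GL (Suc n)) G"
abbreviation "Z_top \<equiv> subtopology (zariski_proj n) Z"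

lemma topspace_G: "topspace G_top = G"
  using G_GL by auto

lemma topspace_Z: "topspace Z_top = Z"
  using Z_proj by (auto simp: topspace_zariski_proj)

lemma openin_quot: "openin (ftop quot) W \<longleftrightarrow> W \<subseteq> fiber ` Z \<and> openin G_top {A \<in> G. fiber (orbit_point A) \<in> W}"
proof -
  have "(\<lambda>A. A <#\<^bsub>GL (Suc n)\<^esub> stabilizer) ` G = fiber ` Z"
    using coset_eq_fiber transitive orbit_point_in_Z by (auto simp: image_iff) metis
  moreover have "{A \<in> G. A <#\<^bsub>GL (Suc n)\<^esub> stabilizer \<in> W} = {A \<in> G. fiber (orbit_point A) \<in> W}"
    using coset_eq_fiber by auto
  ultimately show ?thesis
    by (simp add: quotient_variety_def openin_quotient_topology topspace_G del: topspace_subtopology)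
qed

lemma topspace_quot: "topspace (ftop quot) = fiber ` Z"
proof
  show "topspace (ftop quot) \<subseteq> fiber ` Z" using openin_quot openin_topspace by blast
  have "{A \<in> G. fiber (orbit_point A) \<in> fiber ` Z} = G" using orbit_point_in_Z by auto
  then have "openin (ftop quot) (fiber ` Z)" unfolding openin_quot using openin_topspace[of G_top] topspace_G by simp
  then show "fiber ` Z \<subseteq> topspace (ftop quot)" by (rule openin_subset)
qed

lemma regular_quot: "regular quot W f \<longleftrightarrow>
    regular (group_variety (Suc n) G) {A \<in> G. fiber (orbit_point A) \<in> W} (\<lambda>A. f (A <#\<^bsub>GL (Suc n)\<^esub> stabilizer))"
proof -
  have "{A \<in> G. A <#\<^bsub>GL (Suc n)\<^esub> stabilizer \<in> W} = {A \<in> G. fiber (orbit_point A) \<in> W}"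
    using coset_eq_fiber by auto
  then show ?thesis by (simp add: quotient_variety_def)
qed

lemma open_orbit_preimage:
  assumes "openin Z_top U"
  shows "openin G_top {A \<in> G. orbit_point A \<in> U}"
proof (subst openin_subopen, intro ballI)
  fix A assume "A \<in> {A \<in> G. orbit_point A \<in> U}"
  then have A: "A \<in> G" "line (A *\<^sub>v p) \<in> U" by (auto simp: orbit_point_def)
  obtain F d where F: "F \<in> forms n d" "ev (A *\<^sub>v p) F \<noteq> 0" "principal n Z F \<subseteq> U"
    using open_local_principal[OF assms orbit_homog[OF A(1)] A(2)] by blast
  note Fp = forms_polys_in[OF F(1)]
  have "B \<in> {A \<in> G. orbit_point A \<in> U}" if B: "B \<in> G" "evm B (orbit_poly F) \<noteq> 0" for B
  proof -
    have "line (B *\<^sub>v p) \<in> principal n Z F"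
      using in_principal[OF F(1) orbit_homog[OF B(1)]] B orbit_point_in_Z[OF B(1)] evm_orbit_poly[OF G_mat[OF B(1)] Fp]
      by (simp add: orbit_point_def)
    then show ?thesis using F(3) B(1) by (auto simp: orbit_point_def)
  qed
  then show "\<exists>T. openin G_top T \<and> A \<in> T \<and> T \<subseteq> {A \<in> G. orbit_point A \<in> U}"
    using openin_group_principal[OF orbit_poly_entry[OF Fp] G_GL] A(1) F(2) evm_orbit_poly[OF G_mat[OF A(1)] Fp]
    by (intro exI[of _ "{B \<in> G. evm B (orbit_poly F) \<noteq> 0}"]) auto
qed

lemma regular_orbit:
  assumes U: "U \<subseteq> Z" and f: "regular (proj_variety n Z) U f"
  shows "regular (group_variety (Suc n) G) {A \<in> G. orbit_point A \<in> U} (\<lambda>A. f (orbit_point A))"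
  unfolding regular_group_iff[OF G_GL Collect_restrict]
proof
  fix A assume "A \<in> {A \<in> G. orbit_point A \<in> U}"
  then have A: "A \<in> G" "line (A *\<^sub>v p) \<in> U" by (auto simp: orbit_point_def)
  obtain g h where gh: "is_fraction_near n Z U f (A *\<^sub>v p) g h"
    using f A(2) orbit_homog[OF A(1)] unfolding regular_proj_iff[OF Z_proj U] by blast
  then have pol: "g \<in> polys_in {..n}" "h \<in> polys_in {..n}" by (auto simp: is_fraction_near_def intro: forms_polys_in)
  show "\<exists>g\<in>entry_polys (Suc n). \<exists>h\<in>entry_polys (Suc n). evm A h \<noteq> 0 \<and>
      (\<forall>B\<in>G. evm B h \<noteq> 0 \<longrightarrow> B \<in> {A \<in> G. orbit_point A \<in> U} \<and> f (orbit_point B) = evm B g / evm B h)"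
  proof (rule bexI[of _ "orbit_poly g"], rule bexI[of _ "orbit_poly h"], intro conjI ballI impI)
    show "evm A (orbit_poly h) \<noteq> 0"
      using gh evm_orbit_poly[OF G_mat[OF A(1)] pol(2)] by (simp add: is_fraction_near_def)
    fix B assume B: "B \<in> G" "evm B (orbit_poly h) \<noteq> 0"
    note e = evm_orbit_poly[OF G_mat[OF B(1)] pol(1)] evm_orbit_poly[OF G_mat[OF B(1)] pol(2)]
    have "line (B *\<^sub>v p) \<in> U \<and> f (line (B *\<^sub>v p)) = ev (B *\<^sub>v p) g / ev (B *\<^sub>v p) h"
      using gh orbit_homog[OF B(1)] orbit_point_in_Z[OF B(1)] B(2) e
      by (auto simp: is_fraction_near_def orbit_point_def)
    then show "B \<in> {A \<in> G. orbit_point A \<in> U}" "f (orbit_point B) = evm B (orbit_poly g) / evm B (orbit_poly h)"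
      using B(1) e by (auto simp: orbit_point_def)
  qed (rule orbit_poly_entry, rule pol)+
qed

lemma morphism_base_point: "morphism quot (proj_variety n Z) base_point"
  unfolding morphism_def continuous_map_def topspace_quot ftop_proj_variety topspace_Z
proof (intro conjI allI impI)
  show "base_point \<in> fiber ` Z \<rightarrow> Z" by (auto simp: base_point_fiber)
  have pre: "{A \<in> G. fiber (orbit_point A) \<in> {C \<in> fiber ` Z. base_point C \<in> U}} = {A \<in> G. orbit_point A \<in> U}" for U
    using orbit_point_in_Z base_point_fiber by auto
  show "openin (ftop quot) {C \<in> fiber ` Z. base_point C \<in> U}" if "openin Z_top U" for U
    unfolding openin_quot pre using open_orbit_preimage[OF that] by auto
  fix U f assume "openin Z_top U \<and> regular (proj_variety n Z) U f"
  then have U: "U \<subseteq> Z" "regular (proj_variety n Z) U f" using openin_subset topspace_Z by blast+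
  have "f (base_point (A <#\<^bsub>GL (Suc n)\<^esub> stabilizer)) = f (orbit_point A)" if "A \<in> G" for A
    using coset_eq_fiber[OF that] base_point_fiber[OF orbit_point_in_Z[OF that]] by simp
  then show "regular quot {C \<in> fiber ` Z. base_point C \<in> U} (f \<circ> base_point)"
    using regular_orbit[OF U] unfolding regular_quot pre regular_group_iff[OF G_GL Collect_restrict] o_def
    by (metis (no_types, lifting))
qed

lemma section_pullback:
  assumes g: "\<forall>i\<le>n. \<forall>j\<le>n. g (i, j) \<in> forms n d" and h: "h \<in> forms n d" "ev v h \<noteq> 0"
    and F: "F \<in> entry_polys (Suc n)" and K: "K \<in> entry_polys (Suc n)" "evm (matrix_section n g h v) K \<noteq> 0"
  shows "\<exists>e. \<exists>P\<in>forms n e. \<exists>Q\<in>forms n e. ev v Q \<noteq> 0 \<and> (\<forall>w. ev w Q \<noteq> 0 \<longrightarrow> ev w h \<noteq> 0 \<and>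
    evm (matrix_section n g h w) K \<noteq> 0 \<and>
    evm (matrix_section n g h w) F / evm (matrix_section n g h w) K = ev w P / ev w Q)"
proof -
  let ?s = "matrix_section n g h"
  obtain k P where P: "P \<in> forms n (k * d)" "\<And>w. ev w h \<noteq> 0 \<Longrightarrow> evm (?s w) F = ev w P / ev w h ^ k"
    using evm_matrix_section[OF F g h(1)] by blast
  obtain k' Q where Q: "Q \<in> forms n (k' * d)" "\<And>w. ev w h \<noteq> 0 \<Longrightarrow> evm (?s w) K = ev w Q / ev w h ^ k'"
    using evm_matrix_section[OF K(1) g h(1)] by blast
  \<comment> \<open>The additional factor \<open>h\<close> makes the new denominator vanish wherever
    the section is undefined, also when both exponents of \<open>h\<close> are zero.\<close>
  have "P * h ^ k' * h \<in> forms n (k * d + k' * d + d)" using P Q h by (intro forms_mult forms_power)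
  moreover have "Q * h ^ k * h \<in> forms n (k' * d + k * d + d)" using P Q h by (intro forms_mult forms_power)
  moreover have "ev v (Q * h ^ k * h) \<noteq> 0" using K(2) Q(2)[OF h(2)] h(2) by (simp add: poly_eval_homs)
  moreover have "ev w h \<noteq> 0 \<and> evm (?s w) K \<noteq> 0 \<and> evm (?s w) F / evm (?s w) K = ev w (P * h ^ k' * h) / ev w (Q * h ^ k * h)"
    if "ev w (Q * h ^ k * h) \<noteq> 0" for w
  proof -
    have w: "ev w h \<noteq> 0" "ev w Q \<noteq> 0" using that by (auto simp: poly_eval_homs)
    then show ?thesis by (simp add: P(2) Q(2) poly_eval_homs)
  qed
  ultimately show ?thesis
    by (intro exI[of _ "k * d + k' * d + d"] bexI[of _ "P * h ^ k' * h"] bexI[of _ "Q * h ^ k * h"])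
      (simp_all add: add.commute)
qed

lemma fiber_section:
  assumes "v \<in> homog_coords n" "line v \<in> Z" "ev v h \<noteq> 0"
    and "\<forall>w\<in>homog_coords n. line w \<in> Z \<longrightarrow> ev w h \<noteq> 0 \<longrightarrow>
      matrix_section n g h w \<in> G \<and> line (matrix_section n g h w *\<^sub>v p) = line w"
  shows "matrix_section n g h v \<in> G" "orbit_point (matrix_section n g h v) = line v"
  using assms by (auto simp: orbit_point_def)

text \<open>Open sets and regular functions of the quotient live on \<open>G\<close> by definition;
  pulled back along a local section they become principal open sets and fractions on
  \<open>Z\<close>.\<close>

lemma morphism_fiber: "morphism (proj_variety n Z) quot fiber"
  unfolding morphism_def continuous_map_def topspace_quot ftop_proj_variety topspace_Z
proof (intro conjI allI impI)
  show "fiber \<in> Z \<rightarrow> fiber ` Z" by auto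
next
  fix W assume W: "openin (ftop quot) W"
  then have O: "openin G_top {A \<in> G. fiber (orbit_point A) \<in> W}" by (simp add: openin_quot)
  show "openin Z_top {z \<in> Z. fiber z \<in> W}"
  proof (rule openin_by_principal[OF _ Z_proj])
    fix v assume v: "v \<in> homog_coords n" "line v \<in> {z \<in> Z. fiber z \<in> W}"
    then have vZ: "line v \<in> Z" by simp
    obtain d g h where g: "\<forall>i\<le>n. \<forall>j\<le>n. g (i, j) \<in> forms n d" and h: "h \<in> forms n d" "ev v h \<noteq> 0"
      and s: "\<forall>w\<in>homog_coords n. line w \<in> Z \<longrightarrow> ev w h \<noteq> 0 \<longrightarrow>
        matrix_section n g h w \<in> G \<and> line (matrix_section n g h w *\<^sub>v p) = line w"
      using sections[OF v(1) vZ] by blast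
    have "matrix_section n g h v \<in> {A \<in> G. fiber (orbit_point A) \<in> W}"
      using fiber_section[OF v(1) vZ h(2) s] v(2) by simp
    from group_local_basis[OF O this G_GL] obtain K where K: "K \<in> entry_polys (Suc n)"
      "evm (matrix_section n g h v) K \<noteq> 0"
      "\<forall>B\<in>G. evm B K \<noteq> 0 \<longrightarrow> B \<in> {A \<in> G. fiber (orbit_point A) \<in> W}" by blast
    from section_pullback[OF g h K(1) K(1,2)] obtain e Q where Q: "Q \<in> forms n e" "ev v Q \<noteq> 0"
      "\<forall>w. ev w Q \<noteq> 0 \<longrightarrow> ev w h \<noteq> 0 \<and> evm (matrix_section n g h w) K \<noteq> 0" by blast
    have "fiber (line w) \<in> W" if w: "w \<in> homog_coords n" "line w \<in> Z" "ev w Q \<noteq> 0" for w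
    proof -
      have "ev w h \<noteq> 0" "evm (matrix_section n g h w) K \<noteq> 0" using Q(3) w(3) by auto
      then show ?thesis using fiber_section[OF w(1,2) _ s] K(3) by force
    qed
    then have "principal n Z Q \<subseteq> {z \<in> Z. fiber z \<in> W}" by (auto simp: principal_def)
    then show "\<exists>F d. F \<in> forms n d \<and> ev v F \<noteq> 0 \<and> principal n Z F \<subseteq> {z \<in> Z. fiber z \<in> W}" using Q by blast
  qed auto
next
  fix W f assume "openin (ftop quot) W \<and> regular quot W f"
  then have R: "regular (group_variety (Suc n) G) {A \<in> G. fiber (orbit_point A) \<in> W}
      (\<lambda>A. f (A <#\<^bsub>GL (Suc n)\<^esub> stabilizer))" by (simp add: regular_quot)
  show "regular (proj_variety n Z) {z \<in> Z. fiber z \<in> W} (f \<circ> fiber)"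
    unfolding regular_proj_iff[OF Z_proj Collect_restrict]
  proof (intro ballI impI)
    fix v assume v: "v \<in> homog_coords n" "line v \<in> {z \<in> Z. fiber z \<in> W}"
    then have vZ: "line v \<in> Z" by simp
    obtain d g h where g: "\<forall>i\<le>n. \<forall>j\<le>n. g (i, j) \<in> forms n d" and h: "h \<in> forms n d" "ev v h \<noteq> 0"
      and s: "\<forall>w\<in>homog_coords n. line w \<in> Z \<longrightarrow> ev w h \<noteq> 0 \<longrightarrow>
        matrix_section n g h w \<in> G \<and> line (matrix_section n g h w *\<^sub>v p) = line w"
      using sections[OF v(1) vZ] by blast
    have "matrix_section n g h v \<in> {A \<in> G. fiber (orbit_point A) \<in> W}"
      using fiber_section[OF v(1) vZ h(2) s] v(2) by simp
    with R[unfolded regular_group_iff[OF G_GL Collect_restrict]] obtain F K where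
      F: "F \<in> entry_polys (Suc n)" and K: "K \<in> entry_polys (Suc n)" "evm (matrix_section n g h v) K \<noteq> 0"
      and f: "\<forall>B\<in>G. evm B K \<noteq> 0 \<longrightarrow> B \<in> {A \<in> G. fiber (orbit_point A) \<in> W} \<and>
        f (B <#\<^bsub>GL (Suc n)\<^esub> stabilizer) = evm B F / evm B K" by blast
    from section_pullback[OF g h F K] obtain e P Q where P: "P \<in> forms n e"
      and Q: "Q \<in> forms n e" "ev v Q \<noteq> 0"
      and PQ: "\<forall>w. ev w Q \<noteq> 0 \<longrightarrow> ev w h \<noteq> 0 \<and> evm (matrix_section n g h w) K \<noteq> 0 \<and>
        evm (matrix_section n g h w) F / evm (matrix_section n g h w) K = ev w P / ev w Q" by blast
    have "line w \<in> {z \<in> Z. fiber z \<in> W} \<and> (f \<circ> fiber) (line w) = ev w P / ev w Q"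
      if w: "w \<in> homog_coords n" "line w \<in> Z" "ev w Q \<noteq> 0" for w
    proof -
      let ?B = "matrix_section n g h w"
      have PQw: "ev w h \<noteq> 0" "evm ?B K \<noteq> 0" "evm ?B F / evm ?B K = ev w P / ev w Q" using PQ w(3) by auto
      note B = fiber_section[OF w(1,2) PQw(1) s]
      have "?B \<in> {A \<in> G. fiber (orbit_point A) \<in> W} \<and> f (?B <#\<^bsub>GL (Suc n)\<^esub> stabilizer) = evm ?B F / evm ?B K"
        using f B(1) PQw(2) by blast
      then show ?thesis using coset_eq_fiber[OF B(1)] B(2) PQw(3) w(2) by simp
    qed
    then have "is_fraction_near n Z {z \<in> Z. fiber z \<in> W} (f \<circ> fiber) v P Q"
      unfolding is_fraction_near_def using P Q by blast
    then show "\<exists>g h. is_fraction_near n Z {z \<in> Z. fiber z \<in> W} (f \<circ> fiber) v g h" by blast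
  qed
qed

text \<open>One isomorphism is used in both directions: towards \<open>Z\<close> it shows that the
  stabilizer is parabolic, and from \<open>Z\<close> it is the required identification.\<close>

theorem homogeneous_space: "homogeneous_space (proj_variety n Z)"
proof -
  have inv: "\<forall>z\<in>topspace (ftop (proj_variety n Z)). base_point (fiber z) = z"
    "\<forall>C\<in>topspace (ftop quot). fiber (base_point C) = C"
    using base_point_fiber by (auto simp: topspace_quot topspace_proj_variety[OF Z_proj])
  have "isomorphic quot (proj_variety n Z)" "isomorphic (proj_variety n Z) quot"
    unfolding isomorphic_def using morphism_base_point morphism_fiber inv by blast+
  moreover have "stabilizer \<subseteq> G" by (auto simp: stabilizer_def fiber_def)
  ultimately show ?thesis
    unfolding homogeneous_space_def parabolic_subgroup_def
    using G conn closed linear_algebraic_group_stabilizer by blast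
qed

end

section \<open>Linear automorphisms of a projective variety\<close>

lemma det_polys_in:
  assumes A: "A \<in> carrier_mat m m" and f: "\<And>i k. i < m \<Longrightarrow> k < m \<Longrightarrow> A $$ (i, k) \<in> polys_in I"
  shows "det A \<in> polys_in I"
  unfolding det_def'[OF A]
proof (rule polys_in_sum)
  fix p assume "p \<in> {p. p permutes {0..<m}}"
  then have p: "p permutes {0..<m}" by simp
  have "(\<Prod>i = 0..<m. A $$ (i, p i)) \<in> polys_in I"
    using permutes_in_image[OF p] by (intro polys_in_prod f) auto
  then show "signof p * (\<Prod>i = 0..<m. A $$ (i, p i)) \<in> polys_in I" by (auto simp: sign_def)
qed

text \<open>The cofactors of the generic matrix, whose entries are the variables.\<close>

lemma adj_mat_entry_poly:
  assumes "i < m" "j < m"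
  shows "\<exists>Q\<in>entry_polys m. \<forall>A\<in>carrier_mat m m. evm A Q = adj_mat A $$ (i, j)"
proof -
  define X where "X = mat_delete (mat m m Var :: (nat \<times> nat) cpoly mat) j i"
  define Q where "Q = (-1) ^ (j + i) * det X"
  have X: "X \<in> carrier_mat (m - 1) (m - 1)" unfolding X_def by (rule mat_delete_carrier) simp
  have Xin: "X $$ (a, b) \<in> entry_polys m" if "a < m - 1" "b < m - 1" for a b
    using that by (auto simp: X_def mat_delete_def intro!: polys_in_Var)
  have "Q \<in> entry_polys m" unfolding Q_def by (intro polys_in_mult polys_in_power polys_in_uminus polys_in_1 det_polys_in[OF X] Xin)
  moreover have "evm A Q = adj_mat A $$ (i, j)" if A: "A \<in> carrier_mat m m" for A
  proof -
    have "map_mat (poly_eval (\<lambda>ij. A $$ ij)) X = mat_delete A j i"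
      using A by (intro eq_matI) (auto simp: X_def mat_delete_def)
    then have "evm A (det X) = det (mat_delete A j i)"
      by (simp flip: poly_eval.hom_det)
    then show ?thesis using A assms by (simp add: Q_def adj_mat_def cofactor_def poly_eval_homs)
  qed
  ultimately show ?thesis by blast
qed

text \<open>The entries of the acting matrix \<open>B\<close> may be any polynomials in those of
  \<open>A\<close>. The instances of interest are \<open>A\<close> itself and its adjugate.\<close>

lemma entry_poly_action:
  fixes Q :: "nat \<Rightarrow> nat \<Rightarrow> (nat \<times> nat) cpoly"
  assumes Q: "\<And>i j. i \<le> n \<Longrightarrow> j \<le> n \<Longrightarrow> Q i j \<in> entry_polys (Suc n)" and F: "F \<in> polys_in {..n}"
    and v: "v \<in> carrier_vec (Suc n)"
  shows "\<exists>P\<in>entry_polys (Suc n). \<forall>A B. B \<in> carrier_mat (Suc n) (Suc n) \<longrightarrow>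
    (\<forall>i\<le>n. \<forall>j\<le>n. evm A (Q i j) = B $$ (i, j)) \<longrightarrow> evm A P = ev (B *\<^sub>v v) F"
proof (intro bexI[of _ "poly_subst (\<lambda>i. \<Sum>j\<le>n. Cst (v $ j) * Q i j) F"] allI impI)
  show "poly_subst (\<lambda>i. \<Sum>j\<le>n. Cst (v $ j) * Q i j) F \<in> entry_polys (Suc n)"
    by (rule poly_subst_polys_in[OF F], intro polys_in_sum polys_in_mult polys_in_Cst Q) auto
  fix A B assume B: "B \<in> carrier_mat (Suc n) (Suc n)" "\<forall>i\<le>n. \<forall>j\<le>n. evm A (Q i j) = B $$ (i, j)"
  show "evm A (poly_subst (\<lambda>i. \<Sum>j\<le>n. Cst (v $ j) * Q i j) F) = ev (B *\<^sub>v v) F"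
    unfolding poly_eval_subst
  proof (rule poly_eval_cong_polys_in[OF F])
    fix i assume "i \<in> {..n}"
    then show "evm A (\<Sum>j\<le>n. Cst (v $ j) * Q i j) = (B *\<^sub>v v) $ i"
      using B v by (auto simp: poly_eval_homs scalar_prod_def atLeast0LessThan lessThan_Suc_atMost mult.commute intro!: sum.cong)
  qed
qed

locale projective_zero_locus =
  fixes n :: nat and S :: "nat cpoly set" and Z :: "complex vec set set"
  assumes S: "form_sys n S" and Z: "Z = zero_locus n S"
begin

definition preserves :: "complex mat \<Rightarrow> bool" where
  "preserves A \<longleftrightarrow> (\<forall>v\<in>homog_coords n. line v \<in> Z \<longrightarrow> line (A *\<^sub>v v) \<in> Z)"

text \<open>Preservation by the inverse is part of the definition, which makes closure under
  inverses immediate. What is preserved is the set \<open>Z\<close>, not the ideal of its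
  equations.\<close>

definition automorphisms :: "complex mat set" where
  "automorphisms = {A \<in> carrier_mat (Suc n) (Suc n). \<exists>B\<in>carrier_mat (Suc n) (Suc n).
     A * B = 1\<^sub>m (Suc n) \<and> B * A = 1\<^sub>m (Suc n) \<and> preserves A \<and> preserves B}"

lemma automorphisms_GL: "automorphisms \<subseteq> carrier (GL (Suc n))"
  by (auto simp: automorphisms_def carrier_GL)

lemma preserves_mult:
  assumes "A \<in> carrier (GL (Suc n))" "B \<in> carrier (GL (Suc n))" "preserves A" "preserves B"
  shows "preserves (A * B)"
  unfolding preserves_def
proof (intro ballI impI)
  fix v assume v: "v \<in> homog_coords n" "line v \<in> Z"
  have "line (A *\<^sub>v (B *\<^sub>v v)) \<in> Z"
    using assms(3,4) v GL_homog_coords[OF assms(2) v(1)] unfolding preserves_def by blast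
  then show "line (A * B *\<^sub>v v) \<in> Z"
    using assoc_mult_mat_vec[OF GL_carrier_mat[OF assms(1)] GL_carrier_mat[OF assms(2)] homog_coords_carrier[OF v(1)]]
    by simp
qed

lemma GL_inverse:
  assumes "A \<in> carrier_mat m m" "B \<in> carrier_mat m m" "A * B = 1\<^sub>m m" "B * A = 1\<^sub>m m"
  shows "A \<in> carrier (GL m)" "B \<in> carrier (GL m)" "inv\<^bsub>GL m\<^esub> A = B"
proof -
  show *: "A \<in> carrier (GL m)" "B \<in> carrier (GL m)" using assms by (auto simp: carrier_GL)
  show "inv\<^bsub>GL m\<^esub> A = B" by (rule GL.inv_equality) (use * assms in auto)
qed

lemma in_automorphisms:
  "A \<in> automorphisms \<longleftrightarrow> A \<in> carrier (GL (Suc n)) \<and> preserves A \<and> preserves (inv\<^bsub>GL (Suc n)\<^esub> A)"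
proof
  assume "A \<in> automorphisms"
  then obtain B where B: "A \<in> carrier_mat (Suc n) (Suc n)" "B \<in> carrier_mat (Suc n) (Suc n)"
    "A * B = 1\<^sub>m (Suc n)" "B * A = 1\<^sub>m (Suc n)" "preserves A" "preserves B" by (auto simp: automorphisms_def)
  then show "A \<in> carrier (GL (Suc n)) \<and> preserves A \<and> preserves (inv\<^bsub>GL (Suc n)\<^esub> A)"
    using GL_inverse[OF B(1-4)] by simp
next
  assume A: "A \<in> carrier (GL (Suc n)) \<and> preserves A \<and> preserves (inv\<^bsub>GL (Suc n)\<^esub> A)"
  then show "A \<in> automorphisms"
    using GL.l_inv[of A "Suc n"] GL.r_inv[of A "Suc n"] GL.inv_closed[of A "Suc n"] GL_carrier_mat
    by (auto simp: automorphisms_def intro!: bexI[of _ "inv\<^bsub>GL (Suc n)\<^esub> A"])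
qed

lemma subgroup_automorphisms: "subgroup automorphisms (GL (Suc n))"
proof
  show "automorphisms \<subseteq> carrier (GL (Suc n))" by (rule automorphisms_GL)
  have "preserves (1\<^sub>m (Suc n))" using homog_coords_carrier by (auto simp: preserves_def)
  then show "\<one>\<^bsub>GL (Suc n)\<^esub> \<in> automorphisms"
    unfolding automorphisms_def one_GL by (auto intro!: bexI[of _ "1\<^sub>m (Suc n)"])
  show "A \<otimes>\<^bsub>GL (Suc n)\<^esub> B \<in> automorphisms" if "A \<in> automorphisms" "B \<in> automorphisms" for A B
    using that unfolding in_automorphisms
    by (auto simp: GL.inv_mult_group[of A "Suc n" B, simplified] intro!: preserves_mult GL.m_closed[of A "Suc n" B, simplified] GL.inv_closed)
  show "inv\<^bsub>GL (Suc n)\<^esub> A \<in> automorphisms" if "A \<in> automorphisms" for A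
    using that unfolding in_automorphisms by (auto simp: GL.inv_inv GL.inv_closed)
qed

text \<open>The adjugate is polynomial in the entries and acts on lines as the inverse does; it
  replaces the inverse in polynomial conditions.\<close>

lemma inverse_adj_mat:
  assumes A: "A \<in> carrier (GL m)"
  shows "\<exists>c. c \<noteq> 0 \<and> adj_mat A = c \<cdot>\<^sub>m inv\<^bsub>GL m\<^esub> A"
proof -
  let ?B = "inv\<^bsub>GL m\<^esub> A"
  have B: "A \<in> carrier_mat m m" "?B \<in> carrier_mat m m" "A * ?B = 1\<^sub>m m"
    using GL_carrier_mat[OF A] GL_carrier_mat[OF GL.inv_closed[OF A]] GL.r_inv[OF A] by auto
  note adj = adj_mat[OF B(1)]
  have "adj_mat A = adj_mat A * (A * ?B)" using adj(1) B(3) by simp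
  also have "\<dots> = (det A \<cdot>\<^sub>m 1\<^sub>m m) * ?B" by (simp only: assoc_mult_mat[OF adj(1) B(1,2), symmetric] adj(3))
  also have "\<dots> = det A \<cdot>\<^sub>m ?B" using B(2) by (simp add: mult_smult_assoc_mat[of _ m m])
  finally have "adj_mat A = det A \<cdot>\<^sub>m ?B" .
  moreover have "det A * det ?B = 1" using det_mult[OF B(1,2)] B(3) by simp
  ultimately show ?thesis by (intro exI[of _ "det A"]) auto
qed

lemma preserves_iff:
  assumes "A \<in> carrier (GL (Suc n))"
  shows "preserves A \<longleftrightarrow> (\<forall>v\<in>homog_coords n. line v \<in> Z \<longrightarrow> (\<forall>F\<in>S. ev (A *\<^sub>v v) F = 0))"
proof -
  have "line (A *\<^sub>v v) \<in> Z \<longleftrightarrow> (\<forall>F\<in>S. ev (A *\<^sub>v v) F = 0)" if "v \<in> homog_coords n" for v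
    unfolding Z by (rule in_zero_locus[OF S GL_homog_coords[OF assms that]])
  then show ?thesis by (simp add: preserves_def)
qed

text \<open>For each point of \<open>Z\<close> and each equation, preservation is one polynomial
  condition on \<open>A\<close>; for the inverse it is one on the adjugate, as forms do not
  distinguish vectors that differ by a nonzero factor.\<close>

lemma linear_algebraic_group_automorphisms: "linear_algebraic_group (Suc n) automorphisms"
proof -
  define K where "K = {v \<in> homog_coords n. line v \<in> Z}"
  define m where "m = Suc n"
  have S_polys: "F \<in> polys_in {..n}" if "F \<in> S" for F using S that by (auto simp: form_sys_def intro: forms_polys_in)
  have "\<forall>ij. \<exists>Q. fst ij < m \<longrightarrow> snd ij < m \<longrightarrow> Q \<in> entry_polys m \<and> (\<forall>A\<in>carrier_mat m m. evm A Q = adj_mat A $$ ij)"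
    using adj_mat_entry_poly by (metis prod.collapse)
  from choice[OF this] obtain Q where Q: "\<And>i j. i < m \<Longrightarrow> j < m \<Longrightarrow> Q (i, j) \<in> entry_polys m"
    "\<And>i j A. i < m \<Longrightarrow> j < m \<Longrightarrow> A \<in> carrier_mat m m \<Longrightarrow> evm A (Q (i, j)) = adj_mat A $$ (i, j)" by auto
  have "\<forall>x\<in>K \<times> S. \<exists>P. P \<in> entry_polys (Suc n) \<and> (\<forall>A\<in>carrier_mat m m. evm A P = ev (A *\<^sub>v fst x) (snd x))"
  proof
    fix x assume x: "x \<in> K \<times> S"
    have "\<exists>P\<in>entry_polys (Suc n). \<forall>A B. B \<in> carrier_mat (Suc n) (Suc n) \<longrightarrow>
        (\<forall>i\<le>n. \<forall>j\<le>n. evm A (Var (i, j)) = B $$ (i, j)) \<longrightarrow> evm A P = ev (B *\<^sub>v fst x) (snd x)"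
      by (rule entry_poly_action) (use x in \<open>auto simp: K_def intro: S_polys homog_coords_carrier\<close>)
    then obtain P where P: "P \<in> entry_polys (Suc n)" "\<forall>A B. B \<in> carrier_mat (Suc n) (Suc n) \<longrightarrow>
        (\<forall>i\<le>n. \<forall>j\<le>n. evm A (Var (i, j)) = B $$ (i, j)) \<longrightarrow> evm A P = ev (B *\<^sub>v fst x) (snd x)" ..
    have "evm A P = ev (A *\<^sub>v fst x) (snd x)" if "A \<in> carrier_mat m m" for A
      using P(2)[rule_format, of A A] that by (simp add: m_def)
    then show "\<exists>P. P \<in> entry_polys (Suc n) \<and> (\<forall>A\<in>carrier_mat m m. evm A P = ev (A *\<^sub>v fst x) (snd x))"
      using P(1) by blast
  qed
  from bchoice[OF this] obtain P where P: "\<forall>x\<in>K \<times> S. P x \<in> entry_polys (Suc n) \<and>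
    (\<forall>A\<in>carrier_mat m m. evm A (P x) = ev (A *\<^sub>v fst x) (snd x))" ..
  have "\<forall>x\<in>K \<times> S. \<exists>P. P \<in> entry_polys (Suc n) \<and> (\<forall>A\<in>carrier_mat m m. evm A P = ev (adj_mat A *\<^sub>v fst x) (snd x))"
  proof
    fix x assume x: "x \<in> K \<times> S"
    have "\<exists>P\<in>entry_polys (Suc n). \<forall>A B. B \<in> carrier_mat (Suc n) (Suc n) \<longrightarrow>
        (\<forall>i\<le>n. \<forall>j\<le>n. evm A (Q (i, j)) = B $$ (i, j)) \<longrightarrow> evm A P = ev (B *\<^sub>v fst x) (snd x)"
      by (rule entry_poly_action) (use x Q(1) in \<open>auto intro: S_polys homog_coords_carrier simp: m_def K_def\<close>)
    then obtain P where P: "P \<in> entry_polys (Suc n)" "\<forall>A B. B \<in> carrier_mat (Suc n) (Suc n) \<longrightarrow>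
        (\<forall>i\<le>n. \<forall>j\<le>n. evm A (Q (i, j)) = B $$ (i, j)) \<longrightarrow> evm A P = ev (B *\<^sub>v fst x) (snd x)" ..
    have "evm A P = ev (adj_mat A *\<^sub>v fst x) (snd x)" if A: "A \<in> carrier_mat m m" for A
      using P(2)[rule_format, of "adj_mat A" A] adj_mat(1)[OF A] Q(2)[OF _ _ A] by (simp add: m_def)
    then show "\<exists>P. P \<in> entry_polys (Suc n) \<and> (\<forall>A\<in>carrier_mat m m. evm A P = ev (adj_mat A *\<^sub>v fst x) (snd x))"
      using P(1) by blast
  qed
  from bchoice[OF this] obtain P' where P': "\<forall>x\<in>K \<times> S. P' x \<in> entry_polys (Suc n) \<and>
    (\<forall>A\<in>carrier_mat m m. evm A (P' x) = ev (adj_mat A *\<^sub>v fst x) (snd x))" ..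
  define T where "T = P ` (K \<times> S) \<union> P' ` (K \<times> S)"
  have "A \<in> automorphisms \<longleftrightarrow> (\<forall>F\<in>T. evm A F = 0)" if A: "A \<in> carrier (GL (Suc n))" for A
  proof -
    have Am: "A \<in> carrier_mat m m" using GL_carrier_mat[OF A] by (simp add: m_def)
    have iA: "inv\<^bsub>GL (Suc n)\<^esub> A \<in> carrier (GL (Suc n))" using GL.inv_closed[OF A] .
    obtain c where c: "c \<noteq> 0" "adj_mat A = c \<cdot>\<^sub>m inv\<^bsub>GL (Suc n)\<^esub> A" using inverse_adj_mat[OF A] by blast
    have adj0: "ev (adj_mat A *\<^sub>v v) F = 0 \<longleftrightarrow> ev (inv\<^bsub>GL (Suc n)\<^esub> A *\<^sub>v v) F = 0"
      if "v \<in> K" "F \<in> S" for v F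
    proof -
      have v: "v \<in> carrier_vec (Suc n)" using that homog_coords_carrier by (auto simp: K_def)
      obtain e where e: "F \<in> forms n e" using S \<open>F \<in> S\<close> by (auto simp: form_sys_def)
      have "adj_mat A *\<^sub>v v = c \<cdot>\<^sub>v (inv\<^bsub>GL (Suc n)\<^esub> A *\<^sub>v v)"
        unfolding c(2) using GL_carrier_mat[OF iA] v by (intro eq_vecI) auto
      then show ?thesis
        using ev_smult[OF e mult_mat_vec_carrier[OF GL_carrier_mat[OF iA] v]] c(1) by simp
    qed
    have "(\<forall>F\<in>T. evm A F = 0) \<longleftrightarrow> (\<forall>v\<in>K. \<forall>F\<in>S. ev (A *\<^sub>v v) F = 0) \<and> (\<forall>v\<in>K. \<forall>F\<in>S. ev (adj_mat A *\<^sub>v v) F = 0)"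
      using P P' Am unfolding T_def by (auto simp: ball_Un)
    also have "\<dots> \<longleftrightarrow> preserves A \<and> preserves (inv\<^bsub>GL (Suc n)\<^esub> A)"
      unfolding preserves_iff[OF A] preserves_iff[OF iA] using adj0 by (auto simp: K_def)
    finally show ?thesis using A in_automorphisms by blast
  qed
  then have "automorphisms = {A \<in> carrier (GL (Suc n)). \<forall>F\<in>T. evm A F = 0}" using automorphisms_GL by blast
  moreover have "T \<subseteq> entry_polys (Suc n)" using P P' by (auto simp: T_def)
  ultimately have "closedin (zariski_GL (Suc n)) automorphisms" by (simp only: closedin_zariski_GL)
  then show ?thesis using subgroup_automorphisms by (simp add: linear_algebraic_group_def)
qed

abbreviation "Aut0 \<equiv> identity_component (Suc n) automorphisms"

theorem homogeneous_by_sections: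
  assumes p: "p \<in> homog_coords n" "line p \<in> Z"
    and sections: "\<And>v. v \<in> homog_coords n \<Longrightarrow> line v \<in> Z \<Longrightarrow> \<exists>d g h.
      (\<forall>i\<le>n. \<forall>j\<le>n. g (i, j) \<in> forms n d) \<and> h \<in> forms n d \<and> ev v h \<noteq> 0 \<and>
      (\<forall>w\<in>homog_coords n. line w \<in> Z \<longrightarrow> ev w h \<noteq> 0 \<longrightarrow>
        matrix_section n g h w \<in> Aut0 \<and> line (matrix_section n g h w *\<^sub>v p) = line w)"
  shows "homogeneous_space (proj_variety n Z)"
proof -
  note lag = linear_algebraic_group_automorphisms
  have "line (A *\<^sub>v v) \<in> Z" if "A \<in> Aut0" "v \<in> homog_coords n" "line v \<in> Z" for A v
    using that identity_component_subset[OF lag] by (auto simp: automorphisms_def preserves_def)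
  then interpret orbit_with_sections n Z Aut0 p
    using linear_algebraic_group_identity_component[OF lag] connectedin_identity_component[OF lag]
      closedin_zero_locus[OF S] p sections
    by unfold_locales (auto simp: Z)
  show ?thesis by (rule homogeneous_space)
qed

text \<open>The constant section with value the identity matrix suffices.\<close>

theorem homogeneous_single_point:
  assumes p: "p \<in> homog_coords n" "Z = {line p}"
  shows "homogeneous_space (proj_variety n Z)"
proof (rule homogeneous_by_sections[OF p(1)])
  show "line p \<in> Z" using p by simp
  define g :: "nat \<times> nat \<Rightarrow> nat cpoly" where "g ij = (if fst ij = snd ij then 1 else 0)" for ij
  have one: "matrix_section n g 1 w = 1\<^sub>m (Suc n)" for w
    by (intro eq_matI) (auto simp: matrix_section_def g_def poly_eval_homs)
  have "g ij \<in> forms n 0" for ij by (simp add: g_def)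
  moreover have "line (1\<^sub>m (Suc n) *\<^sub>v p) = line w" if "line w \<in> Z" for w
    using that p homog_coords_carrier by simp
  ultimately show "\<exists>d g h. (\<forall>i\<le>n. \<forall>j\<le>n. g (i, j) \<in> forms n d) \<and> h \<in> forms n d \<and> ev v h \<noteq> 0 \<and>
      (\<forall>w\<in>homog_coords n. line w \<in> Z \<longrightarrow> ev w h \<noteq> 0 \<longrightarrow>
        matrix_section n g h w \<in> Aut0 \<and> line (matrix_section n g h w *\<^sub>v p) = line w)" for v
    using one_identity_component[OF linear_algebraic_group_automorphisms]
    by (intro exI[of _ 0] exI[of _ g] exI[of _ 1]) (auto simp: one poly_eval_homs)
qed

end

section \<open>Linear subspaces and quadrics\<close>

definition functional :: "nat \<Rightarrow> (nat \<Rightarrow> complex) \<Rightarrow> complex vec \<Rightarrow> complex" where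
  "functional n f v = (\<Sum>j\<le>n. f j * v $ j)"

text \<open>The identity plus the product of the column \<open>x\<close> and the row
  \<open>f\<close>. With \<open>functional n f x = 0\<close> this is a transvection, with value -2 a
  reflection.\<close>

definition rank_one :: "nat \<Rightarrow> complex vec \<Rightarrow> (nat \<Rightarrow> complex) \<Rightarrow> complex mat" where
  "rank_one n x f = mat (Suc n) (Suc n) (\<lambda>(i, j). (if i = j then 1 else 0) + x $ i * f j)"

lemma rank_one_carrier [simp]: "rank_one n x f \<in> carrier_mat (Suc n) (Suc n)"
  by (simp add: rank_one_def)

lemma functional_add_smult:
  assumes "v \<in> carrier_vec (Suc n)" "w \<in> carrier_vec (Suc n)"
  shows "functional n f (v + c \<cdot>\<^sub>v w) = functional n f v + c * functional n f w"
  using assms by (simp add: functional_def sum.distrib sum_distrib_left algebra_simps)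

lemma functional_smult: "v \<in> carrier_vec (Suc n) \<Longrightarrow> functional n f (c \<cdot>\<^sub>v v) = c * functional n f v"
  by (simp add: functional_def sum_distrib_left mult_ac)

lemma rank_one_vec:
  assumes v: "v \<in> carrier_vec (Suc n)" and x: "x \<in> carrier_vec (Suc n)"
  shows "rank_one n x f *\<^sub>v v = v + functional n f v \<cdot>\<^sub>v x"
proof (rule eq_vecI)
  fix i assume "i < dim_vec (v + functional n f v \<cdot>\<^sub>v x)"
  then have i: "i \<le> n" using x by simp
  have "(rank_one n x f *\<^sub>v v) $ i = (\<Sum>j\<le>n. ((if i = j then 1 else 0) + x $ i * f j) * v $ j)"
    using v i by (simp add: rank_one_def scalar_prod_def atLeast0LessThan lessThan_Suc_atMost)
  also have "\<dots> = (\<Sum>j\<le>n. (if i = j then v $ j else 0) + x $ i * (f j * v $ j))"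
    by (intro sum.cong) (auto simp: algebra_simps)
  also have "\<dots> = v $ i + functional n f v * x $ i"
    using i by (simp add: functional_def sum.distrib sum_distrib_left mult.commute)
  finally show "(rank_one n x f *\<^sub>v v) $ i = (v + functional n f v \<cdot>\<^sub>v x) $ i" using i v x by simp
qed (use x in \<open>simp add: rank_one_def\<close>)

lemma rank_one_mult:
  assumes x: "x \<in> carrier_vec (Suc n)" and y: "y \<in> carrier_vec (Suc n)"
  shows "rank_one n x f * rank_one n y f = rank_one n (x + y + functional n f y \<cdot>\<^sub>v x) f"
proof (rule eq_matI)
  fix i j assume "i < dim_row (rank_one n (x + y + functional n f y \<cdot>\<^sub>v x) f)"
    "j < dim_col (rank_one n (x + y + functional n f y \<cdot>\<^sub>v x) f)"
  then have ij: "i \<le> n" "j \<le> n" by (simp_all add: rank_one_def)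
  define c where "c = col (rank_one n y f) j"
  have c: "c \<in> carrier_vec (Suc n)" by (simp add: c_def rank_one_def carrier_vecI)
  have ci: "c $ k = (if k = j then 1 else 0) + y $ k * f j" if "k \<le> n" for k
    using that ij by (simp add: c_def rank_one_def)
  have "functional n f c = (\<Sum>k\<le>n. (if k = j then f k else 0) + f k * y $ k * f j)"
    unfolding functional_def by (intro sum.cong) (auto simp: ci algebra_simps)
  also have "\<dots> = f j + functional n f y * f j"
    using ij by (simp add: sum.distrib functional_def sum_distrib_right)
  finally have fc: "functional n f c = f j + functional n f y * f j" .
  have "(rank_one n x f * rank_one n y f) $$ (i, j) = (rank_one n x f *\<^sub>v c) $ i"
    using ij by (simp add: c_def rank_one_def)
  also have "\<dots> = c $ i + functional n f c * x $ i" using rank_one_vec[OF c x] ij c x by simp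
  finally show "(rank_one n x f * rank_one n y f) $$ (i, j) = rank_one n (x + y + functional n f y \<cdot>\<^sub>v x) f $$ (i, j)"
    using ij x y by (simp add: ci fc rank_one_def algebra_simps)
qed (simp_all add: rank_one_def)

lemma rank_one_0: "rank_one n (0\<^sub>v (Suc n)) f = 1\<^sub>m (Suc n)"
  by (intro eq_matI) (auto simp: rank_one_def)

text \<open>The Sherman-Morrison formula; for fixed \<open>f\<close> these matrices are closed under
  products by \<open>rank_one_mult\<close>.\<close>

lemma rank_one_inverse:
  assumes x: "x \<in> carrier_vec (Suc n)" and nz: "1 + functional n f x \<noteq> 0"
    and y: "y = (- 1 / (1 + functional n f x)) \<cdot>\<^sub>v x"
  shows "rank_one n x f * rank_one n y f = 1\<^sub>m (Suc n)" "rank_one n y f * rank_one n x f = 1\<^sub>m (Suc n)"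
proof -
  have yc: "y \<in> carrier_vec (Suc n)" using x y by simp
  define a where "a = - 1 / (1 + functional n f x)"
  have a: "1 + a + a * functional n f x = 0" using nz by (simp add: a_def field_simps)
  have "x $ i + a * x $ i + a * functional n f x * x $ i = 0" for i
    using arg_cong[OF a, of "\<lambda>c. c * x $ i"] by (simp add: algebra_simps)
  then have "x + y + functional n f y \<cdot>\<^sub>v x = 0\<^sub>v (Suc n)" "y + x + functional n f x \<cdot>\<^sub>v y = 0\<^sub>v (Suc n)"
    using x unfolding y functional_smult[OF x] a_def[symmetric]
    by (auto simp: algebra_simps intro!: eq_vecI)
  then show "rank_one n x f * rank_one n y f = 1\<^sub>m (Suc n)" "rank_one n y f * rank_one n x f = 1\<^sub>m (Suc n)"
    using rank_one_mult[OF x yc] rank_one_mult[OF yc x] rank_one_0 by auto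
qed

lemma ev_linear_form:
  assumes F: "F \<in> forms n 1" and v: "v \<in> carrier_vec (Suc n)" "w \<in> carrier_vec (Suc n)"
  shows "ev (v + c \<cdot>\<^sub>v w) F = ev v F + c * ev w F"
proof -
  have "partial_deriv j F \<in> forms n 0" for j using partial_deriv_forms[OF F] by simp
  then have "\<forall>j. \<exists>b. partial_deriv j F = Cst b" by (intro allI forms_degree_0)
  then obtain b where b: "\<And>j. partial_deriv j F = Cst (b j)" by metis
  have e: "ev u F = (\<Sum>j\<le>n. u $ j * b j)" for u
    using euler_forms[OF F, of "\<lambda>i. u $ i"] by (simp add: b)
  show ?thesis unfolding e using v by (simp add: algebra_simps sum.distrib sum_distrib_left)
qed

context projective_zero_locus
begin

lemma rank_one_automorphism:
  assumes x: "x \<in> carrier_vec (Suc n)" and nz: "1 + functional n f x \<noteq> 0"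
    and pres: "\<And>v F. v \<in> homog_coords n \<Longrightarrow> line v \<in> Z \<Longrightarrow> F \<in> S \<Longrightarrow> ev (v + functional n f v \<cdot>\<^sub>v x) F = 0"
      "\<And>v F. v \<in> homog_coords n \<Longrightarrow> line v \<in> Z \<Longrightarrow> F \<in> S \<Longrightarrow>
        ev (v + functional n f v \<cdot>\<^sub>v ((- 1 / (1 + functional n f x)) \<cdot>\<^sub>v x)) F = 0"
  shows "rank_one n x f \<in> automorphisms"
proof -
  define y where "y = (- 1 / (1 + functional n f x)) \<cdot>\<^sub>v x"
  have y: "y \<in> carrier_vec (Suc n)" using x by (simp add: y_def)
  note inv = rank_one_inverse[OF x nz y_def]
  note GL = GL_inverse[OF rank_one_carrier rank_one_carrier inv]
  have "preserves (rank_one n x f)" "preserves (rank_one n y f)"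
    unfolding preserves_iff[OF GL(1)] preserves_iff[OF GL(2)]
    using pres rank_one_vec[OF homog_coords_carrier x] rank_one_vec[OF homog_coords_carrier y] by (auto simp: y_def)
  then show ?thesis unfolding automorphisms_def using inv by (auto intro!: bexI[of _ "rank_one n y f"])
qed

text \<open>A coordinate that is nonzero at both points will do, after rescaling; if neither of the
  two chosen ones is, their sum is.\<close>

lemma normalized_functional_exists:
  assumes p: "p \<in> homog_coords n" and v: "v \<in> homog_coords n"
  shows "\<exists>f. functional n f p = 1 \<and> functional n f v \<noteq> 0"
proof -
  obtain a b where a: "a \<le> n" "p $ a \<noteq> 0" and b: "b \<le> n" "v $ b \<noteq> 0" using p v by (auto simp: homog_coords_iff)
  have e: "functional n (\<lambda>j. if j = i then c else 0) u = c * u $ i" if "i \<le> n" for i c u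
    using that by (simp add: functional_def if_distrib[where f = "\<lambda>x. x * _"] cong: if_cong)
  have e2: "functional n (\<lambda>j. (if j = a then c else 0) + (if j = b then c' else 0)) u = c * u $ a + c' * u $ b" for c c' u
    using e[OF a(1)] e[OF b(1)] by (simp add: functional_def sum.distrib distrib_right)
  show ?thesis
  proof (cases "v $ a = 0 \<and> p $ b = 0")
    case True
    then show ?thesis
      using a b by (intro exI[of _ "\<lambda>j. (if j = a then 1 / p $ a else 0) + (if j = b then 1 else 0)"]) (simp add: e2)
  next
    case False
    then show ?thesis
    proof (cases "v $ a = 0")
      case False
      then show ?thesis using a by (intro exI[of _ "\<lambda>j. if j = a then 1 / p $ a else 0"]) (simp add: e[OF a(1)])
    next
      case True
      then have "p $ b \<noteq> 0" using \<open>\<not> (v $ a = 0 \<and> p $ b = 0)\<close> by simp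
      then show ?thesis using b by (intro exI[of _ "\<lambda>j. if j = b then 1 / p $ b else 0"]) (simp add: e[OF b(1)])
    qed
  qed
qed

text \<open>Where \<open>f\<close> does not vanish, \<open>x = w / f(w) - p\<close> lies in the
  linear space and is killed by \<open>f\<close>. The transvection with \<open>x\<close> and
  \<open>f\<close> takes \<open>p\<close> to \<open>w / f(w)\<close>. Replacing \<open>x\<close> by
  \<open>t x\<close> joins it to the identity by a line of automorphisms.\<close>

theorem homogeneous_linear:
  assumes lin: "\<And>F. F \<in> S \<Longrightarrow> F \<in> forms n 1" and p: "p \<in> homog_coords n" "line p \<in> Z"
  shows "homogeneous_space (proj_variety n Z)"
proof (rule homogeneous_by_sections[OF p])
  fix v assume v: "v \<in> homog_coords n" "line v \<in> Z"
  obtain f where f: "functional n f p = 1" "functional n f v \<noteq> 0" using normalized_functional_exists[OF p(1) v(1)] by blast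
  define h :: "nat cpoly" where "h = (\<Sum>j\<le>n. Cst (f j) * Var j)"
  \<comment> \<open>The entries of this transvection multiplied by \<open>f(w)\<close>, the value of
    \<open>h\<close>, so that they are forms of degree one in \<open>w\<close>.\<close>
  define g where "g ij = Cst (if fst ij = snd ij then 1 else 0) * h + Cst (f (snd ij)) * (Var (fst ij) - Cst (p $ fst ij) * h)"
    for ij :: "nat \<times> nat"
  have h: "h \<in> forms n 1" unfolding h_def by (intro forms_sum forms_Cst_mult forms_Var) auto
  have evh: "ev w h = functional n f w" for w by (simp add: h_def functional_def poly_eval_homs)
  have pc: "p \<in> carrier_vec (Suc n)" using p(1) by (rule homog_coords_carrier)
  have W: "ev w F = 0" if "w \<in> homog_coords n" "line w \<in> Z" "F \<in> S" for w F
    using that in_zero_locus[OF S] by (simp add: Z)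
  have sec: "matrix_section n g h w \<in> Aut0 \<and> line (matrix_section n g h w *\<^sub>v p) = line w"
    if w: "w \<in> homog_coords n" "line w \<in> Z" "ev w h \<noteq> 0" for w
  proof -
    have fw: "functional n f w \<noteq> 0" using w(3) evh by simp
    have wc: "w \<in> carrier_vec (Suc n)" using w(1) by (rule homog_coords_carrier)
    define c where "c = - 1 / functional n f w"
    define x where "x = (- 1) \<cdot>\<^sub>v (p + c \<cdot>\<^sub>v w)"
    have xc: "x \<in> carrier_vec (Suc n)" using pc wc by (simp add: x_def)
    have fx: "functional n f x = 0"
    proof -
      have "functional n f (p + c \<cdot>\<^sub>v w) = 0" using fw f(1) by (simp add: functional_add_smult[OF pc wc] c_def)
      then show ?thesis using pc wc functional_smult[of "p + c \<cdot>\<^sub>v w" n f "- 1"] by (simp add: x_def)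
    qed
    have ftx: "functional n f (t \<cdot>\<^sub>v x) = 0" for t
      using fx functional_smult[OF xc] by simp
    have evx: "ev x F = 0" if "F \<in> S" for F
    proof -
      have "ev (p + c \<cdot>\<^sub>v w) F = 0" using ev_linear_form[OF lin[OF that] pc wc] W[OF p that] W[OF w(1,2) that] by simp
      then show ?thesis using ev_smult[OF lin[OF that], of "p + c \<cdot>\<^sub>v w"] pc wc by (simp add: x_def)
    qed
    have aut: "rank_one n (t \<cdot>\<^sub>v x) f \<in> automorphisms" for t
    proof (rule rank_one_automorphism)
      have "ev (u + b \<cdot>\<^sub>v (t \<cdot>\<^sub>v x)) F = 0" "ev (u + b \<cdot>\<^sub>v (a \<cdot>\<^sub>v (t \<cdot>\<^sub>v x))) F = 0"
        if "u \<in> homog_coords n" "line u \<in> Z" "F \<in> S" for u F a b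
        using ev_linear_form[OF lin[OF that(3)] homog_coords_carrier[OF that(1)] xc] W[OF that] evx[OF that(3)]
        by (simp_all add: smult_smult_assoc)
      then show "ev (u + functional n f u \<cdot>\<^sub>v (t \<cdot>\<^sub>v x)) F = 0"
        "ev (u + functional n f u \<cdot>\<^sub>v ((- 1 / (1 + functional n f (t \<cdot>\<^sub>v x))) \<cdot>\<^sub>v (t \<cdot>\<^sub>v x))) F = 0"
        if "u \<in> homog_coords n" "line u \<in> Z" "F \<in> S" for u F using that by blast+
    qed (use xc ftx in auto)
    have curve: "mat (Suc n) (Suc n) (\<lambda>ij. poly ((\<lambda>ij. [:if fst ij = snd ij then 1 else 0, x $ fst ij * f (snd ij):]) ij) t / poly 1 t)
      = rank_one n (t \<cdot>\<^sub>v x) f" for t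
      using xc by (intro eq_matI) (auto simp: rank_one_def)
    have "rank_one n (1 \<cdot>\<^sub>v x) f \<in> Aut0"
    proof -
      have "0 \<cdot>\<^sub>v x = 0\<^sub>v (Suc n)" using xc by (intro eq_vecI) auto
      then have "rank_one n (0 \<cdot>\<^sub>v x) f = 1\<^sub>m (Suc n)" by (simp only: rank_one_0)
      then show ?thesis
        using rational_curve_identity_component[OF automorphisms_GL, of 1
          "\<lambda>ij. [:if fst ij = snd ij then 1 else 0, x $ fst ij * f (snd ij):]" 0 1, unfolded curve] aut by simp
    qed
    moreover have "matrix_section n g h w = rank_one n x f"
      using pc wc fw
      by (intro eq_matI) (auto simp: matrix_section_def rank_one_def g_def poly_eval_homs evh x_def c_def divide_simps algebra_simps)
    moreover have "rank_one n x f *\<^sub>v p = (- c) \<cdot>\<^sub>v w"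
      unfolding rank_one_vec[OF pc xc] f(1) using pc wc by (intro eq_vecI) (auto simp: x_def)
    moreover have "line ((- c) \<cdot>\<^sub>v w) = line w" using fw by (intro line_smult) (simp add: c_def)
    ultimately show ?thesis by simp
  qed
  have "g ij \<in> forms n 1" if "fst ij \<le> n" for ij
    unfolding g_def using that by (intro forms_add forms_diff forms_Cst_mult forms_Var h)
  then show "\<exists>d g h. (\<forall>i\<le>n. \<forall>j\<le>n. g (i, j) \<in> forms n d) \<and> h \<in> forms n d \<and> ev v h \<noteq> 0 \<and>
      (\<forall>w\<in>homog_coords n. line w \<in> Z \<longrightarrow> ev w h \<noteq> 0 \<longrightarrow>
        matrix_section n g h w \<in> Aut0 \<and> line (matrix_section n g h w *\<^sub>v p) = line w)"
    using h f(2) sec by (intro exI[of _ 1] exI[of _ g] exI[of _ h]) (auto simp: evh)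
qed

end

section \<open>Quadrics in linear spaces, and reflections\<close>

lemma quadratic_form_matrix:
  assumes F: "F \<in> forms n 2"
  obtains B where "\<And>i j. B i j = B j i" "\<And>v j. ev v (partial_deriv j F) = (\<Sum>i\<le>n. B i j * v $ i)"
    "\<And>v. 2 * ev v F = (\<Sum>i\<le>n. \<Sum>j\<le>n. B i j * v $ i * v $ j)"
proof -
  have F1: "partial_deriv j F \<in> forms n 1" for j using partial_deriv_forms[OF F] by simp
  \<comment> \<open>\<open>B\<close> is the Hessian, which is constant for degree two; Euler's
    identity, applied twice, gives the derivatives and then the form up to the factor 2.\<close>
  have "partial_deriv i (partial_deriv j F) \<in> forms n 0" for i j using partial_deriv_forms[OF F1] by simp
  then have "\<exists>c. partial_deriv i (partial_deriv j F) = Cst c" for i j by (rule forms_degree_0)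
  then obtain B where B: "\<And>i j. partial_deriv i (partial_deriv j F) = Cst (B i j)" by metis
  have Cst_inj: "b = c" if "Cst b = (Cst c :: nat cpoly)" for b c
  proof -
    have "poly_eval (\<lambda>_. 0) (Cst b :: nat cpoly) = poly_eval (\<lambda>_. 0) (Cst c :: nat cpoly)" by (simp only: that)
    then show ?thesis by simp
  qed
  have B': "B i j = B j i" for i j using partial_deriv_commute[of i j F] by (intro Cst_inj) (simp only: B)
  have e: "ev v (partial_deriv j F) = (\<Sum>i\<le>n. B i j * v $ i)" for v j
    using euler_forms[OF F1, of "\<lambda>i. v $ i" j] by (simp add: B mult.commute)
  have "2 * ev v F = (\<Sum>j\<le>n. v $ j * (\<Sum>i\<le>n. B i j * v $ i))" for v
    using euler_forms[OF F, of "\<lambda>i. v $ i"] by (simp add: e)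
  also have "\<dots> v = (\<Sum>i\<le>n. \<Sum>j\<le>n. B i j * v $ i * v $ j)" for v
    unfolding sum_distrib_left by (subst sum.swap) (simp add: mult_ac)
  finally have "2 * ev v F = (\<Sum>i\<le>n. \<Sum>j\<le>n. B i j * v $ i * v $ j)" for v .
  with B' e show thesis by (rule that)
qed

lemma functional_scale: "functional n (\<lambda>j. c * f j) v = c * functional n f v"
  by (simp add: functional_def sum_distrib_left mult.assoc)

locale quadric = projective_zero_locus +
  fixes B :: "nat \<Rightarrow> nat \<Rightarrow> complex" and Ls :: "nat cpoly set"
  assumes B_sym: "\<And>i j. B i j = B j i" and Ls: "\<And>L. L \<in> Ls \<Longrightarrow> L \<in> forms n 1"
    and Z_iff: "\<And>v. v \<in> homog_coords n \<Longrightarrow> line v \<in> Z \<longleftrightarrow>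
      (\<forall>L\<in>Ls. ev v L = 0) \<and> (\<Sum>i\<le>n. \<Sum>j\<le>n. B i j * v $ i * v $ j) = 0"
begin

definition W :: "complex vec set" where
  "W = {v \<in> carrier_vec (Suc n). \<forall>L\<in>Ls. ev v L = 0}"

definition bil :: "complex vec \<Rightarrow> complex vec \<Rightarrow> complex" where
  "bil v w = (\<Sum>i\<le>n. \<Sum>j\<le>n. B i j * v $ i * w $ j)"

lemma W_carrier: "v \<in> W \<Longrightarrow> v \<in> carrier_vec (Suc n)"
  by (simp add: W_def)

lemma in_Z: "v \<in> homog_coords n \<Longrightarrow> line v \<in> Z \<longleftrightarrow> v \<in> W \<and> bil v v = 0"
  using Z_iff homog_coords_carrier by (auto simp: W_def bil_def)

lemma W_add_smult: "v \<in> W \<Longrightarrow> w \<in> W \<Longrightarrow> v + c \<cdot>\<^sub>v w \<in> W"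
  using ev_linear_form[OF Ls] by (auto simp: W_def)

lemma bil_sym: "bil v w = bil w v"
proof -
  have "B i j * v $ i * w $ j = B j i * w $ j * v $ i" for i j using B_sym[of i j] by simp
  then have *: "bil v w = (\<Sum>i\<le>n. \<Sum>j\<le>n. B j i * w $ j * v $ i)" unfolding bil_def by (intro sum.cong refl)
  show ?thesis unfolding bil_def[of w v] by (subst sum.swap) (rule *)
qed

lemma bil_functional: "bil v w = functional n (\<lambda>j. \<Sum>i\<le>n. B i j * v $ i) w"
  unfolding bil_def functional_def sum_distrib_right by (rule sum.swap)

lemma bil_right: "w \<in> carrier_vec (Suc n) \<Longrightarrow> x \<in> carrier_vec (Suc n) \<Longrightarrow> bil v (w + c \<cdot>\<^sub>v x) = bil v w + c * bil v x"
  unfolding bil_functional by (rule functional_add_smult)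

lemma bil_left: "w \<in> carrier_vec (Suc n) \<Longrightarrow> x \<in> carrier_vec (Suc n) \<Longrightarrow> bil (w + c \<cdot>\<^sub>v x) v = bil w v + c * bil x v"
  unfolding bil_sym[of _ v] by (rule bil_right)

text \<open>The reflection in the hyperplane orthogonal to \<open>u\<close> for the bilinear form.
  It is meant for \<open>bil u u \<noteq> 0\<close>; for isotropic \<open>u\<close> the division by
  zero makes it the identity.\<close>

definition reflection :: "complex vec \<Rightarrow> complex mat" where
  "reflection u = rank_one n u (\<lambda>j. (- 2 / bil u u) * (\<Sum>i\<le>n. B i j * u $ i))"

lemma reflection_functional:
  "functional n (\<lambda>j. (- 2 / bil u u) * (\<Sum>i\<le>n. B i j * u $ i)) v = (- 2 / bil u u) * bil u v"
  by (simp only: functional_scale bil_functional[of u v])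

lemma reflection_carrier [simp]: "reflection u \<in> carrier_mat (Suc n) (Suc n)"
  by (simp add: reflection_def)

lemma reflection_vec:
  "u \<in> carrier_vec (Suc n) \<Longrightarrow> v \<in> carrier_vec (Suc n) \<Longrightarrow>
    reflection u *\<^sub>v v = v + ((- 2 / bil u u) * bil u v) \<cdot>\<^sub>v u"
  unfolding reflection_def by (simp only: rank_one_vec reflection_functional)

lemma reflection_square:
  assumes u: "u \<in> carrier_vec (Suc n)" "bil u u \<noteq> 0"
  shows "reflection u * reflection u = 1\<^sub>m (Suc n)"
proof -
  have "reflection u * reflection u = rank_one n (u + u + ((- 2 / bil u u) * bil u u) \<cdot>\<^sub>v u)
      (\<lambda>j. (- 2 / bil u u) * (\<Sum>i\<le>n. B i j * u $ i))"
    unfolding reflection_def rank_one_mult[OF u(1) u(1)] reflection_functional ..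
  moreover have "u + u + ((- 2 / bil u u) * bil u u) \<cdot>\<^sub>v u = 0\<^sub>v (Suc n)" using u by (intro eq_vecI) auto
  ultimately show ?thesis by (simp only: rank_one_0)
qed

lemma reflection_automorphism:
  assumes u: "u \<in> W" "bil u u \<noteq> 0"
  shows "reflection u \<in> automorphisms"
proof -
  note uc = W_carrier[OF u(1)]
  note GL = GL_inverse[OF reflection_carrier reflection_carrier reflection_square[OF uc u(2)] reflection_square[OF uc u(2)]]
  have "preserves (reflection u)"
    unfolding preserves_def
  proof (intro ballI impI)
    fix v assume v: "v \<in> homog_coords n" "line v \<in> Z"
    then have vW: "v \<in> W" "bil v v = 0" using in_Z by auto
    note vc = W_carrier[OF vW(1)]
    define c where "c = (- 2 / bil u u) * bil u v"
    have Rv: "reflection u *\<^sub>v v = v + c \<cdot>\<^sub>v u" unfolding c_def by (rule reflection_vec[OF uc vc])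
    have "bil (v + c \<cdot>\<^sub>v u) (v + c \<cdot>\<^sub>v u) = 2 * c * bil u v + c * c * bil u u"
      using vW(2) bil_sym[of v u] by (simp add: bil_left[OF vc uc] bil_right[OF vc uc] algebra_simps)
    also have "\<dots> = 0" using u(2) by (simp add: c_def)
    finally show "line (reflection u *\<^sub>v v) \<in> Z"
      using in_Z[OF GL_homog_coords[OF GL(1) v(1)]] W_add_smult[OF vW(1) u(1)] Rv by simp
  qed
  then show ?thesis unfolding in_automorphisms using GL by simp
qed

text \<open>Numerators and denominator of the entries of \<open>reflection u * R\<close>, for \<open>u\<close> with entries in a
  complex algebra with structure map \<open>e\<close>.\<close>

definition refl_den :: "(complex \<Rightarrow> 'r::comm_ring_1) \<Rightarrow> (nat \<Rightarrow> 'r) \<Rightarrow> 'r" where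
  "refl_den e U = (\<Sum>i\<le>n. \<Sum>j\<le>n. e (B i j) * U i * U j)"

definition refl_num :: "(complex \<Rightarrow> 'r::comm_ring_1) \<Rightarrow> complex mat \<Rightarrow> (nat \<Rightarrow> 'r) \<Rightarrow> nat \<times> nat \<Rightarrow> 'r" where
  "refl_num e R U ik = (\<Sum>j\<le>n. ((if fst ik = j then refl_den e U else 0) -
    e 2 * ((\<Sum>l\<le>n. e (B l j) * U l) * U (fst ik))) * e (R $$ (j, snd ik)))"

lemma refl_den_hom:
  assumes "comm_ring_hom h" "\<And>c. h (e c) = c" "\<And>i. i \<le> n \<Longrightarrow> h (U i) = u $ i"
  shows "h (refl_den e U) = bil u u"
proof -
  interpret comm_ring_hom h by fact
  show ?thesis by (simp add: refl_den_def bil_def hom_distribs assms)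
qed

text \<open>The ring and its structure map are general because two instances occur: polynomials in
  one parameter for a curve of automorphisms through the identity, and forms in the moving point for
  the local section.\<close>

lemma refl_num_hom:
  assumes h: "comm_ring_hom h" "\<And>c. h (e c) = c" "\<And>i. i \<le> n \<Longrightarrow> h (U i) = u $ i"
    and ik: "i \<le> n" "k \<le> n" and u: "u \<in> carrier_vec (Suc n)" "bil u u \<noteq> 0" and R: "R \<in> carrier_mat (Suc n) (Suc n)"
  shows "h (refl_num e R U (i, k)) / bil u u = (reflection u * R) $$ (i, k)"
proof -
  interpret comm_ring_hom h by (rule h(1))
  let ?f = "\<lambda>j. \<Sum>l\<le>n. B l j * u $ l"
  have "h (refl_num e R U (i, k)) = (\<Sum>j\<le>n. ((if i = j then bil u u else 0) - 2 * (?f j * u $ i)) * R $$ (j, k))"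
    unfolding refl_num_def fst_conv snd_conv hom_sum
  proof (intro sum.cong refl)
    fix j
    have f: "h (\<Sum>l\<le>n. e (B l j) * U l) = ?f j" by (simp add: hom_distribs h)
    show "h (((if i = j then refl_den e U else 0) - e 2 * ((\<Sum>l\<le>n. e (B l j) * U l) * U i)) * e (R $$ (j, k))) =
        ((if i = j then bil u u else 0) - 2 * (?f j * u $ i)) * R $$ (j, k)"
      using ik by (simp only: hom_mult hom_minus f h(2) h(3) if_distrib[where f = h] refl_den_hom[OF h] hom_zero)
  qed
  then have "h (refl_num e R U (i, k)) / bil u u =
      (\<Sum>j\<le>n. ((if i = j then bil u u else 0) - 2 * (?f j * u $ i)) * R $$ (j, k) / bil u u)"
    by (simp add: sum_divide_distrib)
  also have "\<dots> = (\<Sum>j\<le>n. ((if i = j then 1 else 0) + u $ i * ((- 2 / bil u u) * ?f j)) * R $$ (j, k))"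
    using u(2) by (intro sum.cong refl) (simp add: field_simps)
  also have "\<dots> = (reflection u * R) $$ (i, k)"
    using ik R by (simp add: reflection_def rank_one_def scalar_prod_def atLeast0LessThan lessThan_Suc_atMost)
  finally show ?thesis .
qed

lemma two_reflections:
  assumes u: "u \<in> W" "bil u u \<noteq> 0" and u': "u' \<in> W" "bil u' u' \<noteq> 0"
  shows "reflection u * reflection u' \<in> Aut0"
proof -
  note uc = W_carrier[OF u(1)] W_carrier[OF u'(1)]
  define x where "x = u + (- 1) \<cdot>\<^sub>v u'"
  have x: "x \<in> W" unfolding x_def by (rule W_add_smult[OF u(1) u'(1)])
  note xc = W_carrier[OF x]
  define U where "U i = [:u' $ i, x $ i:]" for i
  define e where "e c = [:c:]" for c :: complex
  define q where "q = refl_den e U"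
  define a where "a = refl_num e (reflection u') U"
  have hom: "comm_ring_hom (\<lambda>p. poly p t)" for t :: complex by unfold_locales auto
  have ec: "poly (e c) t = c" for c t by (simp add: e_def)
  have Ut: "poly (U i) t = (u' + t \<cdot>\<^sub>v x) $ i" if "i \<le> n" for i t using that uc xc by (simp add: U_def)
  have q: "poly q t = bil (u' + t \<cdot>\<^sub>v x) (u' + t \<cdot>\<^sub>v x)" for t
    unfolding q_def by (rule refl_den_hom[OF hom ec Ut])
  have curve: "mat (Suc n) (Suc n) (\<lambda>ij. poly (a ij) t / poly q t) = reflection (u' + t \<cdot>\<^sub>v x) * reflection u'"
    if "poly q t \<noteq> 0" for t
  proof (rule eq_matI)
    fix i j assume "i < dim_row (reflection (u' + t \<cdot>\<^sub>v x) * reflection u')" "j < dim_col (reflection (u' + t \<cdot>\<^sub>v x) * reflection u')"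
    then have ij: "i \<le> n" "j \<le> n" by (simp_all add: reflection_def rank_one_def)
    have c: "u' + t \<cdot>\<^sub>v x \<in> carrier_vec (Suc n)" using uc xc by simp
    from refl_num_hom[OF hom ec Ut ij c that[unfolded q] reflection_carrier[of u']]
    show "mat (Suc n) (Suc n) (\<lambda>ij. poly (a ij) t / poly q t) $$ (i, j) = (reflection (u' + t \<cdot>\<^sub>v x) * reflection u') $$ (i, j)"
      using ij by (simp add: a_def q)
  qed (simp_all add: reflection_def rank_one_def)
  have u0: "u' + 0 \<cdot>\<^sub>v x = u'" and u1: "u' + 1 \<cdot>\<^sub>v x = u"
    using uc xc by (auto simp: x_def intro!: eq_vecI)
  have q0: "poly q 0 \<noteq> 0" unfolding q u0 by (rule u'(2))
  have q1: "poly q 1 \<noteq> 0" unfolding q u1 by (rule u(2))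
  have "mat (Suc n) (Suc n) (\<lambda>ij. poly (a ij) 1 / poly q 1) \<in> Aut0"
  proof (rule rational_curve_identity_component[OF automorphisms_GL _ q0 _ q1])
    show "mat (Suc n) (Suc n) (\<lambda>ij. poly (a ij) t / poly q t) \<in> automorphisms" if t: "poly q t \<noteq> 0" for t
      unfolding curve[OF t]
      using subgroup.m_closed[OF subgroup_automorphisms reflection_automorphism reflection_automorphism[OF u']]
        W_add_smult[OF u'(1) x] t[unfolded q] by simp
    show "mat (Suc n) (Suc n) (\<lambda>ij. poly (a ij) 0 / poly q 0) = 1\<^sub>m (Suc n)"
      unfolding curve[OF q0] u0 by (rule reflection_square[OF uc(2) u'(2)])
  qed
  then show ?thesis unfolding curve[OF q1] u1 .
qed

text \<open>Reflections move such a vector to multiples of \<open>y\<close> and of \<open>z\<close>.\<close>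

lemma isotropic_exists:
  assumes nondeg: "\<And>v. v \<in> homog_coords n \<Longrightarrow> v \<in> W \<Longrightarrow> bil v v = 0 \<Longrightarrow> \<exists>w\<in>W. bil v w \<noteq> 0"
    and big: "\<And>y z. y \<in> W \<Longrightarrow> z \<in> W \<Longrightarrow> \<exists>e\<in>W. e \<in> homog_coords n \<and> bil y e = 0 \<and> bil z e = 0"
    and y: "y \<in> homog_coords n" "y \<in> W" "bil y y = 0" and z: "z \<in> homog_coords n" "z \<in> W" "bil z z = 0"
  shows "\<exists>x\<in>W. bil x x = 0 \<and> bil y x \<noteq> 0 \<and> bil z x \<noteq> 0"
proof -
  note c = W_carrier[OF y(2)] W_carrier[OF z(2)]
  note lin = bil_left[OF W_carrier W_carrier] bil_right[OF W_carrier W_carrier]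
  show ?thesis
  proof (cases "bil y z = 0")
    case False
    then have zy: "bil z y = bil y z" "bil y z \<noteq> 0" using bil_sym[of z y] by simp_all
    obtain e where e: "e \<in> W" "e \<in> homog_coords n" "bil y e = 0" "bil z e = 0" using big[OF y(2) z(2)] by blast
    \<comment> \<open>Here \<open>y\<close> and \<open>z\<close> span a hyperbolic plane, and a
      non-isotropic vector orthogonal to it is wanted. If \<open>e\<close> is isotropic, a partner
      of it is made orthogonal to the plane.\<close>
    have "\<exists>e\<in>W. bil y e = 0 \<and> bil z e = 0 \<and> bil e e \<noteq> 0"
    proof (cases "bil e e = 0")
      case True
      from nondeg[OF e(2,1) this] obtain w where w: "w \<in> W" "bil e w \<noteq> 0" by blast
      \<comment> \<open>Subtracts from \<open>w\<close> its components along \<open>z\<close> and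
        then \<open>y\<close>. The pairing with \<open>e\<close> is unaffected, because
        \<open>e\<close> is orthogonal to both.\<close>
      define w1 where "w1 = w + (- bil y w / bil y z) \<cdot>\<^sub>v z"
      define w2 where "w2 = w1 + (- bil z w / bil y z) \<cdot>\<^sub>v y"
      have W1: "w1 \<in> W" unfolding w1_def by (rule W_add_smult[OF w(1) z(2)])
      have W2: "w2 \<in> W" unfolding w2_def by (rule W_add_smult[OF W1 y(2)])
      have b1: "bil v w1 = bil v w + (- bil y w / bil y z) * bil v z" for v unfolding w1_def by (rule lin(2)[OF w(1) z(2)])
      have b2: "bil v w2 = bil v w1 + (- bil z w / bil y z) * bil v y" for v unfolding w2_def by (rule lin(2)[OF W1 y(2)])
      have w2: "bil y w2 = 0" "bil z w2 = 0" "bil e w2 = bil e w"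
        using zy y(3) z(3) e(3,4) bil_sym[of e y] bil_sym[of e z] by (simp_all add: b1 b2)
      show ?thesis
      proof (cases "bil w2 w2 = 0")
        case True
        \<comment> \<open>If both vectors are isotropic, their sum has norm twice their pairing,
          which is nonzero.\<close>
        have E: "e + 1 \<cdot>\<^sub>v w2 \<in> W" by (rule W_add_smult[OF e(1) W2])
        have "bil (e + 1 \<cdot>\<^sub>v w2) (e + 1 \<cdot>\<^sub>v w2) = 2 * bil e w"
          unfolding lin(1)[OF e(1) W2] lin(2)[OF e(1) W2] using \<open>bil e e = 0\<close> True bil_sym[of w2 e] w2(3) by simp
        moreover have "bil v (e + 1 \<cdot>\<^sub>v w2) = bil v e + bil v w2" for v using lin(2)[OF e(1) W2, of v 1] by simp
        ultimately show ?thesis using E w(2) e(3,4) w2(1,2) by (intro bexI[of _ "e + 1 \<cdot>\<^sub>v w2"]) simp_all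
      next
        case False
        then show ?thesis using W2 w2 by blast
      qed
    qed (use e in blast)
    then obtain e' where e': "e' \<in> W" "bil y e' = 0" "bil z e' = 0" "bil e' e' \<noteq> 0" by blast
    \<comment> \<open>Chosen so that \<open>z + e' + d y\<close> is isotropic. Its pairing with
      \<open>y\<close> is that of \<open>z\<close> with \<open>y\<close>, and its pairing with
      \<open>z\<close> is nonzero because \<open>d\<close> is.\<close>
    define d where "d = - bil e' e' / (2 * bil y z)"
    define z1 where "z1 = z + 1 \<cdot>\<^sub>v e'"
    define x where "x = z1 + d \<cdot>\<^sub>v y"
    have Z1: "z1 \<in> W" unfolding z1_def by (rule W_add_smult[OF z(2) e'(1)])
    have X: "x \<in> W" unfolding x_def by (rule W_add_smult[OF Z1 y(2)])
    have bz: "bil v z1 = bil v z + bil v e'" for v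
      unfolding z1_def using lin(2)[OF z(2) e'(1), of v 1] by simp
    have bx: "bil v x = bil v z + bil v e' + d * bil v y" for v
      unfolding x_def lin(2)[OF Z1 y(2)] bz ..
    have "bil x x = bil x z + bil x e' + d * bil x y" by (rule bx)
    also have "\<dots> = bil e' e' + 2 * d * bil y z"
      unfolding bil_sym[of x z] bil_sym[of x e'] bil_sym[of x y] bx
      using y(3) z(3) e'(2,3) zy(1) bil_sym[of e' z] bil_sym[of e' y] by simp
    also have "\<dots> = 0" using zy(2) by (simp add: d_def)
    finally have "bil x x = 0" .
    moreover have "bil y x \<noteq> 0" "bil z x \<noteq> 0" using zy e' y(3) z(3) by (simp_all add: bx d_def)
    ultimately show ?thesis using X by blast
  next
    case True
    then have zy: "bil y z = 0" "bil z y = 0" using bil_sym[of z y] by simp_all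
    obtain a1 where a1: "a1 \<in> W" "bil y a1 \<noteq> 0" using nondeg[OF y] by blast
    obtain a2 where a2: "a2 \<in> W" "bil z a2 \<noteq> 0" using nondeg[OF z] by blast
    have "\<exists>a\<in>W. bil y a \<noteq> 0 \<and> bil z a \<noteq> 0"
    proof (cases "bil z a1 \<noteq> 0 \<or> bil y a2 \<noteq> 0")
      case True
      then show ?thesis using a1 a2 by blast
    next
      case False
      have "bil v (a1 + 1 \<cdot>\<^sub>v a2) = bil v a1 + bil v a2" for v using lin(2)[OF a1(1) a2(1), of v 1] by simp
      then show ?thesis using False a1(2) a2(2) W_add_smult[OF a1(1) a2(1), of 1]
        by (intro bexI[of _ "a1 + 1 \<cdot>\<^sub>v a2"]) simp_all
    qed
    then obtain a where a: "a \<in> W" "bil y a \<noteq> 0" "bil z a \<noteq> 0" by blast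
    \<comment> \<open>When \<open>y\<close> and \<open>z\<close> are orthogonal, adding a multiple
      of \<open>z\<close> to \<open>a\<close> leaves both pairings unchanged; this multiple makes
      the vector isotropic.\<close>
    define d where "d = - bil a a / (2 * bil z a)"
    define x where "x = a + d \<cdot>\<^sub>v z"
    have X: "x \<in> W" unfolding x_def by (rule W_add_smult[OF a(1) z(2)])
    have bx: "bil v x = bil v a + d * bil v z" for v unfolding x_def by (rule lin(2)[OF a(1) z(2)])
    have "bil x x = bil x a + d * bil x z" by (rule bx)
    also have "\<dots> = bil a a + 2 * d * bil z a"
      unfolding bil_sym[of x a] bil_sym[of x z] bx using z(3) bil_sym[of a z] by simp
    also have "\<dots> = 0" using a(3) by (simp add: d_def)
    finally show ?thesis using X a zy(1) z(3) by (intro bexI[of _ x]) (simp_all add: bx)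
  qed
qed

text \<open>The auxiliary isotropic point \<open>p'\<close> is orthogonal neither to
  \<open>p\<close> nor to \<open>v\<close>. One reflection takes \<open>p\<close> to
  \<open>p'\<close>, and another, depending on \<open>w\<close>, takes \<open>p'\<close> to a
  multiple of \<open>w\<close>. Their product is a section defined where \<open>bil w p'\<close> is
  nonzero. The hypothesis \<open>nondeg\<close> concerns only isotropic vectors of \<open>W\<close>,
  and \<open>big\<close> leaves room for a vector of \<open>W\<close> orthogonal to two given
  ones.\<close>

theorem homogeneous_quadric:
  assumes nondeg: "\<And>v. v \<in> homog_coords n \<Longrightarrow> v \<in> W \<Longrightarrow> bil v v = 0 \<Longrightarrow> \<exists>w\<in>W. bil v w \<noteq> 0"
    and big: "\<And>y z. y \<in> W \<Longrightarrow> z \<in> W \<Longrightarrow> \<exists>e\<in>W. e \<in> homog_coords n \<and> bil y e = 0 \<and> bil z e = 0"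
    and p: "p \<in> homog_coords n" "line p \<in> Z"
  shows "homogeneous_space (proj_variety n Z)"
proof (rule homogeneous_by_sections[OF p])
  fix v assume v: "v \<in> homog_coords n" "line v \<in> Z"
  have vW: "v \<in> W" "bil v v = 0" and pW: "p \<in> W" "bil p p = 0" using in_Z v p by auto
  have "\<exists>x\<in>W. bil x x = 0 \<and> bil p x \<noteq> 0 \<and> bil v x \<noteq> 0"
    by (rule isotropic_exists[OF _ _ p(1) pW v(1) vW], erule (2) nondeg, erule (1) big)
  then obtain p' where p': "p' \<in> W" "bil p' p' = 0" "bil p p' \<noteq> 0" "bil v p' \<noteq> 0" by blast
  define \<alpha> where "\<alpha> = bil p p'"
  have \<alpha>: "\<alpha> \<noteq> 0" "bil p' p = \<alpha>" using p'(3) bil_sym[of p' p] by (simp_all add: \<alpha>_def)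
  \<comment> \<open>Proportional to the difference of \<open>(\<alpha> / bil w p') w\<close> and
    \<open>p'\<close>, rescaled to be linear in \<open>w\<close>. Both are isotropic and have the
    same pairing with \<open>p'\<close> and \<open>w\<close> respectively scaled, so the reflection
    in their difference exchanges them.\<close>
  define s where "s w = \<alpha> \<cdot>\<^sub>v w + (- bil w p') \<cdot>\<^sub>v p'" for w
  note pc = W_carrier[OF pW(1)] W_carrier[OF p'(1)]
  have smult_W: "c \<cdot>\<^sub>v w \<in> W" if w: "w \<in> W" for c w
  proof -
    have "w + (c - 1) \<cdot>\<^sub>v w = c \<cdot>\<^sub>v w" using W_carrier[OF w] by (intro eq_vecI) (auto simp: algebra_simps)
    then show ?thesis using W_add_smult[OF w w, of "c - 1"] by simp
  qed
  have sW: "s w \<in> W" if "w \<in> W" for w unfolding s_def by (rule W_add_smult[OF smult_W[OF that] p'(1)])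
  have bil_smult: "bil x (c \<cdot>\<^sub>v w) = c * bil x w" if "w \<in> carrier_vec (Suc n)" for x c w
    unfolding bil_functional by (rule functional_smult[OF that])
  have bs: "bil x (s w) = \<alpha> * bil x w - bil w p' * bil x p'" if "w \<in> W" for x w
    unfolding s_def bil_right[OF W_carrier[OF smult_W[OF that]] pc(2)] bil_smult[OF W_carrier[OF that]] by simp
  have s1: "bil (s w) p' = \<alpha> * bil w p'" if "w \<in> W" for w
    unfolding bil_sym[of "s w"] bs[OF that] using p'(2) by (simp add: bil_sym[of p' w])
  have s2: "bil (s w) (s w) = - 2 * \<alpha> * (bil w p')\<^sup>2" if w: "w \<in> W" "bil w w = 0" for w
  proof -
    have "bil (s w) w = - (bil w p')\<^sup>2"
      unfolding bil_sym[of "s w"] bs[OF w(1)] using w(2) by (simp add: power2_eq_square)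
    then show ?thesis unfolding bs[OF w(1)] s1[OF w(1)] by (simp add: power2_eq_square)
  qed
  have "bil p (s p) = - \<alpha>\<^sup>2" unfolding bs[OF pW(1)] pW(2) by (simp add: \<alpha>_def power2_eq_square)
  then have sp: "bil (s p) p = - \<alpha>\<^sup>2" "bil (s p) (s p) = - 2 * \<alpha> * \<alpha>\<^sup>2"
    using s2[OF pW] bil_sym[of "s p" p] by (simp_all add: \<alpha>_def)
  define R where "R = reflection (s p)"
  have Rp: "R *\<^sub>v p = p'"
    unfolding R_def reflection_vec[OF W_carrier[OF sW[OF pW(1)]] pc(1)] sp
    using \<alpha>(1) pc by (intro eq_vecI) (auto simp: s_def \<alpha>_def[symmetric] power2_eq_square field_simps)
  define \<beta> :: "nat cpoly" where "\<beta> = (\<Sum>i\<le>n. Cst (\<Sum>j\<le>n. B i j * p' $ j) * Var i)"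
  define U where "U i = Cst \<alpha> * Var i - Cst (p' $ i) * \<beta>" for i
  define h where "h = refl_den Cst U"
  define g where "g = refl_num Cst R U"
  have ev\<beta>: "ev w \<beta> = bil w p'" for w
    by (simp add: \<beta>_def bil_def poly_eval_homs sum_distrib_left sum_distrib_right mult_ac)
  have evU: "ev w (U i) = s w $ i" if "i \<le> n" "w \<in> W" for w i
    using that W_carrier[OF that(2)] pc by (simp add: U_def s_def ev\<beta> poly_eval_homs mult.commute)
  have evh: "ev w h = bil (s w) (s w)" if "w \<in> W" for w
    unfolding h_def by (rule refl_den_hom[OF poly_eval.comm_ring_hom_axioms poly_eval_Cst evU[OF _ that]])
  have \<beta>1: "\<beta> \<in> forms n 1" unfolding \<beta>_def by (intro forms_sum forms_Cst_mult forms_Var) auto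
  have U1: "U i \<in> forms n 1" if "i \<le> n" for i
    unfolding U_def using that by (intro forms_diff forms_Cst_mult forms_Var \<beta>1)
  have h2: "h \<in> forms n (1 + 1)"
    unfolding h_def refl_den_def by (intro forms_sum forms_mult forms_Cst_mult U1) auto
  have g2: "g (i, j) \<in> forms n (1 + 1)" if "i \<le> n" for i j
    unfolding g_def refl_num_def fst_conv snd_conv
  proof (rule forms_sum)
    fix k
    have "Cst (R $$ (k, j)) * ((if i = k then refl_den Cst U else 0) - Cst 2 * ((\<Sum>l\<le>n. Cst (B l k) * U l) * U i)) \<in> forms n (1 + 1)"
    proof (intro forms_Cst_mult forms_diff)
      show "(if i = k then refl_den Cst U else 0) \<in> forms n (1 + 1)" using h2 by (simp add: h_def)
      show "(\<Sum>l\<le>n. Cst (B l k) * U l) * U i \<in> forms n (1 + 1)"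
        using that by (intro forms_mult forms_sum forms_Cst_mult U1) auto
    qed
    then show "((if i = k then refl_den Cst U else 0) - Cst 2 * ((\<Sum>l\<le>n. Cst (B l k) * U l) * U i)) * Cst (R $$ (k, j)) \<in> forms n (1 + 1)"
      by (simp only: mult.commute)
  qed
  have sec: "matrix_section n g h w \<in> Aut0 \<and> line (matrix_section n g h w *\<^sub>v p) = line w"
    if w: "w \<in> homog_coords n" "line w \<in> Z" "ev w h \<noteq> 0" for w
  proof -
    have wW: "w \<in> W" "bil w w = 0" using in_Z[OF w(1)] w(2) by auto
    note wc = W_carrier[OF wW(1)]
    note sc = W_carrier[OF sW[OF wW(1)]]
    have nz: "bil (s w) (s w) \<noteq> 0" using w(3) evh[OF wW(1)] by simp
    then have wp: "bil w p' \<noteq> 0" using s2[OF wW] by auto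
    have nz': "bil (s p) (s p) \<noteq> 0" using \<alpha>(1) sp by simp
    have eq: "matrix_section n g h w = reflection (s w) * R"
    proof (rule eq_matI)
      fix i j assume "i < dim_row (reflection (s w) * R)" "j < dim_col (reflection (s w) * R)"
      then have ij: "i \<le> n" "j \<le> n" by (simp_all add: R_def reflection_def rank_one_def)
      have "ev w (g (i, j)) / bil (s w) (s w) = (reflection (s w) * R) $$ (i, j)"
        unfolding g_def
        by (rule refl_num_hom[OF poly_eval.comm_ring_hom_axioms poly_eval_Cst evU[OF _ wW(1)] ij sc nz]) (simp_all add: R_def)
      then show "matrix_section n g h w $$ (i, j) = (reflection (s w) * R) $$ (i, j)"
        using ij by (simp add: matrix_section_def evh[OF wW(1)])
    qed (simp_all add: matrix_section_def R_def reflection_def rank_one_def)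
    have "matrix_section n g h w \<in> Aut0"
      unfolding eq R_def by (rule two_reflections[OF sW[OF wW(1)] nz sW[OF pW(1)] nz'])
    moreover have "matrix_section n g h w *\<^sub>v p = (\<alpha> / bil w p') \<cdot>\<^sub>v w"
    proof -
      have "matrix_section n g h w *\<^sub>v p = reflection (s w) *\<^sub>v p'"
        unfolding eq using assoc_mult_mat_vec[OF reflection_carrier, of R "Suc n" p "s w"] pc(1) Rp by (simp add: R_def)
      also have "\<dots> = (\<alpha> / bil w p') \<cdot>\<^sub>v w"
        unfolding reflection_vec[OF sc pc(2)] s1[OF wW(1)] s2[OF wW]
        using \<alpha>(1) wp wc pc by (intro eq_vecI) (auto simp: s_def power2_eq_square field_simps)
      finally show ?thesis .
    qed
    moreover have "line ((\<alpha> / bil w p') \<cdot>\<^sub>v w) = line w" using \<alpha>(1) wp by (intro line_smult) simp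
    ultimately show ?thesis by simp
  qed
  have "ev v h \<noteq> 0" using evh[OF vW(1)] s2[OF vW] \<alpha>(1) p'(4) by simp
  then show "\<exists>d g h. (\<forall>i\<le>n. \<forall>j\<le>n. g (i, j) \<in> forms n d) \<and> h \<in> forms n d \<and> ev v h \<noteq> 0 \<and>
      (\<forall>w\<in>homog_coords n. line w \<in> Z \<longrightarrow> ev w h \<noteq> 0 \<longrightarrow>
        matrix_section n g h w \<in> Aut0 \<and> line (matrix_section n g h w *\<^sub>v p) = line w)"
    using h2 g2 sec by (intro exI[of _ "1 + 1"] exI[of _ g] exI[of _ h]) blast
qed

end

section \<open>Smooth complete intersections with one quadratic equation\<close>

lemma linear_form_coeffs:
  assumes F: "F \<in> forms n 1"
  shows "\<exists>b. (\<forall>u. ev u F = (\<Sum>j\<le>n. b j * u $ j)) \<and> (\<forall>u j. ev u (partial_deriv j F) = b j)"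
proof -
  have "partial_deriv j F \<in> forms n 0" for j using partial_deriv_forms[OF F] by simp
  then have "\<forall>j. \<exists>b. partial_deriv j F = Cst b" by (intro allI forms_degree_0)
  then obtain b where b: "\<And>j. partial_deriv j F = Cst (b j)" by metis
  have "ev u F = (\<Sum>j\<le>n. b j * u $ j)" for u
    using euler_forms[OF F, of "\<lambda>i. u $ i"] by (simp add: b mult.commute)
  then show ?thesis by (intro exI[of _ b]) (simp add: b)
qed

text \<open>The equations are padded to a square matrix whose last row is zero; its determinant
  vanishes, so that it has a kernel vector.\<close>

lemma linear_system_nontrivial_solution:
  fixes a :: "nat \<Rightarrow> nat \<Rightarrow> complex"
  assumes "k \<le> n"
  shows "\<exists>e\<in>homog_coords n. \<forall>r<k. (\<Sum>j\<le>n. a r j * e $ j) = 0"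
proof -
  define A where "A = mat\<^sub>r (Suc n) (Suc n) (\<lambda>i. if i = n then 0\<^sub>v (Suc n) else vec (Suc n) (a i))"
  have A: "A \<in> carrier_mat (Suc n) (Suc n)" by (simp add: A_def)
  have "det A = 0" unfolding A_def by (rule det_row_0) auto
  then obtain e where e: "e \<in> carrier_vec (Suc n)" "e \<noteq> 0\<^sub>v (Suc n)" "A *\<^sub>v e = 0\<^sub>v (Suc n)"
    using det_0_iff_vec_prod_zero[OF A] by blast
  have "(\<Sum>j\<le>n. a r j * e $ j) = 0" if "r < k" for r
  proof -
    have r: "r < Suc n" "r \<noteq> n" using that assms by auto
    have "(A *\<^sub>v e) $ r = (\<Sum>j\<le>n. A $$ (r, j) * e $ j)"
      using A e(1) r(1) by (simp add: scalar_prod_def atLeast0LessThan lessThan_Suc_atMost)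
    also have "\<dots> = (\<Sum>j\<le>n. a r j * e $ j)" using r by (intro sum.cong) (auto simp: A_def)
    finally show ?thesis using e(3) r(1) by simp
  qed
  then show ?thesis using e by (intro bexI[of _ e]) (auto simp: homog_coords_def)
qed

context smooth_variety
begin

lemma projective_zero_locus: "projective_zero_locus n (F ` {..<l}) Z"
  by unfold_locales (auto simp: form_sys_def Z intro: F)

text \<open>Smoothness at isotropic vectors gives \<open>nondeg\<close>. For \<open>big\<close>, the
  space \<open>W\<close> has \<open>l - 1\<close> linear equations and orthogonality to two vectors
  adds two more. The total \<open>l + 1\<close> is exactly the sum of the degrees, so that the
  degree bound leaves a nonzero solution.\<close>

theorem homogeneous_smooth_quadric:
  assumes s: "s < l" "d s = 2" "\<forall>i<l. i \<noteq> s \<longrightarrow> d i = 1" and sum_d: "(\<Sum>i<l. d i) \<le> n"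
    and p: "p \<in> homog_coords n" "line p \<in> Z"
  shows "homogeneous_space (proj_variety n Z)"
proof -
  have Fs: "F s \<in> forms n 2" using F[OF s(1)] s(2) by simp
  have lin: "F i \<in> forms n 1" if "i < l" "i \<noteq> s" for i using F[OF that(1)] s(3) that by simp
  obtain B where B: "\<And>i j. B i j = B j i" "\<And>v j. ev v (partial_deriv j (F s)) = (\<Sum>i\<le>n. B i j * v $ i)"
    "\<And>v. 2 * ev v (F s) = (\<Sum>i\<le>n. \<Sum>j\<le>n. B i j * v $ i * v $ j)"
    by (rule quadratic_form_matrix[OF Fs]) blast
  interpret Q: quadric n "F ` {..<l}" Z B "F ` ({..<l} - {s})"
  proof (rule quadric.intro[OF projective_zero_locus], unfold_locales)
    show "B i j = B j i" for i j by (rule B(1))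
    show "L \<in> forms n 1" if "L \<in> F ` ({..<l} - {s})" for L using that lin by auto
    fix v assume v: "v \<in> homog_coords n"
    have "(\<forall>i<l. ev v (F i) = 0) \<longleftrightarrow> (\<forall>i\<in>{..<l} - {s}. ev v (F i) = 0) \<and> 2 * ev v (F s) = 0" using s(1) by auto
    then show "line v \<in> Z \<longleftrightarrow> (\<forall>L\<in>F ` ({..<l} - {s}). ev v L = 0) \<and> (\<Sum>i\<le>n. \<Sum>j\<le>n. B i j * v $ i * v $ j) = 0"
      unfolding in_Z[OF v] B(3) by simp
  qed
  have WI: "w \<in> Q.W" if "w \<in> carrier_vec (Suc n)" "\<And>i. i < l \<Longrightarrow> i \<noteq> s \<Longrightarrow> ev w (F i) = 0" for w
    using that by (auto simp: Q.W_def)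
  show ?thesis
  proof (rule Q.homogeneous_quadric[OF _ _ p])
    fix v assume v: "v \<in> homog_coords n" "v \<in> Q.W" "Q.bil v v = 0"
    then have "line v \<in> Z" using Q.in_Z by blast
    from right_inverse[OF v(1) this] obtain b where b: "jacobian_right_inverse n l F (\<lambda>i. v $ i) b" by blast
    \<comment> \<open>The column of the right inverse that belongs to the quadratic equation. It is
      annihilated by the other gradients, hence lies in \<open>W\<close>, and pairs to one with
      \<open>v\<close>.\<close>
    define w where "w = vec (Suc n) (b s)"
    have w: "w $ j = b s j" if "j \<le> n" for j using that by (simp add: w_def)
    have "w \<in> Q.W"
    proof (rule WI)
      fix i assume i: "i < l" "i \<noteq> s"
      obtain c where c: "\<forall>u. ev u (F i) = (\<Sum>j\<le>n. c j * u $ j)" "\<forall>u j. ev u (partial_deriv j (F i)) = c j"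
        using linear_form_coeffs[OF lin[OF i]] by blast
      have "(\<Sum>j\<le>n. ev v (partial_deriv j (F i)) * b s j) = 0"
        using b i s(1) by (simp add: jacobian_right_inverse_def)
      then show "ev w (F i) = 0" using c w by simp
    qed (simp add: w_def)
    moreover have "Q.bil v w = 1"
    proof -
      have "Q.bil v w = (\<Sum>j\<le>n. ev v (partial_deriv j (F s)) * b s j)"
        unfolding Q.bil_functional functional_def B(2) by (intro sum.cong) (auto simp: w)
      then show ?thesis using b s(1) by (simp add: jacobian_right_inverse_def)
    qed
    ultimately show "\<exists>w\<in>Q.W. Q.bil v w \<noteq> 0" by (intro bexI[of _ w]) simp_all
  next
    fix y z assume "y \<in> Q.W" "z \<in> Q.W"
    have "\<forall>i. \<exists>c. i < l \<and> i \<noteq> s \<longrightarrow> (\<forall>u. ev u (F i) = (\<Sum>j\<le>n. c j * u $ j))"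
      using linear_form_coeffs[OF lin] by metis
    from choice[OF this] obtain c where c: "\<And>i u. i < l \<Longrightarrow> i \<noteq> s \<Longrightarrow> ev u (F i) = (\<Sum>j\<le>n. c i j * u $ j)" by auto
    \<comment> \<open>The slot \<open>s\<close>, where there is no linear equation, is reused for
      orthogonality to \<open>z\<close>, and the additional slot \<open>l\<close> takes
      orthogonality to \<open>y\<close>.\<close>
    define a where "a r = (if r = l then (\<lambda>j. \<Sum>i\<le>n. B i j * y $ i)
      else if r = s then (\<lambda>j. \<Sum>i\<le>n. B i j * z $ i) else c r)" for r
    have "(\<Sum>i<l. d i) = (\<Sum>i<l. 1 + (if i = s then 1 else 0))" using s by (intro sum.cong) auto
    then have "Suc l \<le> n" using sum_d s(1) by (simp add: sum_Suc)
    from linear_system_nontrivial_solution[OF this, of a] obtain e where e: "e \<in> homog_coords n"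
      "\<forall>r<Suc l. (\<Sum>j\<le>n. a r j * e $ j) = 0" by blast
    have "Q.bil y e = 0" unfolding Q.bil_functional functional_def using e(2)[rule_format, of l] by (simp add: a_def)
    moreover have "Q.bil z e = 0"
      unfolding Q.bil_functional functional_def using e(2)[rule_format, of s] s(1) by (simp add: a_def)
    moreover have "e \<in> Q.W"
    proof (rule WI)
      show "ev e (F i) = 0" if "i < l" "i \<noteq> s" for i
        using c[OF that, of e] e(2)[rule_format, of i] that by (simp add: a_def)
    qed (rule homog_coords_carrier[OF e(1)])
    ultimately show "\<exists>e\<in>Q.W. e \<in> homog_coords n \<and> Q.bil y e = 0 \<and> Q.bil z e = 0" using e(1) by blast
  qed
qed

end

theorem mainTheorem1:
  fixes n :: nat and ds :: "nat list" and Z :: "complex vec set set"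
  assumes "nonsingular_complete_intersection n ds Z"
    and "convex_variety (proj_variety n Z)"
    and "rationally_connected (proj_variety n Z)"
  shows "homogeneous_space (proj_variety n Z)"
proof -
  obtain Fs where len: "length Fs = length ds"
    and Fs: "\<forall>i < length ds. 1 \<le> ds ! i \<and> Fs ! i \<in> forms n (ds ! i)"
    and Z_eq: "Z = zero_locus n (set Fs)" "Z \<noteq> {}"
    and rank: "\<forall>v. v \<in> carrier_vec (Suc n) \<and> v \<noteq> 0\<^sub>v (Suc n) \<and> line v \<in> Z \<longrightarrow>
      vec_space.rank (length Fs) (jacobian n Fs v) = length Fs"
    using assms(1) unfolding nonsingular_complete_intersection_def by blast
  interpret smooth_variety n "length ds" "\<lambda>i. Fs ! i" "\<lambda>i. ds ! i" Z
  proof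
    have "set Fs = (\<lambda>i. Fs ! i) ` {..<length ds}" using len by (auto simp: in_set_conv_nth)
    then show "Z = zero_locus n ((\<lambda>i. Fs ! i) ` {..<length ds})" using Z_eq(1) by simp
    show "\<exists>B. jacobian_right_inverse n (length ds) (\<lambda>i. Fs ! i) (\<lambda>i. v $ i) B"
      if "v \<in> homog_coords n" "line v \<in> Z" for v
      using jacobian_rank_right_inverse[of Fs n v] rank that len by (simp add: homog_coords_def)
  qed (use Fs in auto)
  interpret L: projective_zero_locus n "(\<lambda>i. Fs ! i) ` {..<length ds}" Z by (rule projective_zero_locus)
  obtain p where p: "p \<in> homog_coords n" "line p \<in> Z" using Z_eq(2) Z_subset by (auto simp: proj_space_eq)
  show ?thesis
  proof (cases "Z = {line p}")
    case True
    then show ?thesis by (rule L.homogeneous_single_point[OF p(1)])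
  next
    case False
    then obtain q where q: "q \<in> Z" "line p \<noteq> q" using p(2) by blast
    have d1: "1 \<le> ds ! i" if "i < length ds" for i using Fs that by blast
    have deg: "(\<Sum>i<length ds. ds ! i) \<le> n \<and> ((\<forall>i<length ds. ds ! i = 1) \<or>
        (\<exists>s<length ds. ds ! s = 2 \<and> (\<forall>i<length ds. i \<noteq> s \<longrightarrow> ds ! i = 1)))"
      by (rule convex_rationally_connected_degrees[OF assms(2,3) _ p(2) q], rule d1)
    show ?thesis
    proof (cases "\<forall>i<length ds. ds ! i = 1")
      case True
      have "F \<in> forms n 1" if "F \<in> (\<lambda>i. Fs ! i) ` {..<length ds}" for F using that True Fs by fastforce
      then show ?thesis by (rule L.homogeneous_linear[OF _ p])
    next
      case False
      then obtain s where s: "s < length ds" "ds ! s = 2" "\<forall>i<length ds. i \<noteq> s \<longrightarrow> ds ! i = 1" using deg by blast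
      show ?thesis by (rule homogeneous_smooth_quadric[OF s conjunct1[OF deg] p])
    qed
  qed
qed

end
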